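(* Let $R\subset\mathbb R^N$ be a root system with closed Weyl chamber $C$ and multiplicity function $k\ge0$. Let $(X_t)_{t\ge0}$ be either (a) a Bessel process on $C$ of type $R$ with multiplicity $k$ and drift $\lambda\in C$ whose initial distribution $P_{X_0}$ is Bessel-$\lambda$-radial, or (b) a hybrid Dunkl-Bessel process on $\mathbb R^N$ of type $R$ with multiplicity $k$ and drift $\lambda\in\mathbb R^N$ whose initial distribution $P_{X_0}$ is hybrid-Dunkl-Bessel-$\lambda$-radial. Then for all $t\ge0$ the distribution $P_{X_t}$ is Bessel-$\lambda$-radial in case (a) and hybrid-Dunkl-Bessel-$\lambda$-radial in case (b), and $(\|X_t\|)_{t\ge0}$ is a one-dimensional Bessel process on $[0,\infty)$ with multiplicity $\gamma+N/2-1/2$ and drift $\|\lambda\|$.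
   Context: $\mathbb R^N$ carries the usual scalar product $\langle\cdot,\cdot\rangle$ (extended bilinearly to $\mathbb C^N$) and norm $\|\cdot\|$. A root system $R\subset\mathbb R^N\setminus\{0\}$ is a finite set with $\sigma_\alpha(R)=R$ for all $\alpha\in R$, where $\sigma_\alpha$ is the orthogonal reflection in the hyperplane $\alpha^\perp$; $W$ is the finite group generated by the $\sigma_\alpha$; $R_+\subset R$ is a fixed positive subsystem; $C=\{x\in\mathbb R^N:\langle x,\alpha\rangle\ge0\ \forall\alpha\in R_+\}$; $k:R\to[0,\infty)$ is a $W$-invariant multiplicity function; $\gamma=\sum_{\alpha\in R_+}k(\alpha)$. Dunkl operators: $T_\xi(k)f(x)=\partial_\xi f(x)+\sum_{\alpha\in R_+}k(\alpha)\langle\alpha,\xi\rangle\frac{f(x)-f(\sigma_\alpha x)}{\langle\alpha,x\rangle}$. For $w\in\mathbb C^N$ the Dunkl kernel $E_k(\cdot,w)$ is the unique holomorphic $f$ on $\mathbb C^N$ with $T_\xi(k)f=\langle\xi,w\rangle f$ for all $\xi\in\mathbb C^N$ and $f(0)=1$; $J_k(z,w)=\frac1{|W|}\sum_{g\in W}E_k(z,gw)$. Let $w_k(x)=\prod_{\alpha\in R_+}|\langle\alpha,x\rangle|^{2k(\alpha)}$ and $c_k>0$ with $c_k\int_{\mathbb R^N}e^{-\|y\|^2/2}w_k(y)\,dy=1$. A Bessel process with drift $\lambda\in C$ is a Feller diffusion on $C$ with continuous paths and transition kernels ($t>0$, $x\in C$, Borel $A\subset C$) $$\frac{|W|c_k\,e^{-\|\lambda\|^2t/2}}{t^{\gamma+N/2}}\int_Ae^{-(\|x\|^2+\|y\|^2)/(2t)}\,\frac{J_k(\frac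 x{\sqrt t},\frac y{\sqrt t})J_k(y,\lambda)}{J_k(x,\lambda)}\,w_k(y)\,dy.$$ A hybrid Dunkl-Bessel process with drift $\lambda\in\mathbb R^N$ is a Feller process on $\mathbb R^N$ with RCLL paths and transition kernels ($t>0$, $x\in\mathbb R^N$, Borel $A\subset\mathbb R^N$) $$\frac{c_k\,e^{-\|\lambda\|^2t/2}}{t^{\gamma+N/2}}\int_Ae^{-(\|x\|^2+\|y\|^2)/(2t)}\,\frac{E_k(\frac x{\sqrt t},\frac y{\sqrt t})J_k(y,\lambda)}{J_k(x,\lambda)}\,w_k(y)\,dy.$$ Spherical Bessel functions: $j_\alpha(z)=\Gamma(\alpha+1)\sum_{n=0}^\infty\frac{(-1)^n(z/2)^{2n}}{n!\,\Gamma(n+\alpha+1)}$ for $\alpha\ge-1/2$, $z\in\mathbb C$. Let $\sigma$ be the surface measure on the unit sphere $S^{N-1}$ and $d_k=\int_{S^{N-1}}w_k\,d\sigma$. A probability measure $\mu$ on $C$ is Bessel-$\lambda$-radial if for some probability measure $\nu$ on $[0,\infty)$ and all bounded measurable $f$ on $C$ $$\int_Cf\,d\mu=\frac{|W|}{d_k}\int_0^\infty\int_{S^{N-1}\cap C}\frac{f(rz)J_k(\lambda,rz)}{j_{\gamma+N/2-1}(i\|\lambda\|r)}\,w_k(z)\,d\sigma(z)\,d\nu(r).$$ A probability measure $\mu$ on $\mathbb R^N$ is hybrid-Dunkl-Bessel-$\lambda$-radial if for some probability measure $\nu$ on $[0,\infty)$ and all bounded measurable $f$ on $\mathbb R^N$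 $$\int_{\mathbb R^N}f\,d\mu=\frac1{d_k}\int_0^\infty\int_{S^{N-1}}\frac{f(rz)J_k(\lambda,rz)}{j_{\gamma+N/2-1}(i\|\lambda\|r)}\,w_k(z)\,d\sigma(z)\,d\nu(r).$$ A one-dimensional Bessel process on $[0,\infty)$ with multiplicity $\kappa\ge0$ and drift $\rho\ge0$ is a diffusion on $[0,\infty)$ with continuous paths (up to modification) and transition kernels, for $t>0$, $x\ge0$ and Borel $A\subset[0,\infty)$, $$\frac{e^{-\rho^2t/2}}{2^{\kappa-1/2}\Gamma(\kappa+1/2)\,t^{\kappa+1/2}}\int_Ae^{-(x^2+y^2)/(2t)}\,\frac{j_{\kappa-1/2}(ixy/t)\,j_{\kappa-1/2}(iy\rho)}{j_{\kappa-1/2}(ix\rho)}\,y^{2\kappa}\,dy.$$ *)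

theory Defs
  imports "HOL-Probability.Probability"
begin

section \<open>Root systems\<close>

definition reflection :: "real ^ 'n \<Rightarrow> real ^ 'n \<Rightarrow> real ^ 'n" where
  "reflection \<alpha> x = x - (2 * (x \<bullet> \<alpha>) / (\<alpha> \<bullet> \<alpha>)) *\<^sub>R \<alpha>"

text \<open>Root systems need not be reduced, crystallographic, spanning or nonempty.\<close>

definition root_system :: "(real ^ 'n) set \<Rightarrow> bool" where
  "root_system R \<longleftrightarrow> finite R \<and> 0 \<notin> R \<and> (\<forall>\<alpha>\<in>R. reflection \<alpha> ` R = R)"

definition positive_subsystem :: "(real ^ 'n) set \<Rightarrow> (real ^ 'n) set \<Rightarrow> bool" where
  "positive_subsystem R Rp \<longleftrightarrow>
     (\<exists>\<beta>. (\<forall>\<alpha>\<in>R. \<alpha> \<bullet> \<beta> \<noteq> 0) \<and> Rp = {\<alpha>\<in>R. \<alpha> \<bullet> \<beta> > 0})"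

text \<open>The group generated by the reflections; closure under inverses is automatic because
  the generators are involutions.\<close>

inductive_set weyl_group :: "(real ^ 'n) set \<Rightarrow> (real ^ 'n \<Rightarrow> real ^ 'n) set"
  for R :: "(real ^ 'n) set" where
  weyl_id: "id \<in> weyl_group R"
| weyl_refl: "g \<in> weyl_group R \<Longrightarrow> \<alpha> \<in> R \<Longrightarrow> reflection \<alpha> \<circ> g \<in> weyl_group R"

definition weyl_chamber :: "(real ^ 'n) set \<Rightarrow> (real ^ 'n) set" where
  "weyl_chamber Rp = {x. \<forall>\<alpha>\<in>Rp. x \<bullet> \<alpha> \<ge> 0}"

text \<open>Only the values of a multiplicity function on \<open>R\<close> matter.\<close>

definition multiplicity_function :: "(real ^ 'n) set \<Rightarrow> (real ^ 'n \<Rightarrow> real) \<Rightarrow> bool" where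
  "multiplicity_function R k \<longleftrightarrow>
     (\<forall>\<alpha>\<in>R. k \<alpha> \<ge> 0) \<and> (\<forall>g\<in>weyl_group R. \<forall>\<alpha>\<in>R. k (g \<alpha>) = k \<alpha>)"

definition gamma_index :: "(real ^ 'n) set \<Rightarrow> (real ^ 'n \<Rightarrow> real) \<Rightarrow> real" where
  "gamma_index Rp k = (\<Sum>\<alpha>\<in>Rp. k \<alpha>)"


section \<open>Dunkl kernel\<close>

definition cvec :: "real ^ 'n \<Rightarrow> complex ^ 'n" where
  "cvec x = (\<chi> i. complex_of_real (x $ i))"

definition cbilin :: "complex ^ 'n \<Rightarrow> complex ^ 'n \<Rightarrow> complex" where
  "cbilin z w = (\<Sum>i\<in>UNIV. z $ i * w $ i)"

text \<open>The complex-linear extension of a real-linear map.\<close>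

definition complexify :: "(real ^ 'n \<Rightarrow> real ^ 'n) \<Rightarrow> complex ^ 'n \<Rightarrow> complex ^ 'n" where
  "complexify g z = cvec (g (\<chi> i. Re (z $ i))) + \<i> *s cvec (g (\<chi> i. Im (z $ i)))"

definition entire_on_Cn :: "(complex ^ 'n \<Rightarrow> complex) \<Rightarrow> bool" where
  "entire_on_Cn f \<longleftrightarrow>
     (\<forall>z. \<exists>D. (f has_derivative D) (at z) \<and> (\<forall>c v. D (c *s v) = c * D v))"

text \<open>On the hyperplane \<open>\<langle>\<alpha>,z\<rangle> = 0\<close> the difference quotient has a removable singularity for
  holomorphic \<open>f\<close>; the value there is its limit, since
  \<open>z - \<sigma>\<^sub>\<alpha> z = (2 \<langle>\<alpha>,z\<rangle> / \<langle>\<alpha>,\<alpha>\<rangle>) \<alpha>\<close>.\<close>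

definition dunkl_operator ::
  "(real ^ 'n) set \<Rightarrow> (real ^ 'n \<Rightarrow> real) \<Rightarrow> complex ^ 'n \<Rightarrow> (complex ^ 'n \<Rightarrow> complex)
     \<Rightarrow> complex ^ 'n \<Rightarrow> complex" where
  "dunkl_operator Rp k \<xi> f z =
     frechet_derivative f (at z) \<xi> +
     (\<Sum>\<alpha>\<in>Rp. complex_of_real (k \<alpha>) * cbilin (cvec \<alpha>) \<xi> *
        (if cbilin (cvec \<alpha>) z = 0
         then complex_of_real (2 / (\<alpha> \<bullet> \<alpha>)) * frechet_derivative f (at z) (cvec \<alpha>)
         else (f z - f (complexify (reflection \<alpha>) z)) / cbilin (cvec \<alpha>) z))"

definition dunkl_kernel ::
  "(real ^ 'n) set \<Rightarrow> (real ^ 'n \<Rightarrow> real) \<Rightarrow> complex ^ 'n \<Rightarrow> complex ^ 'n \<Rightarrow> complex" where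
  "dunkl_kernel Rp k z w =
     (THE f. entire_on_Cn f \<and>
        (\<forall>\<xi> x. dunkl_operator Rp k \<xi> f x = cbilin \<xi> w * f x) \<and> f 0 = 1) z"

definition dunkl_bessel ::
  "(real ^ 'n) set \<Rightarrow> (real ^ 'n) set \<Rightarrow> (real ^ 'n \<Rightarrow> real) \<Rightarrow> complex ^ 'n \<Rightarrow> complex ^ 'n
     \<Rightarrow> complex" where
  "dunkl_bessel R Rp k z w =
     (\<Sum>g\<in>weyl_group R. dunkl_kernel Rp k z (complexify g w)) / of_nat (card (weyl_group R))"

text \<open>For real arguments \<open>E\<^sub>k\<close> and \<open>J\<^sub>k\<close> are real-valued, so taking real parts only changes
  the type.\<close>

definition dunkl_kernel_real ::
  "(real ^ 'n) set \<Rightarrow> (real ^ 'n \<Rightarrow> real) \<Rightarrow> real ^ 'n \<Rightarrow> real ^ 'n \<Rightarrow> real" where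
  "dunkl_kernel_real Rp k x y = Re (dunkl_kernel Rp k (cvec x) (cvec y))"

definition dunkl_bessel_real ::
  "(real ^ 'n) set \<Rightarrow> (real ^ 'n) set \<Rightarrow> (real ^ 'n \<Rightarrow> real) \<Rightarrow> real ^ 'n \<Rightarrow> real ^ 'n
     \<Rightarrow> real" where
  "dunkl_bessel_real R Rp k x y = Re (dunkl_bessel R Rp k (cvec x) (cvec y))"

text \<open>Powers of nonnegative reals with the usual convention for a vanishing exponent
  (in HOL, \<open>0 powr 0 = 0\<close>).\<close>

definition rpow :: "real \<Rightarrow> real \<Rightarrow> real" where
  "rpow x a = (if a = 0 then 1 else x powr a)"

definition dunkl_weight ::
  "(real ^ 'n) set \<Rightarrow> (real ^ 'n \<Rightarrow> real) \<Rightarrow> real ^ 'n \<Rightarrow> real" where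
  "dunkl_weight Rp k x = (\<Prod>\<alpha>\<in>Rp. rpow \<bar>\<alpha> \<bullet> x\<bar> (2 * k \<alpha>))"

definition dunkl_const :: "(real ^ 'n) set \<Rightarrow> (real ^ 'n \<Rightarrow> real) \<Rightarrow> real" where
  "dunkl_const Rp k = 1 / (LINT y|lborel. exp (- (norm y)\<^sup>2 / 2) * dunkl_weight Rp k y)"

text \<open>The spherical Bessel function \<open>j\<^sub>\<alpha>\<close>, normalised by \<open>j\<^sub>\<alpha>(0) = 1\<close>.\<close>

definition spherical_bessel :: "real \<Rightarrow> complex \<Rightarrow> complex" where
  "spherical_bessel \<alpha> z = complex_of_real (Gamma (\<alpha> + 1)) *
     (\<Sum>n. (-1) ^ n * (z / 2) ^ (2 * n) / complex_of_real (fact n * Gamma (real n + \<alpha> + 1)))"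

text \<open>\<open>j\<^sub>\<alpha>(\<i> x)\<close> for real \<open>x\<close>, which is real.\<close>

definition spherical_bessel_imag :: "real \<Rightarrow> real \<Rightarrow> real" where
  "spherical_bessel_imag \<alpha> x = Re (spherical_bessel \<alpha> (\<i> * complex_of_real x))"


section \<open>Markov processes\<close>

text \<open>A process is a family of random variables on \<open>M\<close>; only time indices \<open>t \<ge> 0\<close> matter.
  The state space is \<open>S\<close> with its Borel sets.\<close>

abbreviation borel_on :: "'a::topological_space set \<Rightarrow> 'a measure" where
  "borel_on S \<equiv> restrict_space borel S"

definition C0_on :: "'a::real_normed_vector set \<Rightarrow> ('a \<Rightarrow> real) set" where
  "C0_on S = {f. continuous_on S f \<and> (f \<longlongrightarrow> 0) (inf at_infinity (principal S))}"

text \<open>Feller semigroup of Markov kernels: Chapman-Kolmogorov, invariance of \<open>C\<^sub>0(S)\<close>, and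
  pointwise convergence at time 0, which under the other conditions is equivalent to
  strong continuity on \<open>C\<^sub>0(S)\<close>.\<close>

definition feller_kernels ::
  "'a::real_normed_vector set \<Rightarrow> (real \<Rightarrow> 'a \<Rightarrow> 'a measure) \<Rightarrow> bool" where
  "feller_kernels S K \<longleftrightarrow>
     (\<forall>t>0. K t \<in> borel_on S \<rightarrow>\<^sub>M prob_algebra (borel_on S)) \<and>
     (\<forall>s>0. \<forall>t>0. \<forall>x\<in>S. K (s + t) x = K s x \<bind> K t) \<and>
     (\<forall>f\<in>C0_on S. \<forall>t>0. (\<lambda>x. LINT y|K t x. f y) \<in> C0_on S) \<and>
     (\<forall>f\<in>C0_on S. \<forall>x\<in>S. ((\<lambda>t. LINT y|K t x. f y) \<longlongrightarrow> f x) (at_right 0))"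

definition natural_filtration ::
  "'w measure \<Rightarrow> (real \<Rightarrow> 'w \<Rightarrow> 'a::topological_space) \<Rightarrow> real \<Rightarrow> 'w measure" where
  "natural_filtration M X s =
     sigma (space M) (\<Union>u\<in>{0..s}. {X u -` A \<inter> space M |A. A \<in> sets borel})"

text \<open>A Feller process in \<open>S\<close> with transition kernels \<open>K\<close> and arbitrary initial law; the Markov
  property is with respect to the filtration generated by the process itself.\<close>

definition feller_process ::
  "'a::real_normed_vector set \<Rightarrow> (real \<Rightarrow> 'a \<Rightarrow> 'a measure) \<Rightarrow> 'w measure
     \<Rightarrow> (real \<Rightarrow> 'w \<Rightarrow> 'a) \<Rightarrow> bool" where
  "feller_process S K M X \<longleftrightarrow>
     prob_space M \<and> feller_kernels S K \<and>
     (\<forall>t\<ge>0. X t \<in> M \<rightarrow>\<^sub>M borel_on S) \<and>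
     (\<forall>s\<ge>0. \<forall>t>0. \<forall>A\<in>sets (borel_on S). AE \<omega> in M.
        real_cond_exp M (natural_filtration M X s) (indicator (X (s + t) -` A \<inter> space M)) \<omega>
          = measure (K t (X s \<omega>)) A)"

definition continuous_paths ::
  "'w measure \<Rightarrow> (real \<Rightarrow> 'w \<Rightarrow> 'a::topological_space) \<Rightarrow> bool" where
  "continuous_paths M X \<longleftrightarrow> (\<forall>\<omega>\<in>space M. continuous_on {0..} (\<lambda>t. X t \<omega>))"

definition rcll_paths ::
  "'w measure \<Rightarrow> (real \<Rightarrow> 'w \<Rightarrow> 'a::topological_space) \<Rightarrow> bool" where
  "rcll_paths M X \<longleftrightarrow> (\<forall>\<omega>\<in>space M.
     (\<forall>t\<ge>0. continuous (at_right t) (\<lambda>t. X t \<omega>)) \<and>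
     (\<forall>t>0. \<exists>l. ((\<lambda>t. X t \<omega>) \<longlongrightarrow> l) (at_left t)))"


section \<open>Bessel processes with drift\<close>

definition bessel_process ::
  "(real ^ 'n) set \<Rightarrow> (real ^ 'n) set \<Rightarrow> (real ^ 'n \<Rightarrow> real) \<Rightarrow> real ^ 'n \<Rightarrow> 'w measure
     \<Rightarrow> (real \<Rightarrow> 'w \<Rightarrow> real ^ 'n) \<Rightarrow> bool" where
  "bessel_process R Rp k lam M X \<longleftrightarrow>
     (\<exists>K. feller_process (weyl_chamber Rp) K M X \<and>
        (\<forall>t>0. \<forall>x\<in>weyl_chamber Rp. \<forall>A\<in>sets (borel_on (weyl_chamber Rp)).
           measure (K t x) A =
             real (card (weyl_group R)) * dunkl_const Rp k * exp (- (norm lam)\<^sup>2 * t / 2)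
               / t powr (gamma_index Rp k + real CARD('n) / 2) *
             (LINT y:A|lborel. exp (- ((norm x)\<^sup>2 + (norm y)\<^sup>2) / (2 * t)) *
                (dunkl_bessel_real R Rp k (x /\<^sub>R sqrt t) (y /\<^sub>R sqrt t) *
                   dunkl_bessel_real R Rp k y lam / dunkl_bessel_real R Rp k x lam) *
                dunkl_weight Rp k y))) \<and>
     continuous_paths M X"

definition hybrid_dunkl_bessel_process ::
  "(real ^ 'n) set \<Rightarrow> (real ^ 'n) set \<Rightarrow> (real ^ 'n \<Rightarrow> real) \<Rightarrow> real ^ 'n \<Rightarrow> 'w measure
     \<Rightarrow> (real \<Rightarrow> 'w \<Rightarrow> real ^ 'n) \<Rightarrow> bool" where
  "hybrid_dunkl_bessel_process R Rp k lam M X \<longleftrightarrow>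
     (\<exists>K. feller_process UNIV K M X \<and>
        (\<forall>t>0. \<forall>x. \<forall>A\<in>sets borel.
           measure (K t x) A =
             dunkl_const Rp k * exp (- (norm lam)\<^sup>2 * t / 2)
               / t powr (gamma_index Rp k + real CARD('n) / 2) *
             (LINT y:A|lborel. exp (- ((norm x)\<^sup>2 + (norm y)\<^sup>2) / (2 * t)) *
                (dunkl_kernel_real Rp k (x /\<^sub>R sqrt t) (y /\<^sub>R sqrt t) *
                   dunkl_bessel_real R Rp k y lam / dunkl_bessel_real R Rp k x lam) *
                dunkl_weight Rp k y))) \<and>
     rcll_paths M X"

text \<open>A one-dimensional diffusion is a Feller process having a modification with continuous
  paths.\<close>

definition bessel_process_1d ::
  "real \<Rightarrow> real \<Rightarrow> 'w measure \<Rightarrow> (real \<Rightarrow> 'w \<Rightarrow> real) \<Rightarrow> bool" where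
  "bessel_process_1d \<kappa> \<rho> M X \<longleftrightarrow>
     (\<exists>K. feller_process {0..} K M X \<and>
        (\<forall>t>0. \<forall>x\<ge>0. \<forall>A\<in>sets (borel_on {0..}).
           measure (K t x) A =
             exp (- \<rho>\<^sup>2 * t / 2)
               / (2 powr (\<kappa> - 1/2) * Gamma (\<kappa> + 1/2) * t powr (\<kappa> + 1/2)) *
             (LINT y:A|lborel. exp (- (x\<^sup>2 + y\<^sup>2) / (2 * t)) *
                (spherical_bessel_imag (\<kappa> - 1/2) (x * y / t) *
                   spherical_bessel_imag (\<kappa> - 1/2) (y * \<rho>)
                   / spherical_bessel_imag (\<kappa> - 1/2) (x * \<rho>)) *
                rpow y (2 * \<kappa>)))) \<and>
     (\<exists>Y. (\<forall>t\<ge>0. Y t \<in> M \<rightarrow>\<^sub>M borel_on {0..} \<and> (AE \<omega> in M. Y t \<omega> = X t \<omega>)) \<and>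
        continuous_paths M Y)"


section \<open>Radial measures\<close>

text \<open>Surface measure on the unit sphere as the cone measure
  \<open>\<sigma>(A) = N vol {r z | 0 < r \<le> 1, z \<in> A}\<close>; recall \<open>sgn x = x / \<parallel>x\<parallel>\<close>.\<close>

definition surface_measure :: "(real ^ 'n) measure" where
  "surface_measure =
     distr (scale_measure (of_nat CARD('n)) (restrict_space lborel (cball 0 1 - {0}))) borel sgn"

definition sphere_const :: "(real ^ 'n) set \<Rightarrow> (real ^ 'n \<Rightarrow> real) \<Rightarrow> real" where
  "sphere_const Rp k = (LINT z:sphere 0 1|surface_measure. dunkl_weight Rp k z)"

definition bessel_radial ::
  "(real ^ 'n) set \<Rightarrow> (real ^ 'n) set \<Rightarrow> (real ^ 'n \<Rightarrow> real) \<Rightarrow> real ^ 'n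
     \<Rightarrow> (real ^ 'n) measure \<Rightarrow> bool" where
  "bessel_radial R Rp k lam \<mu> \<longleftrightarrow>
     prob_space \<mu> \<and> sets \<mu> = sets (borel_on (weyl_chamber Rp)) \<and>
     (\<exists>\<nu>. prob_space \<nu> \<and> sets \<nu> = sets (borel_on {0..}) \<and>
        (\<forall>f :: real ^ 'n \<Rightarrow> real.
           f \<in> borel_measurable (borel_on (weyl_chamber Rp)) \<longrightarrow> bounded (f ` weyl_chamber Rp) \<longrightarrow>
           (LINT x|\<mu>. f x) =
             real (card (weyl_group R)) / sphere_const Rp k *
             (LINT r|\<nu>. (LINT z:(sphere 0 1 \<inter> weyl_chamber Rp)|surface_measure.
                f (r *\<^sub>R z) * dunkl_bessel_real R Rp k lam (r *\<^sub>R z)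
                  / spherical_bessel_imag (gamma_index Rp k + real CARD('n) / 2 - 1) (norm lam * r)
                  * dunkl_weight Rp k z))))"

definition hybrid_dunkl_bessel_radial ::
  "(real ^ 'n) set \<Rightarrow> (real ^ 'n) set \<Rightarrow> (real ^ 'n \<Rightarrow> real) \<Rightarrow> real ^ 'n
     \<Rightarrow> (real ^ 'n) measure \<Rightarrow> bool" where
  "hybrid_dunkl_bessel_radial R Rp k lam \<mu> \<longleftrightarrow>
     prob_space \<mu> \<and> sets \<mu> = sets borel \<and>
     (\<exists>\<nu>. prob_space \<nu> \<and> sets \<nu> = sets (borel_on {0..}) \<and>
        (\<forall>f :: real ^ 'n \<Rightarrow> real. f \<in> borel_measurable borel \<longrightarrow> bounded (range f) \<longrightarrow>
           (LINT x|\<mu>. f x) =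
             1 / sphere_const Rp k *
             (LINT r|\<nu>. (LINT z:sphere 0 1|surface_measure.
                f (r *\<^sub>R z) * dunkl_bessel_real R Rp k lam (r *\<^sub>R z)
                  / spherical_bessel_imag (gamma_index Rp k + real CARD('n) / 2 - 1) (norm lam * r)
                  * dunkl_weight Rp k z))))"

end

theory Submission
 imports Defs "HOL-Real_Asymp.Real_Asymp" "HOL-Complex_Analysis.Complex_Analysis"
begin

text \<open>
Write \<open>w\<close> for the Dunkl weight and \<open>j\<close> for the spherical Bessel function at imaginary argument. For
\<open>r \<ge> 0\<close> let \<open>\<Lambda>\<^sub>r\<close> be the law on the sphere of radius \<open>r\<close> (in the chamber, respectively in the whole
space) whose density is proportional to \<open>J(\<cdot>,\<lambda>) w\<close>. The radial measures are the mixtures of these laws.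
The theorem rests on an intertwining: starting the process with law \<open>\<Lambda>\<^sub>r\<close>, its law at time \<open>t\<close> is the
mixture of the \<open>\<Lambda>\<^sub>s\<close> over \<open>Q\<^sub>t(r,ds)\<close>, where \<open>Q\<^sub>t\<close> is the kernel of the one-dimensional Bessel process. By
the criterion of Rogers and Pitman (\<open>conditional_law\<close>, \<open>feller_process_Z\<close>) the law of \<open>X\<^sub>t\<close> given the past
of the norm is then \<open>\<Lambda>\<close> at \<open>\<parallel>X\<^sub>t\<parallel>\<close>. Hence \<open>X\<^sub>t\<close> stays radial and the norm is Markov with kernels \<open>Q\<close>; these
inherit the Feller property. The intertwining (\<open>intertwining_density\<close>) is a computation in polar
coordinates: the factor \<open>J(x,\<lambda>)\<close> cancels, and a spherical mean of the Dunkl kernel remains, which is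
\<open>j(r \<parallel>y\<parallel>)\<close> up to a constant (\<open>spherical_mean\<close>).

The mean value formula comes from Gaussian integrals. Integration by parts gives the first moments of
products of two Dunkl kernels (\<open>eigen_gauss_moment\<close>). So, as functions of \<open>s\<close>, the integrals of
\<open>E(s g x, a) E(x, b)\<close> against \<open>exp(-\<parallel>x\<parallel>\<^sup>2/2) w(x)\<close>, for \<open>g\<close> in the reflection group, satisfy the same
singular system of differential equations as \<open>exp(s\<^sup>2 \<parallel>a\<parallel>\<^sup>2/2) E(s g b, a)\<close>. Such a system has at most
one solution for each initial value, because of an energy estimate (\<open>energy_estimate\<close>). This yields the symmetry of \<open>E\<close>
and the Gaussian mean of \<open>E(\<cdot>,a)\<close>; in polar coordinates the latter determines the Taylor coefficients of
the spherical mean.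

The Dunkl kernel is a definite description. Uniqueness and growth of eigenfunctions follow from the same
energy estimate along rays. Existence is read off from the process: the real parameters for which the
eigenvalue problem is solvable form a closed cone (\<open>eigen_limit\<close>), and outside of it the kernel would be
constant in the parameter, so the transition kernels would have rank one there. That is incompatible
with \<open>K\<^sub>t(x,\<cdot>)\<close> converging to the point mass at \<open>x\<close> (\<open>feller_kernel_not_rank_one\<close>).

Integrals over the chamber are reduced to integrals over the whole space since almost every point is moved
into the chamber by exactly one group element; this follows from the total mass of the transition kernel at
the origin (\<open>chamber_hits_AE\<close>). The hybrid process may jump, but \<open>n Q\<^sub>1\<^sub>/\<^sub>n(x,{y. |y - x| \<ge> \<epsilon>})\<close> tends to \<open>0\<close> locally
uniformly in \<open>x\<close>, which excludes jumps of the norm (\<open>Q_rare\<close>, \<open>continuous_modification_of_rcll\<close>).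
\<close>

section \<open>Lebesgue measure under linear maps and in polar coordinates\<close>

lemma nn_integral_lborel_translate:
 fixes g :: "'a::euclidean_space \<Rightarrow> ennreal"
 assumes [measurable]: "g \<in> borel_measurable borel"
 shows "(\<integral>\<^sup>+x. g (c + x) \<partial>lborel) = (\<integral>\<^sup>+x. g x \<partial>lborel)"
proof -
 have "(\<integral>\<^sup>+x. g x \<partial>lborel) = (\<integral>\<^sup>+x. g x \<partial>distr lborel borel ((+) c))"
  by (simp add: lborel_distr_plus)
 also have "\<dots> = (\<integral>\<^sup>+x. g (c + x) \<partial>lborel)"
  by (subst nn_integral_distr) simp_all
 finally show ?thesis by simp
qed

lemma nn_integral_lborel_scale:
 fixes f :: "'a::euclidean_space \<Rightarrow> ennreal"
 assumes [measurable]: "f \<in> borel_measurable borel" and c: "c > 0"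
 shows "(\<integral>\<^sup>+x. f x \<partial>lborel) = ennreal (c ^ DIM('a)) * (\<integral>\<^sup>+x. f (c *\<^sub>R x) \<partial>lborel)"
proof -
 have "(\<integral>\<^sup>+x. f x \<partial>lborel)
   = (\<integral>\<^sup>+x. f x \<partial>density (distr lborel borel (\<lambda>x. 0 + c *\<^sub>R x)) (\<lambda>_. \<bar>c\<bar> ^ DIM('a)))"
  using c by (subst lborel_affine[of c 0]) simp_all
 also have "\<dots> = (\<integral>\<^sup>+x. ennreal (c ^ DIM('a)) * f (c *\<^sub>R x) \<partial>lborel)"
  using c by (simp add: nn_integral_density nn_integral_distr)
 finally show ?thesis by (simp add: nn_integral_cmult)
qed

text \<open>The indicator \<open>h\<close> of the unit ball is invariant under \<open>f\<close>. Integrating \<open>h (f x - y) * g (f x)\<close> over both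
 variables in either order and using translation invariance compares the integrals of \<open>g\<close> and \<open>g \<circ> f\<close>.\<close>

lemma lborel_distr_orthogonal:
 fixes f :: "'a::euclidean_space \<Rightarrow> 'a"
 assumes f: "linear f" and n: "\<And>x. norm (f x) = norm x"
 shows "distr lborel borel f = lborel"
proof -
 have cont: "continuous_on UNIV f" by (rule linear_continuous_on) (simp add: f linear_linear)
 then have [measurable]: "f \<in> borel_measurable borel" by (rule borel_measurable_continuous_onI)
 interpret f: linear f by fact
 have inj: "inj f" unfolding f.inj_iff_eq_0 using n by (metis norm_eq_zero)
 then have surj: "surj f" using f linear_inj_imp_surj by blast
 define h :: "'a \<Rightarrow> ennreal" where "h = indicator (ball 0 1)"
 have [measurable]: "h \<in> borel_measurable borel" unfolding h_def by (intro borel_measurable_indicator) simp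
 define c where "c = (\<integral>\<^sup>+x. h x \<partial>lborel)"
 have hf: "h (f x) = h x" for x by (simp add: h_def indicator_def n)
 have hs: "h (x - y) = h (y - x)" for x y by (simp add: h_def indicator_def norm_minus_commute)
 have ceq: "c = emeasure lborel (ball 0 (1::real) :: 'a set)"
  by (simp add: c_def h_def)
 have cfin: "c < \<infinity>" unfolding ceq by (rule emeasure_lborel_ball_finite)
 have cpos: "c \<noteq> 0"
  unfolding ceq using unit_ball_vol_pos[of "real DIM('a)"] by (simp add: emeasure_ball del: unit_ball_vol_pos)
 have main: "c * (\<integral>\<^sup>+y. g y \<partial>lborel) = c * (\<integral>\<^sup>+y. g (f y) \<partial>lborel)"
  if [measurable]: "g \<in> borel_measurable borel" for g :: "'a \<Rightarrow> ennreal"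
 proof -
  have "c * (\<integral>\<^sup>+y. g y \<partial>lborel) = (\<integral>\<^sup>+x. h (f x) * (\<integral>\<^sup>+y. g y \<partial>lborel) \<partial>lborel)"
   by (simp add: c_def hf nn_integral_multc)
  also have "\<dots> = (\<integral>\<^sup>+x. \<integral>\<^sup>+y. h (f x) * g (f x + y) \<partial>lborel \<partial>lborel)"
   by (simp add: nn_integral_cmult nn_integral_lborel_translate)
  also have "\<dots> = (\<integral>\<^sup>+y. \<integral>\<^sup>+x. h (f x) * g (f x + y) \<partial>lborel \<partial>lborel)"
   by (rule lborel_pair.Fubini') measurable
  also have "\<dots> = (\<integral>\<^sup>+y. \<integral>\<^sup>+x. h (f x - y) * g (f x) \<partial>lborel \<partial>lborel)"
  proof (rule nn_integral_cong)
   fix y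
   obtain v where v: "f v = y" using surj by (metis surjD)
   have "(\<integral>\<^sup>+x. h (f x - y) * g (f x) \<partial>lborel) = (\<integral>\<^sup>+x. h (f (v + x) - y) * g (f (v + x)) \<partial>lborel)"
    by (rule nn_integral_lborel_translate[symmetric]) measurable
   then show "(\<integral>\<^sup>+x. h (f x) * g (f x + y) \<partial>lborel) = (\<integral>\<^sup>+x. h (f x - y) * g (f x) \<partial>lborel)"
    by (simp add: f.add v add.commute)
  qed
  also have "\<dots> = (\<integral>\<^sup>+x. \<integral>\<^sup>+y. h (f x - y) * g (f x) \<partial>lborel \<partial>lborel)"
   by (rule lborel_pair.Fubini'[symmetric]) measurable
  also have "\<dots> = (\<integral>\<^sup>+x. c * g (f x) \<partial>lborel)"
  proof (rule nn_integral_cong)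
   fix x
   have "(\<integral>\<^sup>+y. h (f x - y) \<partial>lborel) = (\<integral>\<^sup>+y. h (- f x + y) \<partial>lborel)"
    by (subst hs) simp
   also have "\<dots> = c" unfolding c_def by (rule nn_integral_lborel_translate) measurable
   finally show "(\<integral>\<^sup>+y. h (f x - y) * g (f x) \<partial>lborel) = c * g (f x)"
    by (simp add: nn_integral_multc)
  qed
  finally show ?thesis by (simp add: nn_integral_cmult)
 qed
 show ?thesis
 proof (rule measure_eqI)
  fix A assume "A \<in> sets (distr lborel borel f)"
  then have [measurable]: "A \<in> sets borel" by simp
  have "(\<integral>\<^sup>+y. indicator A y \<partial>lborel) = (\<integral>\<^sup>+y. indicator A (f y) \<partial>lborel)"
   using main[of "indicator A"] cfin cpos by (auto simp: ennreal_mult_cancel_left)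
  also have "\<dots> = (\<integral>\<^sup>+y. indicator A y \<partial>distr lborel borel f)"
   by (subst nn_integral_distr) simp_all
  finally show "emeasure (distr lborel borel f) A = emeasure lborel A"
   by (simp del: nn_integral_indicator add: nn_integral_indicator[symmetric])
 qed simp
qed

lemma nn_integral_surface:
 fixes G :: "real ^ 'n \<Rightarrow> ennreal"
 assumes [measurable]: "G \<in> borel_measurable borel"
 shows "(\<integral>\<^sup>+z. G z \<partial>surface_measure)
   = of_nat CARD('n) * (\<integral>\<^sup>+u. G (sgn u) * indicator (cball 0 1 - {0}) u \<partial>lborel)"
proof -
 have [measurable]: "(sgn :: real ^ 'n \<Rightarrow> _) \<in> borel_measurable borel"
  unfolding sgn_div_norm[abs_def] by measurable
 have "(\<integral>\<^sup>+z. G z \<partial>surface_measure)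
   = (\<integral>\<^sup>+u. G (sgn u) \<partial>scale_measure (of_nat CARD('n)) (restrict_space lborel (cball 0 1 - {0})))"
  unfolding surface_measure_def
  by (subst nn_integral_distr)
    (auto intro!: measurable_restrict_space1 simp: measurable_cong_sets[OF sets_scale_measure refl])
 then show ?thesis
  by (simp add: nn_integral_scale_measure nn_integral_restrict_space
    measurable_restrict_space1)
qed

lemma sets_surface_measure [simp, measurable_cong]:
 "sets (surface_measure :: (real ^ 'n) measure) = sets borel"
 and space_surface_measure [simp]: "space (surface_measure :: (real ^ 'n) measure) = UNIV"
 by (simp_all add: surface_measure_def)

lemma finite_surface_measure: "finite_measure (surface_measure :: (real ^ 'n) measure)"
proof
 have "emeasure surface_measure (space (surface_measure :: (real ^ 'n) measure))
   = (\<integral>\<^sup>+z. (\<lambda>_. 1) (z :: real ^ 'n) \<partial>surface_measure)" by simp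
 also have "\<dots> = of_nat CARD('n) * emeasure lborel (cball 0 1 - {0::real ^ 'n})"
  by (subst nn_integral_surface) simp_all
 also have "\<dots> < \<infinity>"
  using emeasure_mono[of "cball 0 1 - {0::real ^ 'n}" "cball 0 1" lborel]
   emeasure_lborel_cball_finite[of "0::real^'n" 1]
  by (auto simp: ennreal_mult_less_top of_nat_less_top)
 finally show "emeasure surface_measure (space (surface_measure :: (real ^ 'n) measure)) \<noteq> \<infinity>"
  by simp
qed

interpretation surface: finite_measure "surface_measure :: (real ^ 'n) measure"
 by (rule finite_surface_measure)

lemma DERIV_neg_inverse_power:
 fixes s :: real
 assumes "s > 0" "n > 0"
 shows "((\<lambda>s. - (1 / (real n * s ^ n))) has_real_derivative 1 / s ^ (n + 1)) (at s)"
proof -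
 obtain m where n: "n = Suc m" using assms(2) gr0_implies_Suc by blast
 have "((\<lambda>s. - (1 / (real n * s ^ n))) has_real_derivative
   real n * (real n * s ^ (n - 1)) / (real n * s ^ n) ^ 2) (at s)"
  using assms by (auto intro!: derivative_eq_intros simp: power2_eq_square)
 also have "real n * (real n * s ^ (n - 1)) / (real n * s ^ n) ^ 2 = 1 / s ^ (n + 1)"
  using assms unfolding n by (simp add: power2_eq_square field_simps del: of_nat_Suc)
 finally show ?thesis .
qed

text \<open>The surface integral is an integral over the unit ball. Substituting \<open>r = s \<parallel>u\<parallel>\<close> and then \<open>v = s u\<close>
 turns the right-hand side into an integral of \<open>F v\<close> against the weight \<open>N \<parallel>v\<parallel>\<^sup>N\<close> times the integral of
 \<open>s\<^sup>-\<^sup>N\<^sup>-\<^sup>1\<close> over \<open>s \<ge> \<parallel>v\<parallel>\<close>, which is \<open>1\<close>.\<close>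

lemma nn_integral_polar:
 fixes F :: "real ^ 'n \<Rightarrow> ennreal"
 assumes [measurable]: "F \<in> borel_measurable borel"
 shows "(\<integral>\<^sup>+x. F x \<partial>lborel)
  = (\<integral>\<^sup>+r. indicator {0<..} r * ennreal (r ^ (CARD('n) - 1)) * (\<integral>\<^sup>+z. F (r *\<^sub>R z) \<partial>surface_measure) \<partial>lborel)"
proof -
 let ?N = "CARD('n)"
 let ?B = "cball 0 1 - {0::real ^ 'n}"
 let ?I = "\<lambda>r u. indicator {0<..} r * ennreal (r ^ (?N - 1)) * (F (r *\<^sub>R sgn u) * indicator ?B u)"
 let ?I1 = "\<lambda>s u. indicator {0<..} s * ennreal (norm u ^ ?N * s ^ (?N - 1)) * (F (s *\<^sub>R u) * indicator ?B u)"
 let ?I2 = "\<lambda>v s. F v * ennreal (norm v ^ ?N) * (indicator {norm v..} s * indicator (-{0}) v * ennreal (1 / s ^ (?N + 1)))"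
 have N: "?N > 0" by simp
 have [measurable]: "?B \<in> sets borel" "-{0 :: real ^ 'n} \<in> sets borel" by auto
 have [measurable (raw)]: "(\<lambda>x. indicator {norm (f x)..} (g x) :: ennreal) \<in> borel_measurable M"
  if [measurable]: "f \<in> borel_measurable M" "g \<in> borel_measurable M"
  for f :: "'a \<Rightarrow> real ^ 'n" and g and M :: "'a measure"
  unfolding indicator_def atLeast_iff by measurable
 have p: "x ^ (?N - 1) * x = x ^ ?N" for x :: real
  using N by (metis power_minus_mult)
 have "(\<integral>\<^sup>+r. indicator {0<..} r * ennreal (r ^ (?N - 1)) * (\<integral>\<^sup>+z. F (r *\<^sub>R z) \<partial>surface_measure) \<partial>lborel)
   = of_nat ?N * (\<integral>\<^sup>+r. \<integral>\<^sup>+u. ?I r u \<partial>lborel \<partial>lborel)"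
  unfolding sgn_div_norm
  by (subst nn_integral_cmult[symmetric])
    (auto simp: nn_integral_surface nn_integral_cmult sgn_div_norm ac_simps
       intro!: nn_integral_cong)
 also have "\<dots> = of_nat ?N * (\<integral>\<^sup>+u. \<integral>\<^sup>+r. ?I r u \<partial>lborel \<partial>lborel)"
  unfolding sgn_div_norm by (subst lborel_pair.Fubini') (simp_all)
 also have "\<dots> = of_nat ?N * (\<integral>\<^sup>+u. \<integral>\<^sup>+s. ?I1 s u \<partial>lborel \<partial>lborel)"
 proof (rule arg_cong2[where f="(*)", OF refl], rule nn_integral_cong)
  fix u :: "real ^ 'n"
  show "(\<integral>\<^sup>+r. ?I r u \<partial>lborel)
   = (\<integral>\<^sup>+s. ?I1 s u \<partial>lborel)"
  proof (cases "u = 0")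
   case False
   then have n: "norm u > 0" by simp
   have "(\<integral>\<^sup>+r. ?I r u \<partial>lborel)
    = ennreal (norm u) * (\<integral>\<^sup>+s. indicator {0<..} (norm u * s) * ennreal ((norm u * s) ^ (?N - 1)) * (F ((norm u * s) *\<^sub>R sgn u) * indicator ?B u) \<partial>lborel)"
    using n by (subst nn_integral_lborel_scale[where c="norm u"]) simp_all
   also have "\<dots> = (\<integral>\<^sup>+s. ennreal (norm u) * (indicator {0<..} s * ennreal ((norm u * s) ^ (?N - 1)) * (F (s *\<^sub>R u) * indicator ?B u)) \<partial>lborel)"
   proof -
    have 1: "(norm u * s) *\<^sub>R sgn u = s *\<^sub>R u" for s
     using n by (simp add: sgn_div_norm field_simps)
    have 2: "indicator {0<..} (norm u * s) = (indicator {0<..} s :: ennreal)" for s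
     using n by (simp add: indicator_def zero_less_mult_iff)
    show ?thesis unfolding 1 2 by (rule nn_integral_cmult[symmetric]) simp
   qed
   also have "\<dots> = (\<integral>\<^sup>+s. ?I1 s u \<partial>lborel)"
   proof (rule nn_integral_cong)
    fix s :: real
    have "ennreal (norm u) * ennreal ((norm u * s) ^ (?N - 1)) = ennreal (norm u ^ ?N * s ^ (?N - 1))" if "s > 0"
     using that by (subst ennreal_mult[symmetric]) (auto simp: power_mult_distrib p[symmetric] ac_simps)
    then show "ennreal (norm u) * (indicator {0<..} s * ennreal ((norm u * s) ^ (?N - 1)) * (F (s *\<^sub>R u) * indicator ?B u))
     = ?I1 s u"
     by (auto simp: indicator_def mult.assoc[symmetric])
   qed
   finally show ?thesis .
  qed simp
 qed
 also have "\<dots> = of_nat ?N * (\<integral>\<^sup>+s. \<integral>\<^sup>+u. ?I1 s u \<partial>lborel \<partial>lborel)"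
  by (subst lborel_pair.Fubini') (simp_all)
 also have "\<dots> = of_nat ?N * (\<integral>\<^sup>+s. \<integral>\<^sup>+v. ?I2 v s \<partial>lborel \<partial>lborel)"
 proof (rule arg_cong2[where f="(*)", OF refl], rule nn_integral_cong)
  fix s :: real
  show "(\<integral>\<^sup>+u. ?I1 s u \<partial>lborel)
   = (\<integral>\<^sup>+v. ?I2 v s \<partial>lborel)"
  proof (cases "s > 0")
   case True
   have i: "indicator {norm (s *\<^sub>R u)..} s * indicator (-{0}) (s *\<^sub>R u) = (indicator ?B u :: ennreal)" for u
    using True by (auto simp: indicator_def)
   have "(\<integral>\<^sup>+v. ?I2 v s \<partial>lborel)
    = ennreal (s ^ ?N) * (\<integral>\<^sup>+u. ?I2 (s *\<^sub>R u) s \<partial>lborel)"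
    using True by (subst nn_integral_lborel_scale[where c=s]) simp_all
   also have "\<dots> = (\<integral>\<^sup>+u. ennreal (s ^ ?N) * (?I2 (s *\<^sub>R u) s) \<partial>lborel)"
    unfolding i by (rule nn_integral_cmult[symmetric]) simp
   also have "\<dots> = (\<integral>\<^sup>+u. ?I1 s u \<partial>lborel)"
   proof (rule nn_integral_cong)
    fix u :: "real ^ 'n"
    have e: "ennreal (s ^ ?N) * ennreal (norm (s *\<^sub>R u) ^ ?N) * ennreal (1 / s ^ (?N + 1)) = ennreal (norm u ^ ?N * s ^ (?N - 1))"
    proof -
     have "s ^ ?N * norm (s *\<^sub>R u) ^ ?N * (1 / s ^ (?N + 1)) = norm u ^ ?N * s ^ (?N - 1)"
     proof -
      obtain m where m: "?N = Suc m" using N gr0_implies_Suc by blast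
      show ?thesis using True unfolding m by (simp add: power_mult_distrib)
     qed
     then show ?thesis using True by (simp add: ennreal_mult[symmetric])
    qed
    show "ennreal (s ^ ?N) * (?I2 (s *\<^sub>R u) s)
     = ?I1 s u"
     unfolding i e[symmetric] using True by (simp add: ac_simps)
   qed
   finally show ?thesis by simp
  next
   case False
   then have "indicator {norm v..} s * indicator (-{0}) v = (0::ennreal)" for v :: "real ^ 'n"
    by (auto simp: indicator_def) (metis norm_le_zero_iff order_trans linorder_not_less)
   then show ?thesis using False by (simp only: \<open>\<And>v. indicator {norm v..} s * indicator (-{0}) v = (0::ennreal)\<close>) simp
  qed
 qed
 also have "\<dots> = of_nat ?N * (\<integral>\<^sup>+v. \<integral>\<^sup>+s. ?I2 v s \<partial>lborel \<partial>lborel)"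
  by (subst lborel_pair.Fubini') (simp_all)
 also have "\<dots> = (\<integral>\<^sup>+v. F v * indicator (-{0}) v \<partial>lborel)"
 proof -
  have "of_nat ?N * (\<integral>\<^sup>+s. ?I2 v s \<partial>lborel) = F v * indicator (-{0}) v" for v :: "real ^ 'n"
  proof (cases "v = 0")
   case False
   then have n: "norm v > 0" by simp
   have "(\<integral>\<^sup>+s. ennreal (1 / s ^ (?N + 1)) * indicator {norm v..} s \<partial>lborel)
     = ennreal (0 - (- (1 / (?N * norm v ^ ?N))))"
   proof (rule nn_integral_FTC_atLeast[where F="\<lambda>s::real. - (1 / (?N * s ^ ?N))" and T=0])
    show "((\<lambda>s::real. - (1 / (?N * s ^ ?N))) \<longlongrightarrow> 0) at_top"
     using N by real_asymp
    fix s :: real assume "norm v \<le> s"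
    then have s: "s > 0" using n by linarith
    then show "((\<lambda>s. - (1 / (?N * s ^ ?N))) has_real_derivative 1 / s ^ (?N + 1)) (at s)"
     by (intro DERIV_neg_inverse_power) auto
    show "0 \<le> 1 / s ^ (?N + 1)" using s by simp
   qed measurable
   then have "(\<integral>\<^sup>+s. ?I2 v s \<partial>lborel)
    = F v * ennreal (norm v ^ ?N) * ennreal (1 / (?N * norm v ^ ?N))"
    using False by (subst nn_integral_cmult) (simp_all add: mult.commute)
   then have "of_nat ?N * (\<integral>\<^sup>+s. ?I2 v s \<partial>lborel)
     = F v * (ennreal ?N * ennreal (norm v ^ ?N) * ennreal (1 / (?N * norm v ^ ?N)))"
    by (simp add: ac_simps ennreal_of_nat_eq_real_of_nat)
   also have "ennreal ?N * ennreal (norm v ^ ?N) * ennreal (1 / (?N * norm v ^ ?N)) = 1"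
    using n N by (simp add: ennreal_mult[symmetric])
   finally show ?thesis using False by simp
  qed simp
  then show ?thesis by (subst nn_integral_cmult[symmetric]) simp_all
 qed
 also have "\<dots> = (\<integral>\<^sup>+v. F v \<partial>lborel)"
  by (rule nn_integral_cong_AE) (use AE_lborel_singleton[of "0::real^'n"] in eventually_elim, simp)
 finally show ?thesis by simp
qed

section \<open>Integrals over Euclidean space\<close>

lemma
 fixes g :: "'a::euclidean_space \<Rightarrow> 'b::{banach, second_countable_topology}"
 assumes [measurable]: "g \<in> borel_measurable borel"
 shows integral_lborel_translate: "(\<integral>x. g (c + x) \<partial>lborel) = (\<integral>x. g x \<partial>lborel)"
  and integrable_lborel_translate_iff: "integrable lborel (\<lambda>x. g (c + x)) \<longleftrightarrow> integrable lborel g"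
proof -
 show "(\<integral>x. g (c + x) \<partial>lborel) = (\<integral>x. g x \<partial>lborel)"
  using integral_distr[of "(+) c" lborel borel g] by (simp add: lborel_distr_plus)
 show "integrable lborel (\<lambda>x. g (c + x)) \<longleftrightarrow> integrable lborel g"
  using integrable_distr_eq[of "(+) c" lborel borel g] by (simp add: lborel_distr_plus)
qed

lemma integral_lborel_orthogonal:
 fixes f :: "real ^ 'n \<Rightarrow> real ^ 'n" and g :: "real ^ 'n \<Rightarrow> 'b::{banach, second_countable_topology}"
 assumes f: "linear f" "\<And>x. norm (f x) = norm x" and [measurable]: "g \<in> borel_measurable borel"
 shows "(\<integral>x. g (f x) \<partial>lborel) = (\<integral>x. g x \<partial>lborel)"
proof -
 have [measurable]: "f \<in> borel_measurable borel"
  by (intro borel_measurable_continuous_onI linear_continuous_on) (simp add: f linear_linear)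
 show ?thesis
  using integral_distr[of f lborel borel g] by (simp add: lborel_distr_orthogonal f)
qed

lemma AE_surface_norm: "AE z in surface_measure. norm (z :: real ^ 'n) = 1"
proof (rule AE_I)
 let ?A = "{z :: real ^ 'n. norm z \<noteq> 1}"
 have [measurable]: "?A \<in> sets borel" by measurable
 have "emeasure surface_measure ?A = (\<integral>\<^sup>+z. indicator ?A z \<partial>surface_measure)" by simp
 also have "\<dots> = 0"
  by (subst nn_integral_surface) (auto simp: nn_integral_0_iff_AE indicator_def norm_sgn)
 finally show "emeasure surface_measure ?A = 0" .
qed auto

lemma lborel_polar:
 "lborel = distr (density (lborel \<Otimes>\<^sub>M surface_measure)
   (\<lambda>(r, z). indicator {0<..} r * ennreal (r ^ (CARD('n) - 1)))) borel (\<lambda>(r, z). r *\<^sub>R (z :: real ^ 'n))"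
 (is "_ = ?R")
proof (rule measure_eqI)
 fix A :: "(real ^ 'n) set" assume "A \<in> sets lborel"
 then have [measurable]: "A \<in> sets borel" by simp
 have "emeasure ?R A = (\<integral>\<^sup>+x. indicator A x \<partial>?R)" by simp
 also have "\<dots> = (\<integral>\<^sup>+(r, z). indicator {0<..} r * ennreal (r ^ (CARD('n) - 1)) * indicator A (r *\<^sub>R z) \<partial>(lborel \<Otimes>\<^sub>M surface_measure))"
  by (subst nn_integral_distr) (auto simp: nn_integral_density case_prod_beta intro!: nn_integral_cong)
 also have "\<dots> = (\<integral>\<^sup>+r. \<integral>\<^sup>+z. indicator {0<..} r * ennreal (r ^ (CARD('n) - 1)) * indicator A (r *\<^sub>R z) \<partial>surface_measure \<partial>lborel)"
  by (subst surface.nn_integral_fst[symmetric]) simp_all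
 also have "\<dots> = (\<integral>\<^sup>+x. indicator A x \<partial>lborel)"
  by (subst nn_integral_polar) (auto simp: nn_integral_cmult intro!: nn_integral_cong)
 finally show "emeasure lborel A = emeasure ?R A" by simp
qed simp

lemma integral_polar:
 fixes F :: "real ^ 'n \<Rightarrow> 'b::{banach, second_countable_topology}"
 assumes F: "integrable lborel F"
 shows "(\<integral>x. F x \<partial>lborel)
  = (\<integral>r. (indicator {0<..} r * r ^ (CARD('n) - 1)) *\<^sub>R (\<integral>z. F (r *\<^sub>R z) \<partial>surface_measure) \<partial>lborel)"
proof -
 interpret P: pair_sigma_finite "lborel :: real measure" "surface_measure :: (real ^ 'n) measure" ..
 have [measurable]: "F \<in> borel_measurable borel" using F by simp
 define d :: "real \<times> (real ^ 'n) \<Rightarrow> real"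
  where "d x = indicator {0<..} (fst x) * fst x ^ (CARD('n) - 1)" for x
 have e: "(\<lambda>(r, z). indicator {0<..} r * ennreal (r ^ (CARD('n) - 1))) = (\<lambda>x. ennreal (d x))"
  by (auto simp: fun_eq_iff indicator_def d_def)
 have p: "lborel = distr (density (lborel \<Otimes>\<^sub>M surface_measure) (\<lambda>x. ennreal (d x))) borel (\<lambda>(r, z). r *\<^sub>R (z :: real ^ 'n))"
  unfolding e[symmetric] by (rule lborel_polar)
 have d: "AE x in lborel \<Otimes>\<^sub>M surface_measure. 0 \<le> d x" by (auto simp: indicator_def d_def)
 have [measurable]: "d \<in> borel_measurable (lborel \<Otimes>\<^sub>M surface_measure)" unfolding d_def by measurable
 have "integrable (distr (density (lborel \<Otimes>\<^sub>M surface_measure) d) borel (\<lambda>(r, z). r *\<^sub>R (z :: real ^ 'n))) F"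
  using F by (subst p[symmetric])
 then have int: "integrable (lborel \<Otimes>\<^sub>M surface_measure) (\<lambda>x. d x *\<^sub>R F (fst x *\<^sub>R snd x))"
  by (subst (asm) integrable_distr_eq) (simp_all add: integrable_density[OF _ _ d] case_prod_beta)
 have "(\<integral>x. F x \<partial>lborel) = (\<integral>x. F x \<partial>distr (density (lborel \<Otimes>\<^sub>M surface_measure) d) borel (\<lambda>(r, z). r *\<^sub>R (z :: real ^ 'n)))"
  by (subst p) rule
 also have "\<dots> = (\<integral>x. d x *\<^sub>R F (fst x *\<^sub>R snd x) \<partial>(lborel \<Otimes>\<^sub>M surface_measure))"
  by (subst integral_distr) (simp_all add: integral_density[OF _ _ d] case_prod_beta)
 also have "\<dots> = (\<integral>r. \<integral>z. d (r, z) *\<^sub>R F (r *\<^sub>R z) \<partial>surface_measure \<partial>lborel)"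
  using P.integral_fst'[OF int] by simp
 finally show ?thesis by (simp add: d_def)
qed

lemma integrable_exp_neg_norm: "integrable lborel (\<lambda>x :: real ^ 'n. exp (- norm x))"
proof (rule integrableI_bounded)
 have "(\<integral>\<^sup>+x. ennreal (norm (exp (- norm (x :: real ^ 'n)))) \<partial>lborel)
  = (\<integral>\<^sup>+r. indicator {0<..} r * ennreal (r ^ (CARD('n) - 1)) *
    (\<integral>\<^sup>+z. ennreal (exp (- norm (r *\<^sub>R (z :: real ^ 'n)))) \<partial>surface_measure) \<partial>lborel)"
  by (subst nn_integral_polar) simp_all
 also have "\<dots> = (\<integral>\<^sup>+r. emeasure surface_measure (UNIV :: (real ^ 'n) set) *
   ennreal (indicator {0..} r * r powr (real CARD('n) - 1) / exp r) \<partial>lborel)"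
 proof (rule nn_integral_cong)
  fix r :: real
  have *: "(\<integral>\<^sup>+z. ennreal (exp (- norm (r *\<^sub>R (z :: real ^ 'n)))) \<partial>surface_measure)
    = (\<integral>\<^sup>+z. ennreal (exp (- r)) \<partial>(surface_measure :: (real ^ 'n) measure))" if "r > 0"
   by (rule nn_integral_cong_AE) (use AE_surface_norm in eventually_elim, use that in simp)
  show "indicator {0<..} r * ennreal (r ^ (CARD('n) - 1)) *
    (\<integral>\<^sup>+z. ennreal (exp (- norm (r *\<^sub>R (z :: real ^ 'n)))) \<partial>surface_measure)
   = emeasure surface_measure (UNIV :: (real ^ 'n) set) *
   ennreal (indicator {0..} r * r powr (real CARD('n) - 1) / exp r)"
  proof (cases "r > 0")
   case True
   have "r ^ (CARD('n) - 1) = r powr (real CARD('n) - 1)"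
    using True by (simp add: powr_realpow[symmetric] of_nat_diff)
   with True * show ?thesis
    by (simp add: ennreal_mult[symmetric] exp_minus field_simps divide_ennreal_def
      ennreal_mult'[symmetric] del: ennreal_mult')
  next
   case False
   then show ?thesis by (cases "r = 0") (auto simp: indicator_def)
  qed
 qed
 also have "\<dots> = emeasure surface_measure (UNIV :: (real ^ 'n) set) * ennreal (Gamma (real CARD('n)))"
  by (subst nn_integral_cmult) (simp_all add: Gamma_conv_nn_integral_real)
 also have "\<dots> < \<infinity>"
  using surface.emeasure_finite[of "UNIV :: (real ^ 'n) set"]
  unfolding ennreal_mult_less_top infinity_ennreal_def by (metis ennreal_less_top top.not_eq_extremum)
 finally show "(\<integral>\<^sup>+x. ennreal (norm (exp (- norm (x :: real ^ 'n)))) \<partial>lborel) < \<infinity>" .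
qed simp

lemma exp_linear_minus_square_le:
 fixes C c r :: real
 assumes "c > 0"
 shows "exp (C * r - c * r\<^sup>2) \<le> exp ((C + 1)\<^sup>2 / (4 * c)) * exp (- r)"
proof -
 have "0 \<le> (2 * c * r - (C + 1))\<^sup>2 / (4 * c)" using assms by simp
 also have "\<dots> = (C + 1)\<^sup>2 / (4 * c) - r - (C * r - c * r\<^sup>2)"
  using assms by (simp add: field_simps power2_eq_square)
 finally show ?thesis by (simp add: mult_exp_exp)
qed

lemma integrable_exp_linear_minus_square:
 assumes "c > 0"
 shows "integrable lborel (\<lambda>x :: real ^ 'n. exp (C * norm x - c * (norm x)\<^sup>2))"
 by (rule Bochner_Integration.integrable_bound[OF
    integrable_mult_right[OF integrable_exp_neg_norm, of "exp ((C + 1)\<^sup>2 / (4 * c))"]])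
   (use exp_linear_minus_square_le[OF assms] in auto)

text \<open>Euler's integral for the Gamma function after the substitution \<open>t = r\<^sup>2 / 2\<close>.\<close>

lemma nn_integral_powr_half_square:
 assumes "a > -1"
 shows "(\<integral>\<^sup>+r. indicator {0<..} r * ennreal (r powr a * exp (- r\<^sup>2 / 2)) \<partial>lborel)
  = ennreal (2 powr ((a - 1) / 2) * Gamma ((a + 1) / 2))"
proof -
 define f where "f = (\<lambda>t::real. (2 * t) powr ((a - 1) / 2) * exp (- t))"
 have [measurable]: "f \<in> borel_measurable borel" by (simp add: f_def)
 have lim: "(\<lambda>n. \<integral>\<^sup>+x. ennreal (h x) * indicator {0..c n} x \<partial>lborel) \<longlonglongrightarrow> (\<integral>\<^sup>+x. ennreal (h x) * indicator {0..} x \<partial>lborel)"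
  if [measurable]: "h \<in> borel_measurable borel" and c: "incseq c" "filterlim c at_top sequentially"
  for h and c :: "nat \<Rightarrow> real"
 proof (rule nn_integral_LIMSEQ)
  show "incseq (\<lambda>n x. ennreal (h x) * indicator {0..c n} x)"
   using c(1) by (auto simp: incseq_def le_fun_def indicator_def intro: order_trans)
  fix x
  have "eventually (\<lambda>n. c n \<ge> x) sequentially" using c(2) by (simp add: filterlim_at_top)
  then have "eventually (\<lambda>n. ennreal (h x) * indicator {0..c n} x = ennreal (h x) * indicator {0..} x) sequentially"
   by eventually_elim (auto simp: indicator_def)
  then show "(\<lambda>n. ennreal (h x) * indicator {0..c n} x) \<longlonglongrightarrow> ennreal (h x) * indicator {0..} x"
   by (rule tendsto_eventually)
 qed measurable
 have e: "ennreal u * indicator A x = ennreal (u * indicat_real A x)" for u x and A :: "real set"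
  by (simp add: indicator_def)
 have sub: "(\<integral>\<^sup>+t. ennreal (f t) * indicator {0..(real n)\<^sup>2 / 2} t \<partial>lborel)
   = (\<integral>\<^sup>+r. ennreal (f (r\<^sup>2 / 2) * r) * indicator {0..real n} r \<partial>lborel)" for n
 proof -
  have "((\<lambda>r. r\<^sup>2 / 2) has_real_derivative x) (at x)" for x :: real
   by (auto intro!: derivative_eq_intros)
  then show ?thesis
   using nn_integral_substitution[of "\<lambda>r. r\<^sup>2 / 2" 0 "real n" f "\<lambda>r. r"]
   by (simp add: set_borel_measurable_def e)
 qed
 have "(\<integral>\<^sup>+t. ennreal (f t) * indicator {0..} t \<partial>lborel)
   = (\<integral>\<^sup>+r. ennreal (f (r\<^sup>2 / 2) * r) * indicator {0..} r \<partial>lborel)"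
 proof (rule LIMSEQ_unique)
  show "(\<lambda>n. \<integral>\<^sup>+t. ennreal (f t) * indicator {0..(real n)\<^sup>2 / 2} t \<partial>lborel) \<longlonglongrightarrow> (\<integral>\<^sup>+t. ennreal (f t) * indicator {0..} t \<partial>lborel)"
  proof (rule lim)
   show "filterlim (\<lambda>n. (real n)\<^sup>2 / 2) at_top sequentially" by real_asymp
  qed (auto simp: incseq_def power_mono)
  show "(\<lambda>n. \<integral>\<^sup>+t. ennreal (f t) * indicator {0..(real n)\<^sup>2 / 2} t \<partial>lborel) \<longlonglongrightarrow> (\<integral>\<^sup>+r. ennreal (f (r\<^sup>2 / 2) * r) * indicator {0..} r \<partial>lborel)"
   unfolding sub by (rule lim) (auto simp: incseq_def filterlim_real_sequentially)
 qed
 also have "(\<integral>\<^sup>+r. ennreal (f (r\<^sup>2 / 2) * r) * indicator {0..} r \<partial>lborel)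
  = (\<integral>\<^sup>+r. indicator {0<..} r * ennreal (r powr a * exp (- r\<^sup>2 / 2)) \<partial>lborel)"
 proof (rule nn_integral_cong)
  fix r :: real
  have "(r\<^sup>2) powr ((a - 1) / 2) * r = r powr a" if "r > 0"
  proof -
   have "(r\<^sup>2) powr ((a - 1) / 2) * r = (r powr 2) powr ((a - 1) / 2) * r powr 1"
    using that by simp
   also have "\<dots> = r powr (2 * ((a - 1) / 2) + 1)" by (simp only: powr_powr powr_add)
   also have "2 * ((a - 1) / 2) + 1 = a" by (simp add: field_simps)
   finally show ?thesis .
  qed
  then show "ennreal (f (r\<^sup>2 / 2) * r) * indicator {0..} r = indicator {0<..} r * ennreal (r powr a * exp (- r\<^sup>2 / 2))"
   by (cases "r = 0") (auto simp: f_def indicator_def ac_simps)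
 qed
 finally have *: "(\<integral>\<^sup>+t. ennreal (f t) * indicator {0..} t \<partial>lborel)
  = (\<integral>\<^sup>+r. indicator {0<..} r * ennreal (r powr a * exp (- r\<^sup>2 / 2)) \<partial>lborel)" .
 have "(\<integral>\<^sup>+t. ennreal (f t) * indicator {0..} t \<partial>lborel)
  = (\<integral>\<^sup>+t. ennreal (2 powr ((a - 1) / 2)) * ennreal (indicator {0..} t * t powr ((a + 1) / 2 - 1) / exp t) \<partial>lborel)"
 proof (rule nn_integral_cong)
  fix t :: real
  have 1: "(a + 1) / 2 - 1 = (a - 1) / 2" by (simp add: field_simps)
  show "ennreal (f t) * indicator {0..} t
   = ennreal (2 powr ((a - 1) / 2)) * ennreal (indicator {0..} t * t powr ((a + 1) / 2 - 1) / exp t)"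
  proof (cases "t \<ge> 0")
   case True
   have "f t = 2 powr ((a - 1) / 2) * (t powr ((a - 1) / 2) / exp t)"
    using True by (simp add: f_def powr_mult exp_minus) (simp add: field_simps)
   have "ennreal (f t) = ennreal (2 powr ((a - 1) / 2)) * ennreal (t powr ((a - 1) / 2) / exp t)"
    unfolding \<open>f t = _\<close> by (rule ennreal_mult) simp_all
   with True show ?thesis unfolding 1 by (simp only: indicator_simps atLeast_iff mult_1 mult_1_right)
  qed simp
 qed
 also have "\<dots> = ennreal (2 powr ((a - 1) / 2)) * ennreal (Gamma ((a + 1) / 2))"
  by (subst nn_integral_cmult, simp, subst Gamma_conv_nn_integral_real)
    (use assms in simp, rule refl)
 also have "\<dots> = ennreal (2 powr ((a - 1) / 2) * Gamma ((a + 1) / 2))"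
  by (rule ennreal_mult'[symmetric]) simp
 finally show ?thesis unfolding * .
qed

lemma nn_integral_abs_powr_unit:
 assumes a: "0 < a" "a \<le> 1"
 shows "(\<integral>\<^sup>+u. ennreal (\<bar>u\<bar> powr (a - 1)) * indicator {-1..1} u \<partial>lborel) \<le> ennreal (2 / a)"
proof -
 let ?p = "\<lambda>u::real. ennreal (\<bar>u\<bar> powr (a - 1)) * indicator {0..1} u"
 have *: "(\<integral>\<^sup>+u. ?p u \<partial>lborel) = ennreal (1 / a)"
 proof -
  have "((\<lambda>u. \<bar>u\<bar> powr (a - 1)) has_integral 1 / a) {0..1}"
   using has_integral_powr_from_0[of "a - 1" 1] a
   by (subst has_integral_cong[where g="\<lambda>u. u powr (a - 1)"]) auto
  from nn_integral_has_integral_lebesgue[OF _ this]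
  show ?thesis by (simp add: mult.commute ennreal_mult' ennreal_indicator)
 qed
 have "(\<integral>\<^sup>+u. ennreal (\<bar>u\<bar> powr (a - 1)) * indicator {-1..1} u \<partial>lborel)
  \<le> (\<integral>\<^sup>+u. ?p u + ?p (-1 *\<^sub>R u) \<partial>lborel)"
  by (rule nn_integral_mono) (auto simp: indicator_def)
 also have "\<dots> = (\<integral>\<^sup>+u. ?p u \<partial>lborel) + (\<integral>\<^sup>+u. ?p (-1 *\<^sub>R u) \<partial>lborel)"
  by (rule nn_integral_add) simp_all
 also have "(\<integral>\<^sup>+u. ?p (-1 *\<^sub>R u) \<partial>lborel) = (\<integral>\<^sup>+u. ?p u \<partial>lborel)"
 proof -
  have "(\<integral>\<^sup>+u. ?p u \<partial>lborel) = (\<integral>\<^sup>+u. ?p u \<partial>distr lborel borel uminus)"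
   by (subst lborel_distr_uminus) rule
  also have "\<dots> = (\<integral>\<^sup>+u. ?p (-1 *\<^sub>R u) \<partial>lborel)"
   by (subst nn_integral_distr) simp_all
  finally show ?thesis by simp
 qed
 also have "(\<integral>\<^sup>+u. ?p u \<partial>lborel) + (\<integral>\<^sup>+u. ?p u \<partial>lborel) = ennreal (2 / a)"
  unfolding * using a by (simp flip: ennreal_plus)
 finally show ?thesis .
qed

lemma nn_integral_abs_affine_powr_le:
 assumes a: "0 < a" "a \<le> 1" and b: "b > (0::real)"
 shows "(\<integral>\<^sup>+s. ennreal (\<bar>c + s * b\<bar> powr (a - 1)) * indicator {0..1} s \<partial>lborel) \<le> ennreal (1 + 2 / (a * b))"
proof -
 let ?q = "\<lambda>u::real. ennreal (\<bar>u\<bar> powr (a - 1)) * indicator {-1..1} u"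
 have "(\<integral>\<^sup>+s. ennreal (\<bar>c + s * b\<bar> powr (a - 1)) * indicator {0..1} s \<partial>lborel)
   \<le> (\<integral>\<^sup>+s. indicator {0..1} s + ?q (c + b * s) \<partial>lborel)"
 proof (rule nn_integral_mono)
  fix s
  have "\<bar>u\<bar> powr (a - 1) \<le> 1" if "\<bar>u\<bar> > 1" for u :: real
   using that a powr_mono[of "a - 1" 0 "\<bar>u\<bar>"] by (auto split: if_splits)
  then have "\<bar>c + b * s\<bar> \<le> 1 \<or> \<bar>c + b * s\<bar> powr (a - 1) \<le> 1" by force
  then show "ennreal (\<bar>c + s * b\<bar> powr (a - 1)) * indicator {0..1} s \<le> indicator {0..1} s + ?q (c + b * s)"
   by (auto simp: indicator_def mult.commute[of s] abs_le_iff)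
 qed
 also have "\<dots> = (\<integral>\<^sup>+s. indicator {0..1::real} s \<partial>lborel) + (\<integral>\<^sup>+s. ?q (c + b * s) \<partial>lborel)"
  by (rule nn_integral_add) simp_all
 also have "\<dots> = 1 + (\<integral>\<^sup>+s. ?q (c + b * s) \<partial>lborel)" by simp
 also have "(\<integral>\<^sup>+s. ?q (c + b * s) \<partial>lborel) = ennreal (1 / b) * (\<integral>\<^sup>+u. ?q u \<partial>lborel)"
 proof -
  have "(\<integral>\<^sup>+u. ?q u \<partial>lborel) = ennreal b * (\<integral>\<^sup>+s. ?q (c + b * s) \<partial>lborel)"
   using b by (subst nn_integral_real_affine[where c=b and t=c]) simp_all
  then show ?thesis using b by (simp add: mult.assoc[symmetric] flip: ennreal_mult)
 qed
 also have "1 + ennreal (1 / b) * (\<integral>\<^sup>+u. ?q u \<partial>lborel) \<le> 1 + ennreal (1 / b) * ennreal (2 / a)"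
  by (intro add_left_mono mult_left_mono nn_integral_abs_powr_unit a) simp
 also have "\<dots> = ennreal (1 + 2 / (a * b))"
  using a b by (simp add: ac_simps flip: ennreal_mult)
 finally show ?thesis .
qed

text \<open>Averaging over the translates by \<open>s \<alpha>\<close>, \<open>0 \<le> s \<le> 1\<close>, does not change the integral and reduces the
 singularity along the hyperplane to a one-dimensional integral.\<close>

lemma integrable_abs_inner_powr:
 fixes \<alpha> :: "real ^ 'n"
 assumes a: "0 < a" "a \<le> 1" and \<alpha>: "\<alpha> \<noteq> 0"
 shows "integrable lborel (\<lambda>x :: real ^ 'n. \<bar>\<alpha> \<bullet> x\<bar> powr (a - 1) * exp (- norm x))"
proof (rule integrableI_bounded)
 let ?\<Phi> = "\<lambda>x :: real ^ 'n. ennreal (\<bar>\<alpha> \<bullet> x\<bar> powr (a - 1) * exp (- norm x))"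
 let ?c = "1 + 2 / (a * (\<alpha> \<bullet> \<alpha>))"
 have "(\<integral>\<^sup>+x. ?\<Phi> x \<partial>lborel) = (\<integral>\<^sup>+s. indicator {0..1::real} s * (\<integral>\<^sup>+x. ?\<Phi> x \<partial>lborel) \<partial>lborel)"
  by (subst nn_integral_multc) simp_all
 also have "\<dots> = (\<integral>\<^sup>+s. \<integral>\<^sup>+x. indicator {0..1::real} s * ?\<Phi> (s *\<^sub>R \<alpha> + x) \<partial>lborel \<partial>lborel)"
  by (rule nn_integral_cong)
    (subst nn_integral_lborel_translate[where g="?\<Phi>", symmetric], simp, rule nn_integral_cmult[symmetric], simp)
 also have "\<dots> = (\<integral>\<^sup>+x. \<integral>\<^sup>+s. indicator {0..1::real} s * ?\<Phi> (s *\<^sub>R \<alpha> + x) \<partial>lborel \<partial>lborel)"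
  by (rule lborel_pair.Fubini') simp
 also have "\<dots> \<le> (\<integral>\<^sup>+x. \<integral>\<^sup>+s. ennreal (exp (norm \<alpha>) * exp (- norm x)) * (ennreal (\<bar>\<alpha> \<bullet> x + s * (\<alpha> \<bullet> \<alpha>)\<bar> powr (a - 1)) * indicator {0..1} s) \<partial>lborel \<partial>lborel)"
 proof (intro nn_integral_mono)
  fix x :: "real ^ 'n" and s :: real
  have i: "\<alpha> \<bullet> (s *\<^sub>R \<alpha> + x) = \<alpha> \<bullet> x + s * (\<alpha> \<bullet> \<alpha>)" by (simp add: inner_right_distrib)
  have "exp (- norm (s *\<^sub>R \<alpha> + x)) \<le> exp (norm \<alpha>) * exp (- norm x)" if "s \<in> {0..1}"
  proof -
   have "norm x \<le> norm (s *\<^sub>R \<alpha> + x) + norm (s *\<^sub>R \<alpha>)"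
    by (metis add_diff_cancel_left' norm_triangle_sub norm_minus_commute add.commute norm_triangle_ineq4)
   also have "norm (s *\<^sub>R \<alpha>) \<le> norm \<alpha>" using that by (auto intro: mult_left_le_one_le)
   finally show ?thesis by (simp add: mult_exp_exp)
  qed
  then have "exp (- norm (s *\<^sub>R \<alpha> + x)) * p \<le> exp (norm \<alpha>) * exp (- norm x) * p" if "s \<in> {0..1}" "p \<ge> 0" for p
   using that by (intro mult_right_mono) auto
  then show "indicator {0..1::real} s * ?\<Phi> (s *\<^sub>R \<alpha> + x)
   \<le> ennreal (exp (norm \<alpha>) * exp (- norm x)) * (ennreal (\<bar>\<alpha> \<bullet> x + s * (\<alpha> \<bullet> \<alpha>)\<bar> powr (a - 1)) * indicator {0..1} s)"
   unfolding i
   using \<open>\<And>p. s \<in> {0..1} \<Longrightarrow> 0 \<le> p \<Longrightarrow> exp (- norm (s *\<^sub>R \<alpha> + x)) * p \<le> exp (norm \<alpha>) * exp (- norm x) * p\<close>[of "\<bar>\<alpha> \<bullet> x + s * (\<alpha> \<bullet> \<alpha>)\<bar> powr (a - 1)"]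
   by (auto simp: indicator_def mult.commute intro!: ennreal_leI simp flip: ennreal_mult)
 qed
 also have "\<dots> = (\<integral>\<^sup>+x. ennreal (exp (norm \<alpha>) * exp (- norm x)) * (\<integral>\<^sup>+s. ennreal (\<bar>\<alpha> \<bullet> x + s * (\<alpha> \<bullet> \<alpha>)\<bar> powr (a - 1)) * indicator {0..1} s \<partial>lborel) \<partial>lborel)"
  by (rule nn_integral_cong, rule nn_integral_cmult) simp
 also have "\<dots> \<le> (\<integral>\<^sup>+x. ennreal (exp (norm \<alpha>) * exp (- norm (x :: real ^ 'n))) * ennreal ?c \<partial>lborel)"
  by (intro nn_integral_mono mult_left_mono nn_integral_abs_affine_powr_le a) (use \<alpha> in auto)
 also have "\<dots> = (\<integral>\<^sup>+x. ennreal (exp (norm \<alpha>) * ?c * exp (- norm (x :: real ^ 'n))) \<partial>lborel)"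
  using a by (intro nn_integral_cong) (simp add: ac_simps del: ennreal_plus flip: ennreal_mult)
 also have "\<dots> < \<infinity>"
  using integrable_mult_right[OF integrable_exp_neg_norm, of "exp (norm \<alpha>) * ?c"] a
  by (subst nn_integral_eq_integral) auto
 finally show "(\<integral>\<^sup>+x. ennreal (norm (\<bar>\<alpha> \<bullet> x\<bar> powr (a - 1) * exp (- norm x))) \<partial>lborel) < \<infinity>"
  by simp
qed simp

section \<open>Differentiation and power series\<close>

text \<open>Translation invariance makes the integral of \<open>G (x + \<xi>) - G x\<close> vanish, and by the fundamental theorem of
 calculus and Fubini it equals the integral of \<open>g\<close>. Exceptional points on a line occur where
 it crosses a reflecting hyperplane.\<close>

lemma integral_line_derivative_eq_0:
 fixes G g :: "'a::euclidean_space \<Rightarrow> 'b::euclidean_space"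
 assumes G: "integrable lborel G" "continuous_on UNIV G" and g: "integrable lborel g"
  and deriv: "AE x in lborel. \<exists>S. finite S \<and>
   (\<forall>s\<in>{0<..<1} - S. ((\<lambda>s. G (x + s *\<^sub>R \<xi>)) has_vector_derivative g (x + s *\<^sub>R \<xi>)) (at s))"
 shows "(\<integral>x. g x \<partial>lborel) = 0"
proof -
 let ?h = "\<lambda>s x. indicator {0..1::real} s *\<^sub>R g (x + s *\<^sub>R \<xi>)"
 have [measurable]: "G \<in> borel_measurable borel" "g \<in> borel_measurable borel" using G g by auto
 have tr: "integrable lborel (\<lambda>x. g (x + s *\<^sub>R \<xi>))" "(\<integral>x. g (x + s *\<^sub>R \<xi>) \<partial>lborel) = (\<integral>x. g x \<partial>lborel)"
  "(\<integral>x. norm (g (x + s *\<^sub>R \<xi>)) \<partial>lborel) = (\<integral>x. norm (g x) \<partial>lborel)" for s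
  using g integrable_lborel_translate_iff[of g "s *\<^sub>R \<xi>"] integral_lborel_translate[of g "s *\<^sub>R \<xi>"]
   integral_lborel_translate[of "\<lambda>x. norm (g x)" "s *\<^sub>R \<xi>"]
  by (simp_all add: add.commute)
 have int: "integrable (lborel \<Otimes>\<^sub>M lborel) (case_prod ?h)"
 proof (rule lborel_pair.Fubini_integrable)
  show "integrable lborel (\<lambda>s. \<integral>x. norm (case_prod ?h (s, x)) \<partial>lborel)"
   by (simp add: tr(3))
  show "AE s in lborel. integrable lborel (\<lambda>x. case_prod ?h (s, x))"
   using tr(1) by simp
 qed measurable
 have "(\<integral>x. g x \<partial>lborel) = (\<integral>s. \<integral>x. ?h s x \<partial>lborel \<partial>lborel)"
  by (simp add: tr(2))
 also have "\<dots> = (\<integral>x. \<integral>s. ?h s x \<partial>lborel \<partial>lborel)"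
  by (rule lborel_pair.Fubini_integral[OF int, symmetric])
 also have "\<dots> = (\<integral>x. G (\<xi> + x) - G x \<partial>lborel)"
 proof (rule integral_cong_AE)
  show "AE x in lborel. (\<integral>s. ?h s x \<partial>lborel) = G (\<xi> + x) - G x"
   using lborel_pair.AE_integrable_snd[OF int] deriv
  proof eventually_elim
   case (elim x)
   then obtain S where S: "finite S"
    "\<And>s. s \<in> {0<..<1} - S \<Longrightarrow> ((\<lambda>s. G (x + s *\<^sub>R \<xi>)) has_vector_derivative g (x + s *\<^sub>R \<xi>)) (at s)"
    by blast
   have "continuous_on {0..1} (\<lambda>s. G (x + s *\<^sub>R \<xi>))"
    by (intro continuous_on_compose2[OF G(2)] continuous_intros) auto
   from fundamental_theorem_of_calculus_interior_strong[OF S(1) zero_le_one S(2) this]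
   have 1: "((\<lambda>s. g (x + s *\<^sub>R \<xi>)) has_integral G (x + \<xi>) - G x) {0..1}" by simp
   have "set_integrable lborel {0..1} (\<lambda>s. g (x + s *\<^sub>R \<xi>))"
    using elim by (simp add: set_integrable_def)
   from set_borel_integral_eq_integral(2)[OF this] integral_unique[OF 1]
   show ?case by (simp add: set_lebesgue_integral_def add.commute)
  qed
 qed measurable
 also have "\<dots> = 0"
  using G integrable_lborel_translate_iff[of G \<xi>] integral_lborel_translate[of G \<xi>]
  by (subst Bochner_Integration.integral_diff) simp_all
 finally show ?thesis .
qed

lemma has_field_derivative_lebesgue_integral:
 fixes f f' :: "complex \<Rightarrow> 'a \<Rightarrow> complex"
 assumes der: "\<And>z x. z \<in> cball z0 \<delta> \<Longrightarrow> x \<in> space M \<Longrightarrow> ((\<lambda>z. f z x) has_field_derivative f' z x) (at z)"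
  and \<delta>: "\<delta> > 0"
  and int: "\<And>z. z \<in> cball z0 \<delta> \<Longrightarrow> integrable M (f z)"
  and [measurable]: "f' z0 \<in> borel_measurable M"
  and bound: "\<And>z x. z \<in> cball z0 \<delta> \<Longrightarrow> x \<in> space M \<Longrightarrow> norm (f' z x) \<le> g x"
  and g: "integrable M g"
 shows "((\<lambda>z. \<integral>x. f z x \<partial>M) has_field_derivative (\<integral>x. f' z0 x \<partial>M)) (at z0)"
proof -
 have lip: "norm (f (z0 + h) x - f z0 x) \<le> g x * norm h"
  if h: "norm h \<le> \<delta>" and x: "x \<in> space M" for h x
 proof -
  have "norm (f (z0 + h) x - f z0 x) \<le> g x * norm (z0 + h - z0)"
   by (rule field_differentiable_bound[where S="cball z0 \<delta>" and f'="\<lambda>z. f' z x"])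
     (use \<delta> h x in \<open>auto intro!: bound intro: has_field_derivative_at_within[OF der] simp: dist_norm\<close>)
  then show ?thesis by simp
 qed
 have "((\<lambda>h. ((\<integral>x. f (z0 + h) x \<partial>M) - (\<integral>x. f z0 x \<partial>M)) / h) \<longlongrightarrow> (\<integral>x. f' z0 x \<partial>M)) (at 0)"
  unfolding tendsto_at_iff_sequentially comp_def
 proof safe
  fix X :: "nat \<Rightarrow> complex" assume X0: "\<forall>i. X i \<in> UNIV - {0}" and X: "X \<longlonglongrightarrow> 0"
  from tendstoD[OF X \<delta>] obtain N where N: "\<And>n. norm (X (n + N)) \<le> \<delta>"
   unfolding eventually_sequentially dist_norm by (metis le_add2 diff_zero less_imp_le)
  have i: "integrable M (f (z0 + X (n + N)))" "integrable M (f z0)" for n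
   using N[of n] \<delta> by (auto intro!: int simp: dist_norm)
  have "(\<lambda>n. \<integral>x. (f (z0 + X (n + N)) x - f z0 x) / X (n + N) \<partial>M) \<longlonglongrightarrow> (\<integral>x. f' z0 x \<partial>M)"
  proof (rule integral_dominated_convergence[where w=g])
   show "(\<lambda>x. (f (z0 + X (n + N)) x - f z0 x) / X (n + N)) \<in> borel_measurable M" for n
    using i(1)[of n] i(2) by measurable
   show "AE x in M. (\<lambda>n. (f (z0 + X (n + N)) x - f z0 x) / X (n + N)) \<longlonglongrightarrow> f' z0 x"
   proof (rule AE_I2)
    fix x assume x: "x \<in> space M"
    have "((\<lambda>h. (f (z0 + h) x - f z0 x) / h) \<longlongrightarrow> f' z0 x) (at 0)"
     using der[where z=z0 and x=x] \<delta> x by (simp add: DERIV_def)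
    then have "(\<lambda>n. (f (z0 + X n) x - f z0 x) / X n) \<longlonglongrightarrow> f' z0 x"
     unfolding tendsto_at_iff_sequentially comp_def using X0 X by blast
    then show "(\<lambda>n. (f (z0 + X (n + N)) x - f z0 x) / X (n + N)) \<longlonglongrightarrow> f' z0 x"
     by (rule LIMSEQ_ignore_initial_segment)
   qed
   show "AE x in M. norm ((f (z0 + X (n + N)) x - f z0 x) / X (n + N)) \<le> g x" for n
    using lip[OF N[of n]] X0 by (auto simp: norm_divide divide_le_eq)
  qed (use g in auto)
  also have "(\<lambda>n. \<integral>x. (f (z0 + X (n + N)) x - f z0 x) / X (n + N) \<partial>M)
   = (\<lambda>n. ((\<integral>x. f (z0 + X (n + N)) x \<partial>M) - (\<integral>x. f z0 x \<partial>M)) / X (n + N))"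
   using i by (simp add: Bochner_Integration.integral_diff)
  finally show "(\<lambda>n. ((\<integral>x. f (z0 + X n) x \<partial>M) - (\<integral>x. f z0 x \<partial>M)) / X n) \<longlonglongrightarrow> (\<integral>x. f' z0 x \<partial>M)"
   by (rule LIMSEQ_offset)
 qed
 then show ?thesis by (simp add: DERIV_def)
qed

text \<open>Once the lower coefficients vanish, divide by \<open>s\<^sup>m\<close> and let \<open>s\<close> tend to \<open>0\<close>.\<close>

lemma powser_eq_0_on_unit_interval:
 fixes c :: "nat \<Rightarrow> complex"
 assumes "\<And>s. 0 < s \<Longrightarrow> s \<le> 1 \<Longrightarrow> (\<lambda>n. c n * of_real s ^ n) sums 0"
 shows "c n = 0"
proof (induction n rule: less_induct)
 case (less m)
 define F where "F z = (\<Sum>n. c (n + m) * z ^ n)" for z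
 have real: "(\<lambda>n. c (n + m) * of_real s ^ n) sums 0" if s: "0 < s" "s \<le> 1" for s
 proof -
  have "(\<lambda>n. c (n + m) * of_real s ^ (n + m)) sums 0"
   using sums_split_initial_segment[OF assms[OF s], of m] less by simp
  from sums_mult[OF this, of "inverse (of_real s ^ m)"] show ?thesis
   using s by (simp add: power_add field_simps)
 qed
 have "(\<lambda>n. c (n + m) * z ^ n) sums F z" if "norm z < 1" for z
  unfolding F_def using powser_inside[of "\<lambda>n. c (n + m)" 1 z] real[of 1] that
  by (auto simp: sums_iff)
 then have "(F \<longlongrightarrow> c (0 + m)) (at 0)" by (rule powser_limit_0[OF zero_less_one])
 moreover have "filterlim (\<lambda>n. of_real (1 / real (Suc n)) :: complex) (at 0) sequentially"
  unfolding filterlim_at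
  using tendsto_of_real[where 'a=complex, OF LIMSEQ_inverse_real_of_nat]
  by (auto simp: field_simps simp flip: of_nat_Suc intro!: always_eventually)
 ultimately have "(\<lambda>n. F (of_real (1 / real (Suc n)))) \<longlonglongrightarrow> c (0 + m)"
  by (rule filterlim_compose)
 moreover have "F (of_real (1 / real (Suc n))) = 0" for n
  using real[of "1 / real (Suc n)"] by (simp add: F_def sums_iff)
 ultimately show ?case by (simp add: LIMSEQ_const_iff)
qed

section \<open>An entire function with the Gaussian transform of a spherical Bessel function\<close>

lemma integrable_powr_exp_linear_minus_square:
 assumes "b > -1"
 shows "integrable lborel (\<lambda>r::real. indicator {0<..} r * r powr b * exp (C * r - r\<^sup>2 / 2))"
proof -
 have "integrable lborel (\<lambda>r::real. indicator {0..} r * r powr b / exp r)"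
 proof (rule integrableI_bounded)
  have "(\<integral>\<^sup>+r. ennreal (norm (indicator {0..} r * r powr b / exp r)) \<partial>lborel)
    = (\<integral>\<^sup>+r. ennreal (indicator {0..} r * r powr (b + 1 - 1) / exp r) \<partial>lborel)"
   by (intro nn_integral_cong) (auto simp: indicator_def)
  also have "\<dots> = ennreal (Gamma (b + 1))"
   by (subst Gamma_conv_nn_integral_real) (use assms in simp, rule refl)
  finally show "(\<integral>\<^sup>+r. ennreal (norm (indicator {0..} r * r powr b / exp r)) \<partial>lborel) < \<infinity>" by simp
 qed simp
 then have "integrable lborel (\<lambda>r::real. exp ((C + 1)\<^sup>2 / (4 * (1 / 2))) * (indicator {0..} r * r powr b / exp r))"
  by (rule integrable_mult_right)
 then show ?thesis
 proof (rule Bochner_Integration.integrable_bound)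
  show "AE r in lborel. norm (indicator {0<..} r * r powr b * exp (C * r - r\<^sup>2 / 2))
   \<le> norm (exp ((C + 1)\<^sup>2 / (4 * (1 / 2))) * (indicator {0..} r * r powr b / exp r))"
  proof (rule AE_I2)
   fix r :: real
   have "r powr b * exp (C * r - r\<^sup>2 / 2) \<le> r powr b * (exp ((C + 1)\<^sup>2 / (4 * (1 / 2))) * exp (- r))"
    using exp_linear_minus_square_le[of "1 / 2" C r] by (intro mult_left_mono) auto
   then show "norm (indicator {0<..} r * r powr b * exp (C * r - r\<^sup>2 / 2))
    \<le> norm (exp ((C + 1)\<^sup>2 / (4 * (1 / 2))) * (indicator {0..} r * r powr b / exp r))"
    by (auto simp: indicator_def exp_minus field_simps)
  qed
 qed simp
qed

lemma integral_powr_half_square: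
 assumes "a > (-1 :: real)"
 shows "(\<integral>r. indicator {0<..} r * (r powr a * exp (- r\<^sup>2 / 2)) \<partial>lborel)
  = 2 powr ((a - 1) / 2) * Gamma ((a + 1) / 2)"
proof (rule integral_eq_nn_integral[THEN trans])
 have "(\<integral>\<^sup>+r. ennreal (indicator {0<..} r * (r powr a * exp (- r\<^sup>2 / 2))) \<partial>lborel)
  = (\<integral>\<^sup>+r. indicator {0<..} r * ennreal (r powr a * exp (- r\<^sup>2 / 2)) \<partial>lborel)"
  by (intro nn_integral_cong) (auto simp: indicator_def)
 also have "\<dots> = ennreal (2 powr ((a - 1) / 2) * Gamma ((a + 1) / 2))"
  by (rule nn_integral_powr_half_square[OF assms])
 finally show "enn2real (\<integral>\<^sup>+r. ennreal (indicator {0<..} r * (r powr a * exp (- r\<^sup>2 / 2))) \<partial>lborel)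
   = 2 powr ((a - 1) / 2) * Gamma ((a + 1) / 2)"
  using assms Gamma_real_pos[of "(a + 1) / 2"] by simp
qed (auto simp: indicator_def)

text \<open>Pochhammer symbols increase with \<open>\<alpha>\<close>, and for \<open>\<alpha> = - 1/2\<close> the series is that of \<open>cosh\<close>.\<close>

lemma spherical_bessel_term_le:
 assumes "\<alpha> \<ge> -1/2"
 shows "(x / 2) ^ (2 * n) / (fact n * pochhammer (\<alpha> + 1) n) \<le> x ^ (2 * n) / (fact (2 * n) :: real)"
proof -
 have p: "pochhammer (1 / 2 :: real) n > 0" by (rule pochhammer_pos) simp
 have "pochhammer (1 / 2) n \<le> pochhammer (\<alpha> + 1) n"
  unfolding pochhammer_prod using assms by (intro prod_mono) auto
 then have "(x / 2) ^ (2 * n) / (fact n * pochhammer (\<alpha> + 1) n)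
  \<le> (x / 2) ^ (2 * n) / (fact n * pochhammer (1 / 2) n)"
  using p by (intro divide_left_mono mult_left_mono mult_pos_pos) (auto simp: zero_le_even_power)
 also have "\<dots> = x ^ (2 * n) / fact (2 * n)"
  unfolding fact_double by (simp add: power_divide)
 finally show ?thesis .
qed

lemma sums_even_exp_series: "(\<lambda>n. x ^ (2 * n) / (fact (2 * n))) sums cosh (x :: real)"
proof -
 have "(\<lambda>n. if even n then x ^ n /\<^sub>R fact n else 0) sums cosh x"
  using cosh_converges[of x] by simp
 then have "(\<lambda>n. if even (2 * n) then x ^ (2 * n) /\<^sub>R fact (2 * n) else 0) sums cosh x"
  by (subst sums_mono_reindex[of "\<lambda>n. 2 * n"]) (auto simp: strict_mono_def elim!: evenE)
 then show ?thesis by (simp add: field_simps)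
qed

lemma spherical_bessel_imag_sums:
 assumes "\<alpha> \<ge> -1/2"
 shows "(\<lambda>n. (x / 2) ^ (2 * n) / (fact n * pochhammer (\<alpha> + 1) n)) sums spherical_bessel_imag \<alpha> x"
proof -
 let ?f = "\<lambda>n. (x / 2) ^ (2 * n) / (fact n * pochhammer (\<alpha> + 1) n)"
 have p: "pochhammer (\<alpha> + 1) n > 0" for n using assms by (intro pochhammer_pos) auto
 have f0: "?f n \<ge> 0" for n using p[of n] by (simp add: zero_le_even_power)
 have "summable ?f"
 proof (rule summable_comparison_test)
  show "summable (\<lambda>n. x ^ (2 * n) / fact (2 * n))" using sums_even_exp_series by (rule sums_summable)
  show "\<exists>N. \<forall>n\<ge>N. norm (?f n) \<le> x ^ (2 * n) / fact (2 * n)"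
   using spherical_bessel_term_le[OF assms] by (simp only: real_norm_def abs_of_nonneg[OF f0]) blast
 qed
 have G: "Gamma (\<alpha> + 1) > 0" using assms by (intro Gamma_real_pos) auto
 have Gn: "Gamma (real n + \<alpha> + 1) = pochhammer (\<alpha> + 1) n * Gamma (\<alpha> + 1)" for n
 proof -
  have "\<alpha> + 1 \<notin> \<int>\<^sub>\<le>\<^sub>0" using assms by (auto elim!: nonpos_Ints_cases)
  from pochhammer_Gamma[OF this, of n] show ?thesis using G by (simp add: ac_simps)
 qed
 have "(-1) ^ n * (\<i> * complex_of_real x / 2) ^ (2 * n) / complex_of_real (fact n * Gamma (real n + \<alpha> + 1))
   = complex_of_real (?f n / Gamma (\<alpha> + 1))" for n
 proof -
  have "(\<i> * complex_of_real x / 2) ^ (2 * n) = (-1) ^ n * complex_of_real ((x / 2) ^ (2 * n))"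
  proof -
   have "(\<i> * complex_of_real x / 2)\<^sup>2 = (-1) * complex_of_real ((x / 2)\<^sup>2)"
    by (simp add: power_mult_distrib power_divide)
   then show ?thesis by (simp only: power_mult power_mult_distrib of_real_power)
  qed
  then show ?thesis by (simp add: Gn mult.assoc[symmetric] flip: power_mult_distrib)
 qed
 then have "spherical_bessel \<alpha> (\<i> * complex_of_real x)
  = complex_of_real (Gamma (\<alpha> + 1)) * (\<Sum>n. complex_of_real (?f n / Gamma (\<alpha> + 1)))"
  by (simp add: spherical_bessel_def)
 also have "\<dots> = complex_of_real (Gamma (\<alpha> + 1) * (\<Sum>n. ?f n / Gamma (\<alpha> + 1)))"
  using \<open>summable ?f\<close> by (subst suminf_of_real[symmetric]) (auto intro: summable_divide[OF \<open>summable ?f\<close>, of "Gamma (\<alpha> + 1)", simplified])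
 also have "Gamma (\<alpha> + 1) * (\<Sum>n. ?f n / Gamma (\<alpha> + 1)) = (\<Sum>n. ?f n)"
  using G suminf_divide[OF \<open>summable ?f\<close>, of "Gamma (\<alpha> + 1)"] by simp
 finally have "spherical_bessel_imag \<alpha> x = (\<Sum>n. ?f n)" by (simp add: spherical_bessel_imag_def)
 with \<open>summable ?f\<close> show ?thesis by (simp add: sums_iff)
qed

lemma spherical_bessel_imag_ge_1:
 assumes "\<alpha> \<ge> -1/2"
 shows "spherical_bessel_imag \<alpha> x \<ge> 1"
proof -
 have p: "pochhammer (\<alpha> + 1) n > 0" for n using assms by (intro pochhammer_pos) auto
 have "(\<Sum>n<1. (x / 2) ^ (2 * n) / (fact n * pochhammer (\<alpha> + 1) n)) \<le> spherical_bessel_imag \<alpha> x"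
  using spherical_bessel_imag_sums[OF assms, of x] p
  by (subst sums_unique[OF spherical_bessel_imag_sums[OF assms]], intro sum_le_suminf)
    (auto simp: sums_iff zero_le_even_power less_imp_le)
 then show ?thesis by simp
qed

lemma spherical_bessel_imag_le_exp:
 assumes "\<alpha> \<ge> -1/2"
 shows "spherical_bessel_imag \<alpha> x \<le> exp \<bar>x\<bar>"
proof -
 have "spherical_bessel_imag \<alpha> x \<le> cosh x"
  by (rule sums_le[OF spherical_bessel_term_le[OF assms] spherical_bessel_imag_sums[OF assms] sums_even_exp_series])
 also have "\<dots> \<le> exp \<bar>x\<bar>"
  unfolding cosh_field_def by (simp add: field_simps) (cases "x \<ge> 0"; simp add: add_mono[of _ "exp x" _ "exp x", simplified])
 finally show ?thesis .
qed

lemma continuous_spherical_bessel_imag: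
 assumes "\<alpha> \<ge> -1/2"
 shows "continuous_on UNIV (spherical_bessel_imag \<alpha>)"
proof -
 let ?a = "\<lambda>n. 1 / (fact n * pochhammer (\<alpha> + 1) n)"
 define F where "F y = (\<Sum>n. ?a n * y ^ n)" for y :: real
 have F: "spherical_bessel_imag \<alpha> x = F ((x / 2)\<^sup>2)" for x
  unfolding F_def using sums_unique[OF spherical_bessel_imag_sums[OF assms, of x]]
  by (simp only: power_mult) simp
 have sum: "summable (\<lambda>n. ?a n * y ^ n)" for y :: real
 proof (rule summable_norm_cancel)
  have y: "\<bar>y\<bar> = (2 * sqrt \<bar>y\<bar> / 2)\<^sup>2" by simp
  have p: "pochhammer (\<alpha> + 1) n > 0" for n using assms by (intro pochhammer_pos) auto
  have "norm (?a n * y ^ n) = (2 * sqrt \<bar>y\<bar> / 2) ^ (2 * n) / (fact n * pochhammer (\<alpha> + 1) n)" for n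
   using p[of n] by (simp only: power_mult y[symmetric]) (simp add: abs_mult power_abs)
  then show "summable (\<lambda>n. norm (?a n * y ^ n))"
   using sums_summable[OF spherical_bessel_imag_sums[OF assms, of "2 * sqrt \<bar>y\<bar>"]] by simp
 qed
 have "isCont F y" for y
  unfolding F_def by (rule isCont_powser_converges_everywhere[OF sum])
 then have "continuous_on UNIV F" by (simp add: continuous_on_eq_continuous_at)
 then have "continuous_on UNIV (\<lambda>x. F ((x / 2)\<^sup>2))"
  by (rule continuous_on_compose2) (auto intro!: continuous_intros)
 then show ?thesis by (simp add: F[abs_def])
qed

text \<open>Both sides of the transform are power series in \<open>s\<close>. The \<open>n\<close>-th coefficient on the left is the Taylor
 coefficient of \<open>M\<close> times a moment of the weight, which is a value of the Gamma function.\<close>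

lemma spherical_bessel_from_gaussian_transform:
 fixes M :: "complex \<Rightarrow> complex"
 assumes \<alpha>: "\<alpha> \<ge> -1/2" and hol: "M holomorphic_on UNIV"
  and bound: "\<And>z. norm (M z) \<le> K * exp (C * norm z)"
  and transform: "\<And>s. 0 < s \<Longrightarrow> s \<le> 1 \<Longrightarrow>
   (\<integral>r. (indicator {0<..} r * r powr (2 * \<alpha> + 1) * exp (- r\<^sup>2 / 2)) *\<^sub>R M (of_real (s * r)) \<partial>lborel)
    = of_real (Z * exp (s\<^sup>2 * y\<^sup>2 / 2))"
 shows "M (of_real r) = of_real (Z / (2 powr \<alpha> * Gamma (\<alpha> + 1)) * spherical_bessel_imag \<alpha> (y * r))"
proof -
 define b where "b = 2 * \<alpha> + 1"
 have b: "b > -1" using \<alpha> by (simp add: b_def)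
 define m where "m n = (deriv ^^ n) M 0 / fact n" for n
 have M_sums: "(\<lambda>n. m n * z ^ n) sums M z" for z
  using holomorphic_power_series[of M 0 "norm z + 1" z] holomorphic_on_subset[OF hol]
  by (simp add: m_def)
 have m_bound: "norm (m n) * R ^ n \<le> K * exp (C * R)" if "R > 0" for n R
 proof -
  have "norm ((deriv ^^ n) M 0) \<le> fact n * (K * exp (C * R)) / R ^ n"
  proof (rule Cauchy_inequality[OF holomorphic_on_subset[OF hol subset_UNIV]
     continuous_on_subset[OF holomorphic_on_imp_continuous_on[OF hol] subset_UNIV] that])
   show "norm (M x) \<le> K * exp (C * R)" if "norm (0 - x) = R" for x
    using bound[of x] that by simp
  qed
  then show ?thesis using that by (simp add: m_def norm_divide field_simps)
 qed
 define w where "w r = indicator {0<..} r * r powr b * exp (- r\<^sup>2 / 2)" for r :: real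
 have w0: "w r \<ge> 0" for r by (simp add: w_def)
 have [measurable]: "w \<in> borel_measurable borel" unfolding w_def by measurable
 define c where "c n = 2 powr ((b + real n - 1) / 2) * Gamma ((b + real n + 1) / 2)" for n
 have c_pos: "c n > 0" for n using b unfolding c_def by (intro mult_pos_pos Gamma_real_pos) auto
 have w_int: "integrable lborel (\<lambda>r. w r * K * exp (2 * C * r))"
 proof -
  have "(\<lambda>r. w r * K * exp (2 * C * r)) = (\<lambda>r. K * (indicator {0<..} r * r powr b * exp (2 * C * r - r\<^sup>2 / 2)))"
  proof
   fix r :: real
   have "exp (2 * C * r - r\<^sup>2 / 2) = exp (2 * C * r) * exp (- r\<^sup>2 / 2)" by (simp add: mult_exp_exp)
   then show "w r * K * exp (2 * C * r) = K * (indicator {0<..} r * r powr b * exp (2 * C * r - r\<^sup>2 / 2))"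
    by (simp add: w_def)
  qed
  then show ?thesis using integrable_powr_exp_linear_minus_square[OF b, of "2 * C"] by simp
 qed
 have w_moment: "(\<integral>r. w r * r ^ n \<partial>lborel) = c n" for n
 proof -
  have "(\<integral>r. w r * r ^ n \<partial>lborel) = (\<integral>r. indicator {0<..} r * (r powr (b + n) * exp (- r\<^sup>2 / 2)) \<partial>lborel)"
   by (intro Bochner_Integration.integral_cong) (auto simp: w_def indicator_def powr_add powr_realpow)
  also have "\<dots> = c n" unfolding c_def using b by (subst integral_powr_half_square) auto
  finally show ?thesis .
 qed
 define e where "e n = (if even n then Z * (y\<^sup>2 / 2) ^ (n div 2) / fact (n div 2) else 0)" for n
 have even_sums: "(\<lambda>k. f (2 * k)) sums a \<longleftrightarrow> f sums a" if "\<And>n. odd n \<Longrightarrow> f n = 0"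
  for f :: "nat \<Rightarrow> complex" and a
 proof (rule sums_mono_reindex)
  show "f n = 0" if "n \<notin> range (\<lambda>k. 2 * k)" for n
   using that \<open>\<And>n. odd n \<Longrightarrow> f n = 0\<close> by (metis evenE rangeI)
 qed (simp add: strict_mono_def)
 have coeff: "m n * of_real (c n) = of_real (e n)" for n
 proof -
  have "(\<lambda>n. (m n * of_real (c n) - of_real (e n)) * of_real s ^ n) sums 0" if s: "0 < s" "s \<le> 1" for s
  proof -
   let ?g = "\<lambda>n r. w r *\<^sub>R (m n * of_real (s * r) ^ n)"
   (* Cauchy's estimate on the circle of radius 2 r; the factor 2 makes the series of integrals converge. *)
   have g_bound: "norm (?g n r) \<le> (w r * K * exp (2 * C * r)) * (1 / 2) ^ n" for n r
   proof (cases "r > 0")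
    case True
    have "norm (m n * of_real (s * r) ^ n) \<le> norm (m n) * r ^ n"
     using s True by (auto simp: norm_mult norm_power power_mult_distrib intro!: mult_left_mono mult_left_le_one_le power_le_one)
    also have "\<dots> = norm (m n) * (2 * r) ^ n * (1 / 2) ^ n"
     by (simp add: power_mult_distrib power_one_over)
    also have "\<dots> \<le> K * exp (C * (2 * r)) * (1 / 2) ^ n"
     using m_bound[of "2 * r" n] True by (intro mult_right_mono) auto
    finally have "w r * norm (m n * of_real (s * r) ^ n) \<le> w r * (K * exp (C * (2 * r)) * (1 / 2) ^ n)"
     by (intro mult_left_mono w0)
    then show ?thesis using w0[of r] by (simp add: ac_simps)
   qed (simp add: w_def)
   have g_int: "integrable lborel (?g n)" for n
    by (rule Bochner_Integration.integrable_bound[OF integrable_mult_left[OF w_int, of "(1 / 2) ^ n"]])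
      (simp, rule AE_I2, simp only: real_norm_def, rule order_trans[OF g_bound abs_ge_self])
   have "(\<lambda>n. \<integral>r. ?g n r \<partial>lborel) sums (\<integral>r. (\<Sum>n. ?g n r) \<partial>lborel)"
   proof (rule sums_integral[OF g_int])
    show "AE r in lborel. summable (\<lambda>n. norm (?g n r))"
    proof (rule AE_I2, rule summable_comparison_test)
     fix r :: real
     show "summable (\<lambda>n. (w r * K * exp (2 * C * r)) * (1 / 2) ^ n)"
      by (intro summable_mult summable_geometric) simp
     show "\<exists>N. \<forall>n\<ge>N. norm (norm (?g n r)) \<le> (w r * K * exp (2 * C * r)) * (1 / 2) ^ n"
      using g_bound by auto
    qed
    show "summable (\<lambda>n. \<integral>r. norm (?g n r) \<partial>lborel)"
    proof (rule summable_comparison_test)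
     show "summable (\<lambda>n. (\<integral>r. w r * K * exp (2 * C * r) \<partial>lborel) * (1 / 2) ^ n)"
      by (intro summable_mult summable_geometric) simp
     have "(\<integral>r. norm (?g n r) \<partial>lborel) \<le> (\<integral>r. w r * K * exp (2 * C * r) * (1 / 2) ^ n \<partial>lborel)" for n
      by (intro integral_mono integrable_norm g_int integrable_mult_left w_int g_bound)
     then show "\<exists>N. \<forall>n\<ge>N. norm (\<integral>r. norm (?g n r) \<partial>lborel) \<le> (\<integral>r. w r * K * exp (2 * C * r) \<partial>lborel) * (1 / 2) ^ n"
      by auto
    qed
   qed
   also have "(\<integral>r. (\<Sum>n. ?g n r) \<partial>lborel) = (\<integral>r. w r *\<^sub>R M (of_real (s * r)) \<partial>lborel)"
    by (intro Bochner_Integration.integral_cong refl)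
      (use sums_scaleR_right[OF M_sums] in \<open>simp add: sums_iff\<close>)
   also have "\<dots> = of_real (Z * exp (s\<^sup>2 * y\<^sup>2 / 2))"
    using transform[OF s] by (simp add: w_def b_def)
   also have "(\<lambda>n. \<integral>r. ?g n r \<partial>lborel) = (\<lambda>n. m n * of_real (c n) * of_real s ^ n)"
   proof
    fix n
    have "(\<integral>r. ?g n r \<partial>lborel) = (\<integral>r. of_real (w r * r ^ n) * (m n * of_real s ^ n) \<partial>lborel)"
     by (intro Bochner_Integration.integral_cong) (auto simp: scaleR_conv_of_real power_mult_distrib ac_simps)
    also have "\<dots> = of_real (\<integral>r. w r * r ^ n \<partial>lborel) * (m n * of_real s ^ n)"
     by (simp only: integral_mult_left_zero integral_complex_of_real)
    finally show "(\<integral>r. ?g n r \<partial>lborel) = m n * of_real (c n) * of_real s ^ n"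
     by (simp add: w_moment)
   qed
   finally have 1: "(\<lambda>n. m n * of_real (c n) * of_real s ^ n) sums of_real (Z * exp (s\<^sup>2 * y\<^sup>2 / 2))" .
   have "(\<lambda>k. Z * ((s\<^sup>2 * y\<^sup>2 / 2) ^ k /\<^sub>R fact k)) sums (Z * exp (s\<^sup>2 * y\<^sup>2 / 2))"
    by (rule sums_mult[OF exp_converges])
   then have "(\<lambda>k. e (2 * k) * s ^ (2 * k)) sums (Z * exp (s\<^sup>2 * y\<^sup>2 / 2))"
   proof (rule sums_cong[THEN iffD1, rotated])
    fix k
    have "(s\<^sup>2 * y\<^sup>2 / 2) ^ k = (y\<^sup>2 / 2) ^ k * s ^ (2 * k)"
     by (simp only: power_mult power_mult_distrib power_divide) simp
    then show "Z * ((s\<^sup>2 * y\<^sup>2 / 2) ^ k /\<^sub>R fact k) = e (2 * k) * s ^ (2 * k)"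
     by (simp add: e_def field_simps)
   qed
   from sums_of_real[OF this, where 'a=complex]
   have "(\<lambda>k. of_real (e (2 * k)) * of_real s ^ (2 * k)) sums (of_real (Z * exp (s\<^sup>2 * y\<^sup>2 / 2)) :: complex)"
    by (simp only: of_real_mult of_real_power)
   then have 2: "(\<lambda>n. of_real (e n) * of_real s ^ n) sums (of_real (Z * exp (s\<^sup>2 * y\<^sup>2 / 2)) :: complex)"
    by (subst (asm) even_sums) (auto simp: e_def)
   show ?thesis using sums_diff[OF 1 2] by (simp add: algebra_simps)
  qed
  from powser_eq_0_on_unit_interval[OF this, of n] show ?thesis by simp
 qed
 let ?k = "Z / (2 powr \<alpha> * Gamma (\<alpha> + 1))"
 have odd0: "m n = 0" if "odd n" for n
  using coeff[of n] c_pos[of n] that by (simp add: e_def)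
 have "(\<lambda>k. m (2 * k) * of_real r ^ (2 * k)) sums M (of_real r)"
  using M_sums[of "of_real r"] odd0 by (subst even_sums) auto
 moreover have "m (2 * k) * of_real r ^ (2 * k)
   = of_real (?k * ((y * r / 2) ^ (2 * k) / (fact k * pochhammer (\<alpha> + 1) k)))" for k
 proof -
  have G: "Gamma (\<alpha> + 1) > 0" using \<alpha> by (intro Gamma_real_pos) auto
  have Gk: "Gamma (\<alpha> + real k + 1) = pochhammer (\<alpha> + 1) k * Gamma (\<alpha> + 1)"
  proof -
   have "\<alpha> + 1 \<notin> \<int>\<^sub>\<le>\<^sub>0" using \<alpha> by (auto elim!: nonpos_Ints_cases)
   from pochhammer_Gamma[OF this, of k] show ?thesis using G by (simp add: ac_simps)
  qed
  have "(b + real (2 * k) - 1) / 2 = \<alpha> + real k" "(b + real (2 * k) + 1) / 2 = \<alpha> + real k + 1"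
   by (simp_all add: b_def field_simps)
  then have ck: "c (2 * k) = 2 powr \<alpha> * 2 ^ k * (pochhammer (\<alpha> + 1) k * Gamma (\<alpha> + 1))"
   by (simp only: c_def Gk powr_add powr_realpow zero_less_numeral)
  have "m (2 * k) = of_real (e (2 * k) / c (2 * k))"
   using coeff[of "2 * k"] c_pos[of "2 * k"] by (simp add: field_simps)
  moreover have "e (2 * k) / c (2 * k) * r ^ (2 * k) = ?k * ((y * r / 2) ^ (2 * k) / (fact k * pochhammer (\<alpha> + 1) k))"
  proof -
   have "(y * r / 2) ^ (2 * k) = (y\<^sup>2 / 2) ^ k * r ^ (2 * k) / 2 ^ k"
   proof -
    have "(y * r / 2)\<^sup>2 = y\<^sup>2 / 2 * r\<^sup>2 / 2" by (simp add: power2_eq_square)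
    then show ?thesis by (simp only: power_mult power_mult_distrib power_divide)
   qed
   then show ?thesis unfolding ck by (simp add: e_def ac_simps)
  qed
  ultimately show ?thesis by (simp only: of_real_mult[symmetric] of_real_power[symmetric])
 qed
 ultimately have "(\<lambda>k. complex_of_real (?k * ((y * r / 2) ^ (2 * k) / (fact k * pochhammer (\<alpha> + 1) k)))) sums M (of_real r)"
  by simp
 moreover have "(\<lambda>k. complex_of_real (?k * ((y * r / 2) ^ (2 * k) / (fact k * pochhammer (\<alpha> + 1) k)))) sums of_real (?k * spherical_bessel_imag \<alpha> (y * r))"
  by (intro sums_of_real sums_mult spherical_bessel_imag_sums[OF \<alpha>])
 ultimately show ?thesis by (rule sums_unique2)
qed

section \<open>Intertwined Markov kernels\<close>

lemma space_borel_on [simp]: "space (borel_on (A :: 'c::topological_space set)) = A"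
 by (simp add: space_restrict_space)

lemma prob_kernelD:
 assumes "k \<in> N \<rightarrow>\<^sub>M prob_algebra L" "x \<in> space N"
 shows "prob_space (k x)" "sets (k x) = sets L" "space (k x) = space L"
proof -
 have "k x \<in> space (prob_algebra L)" using assms by (rule measurable_space)
 then show "prob_space (k x)" "sets (k x) = sets L" by (auto simp: space_prob_algebra)
 then show "space (k x) = space L" by (metis sets_eq_imp_space_eq)
qed

lemma prob_kernel_nn_integral_measurable:
 assumes k: "k \<in> N \<rightarrow>\<^sub>M prob_algebra L" and g: "g \<in> borel_measurable L"
 shows "(\<lambda>x. \<integral>\<^sup>+y. g y \<partial>k x) \<in> borel_measurable N"
 by (rule measurable_compose[OF measurable_prob_algebraD[OF k]])
   (rule nn_integral_measurable_subprob_algebra[OF g])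

lemma prob_kernel_emeasure_measurable:
 assumes k: "k \<in> N \<rightarrow>\<^sub>M prob_algebra L" and A: "A \<in> sets L"
 shows "(\<lambda>x. emeasure (k x) A) \<in> borel_measurable N"
 by (rule measurable_compose[OF measurable_prob_algebraD[OF k]])
   (rule measurable_emeasure_subprob_algebra[OF A])

lemma nn_integral_kernel_eqI:
 assumes M: "k \<in> M \<rightarrow>\<^sub>M prob_algebra L" "space M \<noteq> {}"
  and N: "l \<in> N \<rightarrow>\<^sub>M prob_algebra L" "space N \<noteq> {}"
  and eq: "\<And>A. A \<in> sets L \<Longrightarrow> (\<integral>\<^sup>+x. emeasure (k x) A \<partial>M) = (\<integral>\<^sup>+x. emeasure (l x) A \<partial>N)"
 shows "M \<bind> k = N \<bind> l"
  and "g \<in> borel_measurable L \<Longrightarrow> (\<integral>\<^sup>+x. \<integral>\<^sup>+y. g y \<partial>k x \<partial>M) = (\<integral>\<^sup>+x. \<integral>\<^sup>+y. g y \<partial>l x \<partial>N)"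
proof -
 note k = measurable_prob_algebraD[OF M(1)] and l = measurable_prob_algebraD[OF N(1)]
 show *: "M \<bind> k = N \<bind> l"
 proof (rule measure_eqI)
  show "sets (M \<bind> k) = sets (N \<bind> l)"
   by (simp add: sets_bind[OF sets_kernel[OF k] M(2)] sets_bind[OF sets_kernel[OF l] N(2)])
  fix A assume "A \<in> sets (M \<bind> k)"
  then have "A \<in> sets L" by (simp add: sets_bind[OF sets_kernel[OF k] M(2)])
  then show "emeasure (M \<bind> k) A = emeasure (N \<bind> l) A"
   by (simp add: emeasure_bind[OF M(2) k] emeasure_bind[OF N(2) l] eq)
 qed
 show "(\<integral>\<^sup>+x. \<integral>\<^sup>+y. g y \<partial>k x \<partial>M) = (\<integral>\<^sup>+x. \<integral>\<^sup>+y. g y \<partial>l x \<partial>N)" if g: "g \<in> borel_measurable L"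
  unfolding nn_integral_bind[OF g k, symmetric] nn_integral_bind[OF g l, symmetric] * ..
qed

lemma C0_on_bounded:
 fixes f :: "'a::euclidean_space \<Rightarrow> real"
 assumes f: "f \<in> C0_on S" and S: "closed S"
 obtains B where "\<And>x. x \<in> S \<Longrightarrow> \<bar>f x\<bar> \<le> B"
proof -
 have cont: "continuous_on S f" and lim: "(f \<longlongrightarrow> 0) (inf at_infinity (principal S))"
  using f by (auto simp: C0_on_def)
 from tendstoD[OF lim zero_less_one] obtain b where b: "\<And>x. norm x \<ge> b \<Longrightarrow> x \<in> S \<Longrightarrow> \<bar>f x\<bar> < 1"
  unfolding eventually_inf_principal eventually_at_infinity by (auto simp: dist_norm)
 have "compact (f ` (S \<inter> cball 0 b))"
  using S by (intro compact_continuous_image continuous_on_subset[OF cont] closed_Int_compact) auto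
 from compact_imp_bounded[OF this] obtain B where "\<forall>y\<in>f ` (S \<inter> cball 0 b). norm y \<le> B"
  unfolding bounded_iff by blast
 then have B: "\<And>x. x \<in> S \<Longrightarrow> norm x \<le> b \<Longrightarrow> \<bar>f x\<bar> \<le> B" by simp
 show ?thesis
 proof
  show "\<bar>f x\<bar> \<le> max B 1" if "x \<in> S" for x
   using b[OF _ that] B[OF that] by (cases "norm x \<le> b") (force simp: not_le)+
 qed
qed

lemma C0_on_measurable: "f \<in> C0_on S \<Longrightarrow> f \<in> borel_measurable (borel_on S)"
 by (auto simp: C0_on_def intro: borel_measurable_continuous_on_restrict)

lemma prob_space_bounded_integrable:
 fixes f :: "'a \<Rightarrow> real"
 assumes "prob_space M" "f \<in> borel_measurable M" "\<And>x. x \<in> space M \<Longrightarrow> \<bar>f x\<bar> \<le> B"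
 shows "integrable M f"
proof -
 interpret prob_space M by fact
 show ?thesis by (rule integrable_const_bound[of _ B]) (use assms in auto)
qed

text \<open>The kernel \<open>\<Lambda> r\<close> is a candidate for the conditional law of the full state when its image under \<open>\<phi>\<close> is \<open>r\<close>.\<close>

locale intertwining =
 fixes S :: "'a::euclidean_space set" and E :: "'b::euclidean_space set" and \<phi> :: "'a \<Rightarrow> 'b"
  and K :: "real \<Rightarrow> 'a \<Rightarrow> 'a measure" and Q :: "real \<Rightarrow> 'b \<Rightarrow> 'b measure"
  and \<Lambda> :: "'b \<Rightarrow> 'a measure"
 assumes K: "feller_kernels S K" and S: "closed S" and E: "closed E"
  and \<phi>: "\<phi> \<in> borel_on S \<rightarrow>\<^sub>M borel_on E"
  and \<Lambda>: "\<Lambda> \<in> borel_on E \<rightarrow>\<^sub>M prob_algebra (borel_on S)"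
  and Q: "\<And>t. t > 0 \<Longrightarrow> Q t \<in> borel_on E \<rightarrow>\<^sub>M prob_algebra (borel_on E)"
  and fibre: "\<And>r. r \<in> E \<Longrightarrow> AE x in \<Lambda> r. \<phi> x = r"
  and intertwine: "\<And>t r A. t > 0 \<Longrightarrow> r \<in> E \<Longrightarrow> A \<in> sets (borel_on S) \<Longrightarrow>
   (\<integral>\<^sup>+x. emeasure (K t x) A \<partial>\<Lambda> r) = (\<integral>\<^sup>+s. emeasure (\<Lambda> s) A \<partial>Q t r)"
begin

lemma K_kernel: "t > 0 \<Longrightarrow> K t \<in> borel_on S \<rightarrow>\<^sub>M prob_algebra (borel_on S)"
 using K by (simp add: feller_kernels_def)

lemma \<Lambda>D:
 assumes "r \<in> E"
 shows "prob_space (\<Lambda> r)" "sets (\<Lambda> r) = sets (borel_on S)" "space (\<Lambda> r) = S"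
 using prob_kernelD[OF \<Lambda>, of r] assms by simp_all

lemma KD:
 assumes "t > 0" "x \<in> S"
 shows "prob_space (K t x)" "sets (K t x) = sets (borel_on S)" "space (K t x) = S"
 using prob_kernelD[OF K_kernel[OF assms(1)], of x] assms(2) by simp_all

lemma QD:
 assumes "t > 0" "r \<in> E"
 shows "prob_space (Q t r)" "sets (Q t r) = sets (borel_on E)" "space (Q t r) = E"
 using prob_kernelD[OF Q[OF assms(1)], of r] assms(2) by simp_all

lemma K_kernel_\<Lambda>: "t > 0 \<Longrightarrow> r \<in> E \<Longrightarrow> K t \<in> \<Lambda> r \<rightarrow>\<^sub>M prob_algebra (borel_on S)"
 using K_kernel[of t] \<Lambda>D(2)[of r] by (simp cong: measurable_cong_sets)

lemma \<Lambda>_kernel_Q: "t > 0 \<Longrightarrow> r \<in> E \<Longrightarrow> \<Lambda> \<in> Q t r \<rightarrow>\<^sub>M prob_algebra (borel_on S)"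
 using \<Lambda> QD(2)[of t r] by (simp cong: measurable_cong_sets)

lemma
 assumes t: "t > 0" and r: "r \<in> E"
 shows intertwine_bind: "\<Lambda> r \<bind> K t = Q t r \<bind> \<Lambda>"
  and intertwine_nn_integral: "g \<in> borel_measurable (borel_on S) \<Longrightarrow>
   (\<integral>\<^sup>+x. \<integral>\<^sup>+y. g y \<partial>K t x \<partial>\<Lambda> r) = (\<integral>\<^sup>+s. \<integral>\<^sup>+y. g y \<partial>\<Lambda> s \<partial>Q t r)"
proof -
 have ne: "space (\<Lambda> r) \<noteq> {}" "space (Q t r) \<noteq> {}"
  using \<Lambda>D(1)[OF r] QD(1)[OF t r] by (simp_all add: prob_space.not_empty)
 note * = nn_integral_kernel_eqI[OF K_kernel_\<Lambda>[OF t r] ne(1) \<Lambda>_kernel_Q[OF t r] ne(2) intertwine[OF t r]]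
 show "\<Lambda> r \<bind> K t = Q t r \<bind> \<Lambda>" by (rule *(1)) simp
 show "g \<in> borel_measurable (borel_on S) \<Longrightarrow>
   (\<integral>\<^sup>+x. \<integral>\<^sup>+y. g y \<partial>K t x \<partial>\<Lambda> r) = (\<integral>\<^sup>+s. \<integral>\<^sup>+y. g y \<partial>\<Lambda> s \<partial>Q t r)"
  by (rule *(2)) simp_all
qed

lemma fibre_nn_integral:
 assumes r: "r \<in> E" and h: "h \<in> borel_measurable (borel_on E)" and g: "g \<in> borel_measurable (borel_on S)"
 shows "(\<integral>\<^sup>+x. h (\<phi> x) * g x \<partial>\<Lambda> r) = h r * (\<integral>\<^sup>+x. g x \<partial>\<Lambda> r)"
proof -
 have "(\<integral>\<^sup>+x. h (\<phi> x) * g x \<partial>\<Lambda> r) = (\<integral>\<^sup>+x. h r * g x \<partial>\<Lambda> r)"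
  by (rule nn_integral_cong_AE) (use fibre[OF r] in eventually_elim, simp)
 also have "\<dots> = h r * (\<integral>\<^sup>+x. g x \<partial>\<Lambda> r)"
  using g \<Lambda>D(2)[OF r] by (intro nn_integral_cmult) (simp cong: measurable_cong_sets)
 finally show ?thesis .
qed

lemma fibre_nn_integral_1:
 assumes r: "r \<in> E" and h: "h \<in> borel_measurable (borel_on E)"
 shows "(\<integral>\<^sup>+x. h (\<phi> x) \<partial>\<Lambda> r) = h r"
 using fibre_nn_integral[OF r h, of "\<lambda>_. 1"] prob_space.emeasure_space_1[OF \<Lambda>D(1)[OF r]] by simp

text \<open>Since \<open>\<Lambda> s\<close> lives on the fibre over \<open>s\<close>, the kernel \<open>Q\<close> is determined by \<open>K\<close> and \<open>\<Lambda>\<close>.\<close>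

lemma Q_nn_integral:
 assumes "t > 0" "r \<in> E" and h: "h \<in> borel_measurable (borel_on E)"
 shows "(\<integral>\<^sup>+s. h s \<partial>Q t r) = (\<integral>\<^sup>+x. \<integral>\<^sup>+y. h (\<phi> y) \<partial>K t x \<partial>\<Lambda> r)"
proof -
 have "(\<integral>\<^sup>+x. \<integral>\<^sup>+y. h (\<phi> y) \<partial>K t x \<partial>\<Lambda> r) = (\<integral>\<^sup>+s. \<integral>\<^sup>+y. h (\<phi> y) \<partial>\<Lambda> s \<partial>Q t r)"
  by (rule intertwine_nn_integral[OF assms(1,2) measurable_compose[OF \<phi> h]])
 also have "\<dots> = (\<integral>\<^sup>+s. h s \<partial>Q t r)"
  by (rule nn_integral_cong) (simp add: fibre_nn_integral_1[OF _ h] QD[OF assms(1,2)])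
 finally show ?thesis ..
qed

text \<open>The identity \<open>\<Lambda> K\<^sub>t g = \<Lambda> K\<^sub>t (\<Lambda> g \<circ> \<phi>)\<close>: both sides are \<open>Q\<^sub>t \<Lambda> g\<close>.\<close>

lemma intertwine_project:
 assumes t: "t > 0" and r: "r \<in> E" and g: "g \<in> borel_measurable (borel_on S)"
 shows "(\<integral>\<^sup>+x. \<integral>\<^sup>+y. g y \<partial>K t x \<partial>\<Lambda> r) = (\<integral>\<^sup>+x. \<integral>\<^sup>+y. \<integral>\<^sup>+z. g z \<partial>\<Lambda> (\<phi> y) \<partial>K t x \<partial>\<Lambda> r)"
 unfolding intertwine_nn_integral[OF assms]
 by (rule Q_nn_integral[OF t r prob_kernel_nn_integral_measurable[OF \<Lambda> g]])

lemma Q_semigroup: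
 assumes s: "s > 0" and t: "t > 0" and r: "r \<in> E"
 shows "Q (s + t) r = Q s r \<bind> Q t"
proof (rule measure_eqI)
 have Qt: "Q t \<in> Q s r \<rightarrow>\<^sub>M subprob_algebra (borel_on E)"
  using measurable_prob_algebraD[OF Q[OF t]] QD(2)[OF s r] by (simp cong: measurable_cong_sets)
 have ne: "space (Q s r) \<noteq> {}" using QD(1)[OF s r] by (simp add: prob_space.not_empty)
 have st: "s + t > 0" using s t by simp
 show "sets (Q (s + t) r) = sets (Q s r \<bind> Q t)"
  using QD(2)[OF st r] by (simp add: sets_bind[OF sets_kernel[OF Qt] ne])
 fix B assume "B \<in> sets (Q (s + t) r)"
 then have B: "B \<in> sets (borel_on E)" by (simp add: QD(2)[OF st r])
 then have iB: "(indicator B :: _ \<Rightarrow> ennreal) \<in> borel_measurable (borel_on E)" by simp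
 have i\<phi>B: "(\<lambda>y. indicator B (\<phi> y) :: ennreal) \<in> borel_measurable (borel_on S)"
  by (rule measurable_compose[OF \<phi> iB])
 have "emeasure (Q (s + t) r) B = (\<integral>\<^sup>+x. \<integral>\<^sup>+y. indicator B (\<phi> y) \<partial>K (s + t) x \<partial>\<Lambda> r)"
  using Q_nn_integral[OF st r iB] B QD(2)[OF st r] by simp
 also have "\<dots> = (\<integral>\<^sup>+x. \<integral>\<^sup>+u. \<integral>\<^sup>+y. indicator B (\<phi> y) \<partial>K t u \<partial>K s x \<partial>\<Lambda> r)"
 proof (rule nn_integral_cong)
  fix x assume "x \<in> space (\<Lambda> r)"
  then have x: "x \<in> S" by (simp add: \<Lambda>D(3)[OF r])
  have Kt: "K t \<in> K s x \<rightarrow>\<^sub>M subprob_algebra (borel_on S)"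
   using measurable_prob_algebraD[OF K_kernel[OF t]] KD(2)[OF s x] by (simp cong: measurable_cong_sets)
  have "K (s + t) x = K s x \<bind> K t"
   using K s t x unfolding feller_kernels_def by blast
  then show "(\<integral>\<^sup>+y. indicator B (\<phi> y) \<partial>K (s + t) x) = (\<integral>\<^sup>+u. \<integral>\<^sup>+y. indicator B (\<phi> y) \<partial>K t u \<partial>K s x)"
   using nn_integral_bind[OF i\<phi>B Kt] by simp
 qed
 also have "\<dots> = (\<integral>\<^sup>+u. \<integral>\<^sup>+v. \<integral>\<^sup>+y. indicator B (\<phi> y) \<partial>K t v \<partial>\<Lambda> u \<partial>Q s r)"
  by (rule intertwine_nn_integral[OF s r prob_kernel_nn_integral_measurable[OF K_kernel[OF t] i\<phi>B]])
 also have "\<dots> = (\<integral>\<^sup>+u. emeasure (Q t u) B \<partial>Q s r)"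
 proof (rule nn_integral_cong)
  fix u assume "u \<in> space (Q s r)"
  then have u: "u \<in> E" by (simp add: QD(3)[OF s r])
  show "(\<integral>\<^sup>+v. \<integral>\<^sup>+y. indicator B (\<phi> y) \<partial>K t v \<partial>\<Lambda> u) = emeasure (Q t u) B"
   using Q_nn_integral[OF t u iB] B QD(2)[OF t u] by simp
 qed
 also have "\<dots> = emeasure (Q s r \<bind> Q t) B"
  by (rule emeasure_bind[OF ne Qt B, symmetric])
 finally show "emeasure (Q (s + t) r) B = emeasure (Q s r \<bind> Q t) B" .
qed

lemma fibre_integral:
 fixes f :: "'b \<Rightarrow> real"
 assumes r: "r \<in> E" and f: "f \<in> borel_measurable (borel_on E)"
 shows "(\<integral>x. f (\<phi> x) \<partial>\<Lambda> r) = f r"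
proof -
 interpret prob_space "\<Lambda> r" by (rule \<Lambda>D(1)[OF r])
 have "(\<integral>x. f (\<phi> x) \<partial>\<Lambda> r) = (\<integral>x. f r \<partial>\<Lambda> r)"
 proof (rule integral_cong_AE)
  show "(\<lambda>x. f (\<phi> x)) \<in> borel_measurable (\<Lambda> r)"
   using measurable_compose[OF \<phi> f] \<Lambda>D(2)[OF r] by (simp cong: measurable_cong_sets)
  show "AE x in \<Lambda> r. f (\<phi> x) = f r" using fibre[OF r] by eventually_elim simp
 qed simp
 then show ?thesis by (simp add: prob_space)
qed

lemma Q_integral:
 fixes f :: "'b \<Rightarrow> real"
 assumes t: "t > 0" and r: "r \<in> E" and f: "f \<in> borel_measurable (borel_on E)"
  and B: "\<And>x. x \<in> E \<Longrightarrow> \<bar>f x\<bar> \<le> B"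
 shows "(\<integral>s. f s \<partial>Q t r) = (\<integral>x. \<integral>y. f (\<phi> y) \<partial>K t x \<partial>\<Lambda> r)"
proof -
 note f\<phi> = measurable_compose[OF \<phi> f]
 have b: "\<bar>f (\<phi> x)\<bar> \<le> B" if "x \<in> space (borel_on S)" for x
  using measurable_space[OF \<phi> that] by (auto intro: B)
 have "(\<integral>x. \<integral>y. f (\<phi> y) \<partial>K t x \<partial>\<Lambda> r) = (\<integral>y. f (\<phi> y) \<partial>(\<Lambda> r \<bind> K t))"
  by (rule integral_bind[OF f\<phi> b measurable_prob_algebraD[OF K_kernel_\<Lambda>[OF t r]], symmetric, where B'=1])
    (use \<Lambda>D[OF r] prob_space.emeasure_space_1[OF KD(1)[OF t]] in \<open>auto simp: prob_space_def\<close>)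
 also have "\<dots> = (\<integral>s. \<integral>y. f (\<phi> y) \<partial>\<Lambda> s \<partial>Q t r)"
  unfolding intertwine_bind[OF t r]
  by (rule integral_bind[OF f\<phi> b measurable_prob_algebraD[OF \<Lambda>_kernel_Q[OF t r]], where B'=1])
    (use QD[OF t r] prob_space.emeasure_space_1[OF \<Lambda>D(1)] in \<open>auto simp: prob_space_def\<close>)
 also have "\<dots> = (\<integral>s. f s \<partial>Q t r)"
  by (intro Bochner_Integration.integral_cong refl) (simp add: fibre_integral[OF _ f] QD[OF t r])
 finally show ?thesis ..
qed

lemma feller_kernels_Q:
 assumes C0_\<phi>: "\<And>f. f \<in> C0_on E \<Longrightarrow> (\<lambda>x. f (\<phi> x)) \<in> C0_on S"
  and C0_\<Lambda>: "\<And>g. g \<in> C0_on S \<Longrightarrow> (\<lambda>r. \<integral>x. g x \<partial>\<Lambda> r) \<in> C0_on E"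
 shows "feller_kernels E Q"
 unfolding feller_kernels_def
proof (intro conjI allI impI ballI)
 show "Q t \<in> borel_on E \<rightarrow>\<^sub>M prob_algebra (borel_on E)" if "t > 0" for t by (rule Q[OF that])
 show "Q (s + t) x = Q s x \<bind> Q t" if "s > 0" "t > 0" "x \<in> E" for s t x by (rule Q_semigroup[OF that])
next
 fix f :: "'b \<Rightarrow> real" and t :: real assume f: "f \<in> C0_on E" and t: "t > 0"
 obtain B where B: "\<And>x. x \<in> E \<Longrightarrow> \<bar>f x\<bar> \<le> B" using C0_on_bounded[OF f E] by blast
 have "(\<lambda>x. \<integral>y. f (\<phi> y) \<partial>K t x) \<in> C0_on S"
  using K C0_\<phi>[OF f] t unfolding feller_kernels_def by blast
 then have "(\<lambda>r. \<integral>x. \<integral>y. f (\<phi> y) \<partial>K t x \<partial>\<Lambda> r) \<in> C0_on E" by (rule C0_\<Lambda>)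
 moreover have "((\<lambda>r. \<integral>y. f y \<partial>Q t r) \<in> C0_on E) = ((\<lambda>r. \<integral>x. \<integral>y. f (\<phi> y) \<partial>K t x \<partial>\<Lambda> r) \<in> C0_on E)"
  unfolding C0_on_def mem_Collect_eq
  by (intro arg_cong2[where f="(\<and>)"] continuous_on_cong tendsto_cong refl Q_integral[OF t _ C0_on_measurable[OF f] B])
    (auto simp: eventually_inf_principal Q_integral[OF t _ C0_on_measurable[OF f] B])
 ultimately show "(\<lambda>r. \<integral>y. f y \<partial>Q t r) \<in> C0_on E" by simp
next
 fix f :: "'b \<Rightarrow> real" and r assume f: "f \<in> C0_on E" and r: "r \<in> E"
 obtain B where B: "\<And>x. x \<in> E \<Longrightarrow> \<bar>f x\<bar> \<le> B" using C0_on_bounded[OF f E] by blast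
 note f\<phi> = measurable_compose[OF \<phi> C0_on_measurable[OF f]]
 interpret L: prob_space "\<Lambda> r" by (rule \<Lambda>D(1)[OF r])
 have bK: "\<bar>\<integral>y. f (\<phi> y) \<partial>K t x\<bar> \<le> B" if "t > 0" "x \<in> S" for t x
 proof -
  interpret P: prob_space "K t x" by (rule KD(1)[OF that])
  have b: "\<bar>f (\<phi> y)\<bar> \<le> B" if "y \<in> space (K t x)" for y
   using measurable_space[OF \<phi>, of y] that KD(3)[OF \<open>t > 0\<close> \<open>x \<in> S\<close>] by (auto intro: B)
  have i: "integrable (K t x) (\<lambda>y. f (\<phi> y))"
   using f\<phi> KD(2)[OF that] b
   by (intro prob_space_bounded_integrable[OF P.prob_space_axioms, of _ B]) (auto cong: measurable_cong_sets)
  have "AE y in K t x. f (\<phi> y) \<le> B" "AE y in K t x. - B \<le> f (\<phi> y)"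
   using b by (auto simp: abs_le_iff minus_le_iff)
  then show ?thesis
   using P.integral_le_const[OF i, of B] P.integral_ge_const[OF i, of "- B"]
   by (auto simp: abs_le_iff)
 qed
 show "((\<lambda>t. \<integral>y. f y \<partial>Q t r) \<longlongrightarrow> f r) (at_right 0)"
  unfolding tendsto_at_iff_sequentially comp_def
 proof (intro allI impI)
  fix T :: "nat \<Rightarrow> real" assume T: "\<forall>i. T i \<in> {0<..} - {0}" and T0: "T \<longlonglongrightarrow> 0"
  have "(\<lambda>i. \<integral>x. \<integral>y. f (\<phi> y) \<partial>K (T i) x \<partial>\<Lambda> r) \<longlonglongrightarrow> (\<integral>x. f (\<phi> x) \<partial>\<Lambda> r)"
  proof (rule integral_dominated_convergence[where w="\<lambda>_. B"])
   show "AE x in \<Lambda> r. (\<lambda>i. \<integral>y. f (\<phi> y) \<partial>K (T i) x) \<longlonglongrightarrow> f (\<phi> x)"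
   proof (rule AE_I2)
    fix x assume "x \<in> space (\<Lambda> r)"
    then have "((\<lambda>t. \<integral>y. f (\<phi> y) \<partial>K t x) \<longlongrightarrow> f (\<phi> x)) (at_right 0)"
     using K C0_\<phi>[OF f] \<Lambda>D(3)[OF r] unfolding feller_kernels_def by blast
    then show "(\<lambda>i. \<integral>y. f (\<phi> y) \<partial>K (T i) x) \<longlonglongrightarrow> f (\<phi> x)"
     unfolding tendsto_at_iff_sequentially comp_def using T T0 by blast
   qed
   show "AE x in \<Lambda> r. norm (\<integral>y. f (\<phi> y) \<partial>K (T i) x) \<le> B" for i
    using bK T \<Lambda>D(3)[OF r] by (intro AE_I2) auto
   show "(\<lambda>x. \<integral>y. f (\<phi> y) \<partial>K (T i) x) \<in> borel_measurable (\<Lambda> r)" for i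
   proof -
    have "T i > 0" using T by auto
    then have "(\<lambda>x. \<integral>y. f (\<phi> y) \<partial>K (T i) x) \<in> C0_on S"
     using K C0_\<phi>[OF f] unfolding feller_kernels_def by blast
    from C0_on_measurable[OF this] show ?thesis
     using \<Lambda>D(2)[OF r] by (simp cong: measurable_cong_sets)
   qed
   show "(\<lambda>x. f (\<phi> x)) \<in> borel_measurable (\<Lambda> r)"
    using f\<phi> \<Lambda>D(2)[OF r] by (simp cong: measurable_cong_sets)
  qed simp
  then show "(\<lambda>i. \<integral>y. f y \<partial>Q (T i) r) \<longlonglongrightarrow> f r"
   using T by (simp add: fibre_integral[OF r C0_on_measurable[OF f]] Q_integral[OF _ r C0_on_measurable[OF f] B])
 qed
qed

end

section \<open>Projecting a Markov process along an intertwining\<close>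

lemma natural_filtration_subalgebra:
 assumes "\<And>u. 0 \<le> u \<Longrightarrow> u \<le> s \<Longrightarrow> X u \<in> borel_measurable M"
 shows "subalgebra M (natural_filtration M X s)"
 unfolding subalgebra_def natural_filtration_def
proof (intro conjI sets.sigma_sets_subset)
 have sub: "(\<Union>u\<in>{0..s}. {X u -` A \<inter> space M |A. A \<in> sets borel}) \<subseteq> Pow (space M)" by auto
 show "space (sigma (space M) (\<Union>u\<in>{0..s}. {X u -` A \<inter> space M |A. A \<in> sets borel})) = space M"
  using sub by (simp add: space_measure_of)
 show "sets (sigma (space M) (\<Union>u\<in>{0..s}. {X u -` A \<inter> space M |A. A \<in> sets borel})) \<subseteq> sets M"
  unfolding sets_measure_of[OF sub]
  by (intro sets.sigma_sets_subset) (use assms in \<open>auto intro: measurable_sets\<close>)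
qed

lemma space_natural_filtration [simp]: "space (natural_filtration M X s) = space M"
 unfolding natural_filtration_def by (intro space_measure_of) auto

lemma sets_natural_filtration:
 "sets (natural_filtration M X s)
  = sigma_sets (space M) (\<Union>u\<in>{0..s}. {X u -` A \<inter> space M |A. A \<in> sets borel})"
 unfolding natural_filtration_def by (intro sets_measure_of) auto

lemma natural_filtration_measurable:
 fixes X :: "real \<Rightarrow> 'w \<Rightarrow> 'a::topological_space"
 assumes "0 \<le> u" "u \<le> s"
 shows "X u \<in> borel_measurable (natural_filtration M X s)"
proof (rule measurableI)
 fix A assume "A \<in> sets (borel :: 'a measure)"
 then show "X u -` A \<inter> space (natural_filtration M X s) \<in> sets (natural_filtration M X s)"
  unfolding sets_natural_filtration space_natural_filtration
  using assms by (intro sigma_sets.Basic UN_I[of u]) auto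
qed simp

lemma measurable_borel_on_borel:
 "f \<in> M \<rightarrow>\<^sub>M borel_on A \<Longrightarrow> f \<in> borel_measurable M"
 by (auto simp: measurable_restrict_space2_iff)

text \<open>Under the measure restricted to \<open>F\<close>, the law of \<open>X (s + t)\<close> is the mixture of the \<open>K t (X s \<omega>)\<close>; this
 passes from events to nonnegative functions.\<close>

lemma feller_process_nn_markov:
 fixes X :: "real \<Rightarrow> 'w \<Rightarrow> 'a::real_normed_vector"
 assumes X: "feller_process S K M X" and s: "s \<ge> 0" and t: "t > 0"
  and F: "F \<in> sets (natural_filtration M X s)" and g: "g \<in> borel_measurable (borel_on S)"
 shows "(\<integral>\<^sup>+\<omega>. indicator F \<omega> * g (X (s + t) \<omega>) \<partial>M)
  = (\<integral>\<^sup>+\<omega>. indicator F \<omega> * (\<integral>\<^sup>+y. g y \<partial>K t (X s \<omega>)) \<partial>M)"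
proof -
 interpret prob_space M using X by (simp add: feller_process_def)
 have Xm: "X u \<in> M \<rightarrow>\<^sub>M borel_on S" if "u \<ge> 0" for u using X that by (simp add: feller_process_def)
 have sub: "subalgebra M (natural_filtration M X s)"
  by (intro natural_filtration_subalgebra measurable_borel_on_borel[OF Xm])
 interpret sigma_finite_subalgebra M "natural_filtration M X s"
  by (rule finite_measure_subalgebra_is_sigma_finite) (unfold_locales, rule sub)
 have FM [measurable]: "F \<in> sets M" using F sub by (auto simp: subalgebra_def)
 have K: "K t \<in> borel_on S \<rightarrow>\<^sub>M prob_algebra (borel_on S)"
  using X t by (simp add: feller_process_def feller_kernels_def)
 have KX: "(\<lambda>\<omega>. K t (X s \<omega>)) \<in> M \<rightarrow>\<^sub>M prob_algebra (borel_on S)"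
  by (rule measurable_compose[OF Xm[OF s] K])
 have st: "s + t \<ge> 0" using s t by simp
 let ?D = "density M (indicator F)"
 have KXD: "(\<lambda>\<omega>. K t (X s \<omega>)) \<in> ?D \<rightarrow>\<^sub>M prob_algebra (borel_on S)" using KX by simp
 have XD: "X (s + t) \<in> ?D \<rightarrow>\<^sub>M borel_on S" using Xm[OF st] by simp
 have ne: "space ?D \<noteq> {}" using not_empty by simp
 have "distr ?D (borel_on S) (X (s + t)) = ?D \<bind> (\<lambda>\<omega>. K t (X s \<omega>))"
 proof (rule measure_eqI)
  show "sets (distr ?D (borel_on S) (X (s + t))) = sets (?D \<bind> (\<lambda>\<omega>. K t (X s \<omega>)))"
   using sets_bind[OF sets_kernel[OF measurable_prob_algebraD[OF KXD]] ne] by simp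
  fix A assume "A \<in> sets (distr ?D (borel_on S) (X (s + t)))"
  then have A: "A \<in> sets (borel_on S)" by simp
  let ?A = "X (s + t) -` A \<inter> space M"
  have [measurable]: "?A \<in> sets M" using Xm[OF st] A by (rule measurable_sets)
  have em [measurable]: "(\<lambda>\<omega>. emeasure (K t (X s \<omega>)) A) \<in> borel_measurable M"
   by (rule prob_kernel_emeasure_measurable[OF KX A])
  then have mm [measurable]: "(\<lambda>\<omega>. measure (K t (X s \<omega>)) A) \<in> borel_measurable M"
   by (simp add: measure_def)
  have fin: "emeasure (K t (X s \<omega>)) A = ennreal (measure (K t (X s \<omega>)) A)" if "\<omega> \<in> space M" for \<omega>
  proof -
   interpret P: prob_space "K t (X s \<omega>)" by (rule prob_kernelD(1)[OF KX that])
   show ?thesis by (rule P.emeasure_eq_measure)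
  qed
  have le1: "measure (K t (X s \<omega>)) A \<le> 1" if "\<omega> \<in> space M" for \<omega>
  proof -
   interpret P: prob_space "K t (X s \<omega>)" by (rule prob_kernelD(1)[OF KX that])
   show ?thesis by (rule P.prob_le_1)
  qed
  have i: "integrable M (\<lambda>\<omega>. indicator F \<omega> * measure (K t (X s \<omega>)) A)"
   by (rule integrable_const_bound[of _ 1]) (use le1 in \<open>auto simp: indicator_def\<close>)
  have "emeasure (distr ?D (borel_on S) (X (s + t))) A = emeasure ?D ?A"
   using A XD by (subst emeasure_distr) simp_all
  also have "\<dots> = emeasure M (F \<inter> ?A)"
   by (subst emeasure_density) (simp_all flip: indicator_inter_arith)
  also have "\<dots> = ennreal (\<integral>\<omega>. indicator F \<omega> * indicator ?A \<omega> \<partial>M)"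
   by (simp add: emeasure_eq_measure flip: indicator_inter_arith)
  also have "(\<integral>\<omega>. indicator F \<omega> * indicator ?A \<omega> \<partial>M)
    = (\<integral>\<omega>. indicator F \<omega> * real_cond_exp M (natural_filtration M X s) (indicator ?A) \<omega> \<partial>M)"
   using real_cond_exp_intA[OF _ F, of "indicator ?A"] emeasure_finite
   by (simp add: set_lebesgue_integral_def less_top[symmetric])
  also have "\<dots> = (\<integral>\<omega>. indicator F \<omega> * measure (K t (X s \<omega>)) A \<partial>M)"
  proof (rule integral_cong_AE)
   have "AE \<omega> in M. real_cond_exp M (natural_filtration M X s) (indicator ?A) \<omega> = measure (K t (X s \<omega>)) A"
    using X s t A unfolding feller_process_def by blast
   then show "AE \<omega> in M. indicator F \<omega> * real_cond_exp M (natural_filtration M X s) (indicator ?A) \<omega>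
     = indicator F \<omega> * measure (K t (X s \<omega>)) A"
    by eventually_elim simp
  qed (measurable, (intro measurable_from_subalg[OF sub] borel_measurable_cond_exp)?)
  also have "ennreal \<dots> = (\<integral>\<^sup>+\<omega>. ennreal (indicator F \<omega> * measure (K t (X s \<omega>)) A) \<partial>M)"
   by (rule nn_integral_eq_integral[OF i, symmetric]) simp
  also have "\<dots> = (\<integral>\<^sup>+\<omega>. indicator F \<omega> * emeasure (K t (X s \<omega>)) A \<partial>M)"
   by (rule nn_integral_cong) (simp add: fin indicator_def)
  also have "\<dots> = (\<integral>\<^sup>+\<omega>. emeasure (K t (X s \<omega>)) A \<partial>?D)"
   by (simp add: nn_integral_density)
  also have "\<dots> = emeasure (?D \<bind> (\<lambda>\<omega>. K t (X s \<omega>))) A"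
   by (rule emeasure_bind[OF ne measurable_prob_algebraD[OF KXD] A, symmetric])
  finally show "emeasure (distr ?D (borel_on S) (X (s + t))) A = emeasure (?D \<bind> (\<lambda>\<omega>. K t (X s \<omega>))) A" .
 qed
 then have "(\<integral>\<^sup>+y. g y \<partial>distr ?D (borel_on S) (X (s + t))) = (\<integral>\<^sup>+y. g y \<partial>(?D \<bind> (\<lambda>\<omega>. K t (X s \<omega>))))"
  by simp
 then have "(\<integral>\<^sup>+\<omega>. g (X (s + t) \<omega>) \<partial>?D) = (\<integral>\<^sup>+\<omega>. \<integral>\<^sup>+y. g y \<partial>K t (X s \<omega>) \<partial>?D)"
  using XD g by (simp add: nn_integral_distr nn_integral_bind[OF g measurable_prob_algebraD[OF KXD]])
 then show ?thesis
  using measurable_compose[OF Xm[OF st] g] prob_kernel_nn_integral_measurable[OF KX g]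
  by (simp add: nn_integral_density)
qed

locale intertwined_process = intertwining S E \<phi> K Q \<Lambda>
 for S :: "'a::euclidean_space set" and E :: "'b::euclidean_space set" and \<phi> K Q \<Lambda> +
 fixes M :: "'w measure" and X :: "real \<Rightarrow> 'w \<Rightarrow> 'a"
 assumes X: "feller_process S K M X"
  and initial: "\<And>A. A \<in> sets (borel_on S) \<Longrightarrow>
   emeasure M (X 0 -` A \<inter> space M) = (\<integral>\<^sup>+\<omega>. emeasure (\<Lambda> (\<phi> (X 0 \<omega>))) A \<partial>M)"
begin

sublocale prob_space M using X by (simp add: feller_process_def)

abbreviation Z where "Z t \<omega> \<equiv> \<phi> (X t \<omega>)"

lemma X_measurable: "u \<ge> 0 \<Longrightarrow> X u \<in> M \<rightarrow>\<^sub>M borel_on S"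
 using X by (simp add: feller_process_def)

lemma Z_measurable: "u \<ge> 0 \<Longrightarrow> Z u \<in> M \<rightarrow>\<^sub>M borel_on E"
 by (rule measurable_compose[OF X_measurable \<phi>])

lemma Z_subalgebra: "subalgebra M (natural_filtration M Z s)"
 by (intro natural_filtration_subalgebra measurable_borel_on_borel[OF Z_measurable])

lemma Z_event_in_X_filtration:
 assumes "0 \<le> u" "u \<le> s" "A \<in> sets borel"
 shows "Z u -` A \<inter> space M \<in> sets (natural_filtration M X s)"
proof -
 have "\<phi> -` A \<inter> S \<in> sets (borel_on S)"
  using measurable_sets[OF measurable_borel_on_borel[OF \<phi>] assms(3)] by simp
 then obtain B where B: "B \<in> sets borel" "\<phi> -` A \<inter> S = S \<inter> B" by (auto simp: sets_restrict_space)
 have "Z u -` A \<inter> space M = X u -` B \<inter> space M"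
  using B(2) measurable_space[OF X_measurable[OF assms(1)]] by auto
 then show ?thesis
  using natural_filtration_measurable[OF assms(1,2), of X M] B(1)
  by (metis measurable_sets space_natural_filtration)
qed

lemma Z_filtration_le: "sets (natural_filtration M Z s) \<subseteq> sets (natural_filtration M X s)"
 unfolding sets_natural_filtration[of M Z]
 using Z_event_in_X_filtration[of _ s]
 by (intro sets.sigma_sets_subset[where M="natural_filtration M X s", simplified]) auto

text \<open>The Markov property followed by the intertwining: starting from \<open>\<Lambda>\<close> of the projection at time \<open>b\<close>, the
 law at a later time is a mixture of the kernels \<open>\<Lambda>\<close>, and the mixing measure is the law of the projection.\<close>

lemma conditional_law_propagates:
 assumes b: "b \<ge> 0" and t: "t > 0" and F: "F \<in> sets (natural_filtration M X b)"
  and at_b: "\<And>g. g \<in> borel_measurable (borel_on S) \<Longrightarrow>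
   (\<integral>\<^sup>+\<omega>. indicator F \<omega> * g (X b \<omega>) \<partial>M) = (\<integral>\<^sup>+\<omega>. indicator F \<omega> * (\<integral>\<^sup>+y. g y \<partial>\<Lambda> (Z b \<omega>)) \<partial>M)"
  and g: "g \<in> borel_measurable (borel_on S)"
 shows "(\<integral>\<^sup>+\<omega>. indicator F \<omega> * g (X (b + t) \<omega>) \<partial>M)
  = (\<integral>\<^sup>+\<omega>. indicator F \<omega> * (\<integral>\<^sup>+y. g y \<partial>\<Lambda> (Z (b + t) \<omega>)) \<partial>M)"
proof -
 have g': "(\<lambda>x. \<integral>\<^sup>+y. g y \<partial>\<Lambda> (\<phi> x)) \<in> borel_measurable (borel_on S)"
  by (rule measurable_compose[OF \<phi> prob_kernel_nn_integral_measurable[OF \<Lambda> g]])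
 note Kg = prob_kernel_nn_integral_measurable[OF K_kernel[OF t] g]
  and Kg' = prob_kernel_nn_integral_measurable[OF K_kernel[OF t] g']
 have "(\<integral>\<^sup>+\<omega>. indicator F \<omega> * g (X (b + t) \<omega>) \<partial>M)
   = (\<integral>\<^sup>+\<omega>. indicator F \<omega> * (\<integral>\<^sup>+x. \<integral>\<^sup>+y. g y \<partial>K t x \<partial>\<Lambda> (Z b \<omega>)) \<partial>M)"
  by (simp add: feller_process_nn_markov[OF X b t F g] at_b[OF Kg])
 also have "\<dots> = (\<integral>\<^sup>+\<omega>. indicator F \<omega> * (\<integral>\<^sup>+x. \<integral>\<^sup>+y. \<integral>\<^sup>+z. g z \<partial>\<Lambda> (\<phi> y) \<partial>K t x \<partial>\<Lambda> (Z b \<omega>)) \<partial>M)"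
  using measurable_space[OF Z_measurable[OF b]]
  by (intro nn_integral_cong) (simp add: intertwine_project[OF t _ g])
 also have "\<dots> = (\<integral>\<^sup>+\<omega>. indicator F \<omega> * (\<integral>\<^sup>+y. g y \<partial>\<Lambda> (Z (b + t) \<omega>)) \<partial>M)"
  by (simp add: feller_process_nn_markov[OF X b t F g'] at_b[OF Kg'])
 finally show ?thesis .
qed

text \<open>Induction on the observation times in increasing order. Restricting to an event \<open>Z b \<in> A b\<close> at the last
 time preserves the conditional law because \<open>\<Lambda> r\<close> lives on the fibre over \<open>r\<close>.\<close>

lemma conditional_law_cylinder:
 assumes "finite U" "\<And>u. u \<in> U \<Longrightarrow> 0 \<le> u" "\<And>u. u \<in> U \<Longrightarrow> A u \<in> sets borel"
  and "s \<ge> 0" "\<And>u. u \<in> U \<Longrightarrow> u \<le> s" and "g \<in> borel_measurable (borel_on S)"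
 shows "(\<integral>\<^sup>+\<omega>. indicator {\<omega>\<in>space M. \<forall>u\<in>U. Z u \<omega> \<in> A u} \<omega> * g (X s \<omega>) \<partial>M)
  = (\<integral>\<^sup>+\<omega>. indicator {\<omega>\<in>space M. \<forall>u\<in>U. Z u \<omega> \<in> A u} \<omega> * (\<integral>\<^sup>+y. g y \<partial>\<Lambda> (Z s \<omega>)) \<partial>M)"
 using assms
proof (induction U arbitrary: s g rule: finite_linorder_max_induct)
 case empty
 have 0: "(\<integral>\<^sup>+\<omega>. indicator (space M) \<omega> * g (X 0 \<omega>) \<partial>M)
   = (\<integral>\<^sup>+\<omega>. indicator (space M) \<omega> * (\<integral>\<^sup>+y. g y \<partial>\<Lambda> (Z 0 \<omega>)) \<partial>M)"
  if g: "g \<in> borel_measurable (borel_on S)" for g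
 proof -
  have \<Lambda>Z: "(\<lambda>\<omega>. \<Lambda> (Z 0 \<omega>)) \<in> M \<rightarrow>\<^sub>M prob_algebra (borel_on S)"
   by (rule measurable_compose[OF Z_measurable \<Lambda>]) simp
  have X0: "X 0 \<in> M \<rightarrow>\<^sub>M borel_on S" by (rule X_measurable) simp
  have r: "return (borel_on S) \<in> borel_on S \<rightarrow>\<^sub>M prob_algebra (borel_on S)" by simp
  have rX: "(\<lambda>\<omega>. return (borel_on S) (X 0 \<omega>)) \<in> M \<rightarrow>\<^sub>M prob_algebra (borel_on S)"
   by (rule measurable_compose[OF X0 r])
  have "(\<integral>\<^sup>+\<omega>. \<integral>\<^sup>+y. g y \<partial>return (borel_on S) (X 0 \<omega>) \<partial>M) = (\<integral>\<^sup>+\<omega>. \<integral>\<^sup>+y. g y \<partial>\<Lambda> (Z 0 \<omega>) \<partial>M)"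
  proof (rule nn_integral_kernel_eqI(2)[OF rX not_empty \<Lambda>Z not_empty _ g])
   fix A assume A: "A \<in> sets (borel_on S)"
   have "(\<integral>\<^sup>+\<omega>. emeasure (return (borel_on S) (X 0 \<omega>)) A \<partial>M) = (\<integral>\<^sup>+\<omega>. indicator (X 0 -` A \<inter> space M) \<omega> \<partial>M)"
    using A by (intro nn_integral_cong) (simp add: indicator_def)
   also have "\<dots> = emeasure M (X 0 -` A \<inter> space M)"
    using measurable_sets[OF X0 A] by simp
   also have "\<dots> = (\<integral>\<^sup>+\<omega>. emeasure (\<Lambda> (Z 0 \<omega>)) A \<partial>M)" by (rule initial[OF A])
   finally show "(\<integral>\<^sup>+\<omega>. emeasure (return (borel_on S) (X 0 \<omega>)) A \<partial>M) = (\<integral>\<^sup>+\<omega>. emeasure (\<Lambda> (Z 0 \<omega>)) A \<partial>M)" .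
  qed
  moreover have "(\<integral>\<^sup>+\<omega>. \<integral>\<^sup>+y. g y \<partial>return (borel_on S) (X 0 \<omega>) \<partial>M) = (\<integral>\<^sup>+\<omega>. g (X 0 \<omega>) \<partial>M)"
   using measurable_space[OF X0] g by (intro nn_integral_cong) (simp add: nn_integral_return)
  ultimately show ?thesis by (simp add: indicator_def cong: nn_integral_cong)
 qed
 have top: "space M \<in> sets (natural_filtration M X 0)"
  using sets.top[of "natural_filtration M X 0"] by simp
 have s: "{\<omega>\<in>space M. \<forall>u\<in>{}. Z u \<omega> \<in> A u} = space M" by simp
 show ?case
 proof (cases "s = 0")
  case True
  then show ?thesis unfolding s using 0[OF empty.prems(5)] by simp
 next
  case False
  then show ?thesis
   unfolding s using conditional_law_propagates[OF order_refl, of s "space M" g, OF _ top 0] empty.prems by simp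
 qed
next
 case (insert b U)
 let ?F = "{\<omega>\<in>space M. \<forall>u\<in>U. Z u \<omega> \<in> A u}"
 let ?F' = "{\<omega>\<in>space M. \<forall>u\<in>insert b U. Z u \<omega> \<in> A u}"
 have b: "b \<ge> 0" and Ab: "A b \<in> sets borel" using insert.prems by auto
 have F': "indicator ?F' \<omega> = indicator ?F \<omega> * (indicator (A b) (Z b \<omega>) :: ennreal)" if "\<omega> \<in> space M" for \<omega>
  using that by (auto simp: indicator_def)
 have iA: "(indicator (A b) :: _ \<Rightarrow> ennreal) \<in> borel_measurable (borel_on E)"
  using Ab by (intro measurable_restrict_space1) simp
 have at_b: "(\<integral>\<^sup>+\<omega>. indicator ?F' \<omega> * g (X b \<omega>) \<partial>M) = (\<integral>\<^sup>+\<omega>. indicator ?F' \<omega> * (\<integral>\<^sup>+y. g y \<partial>\<Lambda> (Z b \<omega>)) \<partial>M)"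
  if g: "g \<in> borel_measurable (borel_on S)" for g
 proof -
  have "(\<integral>\<^sup>+\<omega>. indicator ?F' \<omega> * g (X b \<omega>) \<partial>M) = (\<integral>\<^sup>+\<omega>. indicator ?F \<omega> * (indicator (A b) (\<phi> (X b \<omega>)) * g (X b \<omega>)) \<partial>M)"
   by (intro nn_integral_cong) (simp only: F' mult.assoc)
  also have "\<dots> = (\<integral>\<^sup>+\<omega>. indicator ?F \<omega> * (\<integral>\<^sup>+y. indicator (A b) (\<phi> y) * g y \<partial>\<Lambda> (Z b \<omega>)) \<partial>M)"
  proof (rule insert.IH[of b "\<lambda>x. indicator (A b) (\<phi> x) * g x"])
   show "(\<lambda>x. indicator (A b) (\<phi> x) * g x) \<in> borel_measurable (borel_on S)"
    by (intro borel_measurable_times_ennreal measurable_compose[OF \<phi> iA] g)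
  qed (use insert.prems insert.hyps b in \<open>auto intro: less_imp_le\<close>)
  also have "\<dots> = (\<integral>\<^sup>+\<omega>. indicator ?F' \<omega> * (\<integral>\<^sup>+y. g y \<partial>\<Lambda> (Z b \<omega>)) \<partial>M)"
  proof (rule nn_integral_cong)
   fix \<omega> assume \<omega>: "\<omega> \<in> space M"
   have "Z b \<omega> \<in> E" using measurable_space[OF Z_measurable[OF b] \<omega>] by simp
   then show "indicator ?F \<omega> * (\<integral>\<^sup>+y. indicator (A b) (\<phi> y) * g y \<partial>\<Lambda> (Z b \<omega>))
    = indicator ?F' \<omega> * (\<integral>\<^sup>+y. g y \<partial>\<Lambda> (Z b \<omega>))"
    by (simp only: F'[OF \<omega>] fibre_nn_integral[OF _ iA g] mult.assoc)
  qed
  finally show ?thesis .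
 qed
 have ev: "?F' \<in> sets (natural_filtration M X b)"
 proof -
  have "?F' = (\<Inter>u\<in>insert b U. Z u -` A u \<inter> space M)" by auto
  also have "\<dots> \<in> sets (natural_filtration M X b)"
   using insert.prems insert.hyps b
   by (intro sets.finite_INT Z_event_in_X_filtration) (auto intro: less_imp_le)
  finally show ?thesis .
 qed
 show ?case
 proof (cases "s = b")
  case True
  then show ?thesis using at_b[OF insert.prems(5)] by simp
 next
  case False
  then have "s - b > 0" using insert.prems(4)[of b] by simp
  from conditional_law_propagates[OF b this ev at_b insert.prems(5)] show ?thesis by simp
 qed
qed

text \<open>The cylinder events generate the past of \<open>Z\<close> and are stable under intersections.\<close>

lemma conditional_law:
 assumes s: "s \<ge> 0" and F: "F \<in> sets (natural_filtration M Z s)"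
  and g: "g \<in> borel_measurable (borel_on S)" "\<And>x. x \<in> S \<Longrightarrow> g x \<le> 1"
 shows "(\<integral>\<^sup>+\<omega>. indicator F \<omega> * g (X s \<omega>) \<partial>M) = (\<integral>\<^sup>+\<omega>. indicator F \<omega> * (\<integral>\<^sup>+y. g y \<partial>\<Lambda> (Z s \<omega>)) \<partial>M)"
proof -
 define P where "P = {{\<omega>\<in>space M. \<forall>u\<in>U. Z u \<omega> \<in> A u} |U A. finite U \<and> U \<subseteq> {0..s} \<and> (\<forall>u. A u \<in> sets borel)}"
 let ?N = "natural_filtration M Z s"
 define u where "u \<omega> = g (X s \<omega>)" for \<omega>
 define v where "v \<omega> = (\<integral>\<^sup>+y. g y \<partial>\<Lambda> (Z s \<omega>))" for \<omega>
 have um [measurable]: "u \<in> borel_measurable M"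
  unfolding u_def[abs_def] by (rule measurable_compose[OF X_measurable[OF s] g(1)])
 have vm [measurable]: "v \<in> borel_measurable M"
  unfolding v_def[abs_def] by (rule measurable_compose[OF Z_measurable[OF s] prob_kernel_nn_integral_measurable[OF \<Lambda> g(1)]])
 have Psub: "P \<subseteq> Pow (space M)" by (auto simp: P_def)
 have PN: "P \<subseteq> sets ?N"
 proof
  fix B assume "B \<in> P"
  then obtain U A where B: "B = {\<omega>\<in>space M. \<forall>u\<in>U. Z u \<omega> \<in> A u}" and UA: "finite U" "U \<subseteq> {0..s}" "\<forall>u. A u \<in> sets borel"
   by (auto simp: P_def)
  have "{\<omega>\<in>space ?N. Z u \<omega> \<in> A u} \<in> sets ?N" if "u \<in> U" for u
  proof -
   have "Z u \<in> borel_measurable ?N" using UA that by (intro natural_filtration_measurable) auto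
   from measurable_sets[OF this, of "A u"] UA show ?thesis by (simp add: vimage_def Int_def conj_commute)
  qed
  then have "{\<omega>\<in>space ?N. \<forall>u\<in>U. Z u \<omega> \<in> A u} \<in> sets ?N"
   by (rule sets.sets_Collect_finite_All[OF _ UA(1)])
  then show "B \<in> sets ?N" by (simp add: B)
 qed
 have gen: "sets ?N = sigma_sets (space M) P"
 proof
  show "sigma_sets (space M) P \<subseteq> sets ?N" using sets.sigma_sets_subset[OF PN] by simp
  have "(\<Union>u\<in>{0..s}. {Z u -` A \<inter> space M |A. A \<in> sets borel}) \<subseteq> sigma_sets (space M) P"
  proof (safe, rule sigma_sets.Basic)
   fix u A assume "u \<in> {0..s}" "A \<in> sets (borel :: 'b measure)"
   then show "Z u -` A \<inter> space M \<in> P"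
    unfolding P_def by (intro CollectI exI[of _ "{u}"] exI[of _ "\<lambda>_. A"]) auto
  qed
  then show "sets ?N \<subseteq> sigma_sets (space M) P"
   unfolding sets_natural_filtration by (rule sigma_sets_mono)
 qed
 have stable: "Int_stable P"
 proof (rule Int_stableI)
  fix B B' assume "B \<in> P" "B' \<in> P"
  then obtain U A U' A' where B: "B = {\<omega>\<in>space M. \<forall>u\<in>U. Z u \<omega> \<in> A u}" "finite U" "U \<subseteq> {0..s}" "\<forall>u. A u \<in> sets borel"
   and B': "B' = {\<omega>\<in>space M. \<forall>u\<in>U'. Z u \<omega> \<in> A' u}" "finite U'" "U' \<subseteq> {0..s}" "\<forall>u. A' u \<in> sets borel"
   by (auto simp: P_def)
  let ?A = "\<lambda>u. (if u \<in> U then A u else UNIV) \<inter> (if u \<in> U' then A' u else UNIV)"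
  have "B \<inter> B' = {\<omega>\<in>space M. \<forall>u\<in>U \<union> U'. Z u \<omega> \<in> ?A u}" unfolding B(1) B'(1) by auto
  then show "B \<inter> B' \<in> P"
   unfolding P_def using B B' by (intro CollectI exI[of _ "U \<union> U'"] exI[of _ ?A]) auto
 qed
 have sub: "subalgebra (density M f) ?N" for f
  using Z_subalgebra[of s] by (simp add: subalgebra_def)
 have emd: "emeasure (restr_to_subalg (density M f) ?N) B = (\<integral>\<^sup>+\<omega>. indicator B \<omega> * f \<omega> \<partial>M)"
  if [measurable]: "f \<in> borel_measurable M" and B: "B \<in> sets ?N" for f B
 proof -
  have "B \<in> sets M" using B Z_subalgebra[of s] by (auto simp: subalgebra_def)
  then show ?thesis
   by (simp add: emeasure_restr_to_subalg[OF sub B] emeasure_density mult.commute)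
 qed
 have "restr_to_subalg (density M u) ?N = restr_to_subalg (density M v) ?N"
 proof (rule measure_eqI_generator_eq[OF stable Psub, where A="\<lambda>_. space M"])
  show "emeasure (restr_to_subalg (density M u) ?N) B = emeasure (restr_to_subalg (density M v) ?N) B"
   if BP: "B \<in> P" for B
  proof -
   obtain U A where B: "B = {\<omega>\<in>space M. \<forall>u\<in>U. Z u \<omega> \<in> A u}" and UA: "finite U" "U \<subseteq> {0..s}" "\<forall>u. A u \<in> sets borel"
    using BP by (auto simp: P_def)
   have "(\<integral>\<^sup>+\<omega>. indicator B \<omega> * u \<omega> \<partial>M) = (\<integral>\<^sup>+\<omega>. indicator B \<omega> * v \<omega> \<partial>M)"
    unfolding B u_def v_def using UA s by (intro conditional_law_cylinder g(1)) auto
   then show ?thesis using that PN by (simp add: emd subset_eq)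
  qed
  show "range (\<lambda>_. space M) \<subseteq> P"
   unfolding P_def by (auto intro!: exI[of _ "{}"] exI[of _ "\<lambda>_. UNIV"])
  have "emeasure (restr_to_subalg (density M u) ?N) (space M) = (\<integral>\<^sup>+\<omega>. indicator (space M) \<omega> * u \<omega> \<partial>M)"
   using sets.top[of ?N] by (intro emd) simp_all
  also have "\<dots> \<le> (\<integral>\<^sup>+\<omega>. 1 \<partial>M)"
   using measurable_space[OF X_measurable[OF s]]
   by (intro nn_integral_mono) (auto simp: u_def indicator_def intro!: g(2))
  also have "\<dots> < \<infinity>" by (simp add: emeasure_space_1)
  finally show "emeasure (restr_to_subalg (density M u) ?N) (space M) \<noteq> \<infinity>" by simp
 qed (simp_all add: sets_restr_to_subalg[OF sub] gen)
 then have "emeasure (restr_to_subalg (density M u) ?N) F = emeasure (restr_to_subalg (density M v) ?N) F" by simp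
 then show ?thesis by (simp add: emd[OF um F] emd[OF vm F] u_def v_def)
qed

lemma law_at_time:
 assumes t: "t \<ge> 0"
 shows "distr M (borel_on S) (X t) = distr M (borel_on E) (Z t) \<bind> \<Lambda>"
proof (rule measure_eqI)
 let ?D = "distr M (borel_on E) (Z t)"
 have ne: "space ?D \<noteq> {}" using not_empty measurable_space[OF Z_measurable[OF t]] by auto
 have \<Lambda>': "\<Lambda> \<in> ?D \<rightarrow>\<^sub>M subprob_algebra (borel_on S)" using measurable_prob_algebraD[OF \<Lambda>] by simp
 show "sets (distr M (borel_on S) (X t)) = sets (?D \<bind> \<Lambda>)"
  using sets_bind[OF sets_kernel[OF \<Lambda>'] ne] by simp
 fix A assume "A \<in> sets (distr M (borel_on S) (X t))"
 then have A: "A \<in> sets (borel_on S)" by simp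
 have "emeasure (distr M (borel_on S) (X t)) A = (\<integral>\<^sup>+\<omega>. indicator (space M) \<omega> * indicator A (X t \<omega>) \<partial>M)"
 proof -
  have "emeasure (distr M (borel_on S) (X t)) A = (\<integral>\<^sup>+\<omega>. indicator (X t -` A \<inter> space M) \<omega> \<partial>M)"
   using measurable_sets[OF X_measurable[OF t] A] by (simp add: emeasure_distr[OF X_measurable[OF t] A])
  also have "\<dots> = (\<integral>\<^sup>+\<omega>. indicator (space M) \<omega> * indicator A (X t \<omega>) \<partial>M)"
   by (intro nn_integral_cong) (simp add: indicator_def)
  finally show ?thesis .
 qed
 also have "\<dots> = (\<integral>\<^sup>+\<omega>. indicator (space M) \<omega> * (\<integral>\<^sup>+y. indicator A y \<partial>\<Lambda> (Z t \<omega>)) \<partial>M)"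
  using A sets.top[of "natural_filtration M Z t"] by (intro conditional_law t) (auto simp: indicator_def)
 also have "\<dots> = (\<integral>\<^sup>+\<omega>. emeasure (\<Lambda> (Z t \<omega>)) A \<partial>M)"
  using A measurable_space[OF Z_measurable[OF t]] by (intro nn_integral_cong) (simp add: \<Lambda>D)
 also have "\<dots> = (\<integral>\<^sup>+r. emeasure (\<Lambda> r) A \<partial>?D)"
  using prob_kernel_emeasure_measurable[OF \<Lambda> A] by (simp add: nn_integral_distr[OF Z_measurable[OF t]])
 also have "\<dots> = emeasure (?D \<bind> \<Lambda>) A"
  by (rule emeasure_bind[OF ne \<Lambda>' A, symmetric])
 finally show "emeasure (distr M (borel_on S) (X t)) A = emeasure (?D \<bind> \<Lambda>) A" .
qed

text \<open>Condition on the past of \<open>X\<close> first and then on the past of \<open>Z\<close>, given which \<open>X s\<close> has law \<open>\<Lambda> (Z s)\<close>;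
 by \<open>Q_nn_integral\<close> the result depends on \<open>Z s\<close> through \<open>Q\<close>.\<close>

lemma feller_process_Z:
 assumes C0_\<phi>: "\<And>f. f \<in> C0_on E \<Longrightarrow> (\<lambda>x. f (\<phi> x)) \<in> C0_on S"
  and C0_\<Lambda>: "\<And>g. g \<in> C0_on S \<Longrightarrow> (\<lambda>r. \<integral>x. g x \<partial>\<Lambda> r) \<in> C0_on E"
 shows "feller_process E Q M Z"
 unfolding feller_process_def
proof (intro conjI allI impI ballI)
 show "prob_space M" by (rule prob_space_axioms)
 show "feller_kernels E Q" by (rule feller_kernels_Q[OF assms])
 show "Z t \<in> M \<rightarrow>\<^sub>M borel_on E" if "t \<ge> 0" for t by (rule Z_measurable[OF that])
next
 fix s t :: real and A assume s: "s \<ge> 0" and t: "t > 0" and A: "A \<in> sets (borel_on E)"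
 let ?N = "natural_filtration M Z s"
 have st: "s + t \<ge> 0" using s t by simp
 interpret sigma_finite_subalgebra M ?N
  by (rule finite_measure_subalgebra_is_sigma_finite) (unfold_locales, rule Z_subalgebra)
 let ?A = "Z (s + t) -` A \<inter> space M"
 have [measurable]: "?A \<in> sets M" by (rule measurable_sets[OF Z_measurable[OF st] A])
 have ZN: "Z s \<in> ?N \<rightarrow>\<^sub>M borel_on E"
  using measurable_space[OF Z_measurable[OF s]]
  by (intro measurable_restrict_space2 natural_filtration_measurable s) auto
 have QN: "(\<lambda>\<omega>. measure (Q t (Z s \<omega>)) A) \<in> borel_measurable ?N"
  unfolding measure_def
  by (intro borel_measurable_enn2real prob_kernel_emeasure_measurable[OF measurable_compose[OF ZN Q[OF t]] A])
 have QM [measurable]: "(\<lambda>\<omega>. measure (Q t (Z s \<omega>)) A) \<in> borel_measurable M"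
  by (rule measurable_from_subalg[OF Z_subalgebra QN])
 have QP: "prob_space (Q t (Z s \<omega>))" if "\<omega> \<in> space M" for \<omega>
  using measurable_space[OF Z_measurable[OF s] that] by (intro QD t) simp
 have Q1: "integrable M (\<lambda>\<omega>. measure (Q t (Z s \<omega>)) A)"
  by (rule integrable_const_bound[of _ 1]) (auto intro!: prob_space.prob_le_1 QP)
 have iA: "(indicator A :: _ \<Rightarrow> ennreal) \<in> borel_measurable (borel_on E)" using A by simp
 note i\<phi>A = measurable_compose[OF \<phi> iA]
 show "AE \<omega> in M. real_cond_exp M ?N (indicator ?A) \<omega> = measure (Q t (Z s \<omega>)) A"
 proof (rule real_cond_exp_charact)
  fix F assume F: "F \<in> sets ?N"
  have FX: "F \<in> sets (natural_filtration M X s)" using F Z_filtration_le by blast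
  have FM [measurable]: "F \<in> sets M" using F Z_subalgebra by (auto simp: subalgebra_def)
  have "ennreal (\<integral>\<omega>\<in>F. indicator ?A \<omega> \<partial>M) = (\<integral>\<^sup>+\<omega>. indicator F \<omega> * indicator A (\<phi> (X (s + t) \<omega>)) \<partial>M)"
  proof -
   have "ennreal (\<integral>\<omega>\<in>F. indicator ?A \<omega> \<partial>M) = emeasure M (F \<inter> ?A)"
    by (simp add: set_lebesgue_integral_def emeasure_eq_measure flip: indicator_inter_arith)
   also have "\<dots> = (\<integral>\<^sup>+\<omega>. indicator (F \<inter> ?A) \<omega> \<partial>M)" by simp
   also have "\<dots> = (\<integral>\<^sup>+\<omega>. indicator F \<omega> * indicator A (\<phi> (X (s + t) \<omega>)) \<partial>M)"
    by (intro nn_integral_cong) (simp add: indicator_def)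
   finally show ?thesis .
  qed
  also have "\<dots> = (\<integral>\<^sup>+\<omega>. indicator F \<omega> * (\<integral>\<^sup>+y. indicator A (\<phi> y) \<partial>K t (X s \<omega>)) \<partial>M)"
   by (rule feller_process_nn_markov[OF X s t FX i\<phi>A])
  also have "\<dots> = (\<integral>\<^sup>+\<omega>. indicator F \<omega> * (\<integral>\<^sup>+x. \<integral>\<^sup>+y. indicator A (\<phi> y) \<partial>K t x \<partial>\<Lambda> (Z s \<omega>)) \<partial>M)"
  proof (rule conditional_law[OF s F prob_kernel_nn_integral_measurable[OF K_kernel[OF t] i\<phi>A]])
   fix x assume "x \<in> S"
   then interpret P: prob_space "K t x" by (rule KD(1)[OF t])
   have "(\<integral>\<^sup>+y. indicator A (\<phi> y) \<partial>K t x) \<le> (\<integral>\<^sup>+y. 1 \<partial>K t x)"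
    by (intro nn_integral_mono) (simp add: indicator_def)
   then show "(\<integral>\<^sup>+y. indicator A (\<phi> y) \<partial>K t x) \<le> 1" by (simp add: P.emeasure_space_1)
  qed
  also have "\<dots> = (\<integral>\<^sup>+\<omega>. ennreal (indicator F \<omega> * measure (Q t (Z s \<omega>)) A) \<partial>M)"
  proof (rule nn_integral_cong)
   fix \<omega> assume \<omega>: "\<omega> \<in> space M"
   then have Zs: "Z s \<omega> \<in> E" using measurable_space[OF Z_measurable[OF s]] by simp
   interpret P: prob_space "Q t (Z s \<omega>)" by (rule QP[OF \<omega>])
   have "(\<integral>\<^sup>+x. \<integral>\<^sup>+y. indicator A (\<phi> y) \<partial>K t x \<partial>\<Lambda> (Z s \<omega>)) = (\<integral>\<^sup>+y. indicator A y \<partial>Q t (Z s \<omega>))"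
    by (rule Q_nn_integral[OF t Zs iA, symmetric])
   also have "\<dots> = ennreal (measure (Q t (Z s \<omega>)) A)"
    using A QD(2)[OF t Zs] by (simp add: P.emeasure_eq_measure)
   finally show "indicator F \<omega> * (\<integral>\<^sup>+x. \<integral>\<^sup>+y. indicator A (\<phi> y) \<partial>K t x \<partial>\<Lambda> (Z s \<omega>))
    = ennreal (indicator F \<omega> * measure (Q t (Z s \<omega>)) A)"
    by (simp add: indicator_def)
  qed
  also have "\<dots> = ennreal (\<integral>\<omega>\<in>F. measure (Q t (Z s \<omega>)) A \<partial>M)"
   using integrable_mult_indicator[OF FM Q1]
   by (subst nn_integral_eq_integral) (auto simp: set_lebesgue_integral_def)
  finally show "(\<integral>\<omega>\<in>F. indicator ?A \<omega> \<partial>M) = (\<integral>\<omega>\<in>F. measure (Q t (Z s \<omega>)) A \<partial>M)"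
   by (subst (asm) ennreal_inj) (auto simp: set_lebesgue_integral_def)
 qed (use Q1 QN in \<open>auto simp: less_top[symmetric]\<close>)
qed

end

section \<open>Continuous modifications of processes with rare large increments\<close>

definition grid_crossing :: "(real \<Rightarrow> real) \<Rightarrow> nat \<Rightarrow> real set \<Rightarrow> real set \<Rightarrow> nat \<Rightarrow> bool" where
 "grid_crossing z T B A n \<longleftrightarrow> (\<exists>i\<le>T * n. z (real i / real n) \<in> B \<and> z (real (Suc i) / real n) \<in> A)"

text \<open>On a fine grid the last point before \<open>t\<close> sees the left limit and the next one the value at \<open>t\<close> or to
 the right of it.\<close>

lemma jump_crosses_grids:
 fixes z :: "real \<Rightarrow> real"
 assumes t: "t > 0" "t \<le> real T"
  and B: "eventually (\<lambda>s. z s \<in> B) (at_left t)" and A: "z t \<in> A" "eventually (\<lambda>s. z s \<in> A) (at_right t)"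
 shows "eventually (grid_crossing z T B A) sequentially"
proof -
 obtain b where b: "b < t" "\<And>s. b < s \<Longrightarrow> s < t \<Longrightarrow> z s \<in> B"
  using B by (auto simp: eventually_at_left[of "t - 1" t])
 obtain a where a: "a > t" "\<And>s. t < s \<Longrightarrow> s < a \<Longrightarrow> z s \<in> A"
  using A(2) by (auto simp: eventually_at_right[of t "t + 1"])
 have "eventually (\<lambda>n. 1 / real n < min (t - b) (a - t)) sequentially"
  by (rule order_tendstoD(2)[OF lim_1_over_n]) (use a b in auto)
 then show ?thesis using eventually_gt_at_top[of 0]
 proof eventually_elim
  case (elim n)
  define i where "i = nat (\<lceil>t * n\<rceil> - 1)"
  have c: "\<lceil>t * n\<rceil> \<ge> 1" using t elim by (simp add: one_le_ceiling)
  then have ri: "real i = of_int \<lceil>t * n\<rceil> - 1" "real (Suc i) = of_int \<lceil>t * n\<rceil>" by (simp_all add: i_def)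
  have u: "real i < t * n" "t * n \<le> real (Suc i)" "real (Suc i) < t * n + 1"
   unfolding ri by linarith+
  then have u': "real i / n < t" "t \<le> real (Suc i) / n" "real (Suc i) / n < t + 1 / n"
   using elim by (simp_all add: field_simps)
  have "(t * n - 1) / n \<le> real i / n" using u by (intro divide_right_mono) auto
  then have u'': "t - 1 / n \<le> real i / n" using elim by (simp add: diff_divide_distrib)
  have "z (real i / n) \<in> B" using u' u'' elim by (intro b) auto
  moreover have "z (real (Suc i) / n) \<in> A"
   using u' elim a(2)[of "real (Suc i) / n"] A(1) by (cases "t = real (Suc i) / n") auto
  moreover have "i \<le> T * n"
  proof -
   have "real i \<le> real T * real n" using u(1) t(2) mult_right_mono[OF t(2), of "real n"] by linarith
   then show ?thesis by (simp flip: of_nat_mult)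
  qed
  ultimately show ?case unfolding grid_crossing_def by blast
 qed
qed

text \<open>A discontinuity separates the left limit from the value by a rational gap, which the path
 crosses, upwards or downwards, in one step of every fine grid.\<close>

lemma rcll_continuous_onI:
 fixes z :: "real \<Rightarrow> real"
 assumes z0: "\<And>t. t \<ge> 0 \<Longrightarrow> z t \<ge> 0"
  and right: "\<And>t. t \<ge> 0 \<Longrightarrow> continuous (at_right t) z"
  and left: "\<And>t. t > 0 \<Longrightarrow> \<exists>l. (z \<longlongrightarrow> l) (at_left t)"
  and no_crossing: "\<And>p p' L T. p \<in> \<rat> \<Longrightarrow> p' \<in> \<rat> \<Longrightarrow> p < p' \<Longrightarrow>
   \<not> eventually (grid_crossing z T {0..p} {p'..}) sequentially \<and>
   \<not> eventually (grid_crossing z T {p'..real L} {0..p}) sequentially"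
 shows "continuous_on {0..} z"
 unfolding continuous_on_eq_continuous_within
proof
 fix t :: real assume t: "t \<in> {0..}"
 show "continuous (at t within {0..}) z"
 proof (cases "t = 0")
  case True
  then show ?thesis unfolding at_within_Ici_at_right True by (intro right) simp
 next
  case False
  then have t0: "t > 0" using t by simp
  obtain T :: nat where T: "t \<le> real T" using real_arch_simple by blast
  have rt: "(z \<longlongrightarrow> z t) (at_right t)" using right[of t] t by (simp add: continuous_within)
  obtain l where l: "(z \<longlongrightarrow> l) (at_left t)" using left[OF t0] by blast
  have pos: "eventually (\<lambda>s. z s \<ge> 0) (at_left t)" "eventually (\<lambda>s. z s \<ge> 0) (at_right t)"
   by (rule eventually_at_leftI[OF _ t0], simp add: z0)
     (rule eventually_at_rightI[of t "t + 1"], use t0 in \<open>simp_all add: z0\<close>)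
  have "l = z t"
  proof (rule ccontr)
   assume "l \<noteq> z t"
   then consider "l < z t" | "z t < l" by linarith
   then show False
   proof cases
    case 1
    then obtain p where p: "p \<in> \<rat>" "l < p" "p < z t" using Rats_dense_in_real[OF 1] by blast
    obtain p' where p': "p' \<in> \<rat>" "p < p'" "p' < z t" using Rats_dense_in_real[OF p(3)] by blast
    have "eventually (grid_crossing z T {0..p} {p'..}) sequentially"
    proof (rule jump_crosses_grids[OF t0 T])
     show "eventually (\<lambda>s. z s \<in> {0..p}) (at_left t)"
      using order_tendstoD(2)[OF l p(2)] pos(1) by eventually_elim simp
     show "eventually (\<lambda>s. z s \<in> {p'..}) (at_right t)"
      using order_tendstoD(1)[OF rt p'(3)] by eventually_elim simp
    qed (use p' in simp)
    then show False using no_crossing[OF p(1) p'(1,2)] by metis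
   next
    case 2
    then obtain p where p: "p \<in> \<rat>" "z t < p" "p < l" using Rats_dense_in_real[OF 2] by blast
    obtain p' where p': "p' \<in> \<rat>" "p < p'" "p' < l" using Rats_dense_in_real[OF p(3)] by blast
    obtain L :: nat where L: "l < real L" using reals_Archimedean2 by blast
    have "eventually (grid_crossing z T {p'..real L} {0..p}) sequentially"
    proof (rule jump_crosses_grids[OF t0 T])
     show "eventually (\<lambda>s. z s \<in> {p'..real L}) (at_left t)"
      using order_tendstoD(1)[OF l p'(3)] order_tendstoD(2)[OF l L] by eventually_elim simp
     show "eventually (\<lambda>s. z s \<in> {0..p}) (at_right t)"
      using order_tendstoD(2)[OF rt p(2)] pos(2) by eventually_elim simp
    qed (use p z0 t in simp)
    then show False using no_crossing[OF p(1) p'(1,2)] by metis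
   qed
  qed
  then have "continuous (at t) z"
   unfolding continuous_at using l rt by (intro filterlim_split_at) simp_all
  then show ?thesis by (rule continuous_at_imp_continuous_within)
 qed
qed

lemma feller_process_joint_le:
 fixes Z :: "real \<Rightarrow> 'w \<Rightarrow> real"
 assumes Z: "feller_process {0..} Q M Z" and s: "s \<ge> 0" and h: "h > 0"
  and A: "A \<in> sets (borel_on {0..})" and B: "B \<in> sets borel"
  and c: "c \<ge> 0" "\<And>x. x \<in> B \<Longrightarrow> x \<ge> 0 \<Longrightarrow> measure (Q h x) A \<le> c"
 shows "emeasure M {\<omega>\<in>space M. Z s \<omega> \<in> B \<and> Z (s + h) \<omega> \<in> A} \<le> ennreal c"
proof -
 interpret prob_space M using Z by (simp add: feller_process_def)
 have Zm: "Z u \<in> M \<rightarrow>\<^sub>M borel_on {0..}" if "u \<ge> 0" for u using Z that by (simp add: feller_process_def)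
 have Q: "Q h \<in> borel_on {0..} \<rightarrow>\<^sub>M prob_algebra (borel_on {0..})"
  using Z h by (simp add: feller_process_def feller_kernels_def)
 let ?F = "Z s -` B \<inter> space M"
 have F: "?F \<in> sets (natural_filtration M Z s)"
  using measurable_sets[OF natural_filtration_measurable[of s s Z M] B] s by simp
 have sh: "s + h \<ge> 0" using s h by simp
 have iA: "(indicator A :: real \<Rightarrow> ennreal) \<in> borel_measurable (borel_on {0..})" using A by simp
 have FM: "?F \<in> sets M" using measurable_borel_on_borel[OF Zm[OF s]] B by simp
 have e: "{\<omega>\<in>space M. Z s \<omega> \<in> B \<and> Z (s + h) \<omega> \<in> A} = ?F \<inter> (Z (s + h) -` A \<inter> space M)" by auto
 have "emeasure M {\<omega>\<in>space M. Z s \<omega> \<in> B \<and> Z (s + h) \<omega> \<in> A}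
   = (\<integral>\<^sup>+\<omega>. indicator (?F \<inter> (Z (s + h) -` A \<inter> space M)) \<omega> \<partial>M)"
  unfolding e using FM measurable_sets[OF Zm[OF sh] A] by simp
 also have "\<dots> = (\<integral>\<^sup>+\<omega>. indicator ?F \<omega> * indicator A (Z (s + h) \<omega>) \<partial>M)"
  by (intro nn_integral_cong) (simp add: indicator_def)
 also have "\<dots> = (\<integral>\<^sup>+\<omega>. indicator ?F \<omega> * (\<integral>\<^sup>+y. indicator A y \<partial>Q h (Z s \<omega>)) \<partial>M)"
  by (rule feller_process_nn_markov[OF Z s h F iA])
 also have "\<dots> \<le> (\<integral>\<^sup>+\<omega>. ennreal c \<partial>M)"
 proof (rule nn_integral_mono)
  fix \<omega> assume \<omega>: "\<omega> \<in> space M"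
  then have Zs: "Z s \<omega> \<in> space (borel_on {0::real..})" by (rule measurable_space[OF Zm[OF s]])
  interpret P: prob_space "Q h (Z s \<omega>)" by (rule prob_kernelD(1)[OF Q Zs])
  show "indicator ?F \<omega> * (\<integral>\<^sup>+y. indicator A y \<partial>Q h (Z s \<omega>)) \<le> ennreal c"
   using A Zs c prob_kernelD(2)[OF Q Zs]
   by (cases "\<omega> \<in> ?F") (simp_all add: P.emeasure_eq_measure)
 qed
 also have "\<dots> = ennreal c" by (simp add: emeasure_space_1)
 finally show ?thesis .
qed

text \<open>There are about \<open>T n\<close> grid steps, each a crossing with probability at most \<open>\<eta> n / n\<close>.\<close>

lemma AE_no_grid_crossing:
 fixes Z :: "real \<Rightarrow> 'w \<Rightarrow> real"
 assumes Z: "feller_process {0..} Q M Z"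
  and A: "A \<in> sets (borel_on {0..})" and B: "B \<in> sets borel"
  and \<eta>: "\<eta> \<longlonglongrightarrow> 0" "\<And>n x. n \<ge> 1 \<Longrightarrow> x \<in> B \<Longrightarrow> x \<ge> 0 \<Longrightarrow> real n * measure (Q (1 / real n) x) A \<le> \<eta> n"
  and \<eta>0: "\<And>n. \<eta> n \<ge> 0"
 shows "AE \<omega> in M. \<not> eventually (grid_crossing (\<lambda>t. Z t \<omega>) T B A) sequentially"
proof -
 interpret prob_space M using Z by (simp add: feller_process_def)
 have Zm: "Z u \<in> M \<rightarrow>\<^sub>M borel_on {0..}" if "u \<ge> 0" for u using Z that by (simp add: feller_process_def)
 define C where "C n i = {\<omega>\<in>space M. Z (real i / real n) \<omega> \<in> B \<and> Z (real i / real n + 1 / real n) \<omega> \<in> A}" for n i :: nat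
 define D where "D n = (\<Union>i\<le>T * n. C n i)" for n
 have C [measurable]: "C n i \<in> sets M" for n i
 proof -
  have "C n i = (Z (real i / real n) -` B \<inter> space M) \<inter> (Z (real i / real n + 1 / real n) -` A \<inter> space M)"
   by (auto simp: C_def)
  moreover have "Z (real i / real n) -` B \<inter> space M \<in> sets M"
   by (rule measurable_sets[OF measurable_borel_on_borel[OF Zm] B]) simp
  moreover have "Z (real i / real n + 1 / real n) -` A \<inter> space M \<in> sets M"
   by (rule measurable_sets[OF Zm A]) simp
  ultimately show ?thesis by simp
 qed
 have D [measurable]: "D n \<in> sets M" for n unfolding D_def by measurable
 have gc: "grid_crossing (\<lambda>t. Z t \<omega>) T B A n \<longleftrightarrow> \<omega> \<in> D n" if "\<omega> \<in> space M" for \<omega> n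
  using that by (auto simp: grid_crossing_def D_def C_def add_divide_distrib add.commute Bex_def)
 have D_le: "emeasure M (D n) \<le> ennreal (real (T * n + 1) * (\<eta> n / n))" if n: "n \<ge> 1" for n
 proof -
  have "emeasure M (D n) \<le> (\<Sum>i\<le>T * n. emeasure M (C n i))"
   unfolding D_def by (rule emeasure_subadditive_finite) auto
  also have "\<dots> \<le> (\<Sum>i\<le>T * n. ennreal (\<eta> n / n))"
  proof (rule sum_mono)
   fix i
   show "emeasure M (C n i) \<le> ennreal (\<eta> n / n)"
    unfolding C_def using n \<eta>0[of n] \<eta>(2)[OF n]
    by (intro feller_process_joint_le[OF Z _ _ A B]) (auto simp: field_simps)
  qed
  also have "\<dots> = ennreal (real (T * n + 1)) * ennreal (\<eta> n / n)"
   by (simp only: sum_constant card_atMost ennreal_of_nat_eq_real_of_nat Suc_eq_plus1)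
  also have "\<dots> = ennreal (real (T * n + 1) * (\<eta> n / n))"
   using \<eta>0[of n] by (intro ennreal_mult[symmetric]) simp_all
  finally show ?thesis .
 qed
 have lim: "(\<lambda>n. real (T * n + 1) * (\<eta> n / n)) \<longlonglongrightarrow> 0"
 proof -
  have "(\<lambda>n. (real T + 1 / real n) * \<eta> n) \<longlonglongrightarrow> (real T + 0) * 0"
   by (intro tendsto_intros \<eta>(1) lim_1_over_n)
  moreover have "eventually (\<lambda>n. (real T + 1 / real n) * \<eta> n = real (T * n + 1) * (\<eta> n / n)) sequentially"
   using eventually_gt_at_top[of 0] by eventually_elim (simp add: field_simps)
  ultimately have "(\<lambda>n. real (T * n + 1) * (\<eta> n / n)) \<longlonglongrightarrow> (real T + 0) * 0"
   by (rule Lim_transform_eventually)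
  then show ?thesis by simp
 qed
 have null: "AE \<omega> in M. \<not> (\<forall>n\<ge>N. \<omega> \<in> D n)" for N
 proof -
  have "emeasure M {\<omega>\<in>space M. \<forall>n\<ge>N. \<omega> \<in> D n} \<le> ennreal 0"
  proof (rule LIMSEQ_le_const[OF tendsto_ennrealI[OF lim]], intro exI allI impI)
   fix n assume n: "max N 1 \<le> n"
   have "emeasure M {\<omega>\<in>space M. \<forall>n\<ge>N. \<omega> \<in> D n} \<le> emeasure M (D n)"
    using n by (intro emeasure_mono) auto
   also have "\<dots> \<le> ennreal (real (T * n + 1) * (\<eta> n / n))" using n by (intro D_le) simp
   finally show "emeasure M {\<omega>\<in>space M. \<forall>n\<ge>N. \<omega> \<in> D n} \<le> ennreal (real (T * n + 1) * (\<eta> n / n))" .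
  qed
  then show ?thesis by (intro AE_I[where N="{\<omega>\<in>space M. \<forall>n\<ge>N. \<omega> \<in> D n}"]) auto
 qed
 have "AE \<omega> in M. \<forall>N. \<not> (\<forall>n\<ge>N. \<omega> \<in> D n)" using null by (simp add: AE_all_countable)
 then show ?thesis
  by (rule AE_mp) (auto simp: eventually_sequentially gc)
qed

lemma continuous_modification_of_rcll:
 fixes Z :: "real \<Rightarrow> 'w \<Rightarrow> real"
 assumes Z: "feller_process {0..} Q M Z" and rcll: "rcll_paths M Z"
  and rare: "\<And>L \<epsilon>. \<epsilon> > 0 \<Longrightarrow> \<exists>\<eta>. \<eta> \<longlonglongrightarrow> 0 \<and> (\<forall>n. \<eta> n \<ge> 0) \<and>
   (\<forall>n\<ge>1. \<forall>x\<in>{0..L}. real n * measure (Q (1 / real n) x) {y\<in>{0..}. \<bar>y - x\<bar> \<ge> \<epsilon>} \<le> \<eta> n)"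
 shows "\<exists>Y. (\<forall>t\<ge>0. Y t \<in> M \<rightarrow>\<^sub>M borel_on {0..} \<and> (AE \<omega> in M. Y t \<omega> = Z t \<omega>)) \<and> continuous_paths M Y"
proof -
 interpret prob_space M using Z by (simp add: feller_process_def)
 have Zm: "Z u \<in> M \<rightarrow>\<^sub>M borel_on {0..}" if "u \<ge> 0" for u using Z that by (simp add: feller_process_def)
 have Qk: "Q h \<in> borel_on {0..} \<rightarrow>\<^sub>M prob_algebra (borel_on {0..})" if "h > 0" for h
  using Z that by (simp add: feller_process_def feller_kernels_def)
 have no: "AE \<omega> in M. \<not> eventually (grid_crossing (\<lambda>t. Z t \<omega>) T B A) sequentially"
  if A: "A \<in> sets borel" "A \<subseteq> {0..}" and B: "B \<in> sets borel" "B \<subseteq> {..L}"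
   and gap: "\<epsilon> > 0" "\<And>x y. x \<in> B \<Longrightarrow> y \<in> A \<Longrightarrow> \<bar>y - x\<bar> \<ge> \<epsilon>" for A B \<epsilon> L T
 proof -
  obtain \<eta> where \<eta>: "\<eta> \<longlonglongrightarrow> 0" "\<And>n. \<eta> n \<ge> 0"
   "\<And>n x. n \<ge> 1 \<Longrightarrow> x \<in> {0..L} \<Longrightarrow> real n * measure (Q (1 / real n) x) {y\<in>{0..}. \<bar>y - x\<bar> \<ge> \<epsilon>} \<le> \<eta> n"
   using rare[OF gap(1), of L] by blast
  have A': "A \<in> sets (borel_on {0..})" using A by (simp add: sets_restrict_space_iff)
  show ?thesis
  proof (rule AE_no_grid_crossing[OF Z A' B(1) \<eta>(1) _ \<eta>(2)])
   fix n :: nat and x :: real assume n: "n \<ge> 1" and x: "x \<in> B" "x \<ge> 0"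
   interpret P: prob_space "Q (1 / real n) x" by (rule prob_kernelD(1)[OF Qk]) (use n x in auto)
   have sQ: "sets (Q (1 / real n) x) = sets (borel_on {0..})" by (rule prob_kernelD(2)[OF Qk]) (use n x in auto)
   have "{y\<in>{0..}. \<bar>y - x\<bar> \<ge> \<epsilon>} \<in> sets borel" by simp
   then have "measure (Q (1 / real n) x) A \<le> measure (Q (1 / real n) x) {y\<in>{0..}. \<bar>y - x\<bar> \<ge> \<epsilon>}"
    using A gap(2)[OF x(1)] sQ by (intro P.finite_measure_mono) (auto simp: sets_restrict_space_iff)
   then have "real n * measure (Q (1 / real n) x) A \<le> real n * measure (Q (1 / real n) x) {y\<in>{0..}. \<bar>y - x\<bar> \<ge> \<epsilon>}"
    by (intro mult_left_mono) auto
   also have "\<dots> \<le> \<eta> n" using x B by (intro \<eta>(3) n) auto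
   finally show "real n * measure (Q (1 / real n) x) A \<le> \<eta> n" .
  qed
 qed
 have "AE \<omega> in M. \<forall>p\<in>\<rat>. \<forall>p'\<in>\<rat>. \<forall>L T. p < p' \<longrightarrow>
   \<not> eventually (grid_crossing (\<lambda>t. Z t \<omega>) T {0..p} {p'..}) sequentially \<and>
   \<not> eventually (grid_crossing (\<lambda>t. Z t \<omega>) T {p'..real L} {0..p}) sequentially"
  unfolding AE_ball_countable[OF countable_rat] AE_all_countable
 proof (intro ballI allI)
  fix p p' :: real and L T :: nat
  show "AE \<omega> in M. p < p' \<longrightarrow>
   \<not> eventually (grid_crossing (\<lambda>t. Z t \<omega>) T {0..p} {p'..}) sequentially \<and>
   \<not> eventually (grid_crossing (\<lambda>t. Z t \<omega>) T {p'..real L} {0..p}) sequentially"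
  proof (cases "p < p'")
   case True
   have 2: "AE \<omega> in M. \<not> eventually (grid_crossing (\<lambda>t. Z t \<omega>) T {p'..real L} {0..p}) sequentially"
    by (rule no[of _ _ "real L" "p' - p"]) (use True in auto)
   have 1: "AE \<omega> in M. \<not> eventually (grid_crossing (\<lambda>t. Z t \<omega>) T {0..p} {p'..}) sequentially"
   proof (cases "p' \<ge> 0")
    case p': True
    show ?thesis by (rule no[of _ _ p "p' - p"]) (use True p' in auto)
   next
    case False
    then have "{0..p} = {}" using True by auto
    then show ?thesis
     by (auto simp: grid_crossing_def eventually_sequentially)
   qed
   show ?thesis using 1 2 by eventually_elim simp
  qed simp
 qed
 then obtain N where N': "\<And>\<omega>. \<omega> \<in> space M - N \<Longrightarrow> \<forall>p\<in>\<rat>. \<forall>p'\<in>\<rat>. \<forall>L T. p < p' \<longrightarrow>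
   \<not> eventually (grid_crossing (\<lambda>t. Z t \<omega>) T {0..p} {p'..}) sequentially \<and>
   \<not> eventually (grid_crossing (\<lambda>t. Z t \<omega>) T {p'..real L} {0..p}) sequentially"
  and N: "N \<in> null_sets M"
  by (rule AE_E3) blast
 define Y where "Y t \<omega> = (if \<omega> \<in> N then 0 else Z t \<omega>)" for t \<omega>
 show ?thesis
 proof (intro exI[of _ Y] conjI allI impI)
  fix t :: real assume t: "t \<ge> 0"
  show "Y t \<in> M \<rightarrow>\<^sub>M borel_on {0..}"
   unfolding Y_def[abs_def] using N Zm[OF t]
   by (intro measurable_If_set) (auto simp: space_restrict_space)
  show "AE \<omega> in M. Y t \<omega> = Z t \<omega>"
   using AE_not_in[OF N] by eventually_elim (simp add: Y_def)
 next
  show "continuous_paths M Y"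
   unfolding continuous_paths_def
  proof
   fix \<omega> assume \<omega>: "\<omega> \<in> space M"
   show "continuous_on {0..} (\<lambda>t. Y t \<omega>)"
   proof (cases "\<omega> \<in> N")
    case False
    have "continuous_on {0..} (\<lambda>t. Z t \<omega>)"
    proof (rule rcll_continuous_onI)
     show "Z t \<omega> \<ge> 0" if "t \<ge> 0" for t using measurable_space[OF Zm[OF that] \<omega>] by simp
    qed (use rcll \<omega> N'[of \<omega>] False in \<open>auto simp: rcll_paths_def\<close>)
    then show ?thesis using False by (simp add: Y_def)
   qed (simp add: Y_def)
  qed
 qed
qed

section \<open>Reflections and complexification\<close>

lemma linear_reflection: "linear (reflection \<alpha>)"
 unfolding reflection_def
 by (rule linearI) (simp_all add: inner_left_distrib algebra_simps add_divide_distrib)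

lemma reflection_inner: "reflection \<alpha> x \<bullet> y = x \<bullet> reflection \<alpha> y"
 by (simp add: reflection_def inner_diff_left inner_diff_right inner_commute)

lemma reflection_reflection [simp]: "reflection \<alpha> (reflection \<alpha> x) = x"
proof (cases "\<alpha> = 0")
 case False
 have "reflection \<alpha> (reflection \<alpha> x) = x - (2 * (x \<bullet> \<alpha>) / (\<alpha> \<bullet> \<alpha>)) *\<^sub>R \<alpha> - (2 * ((x \<bullet> \<alpha>) - 2 * (x \<bullet> \<alpha>) / (\<alpha> \<bullet> \<alpha>) * (\<alpha> \<bullet> \<alpha>)) / (\<alpha> \<bullet> \<alpha>)) *\<^sub>R \<alpha>"
  by (simp add: reflection_def inner_diff_left)
 also have "2 * ((x \<bullet> \<alpha>) - 2 * (x \<bullet> \<alpha>) / (\<alpha> \<bullet> \<alpha>) * (\<alpha> \<bullet> \<alpha>)) / (\<alpha> \<bullet> \<alpha>) = - (2 * (x \<bullet> \<alpha>) / (\<alpha> \<bullet> \<alpha>))"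
  using False by simp
 finally show ?thesis by simp
qed (simp add: reflection_def)

lemma norm_reflection [simp]: "norm (reflection \<alpha> x) = norm x"
 using reflection_inner[of \<alpha> x "reflection \<alpha> x"] by (simp add: norm_eq_sqrt_inner)

lemma reflection_self: "reflection \<alpha> \<alpha> = - \<alpha>"
 by (cases "\<alpha> = 0") (simp_all add: reflection_def scaleR_2)

lemma reflection_minus: "reflection (- \<alpha>) = reflection \<alpha>"
 by (simp add: reflection_def fun_eq_iff)

lemma reflection_image_root:
 "reflection \<beta> (reflection \<alpha> x) = reflection (reflection \<beta> \<alpha>) (reflection \<beta> x)"
proof -
 have i: "reflection \<beta> x \<bullet> reflection \<beta> \<alpha> = x \<bullet> \<alpha>" "reflection \<beta> \<alpha> \<bullet> reflection \<beta> \<alpha> = \<alpha> \<bullet> \<alpha>"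
  using reflection_inner[of \<beta> x "reflection \<beta> \<alpha>"] reflection_inner[of \<beta> \<alpha> "reflection \<beta> \<alpha>"] by simp_all
 interpret linear "reflection \<beta>" by (rule linear_reflection)
 show ?thesis unfolding reflection_def[of \<alpha> x] reflection_def[of "reflection \<beta> \<alpha>"] i
  by (simp add: diff scale)
qed

lemma cvec_simps [simp]:
 "cvec 0 = 0" "cvec (x + y) = cvec x + cvec y" "cvec (- x) = - cvec x"
 "cvec (a *\<^sub>R x) = complex_of_real a *s cvec x" "cvec (x - y) = cvec x - cvec y"
 by (simp_all add: cvec_def vec_eq_iff)

lemma cbilin_cvec: "cbilin (cvec x) (cvec y) = complex_of_real (x \<bullet> y)"
 by (simp add: cbilin_def cvec_def inner_vec_def)

lemma cbilin_simps [simp]: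
 "cbilin (x + y) z = cbilin x z + cbilin y z" "cbilin z (x + y) = cbilin z x + cbilin z y"
 "cbilin (x - y) z = cbilin x z - cbilin y z" "cbilin z (x - y) = cbilin z x - cbilin z y"
 "cbilin (c *s x) z = c * cbilin x z" "cbilin z (c *s x) = c * cbilin z x"
 "cbilin 0 z = 0" "cbilin z 0 = 0" "cbilin (- x) z = - cbilin x z" "cbilin z (- x) = - cbilin z x"
 by (simp_all add: cbilin_def sum.distrib sum_subtractf sum_distrib_left sum_negf algebra_simps)

lemma cbilin_commute: "cbilin x y = cbilin y x"
 by (simp add: cbilin_def mult.commute)

lemma norm_cvec [simp]: "norm (cvec x) = norm x"
 by (simp add: norm_vec_def cvec_def)

lemma norm_vec_smult: "norm (c *s (z :: complex ^ 'n)) = norm c * norm z"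
 by (simp add: norm_vec_def norm_mult L2_set_def power_mult_distrib real_sqrt_mult flip: sum_distrib_left)

lemma norm_cbilin_le: "norm (cbilin z w) \<le> norm z * norm w"
proof -
 have "norm (cbilin z w) \<le> (\<Sum>i\<in>UNIV. norm (z $ i) * norm (w $ i))"
  unfolding cbilin_def by (rule order_trans[OF norm_sum]) (simp add: norm_mult)
 also have "\<dots> \<le> norm z * norm w"
  unfolding norm_vec_def using L2_set_mult_ineq[of "\<lambda>i. norm (z $ i)" "\<lambda>i. norm (w $ i)" UNIV] by simp
 finally show ?thesis .
qed

lemma scaleR_eq_smult: "a *\<^sub>R z = complex_of_real a *s z"
 unfolding vec_eq_iff vector_scaleR_component vector_smult_component
 by (simp add: scaleR_conv_of_real)

lemma cvec_decompose: "z = cvec (\<chi> i. Re (z $ i)) + \<i> *s cvec (\<chi> i. Im (z $ i))"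
 by (simp add: vec_eq_iff cvec_def complex_eq_iff)

lemma complexify_eq:
 assumes "linear g"
 shows "complexify g (cvec x + \<i> *s cvec y) = cvec (g x) + \<i> *s cvec (g y)"
proof -
 have "(\<chi> i. Re ((cvec x + \<i> *s cvec y) $ i)) = x" "(\<chi> i. Im ((cvec x + \<i> *s cvec y) $ i)) = y"
  by (simp_all add: vec_eq_iff cvec_def)
 then show ?thesis by (simp add: complexify_def)
qed

lemma complexify_cvec: "linear g \<Longrightarrow> complexify g (cvec x) = cvec (g x)"
 using complexify_eq[of g x 0] linear_0[of g] by simp

lemma complexify_add:
 assumes g: "linear g"
 shows "complexify g (z + w) = complexify g z + complexify g w"
proof -
 have "(\<chi> i. Re ((z + w) $ i)) = (\<chi> i. Re (z $ i)) + (\<chi> i. Re (w $ i))"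
  "(\<chi> i. Im ((z + w) $ i)) = (\<chi> i. Im (z $ i)) + (\<chi> i. Im (w $ i))" by (simp_all add: vec_eq_iff)
 then show ?thesis by (simp add: complexify_def linear_add[OF g] vector_add_ldistrib)
qed

lemma complexify_smult:
 assumes g: "linear g"
 shows "complexify g (c *s z) = c *s complexify g z"
proof -
 have "(\<chi> i. Re ((c *s z) $ i)) = Re c *\<^sub>R (\<chi> i. Re (z $ i)) - Im c *\<^sub>R (\<chi> i. Im (z $ i))"
  "(\<chi> i. Im ((c *s z) $ i)) = Re c *\<^sub>R (\<chi> i. Im (z $ i)) + Im c *\<^sub>R (\<chi> i. Re (z $ i))"
  by (simp_all add: vec_eq_iff)
 moreover have "cvec (Re c *\<^sub>R x - Im c *\<^sub>R y) + \<i> *s cvec (Re c *\<^sub>R y + Im c *\<^sub>R x) = c *s (cvec x + \<i> *s cvec y)" for x y :: "real ^ 'b"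
  by (simp add: vec_eq_iff cvec_def complex_eq_iff)
 ultimately show ?thesis
  by (simp only: complexify_def linear_add[OF g] linear_diff[OF g] linear_scale[OF g])
qed

lemma complexify_compose:
 assumes "linear g" "linear h"
 shows "complexify (g \<circ> h) z = complexify g (complexify h z)"
proof -
 have "complexify g (complexify h z) = complexify g (cvec (h (\<chi> i. Re (z $ i))) + \<i> *s cvec (h (\<chi> i. Im (z $ i))))"
  by (simp add: complexify_def)
 then show ?thesis unfolding complexify_eq[OF assms(1)] by (simp add: complexify_def)
qed

lemma complexify_id [simp]: "complexify id z = z" "complexify (\<lambda>x. x) z = z"
 using cvec_decompose[of z] by (simp_all add: complexify_def)

lemma norm_complexify:
 assumes "\<And>x. norm (g x) = norm x"
 shows "norm (complexify g z) = norm z"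
proof -
 have n: "(norm (cvec x + \<i> *s cvec y))\<^sup>2 = (norm x)\<^sup>2 + (norm y)\<^sup>2" for x y :: "real ^ 'b"
  by (simp add: norm_vec_def L2_set_def sum_nonneg cvec_def cmod_power2 sum.distrib)
 have "(norm (complexify g z))\<^sup>2 = (norm z)\<^sup>2"
  unfolding complexify_def n assms by (subst (3) cvec_decompose) (simp only: n)
 then show ?thesis by simp
qed

lemma complexify_reflection:
 "complexify (reflection \<alpha>) z = z - (2 * cbilin (cvec \<alpha>) z / complex_of_real (\<alpha> \<bullet> \<alpha>)) *s cvec \<alpha>"
proof -
 define x y where "x = (\<chi> i. Re (z $ i))" and "y = (\<chi> i. Im (z $ i))"
 have z: "z = cvec x + \<i> *s cvec y" unfolding x_def y_def by (rule cvec_decompose)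
 show ?thesis
  unfolding z complexify_eq[OF linear_reflection]
  by (simp add: reflection_def cbilin_cvec inner_commute)
    (simp add: vec_eq_iff algebra_simps add_divide_distrib)
qed

lemma cbilin_complexify_reflection:
 "cbilin (complexify (reflection \<alpha>) z) w = cbilin z (complexify (reflection \<alpha>) w)"
 unfolding complexify_reflection by (simp add: cbilin_commute)

lemma complexify_reflection_involution [simp]:
 "complexify (reflection \<alpha>) (complexify (reflection \<alpha>) z) = z"
 using complexify_compose[OF linear_reflection linear_reflection, of \<alpha> \<alpha> z]
 by (simp add: comp_def)

lemma bounded_linear_complexify:
 assumes "linear g" "\<And>x. norm (g x) = norm x"
 shows "bounded_linear (complexify g)"
 by (rule bounded_linear_intro[of _ 1])
   (simp_all add: complexify_add[OF assms(1)] complexify_smult[OF assms(1)] scaleR_eq_smult norm_complexify[OF assms(2)])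

section \<open>The reflection group\<close>

lemma weyl_group_linear: "g \<in> weyl_group R \<Longrightarrow> linear g"
proof (induction rule: weyl_group.induct)
 case weyl_id
 show ?case by (rule linear_id)
next
 case (weyl_refl g \<alpha>)
 then show ?case by (intro linear_compose linear_reflection)
qed

lemma weyl_group_norm: "g \<in> weyl_group R \<Longrightarrow> norm (g x) = norm x"
 by (induction arbitrary: x rule: weyl_group.induct) simp_all

lemma weyl_group_reflection: "\<alpha> \<in> R \<Longrightarrow> reflection \<alpha> \<in> weyl_group R"
 using weyl_group.weyl_refl[OF weyl_group.weyl_id, of \<alpha> R] by simp

lemma weyl_group_compose: "g \<in> weyl_group R \<Longrightarrow> h \<in> weyl_group R \<Longrightarrow> g \<circ> h \<in> weyl_group R"
 by (induction rule: weyl_group.induct) (auto simp: comp_assoc intro: weyl_group.intros)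

lemma weyl_group_inverse:
 "g \<in> weyl_group R \<Longrightarrow> \<exists>h\<in>weyl_group R. h \<circ> g = id \<and> g \<circ> h = id"
proof (induction rule: weyl_group.induct)
 case weyl_id
 show ?case by (intro bexI[of _ id] conjI weyl_group.weyl_id) simp_all
next
 case (weyl_refl g \<alpha>)
 then obtain h where h: "h \<in> weyl_group R" "h \<circ> g = id" "g \<circ> h = id" by blast
 have "(h \<circ> reflection \<alpha>) \<circ> (reflection \<alpha> \<circ> g) = id" "(reflection \<alpha> \<circ> g) \<circ> (h \<circ> reflection \<alpha>) = id"
  using h(2,3) by (auto simp: fun_eq_iff)
 then show ?case using weyl_group_compose[OF h(1) weyl_group_reflection[OF weyl_refl(2)]] by blast
qed

lemma weyl_group_inv:
 assumes "g \<in> weyl_group R"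
 shows "inv g \<in> weyl_group R" "g (inv g x) = x" "inv g (g x) = x" "bij g"
proof -
 obtain h where h: "h \<in> weyl_group R" "h \<circ> g = id" "g \<circ> h = id" using weyl_group_inverse[OF assms] by blast
 then have "inv g = h" by (metis inv_unique_comp)
 with h show "inv g \<in> weyl_group R" "g (inv g x) = x" "inv g (g x) = x" "bij g"
  by (simp_all add: o_bij pointfree_idE)
qed

lemma bij_betw_weyl_group_compose:
 assumes "h \<in> weyl_group R"
 shows "bij_betw (\<lambda>g. g \<circ> h) (weyl_group R) (weyl_group R)" "bij_betw (\<lambda>g. h \<circ> g) (weyl_group R) (weyl_group R)"
proof -
 have e: "h \<circ> inv h = id" "inv h \<circ> h = id" using weyl_group_inv[OF assms] by (auto simp: fun_eq_iff)
 show "bij_betw (\<lambda>g. g \<circ> h) (weyl_group R) (weyl_group R)"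
  by (rule bij_betw_byWitness[where f'="\<lambda>g. g \<circ> inv h"])
    (auto simp: comp_assoc e intro: weyl_group_compose assms weyl_group_inv(1)[OF assms])
 show "bij_betw (\<lambda>g. h \<circ> g) (weyl_group R) (weyl_group R)"
  by (rule bij_betw_byWitness[where f'="\<lambda>g. inv h \<circ> g"])
    (auto simp: e intro: weyl_group_compose assms weyl_group_inv(1)[OF assms] simp flip: comp_assoc)
qed

lemma bij_betw_weyl_group_inv: "bij_betw inv (weyl_group R) (weyl_group R)"
 by (rule bij_betw_byWitness[where f'=inv]) (auto simp: weyl_group_inv inv_inv_eq)

locale dunkl_setting =
 fixes R Rp :: "(real ^ 'n) set" and k :: "real ^ 'n \<Rightarrow> real"
 assumes root_system: "root_system R" and positive: "positive_subsystem R Rp"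
  and multiplicity: "multiplicity_function R k"
begin

abbreviation W where "W \<equiv> weyl_group R"

abbreviation weight where "weight \<equiv> dunkl_weight Rp k"

lemma finite_R: "finite R" and zero_notin_R: "0 \<notin> R"
 and reflection_root: "\<alpha> \<in> R \<Longrightarrow> \<beta> \<in> R \<Longrightarrow> reflection \<alpha> \<beta> \<in> R"
 using root_system by (auto simp: root_system_def)

lemma Rp_subset: "Rp \<subseteq> R" and finite_Rp: "finite Rp"
 using positive finite_R by (auto simp: positive_subsystem_def)

lemma uminus_root: "\<alpha> \<in> R \<Longrightarrow> - \<alpha> \<in> R"
 using reflection_root[of \<alpha> \<alpha>] by (simp add: reflection_self)

lemma uminus_in_Rp_iff: "\<alpha> \<in> R \<Longrightarrow> - \<alpha> \<in> Rp \<longleftrightarrow> \<alpha> \<notin> Rp"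
proof -
 assume \<alpha>: "\<alpha> \<in> R"
 obtain \<beta> where \<beta>: "\<forall>\<alpha>\<in>R. \<alpha> \<bullet> \<beta> \<noteq> 0" "Rp = {\<alpha>\<in>R. \<alpha> \<bullet> \<beta> > 0}"
  using positive by (auto simp: positive_subsystem_def)
 have "\<alpha> \<bullet> \<beta> \<noteq> 0" using \<beta> \<alpha> by blast
 then show ?thesis using \<beta>(2) \<alpha> uminus_root[OF \<alpha>] by auto
qed

lemma k_nonneg: "\<alpha> \<in> R \<Longrightarrow> k \<alpha> \<ge> 0" and k_weyl: "g \<in> W \<Longrightarrow> \<alpha> \<in> R \<Longrightarrow> k (g \<alpha>) = k \<alpha>"
 using multiplicity by (auto simp: multiplicity_function_def)

lemma k_reflection: "\<beta> \<in> R \<Longrightarrow> \<alpha> \<in> R \<Longrightarrow> k (reflection \<beta> \<alpha>) = k \<alpha>"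
 by (rule k_weyl[OF weyl_group_reflection])

lemma k_uminus: "\<alpha> \<in> R \<Longrightarrow> k (- \<alpha>) = k \<alpha>"
 using k_reflection[of \<alpha> \<alpha>] by (simp add: reflection_self)

lemma weyl_group_root: "g \<in> W \<Longrightarrow> \<alpha> \<in> R \<Longrightarrow> g \<alpha> \<in> R"
 by (induction rule: weyl_group.induct) (auto intro: reflection_root)

lemma finite_weyl_group: "finite W"
proof -
 have fix_orth: "g x = x" if "g \<in> W" "\<And>y. y \<in> R \<Longrightarrow> x \<bullet> y = 0" for g x
  using that by (induction rule: weyl_group.induct) (simp_all add: reflection_def)
 have inj: "inj_on (\<lambda>g. restrict g R) W"
 proof (rule inj_onI)
  fix g h assume g: "g \<in> W" and h: "h \<in> W" and eq: "restrict g R = restrict h R"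
  show "g = h"
  proof
   fix x
   obtain p q where pq: "p \<in> span R" "\<And>y. y \<in> span R \<Longrightarrow> orthogonal q y" "x = p + q"
    using orthogonal_subspace_decomp_exists[of R x] by blast
   have "g p = h p"
    by (rule linear_eq_on_span[OF weyl_group_linear[OF g] weyl_group_linear[OF h] _ pq(1)])
      (use eq in \<open>metis restrict_apply\<close>)
   moreover have "g q = q" "h q = q"
    using fix_orth[OF g] fix_orth[OF h] pq(2) by (auto simp: orthogonal_def span_base)
   ultimately show "g x = h x"
    by (simp add: pq(3) linear_add[OF weyl_group_linear[OF g]] linear_add[OF weyl_group_linear[OF h]])
  qed
 qed
 have "(\<lambda>g. restrict g R) ` W \<subseteq> R \<rightarrow>\<^sub>E R" using weyl_group_root by auto
 moreover have "finite (R \<rightarrow>\<^sub>E R)" by (intro finite_PiE finite_R)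
 ultimately show ?thesis using inj finite_subset finite_imageD by metis
qed

lemma card_W_pos: "card W > 0"
 using finite_weyl_group weyl_group.weyl_id by (auto simp: card_gt_0_iff)

text \<open>A reflection permutes the positive roots up to sign.\<close>

lemma
 assumes \<beta>: "\<beta> \<in> R"
 shows sum_Rp_reflection: "(\<And>\<alpha>. \<alpha> \<in> R \<Longrightarrow> F (- \<alpha>) = F \<alpha>) \<Longrightarrow> (\<Sum>\<alpha>\<in>Rp. F (reflection \<beta> \<alpha>)) = (\<Sum>\<alpha>\<in>Rp. (F \<alpha> :: 'b::comm_monoid_add))"
  and prod_Rp_reflection: "(\<And>\<alpha>. \<alpha> \<in> R \<Longrightarrow> G (- \<alpha>) = G \<alpha>) \<Longrightarrow> (\<Prod>\<alpha>\<in>Rp. G (reflection \<beta> \<alpha>)) = (\<Prod>\<alpha>\<in>Rp. (G \<alpha> :: 'c::comm_monoid_mult))"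
proof -
 define p where "p \<alpha> = (if reflection \<beta> \<alpha> \<in> Rp then reflection \<beta> \<alpha> else - reflection \<beta> \<alpha>)" for \<alpha>
 have r: "reflection \<beta> \<alpha> \<in> R" if "\<alpha> \<in> Rp" for \<alpha> using that Rp_subset \<beta> by (auto intro: reflection_root)
 have p1: "p \<alpha> \<in> Rp" if "\<alpha> \<in> Rp" for \<alpha>
  using uminus_in_Rp_iff[OF r[OF that]] by (auto simp: p_def)
 have p2: "p (p \<alpha>) = \<alpha>" if "\<alpha> \<in> Rp" for \<alpha>
  using that uminus_in_Rp_iff[of \<alpha>] Rp_subset
  by (auto simp: p_def linear_neg[OF linear_reflection])
 show "(\<Sum>\<alpha>\<in>Rp. F (reflection \<beta> \<alpha>)) = (\<Sum>\<alpha>\<in>Rp. F \<alpha>)" if "\<And>\<alpha>. \<alpha> \<in> R \<Longrightarrow> F (- \<alpha>) = F \<alpha>"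
  by (rule sum.reindex_bij_witness[where i=p and j=p]) (use p1 p2 that r in \<open>auto simp: p_def\<close>)
 show "(\<Prod>\<alpha>\<in>Rp. G (reflection \<beta> \<alpha>)) = (\<Prod>\<alpha>\<in>Rp. G \<alpha>)" if "\<And>\<alpha>. \<alpha> \<in> R \<Longrightarrow> G (- \<alpha>) = G \<alpha>"
  by (rule prod.reindex_bij_witness[where i=p and j=p]) (use p1 p2 that r in \<open>auto simp: p_def\<close>)
qed

lemma dunkl_weight_weyl:
 assumes "g \<in> W"
 shows "weight (g x) = weight x"
 using assms
proof (induction arbitrary: x rule: weyl_group.induct)
 case (weyl_refl g \<beta>)
 have "weight (reflection \<beta> y) = weight y" for y
 proof -
  have "weight (reflection \<beta> y) = (\<Prod>\<alpha>\<in>Rp. rpow \<bar>reflection \<beta> \<alpha> \<bullet> y\<bar> (2 * k (reflection \<beta> \<alpha>)))"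
   unfolding dunkl_weight_def using weyl_refl(2) Rp_subset
   by (intro prod.cong) (auto simp: reflection_inner k_reflection)
  also have "\<dots> = weight y"
   unfolding dunkl_weight_def by (rule prod_Rp_reflection[OF weyl_refl(2)]) (simp add: k_uminus)
  finally show ?thesis .
 qed
 with weyl_refl show ?case by simp
qed simp

text \<open>Maximise \<open>\<langle>g x, \<beta>\<rangle>\<close> over the group, for a \<open>\<beta>\<close> that defines the
 positive system.\<close>

lemma orbit_meets_chamber: "\<exists>g\<in>W. g x \<in> weyl_chamber Rp"
proof -
 obtain \<beta> where \<beta>: "Rp = {\<alpha>\<in>R. \<alpha> \<bullet> \<beta> > 0}"
  using positive by (auto simp: positive_subsystem_def)
 have "W \<noteq> {}" using weyl_group.weyl_id by blast
 then have "Max ((\<lambda>g. g x \<bullet> \<beta>) ` W) \<in> (\<lambda>g. g x \<bullet> \<beta>) ` W"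
  using finite_weyl_group by (intro Max_in) auto
 then obtain g where g0: "g \<in> W" "Max ((\<lambda>g. g x \<bullet> \<beta>) ` W) = g x \<bullet> \<beta>" by auto
 have g: "g \<in> W" "h x \<bullet> \<beta> \<le> g x \<bullet> \<beta>" if "h \<in> W" for h
  using g0 that finite_weyl_group by (auto simp flip: g0(2) intro: Max_ge)
 have "g x \<bullet> \<alpha> \<ge> 0" if \<alpha>: "\<alpha> \<in> Rp" for \<alpha>
 proof -
  have \<alpha>R: "\<alpha> \<in> R" "\<alpha> \<bullet> \<beta> > 0" "\<alpha> \<bullet> \<alpha> > 0" using \<alpha> \<beta> zero_notin_R by auto
  have "(reflection \<alpha> \<circ> g) x \<bullet> \<beta> \<le> g x \<bullet> \<beta>" by (intro g(2) weyl_group.weyl_refl \<alpha>R g0(1))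
  then have "0 \<le> 2 * (g x \<bullet> \<alpha>) / (\<alpha> \<bullet> \<alpha>) * (\<alpha> \<bullet> \<beta>)" by (simp add: reflection_def inner_diff_left)
  then show ?thesis using \<alpha>R by (simp add: zero_le_mult_iff zero_le_divide_iff)
 qed
 then show ?thesis using g0(1) by (auto simp: weyl_chamber_def)
qed

end

section \<open>An energy estimate for Euler-type systems\<close>

text \<open>Multiplied by \<open>s\<close>, the derivative of \<open>\<Sum>g. \<bar>H g s\<bar>\<^sup>2\<close> contains the reflection terms
 \<open>- \<Sum>g. 2 k \<alpha> Re (cnj (H g) (H g - H (\<tau> \<alpha> g)))\<close>. As \<open>\<tau> \<alpha>\<close> is an involution of the index set, they are
 \<open>- k \<alpha> \<Sum>g. \<bar>H g - H (\<tau> \<alpha> g)\<bar>\<^sup>2 \<le> 0\<close> and can be dropped. This removes the singularity at \<open>s = 0\<close>, and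
 Gronwall's argument applies.\<close>

lemma energy_estimate:
 fixes H H' b e :: "'i \<Rightarrow> real \<Rightarrow> complex" and k :: "'r \<Rightarrow> real"
 assumes I: "finite I" and A: "finite A" "\<And>\<alpha>. \<alpha> \<in> A \<Longrightarrow> k \<alpha> \<ge> 0"
  and \<tau>: "\<And>\<alpha> g. \<alpha> \<in> A \<Longrightarrow> g \<in> I \<Longrightarrow> \<tau> \<alpha> g \<in> I" "\<And>\<alpha> g. \<alpha> \<in> A \<Longrightarrow> g \<in> I \<Longrightarrow> \<tau> \<alpha> (\<tau> \<alpha> g) = g"
  and cont: "\<And>g. g \<in> I \<Longrightarrow> continuous_on {0..1} (H g)"
  and deriv: "\<And>g s. g \<in> I \<Longrightarrow> 0 < s \<Longrightarrow> s < 1 \<Longrightarrow> (H g has_vector_derivative H' g s) (at s)"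
  and eq: "\<And>g s. g \<in> I \<Longrightarrow> 0 < s \<Longrightarrow> s < 1 \<Longrightarrow>
   of_real s * H' g s = of_real s * b g s * H g s
    - (\<Sum>\<alpha>\<in>A. of_real (k \<alpha>) * (H g s - H (\<tau> \<alpha> g) s)) + of_real s * e g s"
  and b: "\<And>g s. g \<in> I \<Longrightarrow> 0 < s \<Longrightarrow> s < 1 \<Longrightarrow> norm (b g s) \<le> L"
  and e: "\<And>g s. g \<in> I \<Longrightarrow> 0 < s \<Longrightarrow> s < 1 \<Longrightarrow> norm (e g s) \<le> \<epsilon>"
  and L: "L \<ge> 0" and s: "0 \<le> s" "s \<le> 1"
 shows "(\<Sum>g\<in>I. (norm (H g s))\<^sup>2) \<le> exp (2 * L + 1) * ((\<Sum>g\<in>I. (norm (H g 0))\<^sup>2) + real (card I) * \<epsilon>\<^sup>2)"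
proof -
 define N where "N s = (\<Sum>g\<in>I. (norm (H g s))\<^sup>2)" for s
 define N' where "N' s = (\<Sum>g\<in>I. 2 * Re (cnj (H g s) * H' g s))" for s
 have N0: "N s \<ge> 0" for s by (simp add: N_def sum_nonneg)
 have dN: "(N has_real_derivative N' s) (at s)" if s: "0 < s" "s < 1" for s
 proof -
  have "((\<lambda>s. (norm (H g s))\<^sup>2) has_real_derivative 2 * Re (cnj (H g s) * H' g s)) (at s)" if "g \<in> I" for g
  proof -
   have d: "(H g has_vector_derivative H' g s) (at s)" by (rule deriv[OF that s])
   have "((\<lambda>s. Re (H g s)) has_vector_derivative Re (H' g s)) (at s)"
    "((\<lambda>s. Im (H g s)) has_vector_derivative Im (H' g s)) (at s)"
    using bounded_linear.has_vector_derivative[OF bounded_linear_Re d]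
     bounded_linear.has_vector_derivative[OF bounded_linear_Im d] by simp_all
   then have 1: "((\<lambda>s. Re (H g s)) has_real_derivative Re (H' g s)) (at s)"
    "((\<lambda>s. Im (H g s)) has_real_derivative Im (H' g s)) (at s)"
    unfolding has_real_derivative_iff_has_vector_derivative .
   have "((\<lambda>s. (Re (H g s))\<^sup>2 + (Im (H g s))\<^sup>2) has_real_derivative
     2 * Re (H g s) * Re (H' g s) + 2 * Im (H g s) * Im (H' g s)) (at s)"
    by (rule DERIV_cong[OF DERIV_add[OF DERIV_power[OF 1(1), of 2] DERIV_power[OF 1(2), of 2]]]) simp
   then show ?thesis by (simp add: cmod_power2 algebra_simps)
  qed
  then show ?thesis unfolding N_def[abs_def] N'_def by (intro DERIV_sum)
 qed
 have N'_le: "N' s \<le> (2 * L + 1) * N s + real (card I) * \<epsilon>\<^sup>2" if s: "0 < s" "s < 1" for s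
 proof -
  have sym: "(\<Sum>g\<in>I. (norm (H (\<tau> \<alpha> g) s))\<^sup>2) = N s" if "\<alpha> \<in> A" for \<alpha>
   unfolding N_def by (rule sum.reindex_bij_witness[where i="\<tau> \<alpha>" and j="\<tau> \<alpha>"]) (use \<tau> that in auto)
  have dissip: "(\<Sum>g\<in>I. Re (cnj (H g s) * (H g s - H (\<tau> \<alpha> g) s))) \<ge> 0" if "\<alpha> \<in> A" for \<alpha>
  proof -
   have "(norm u)\<^sup>2 / 2 - (norm v)\<^sup>2 / 2 \<le> Re (cnj u * (u - v))" for u v :: complex
   proof -
    have "0 \<le> (Re u - Re v)\<^sup>2 + (Im u - Im v)\<^sup>2" by simp
    then have "Re u * Re v + Im u * Im v \<le> (Re u)\<^sup>2 / 2 + (Im u)\<^sup>2 / 2 + (Re v)\<^sup>2 / 2 + (Im v)\<^sup>2 / 2"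
     by (simp add: power2_eq_square algebra_simps)
    then show ?thesis unfolding cmod_power2 by (simp add: algebra_simps add_divide_distrib) (simp add: power2_eq_square)
   qed
   then have "(\<Sum>g\<in>I. (norm (H g s))\<^sup>2 / 2 - (norm (H (\<tau> \<alpha> g) s))\<^sup>2 / 2)
    \<le> (\<Sum>g\<in>I. Re (cnj (H g s) * (H g s - H (\<tau> \<alpha> g) s)))" by (intro sum_mono)
   then show ?thesis using sym[OF that]
    by (simp add: sum_subtractf N_def flip: sum_divide_distrib)
  qed
  have R: "Re (of_real r * z) = r * Re z" for r z by simp
  have "s * N' s = (\<Sum>g\<in>I. 2 * Re (cnj (H g s) * (of_real s * H' g s)))"
   unfolding N'_def sum_distrib_left by (intro sum.cong) (simp_all add: algebra_simps)
  also have "\<dots> = (\<Sum>g\<in>I. s * (2 * Re (cnj (H g s) * b g s * H g s)) + s * (2 * Re (cnj (H g s) * e g s))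
    - 2 * (\<Sum>\<alpha>\<in>A. k \<alpha> * Re (cnj (H g s) * (H g s - H (\<tau> \<alpha> g) s))))"
  proof (intro sum.cong refl)
   fix g assume g: "g \<in> I"
   have "cnj (H g s) * (of_real s * H' g s) = of_real s * (cnj (H g s) * b g s * H g s) + of_real s * (cnj (H g s) * e g s)
     - (\<Sum>\<alpha>\<in>A. of_real (k \<alpha>) * (cnj (H g s) * (H g s - H (\<tau> \<alpha> g) s)))"
    unfolding eq[OF g s] by (simp add: algebra_simps sum_distrib_left sum_subtractf)
   then have "Re (cnj (H g s) * (of_real s * H' g s)) = s * Re (cnj (H g s) * b g s * H g s) + s * Re (cnj (H g s) * e g s)
     - (\<Sum>\<alpha>\<in>A. k \<alpha> * Re (cnj (H g s) * (H g s - H (\<tau> \<alpha> g) s)))"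
    by (simp only: plus_complex.simps minus_complex.simps Re_sum R)
   then show "2 * Re (cnj (H g s) * (of_real s * H' g s)) = s * (2 * Re (cnj (H g s) * b g s * H g s)) + s * (2 * Re (cnj (H g s) * e g s))
    - 2 * (\<Sum>\<alpha>\<in>A. k \<alpha> * Re (cnj (H g s) * (H g s - H (\<tau> \<alpha> g) s)))" by (simp only:) (simp add: algebra_simps)
  qed
  also have "\<dots> = s * (\<Sum>g\<in>I. 2 * Re (cnj (H g s) * b g s * H g s) + 2 * Re (cnj (H g s) * e g s))
    - 2 * (\<Sum>\<alpha>\<in>A. k \<alpha> * (\<Sum>g\<in>I. Re (cnj (H g s) * (H g s - H (\<tau> \<alpha> g) s))))"
  proof -
   have "(\<Sum>g\<in>I. s * a g + s * b g - 2 * (\<Sum>\<alpha>\<in>A. k \<alpha> * c \<alpha> g))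
    = s * (\<Sum>g\<in>I. a g + b g) - 2 * (\<Sum>\<alpha>\<in>A. k \<alpha> * (\<Sum>g\<in>I. c \<alpha> g))" for a b :: "'i \<Rightarrow> real" and c
    by (simp add: sum.distrib sum_subtractf sum_distrib_left distrib_left sum.swap[of _ A I])
   then show ?thesis .
  qed
  also have "\<dots> \<le> s * (\<Sum>g\<in>I. 2 * Re (cnj (H g s) * b g s * H g s) + 2 * Re (cnj (H g s) * e g s))"
  proof -
   have "0 \<le> (\<Sum>\<alpha>\<in>A. k \<alpha> * (\<Sum>g\<in>I. Re (cnj (H g s) * (H g s - H (\<tau> \<alpha> g) s))))"
    by (intro sum_nonneg mult_nonneg_nonneg A(2) dissip)
   then show ?thesis by simp
  qed
  also have "\<dots> \<le> s * (\<Sum>g\<in>I. (2 * L + 1) * (norm (H g s))\<^sup>2 + \<epsilon>\<^sup>2)"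
  proof (intro mult_left_mono sum_mono)
   fix g assume g: "g \<in> I"
   have 1: "Re (cnj (H g s) * b g s * H g s) \<le> L * (norm (H g s))\<^sup>2"
   proof -
    have "Re (cnj (H g s) * b g s * H g s) \<le> norm (cnj (H g s) * b g s * H g s)" by (rule complex_Re_le_cmod)
    also have "\<dots> = norm (b g s) * (norm (H g s))\<^sup>2" by (simp add: norm_mult power2_eq_square)
    also have "\<dots> \<le> L * (norm (H g s))\<^sup>2" using b[OF g s] by (intro mult_right_mono) auto
    finally show ?thesis .
   qed
   have 2: "2 * Re (cnj (H g s) * e g s) \<le> (norm (H g s))\<^sup>2 + \<epsilon>\<^sup>2"
   proof -
    have "Re (cnj (H g s) * e g s) \<le> norm (cnj (H g s) * e g s)" by (rule complex_Re_le_cmod)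
    also have "\<dots> \<le> norm (H g s) * \<epsilon>" using e[OF g s] by (simp add: norm_mult mult_left_mono)
    finally have "2 * Re (cnj (H g s) * e g s) \<le> 2 * (norm (H g s) * \<epsilon>)" by simp
    also have "\<dots> \<le> (norm (H g s))\<^sup>2 + \<epsilon>\<^sup>2" using sum_squares_bound[of "norm (H g s)" \<epsilon>] by simp
    finally show ?thesis .
   qed
   show "2 * Re (cnj (H g s) * b g s * H g s) + 2 * Re (cnj (H g s) * e g s) \<le> (2 * L + 1) * (norm (H g s))\<^sup>2 + \<epsilon>\<^sup>2"
    using 1 2 by (simp add: algebra_simps)
  qed (use s in auto)
  also have "\<dots> = s * ((2 * L + 1) * N s + real (card I) * \<epsilon>\<^sup>2)"
   by (simp add: sum.distrib N_def sum_distrib_left)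
  finally show ?thesis using s by simp
 qed
 define \<phi> where "\<phi> s = exp (- ((2 * L + 1) * s)) * N s - real (card I) * \<epsilon>\<^sup>2 * s" for s
 have "\<phi> s \<le> \<phi> 0"
 proof (cases "s = 0")
  case False
  show ?thesis
  proof (rule DERIV_nonpos_imp_decreasing_open[of 0 s])
   fix x assume x: "0 < x" "x < s"
   then have x': "0 < x" "x < 1" using s by auto
   let ?E = "exp (- ((2 * L + 1) * x))"
   have "(\<phi> has_real_derivative ?E * N' x - (2 * L + 1) * ?E * N x - real (card I) * \<epsilon>\<^sup>2) (at x)"
    unfolding \<phi>_def[abs_def] by (auto intro!: derivative_eq_intros dN[OF x'] simp: algebra_simps)
   moreover have "?E * N' x \<le> ?E * ((2 * L + 1) * N x + real (card I) * \<epsilon>\<^sup>2)"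
    using N'_le[OF x'] by (intro mult_left_mono) auto
   moreover have "?E * (real (card I) * \<epsilon>\<^sup>2) \<le> 1 * (real (card I) * \<epsilon>\<^sup>2)"
    using L x by (intro mult_right_mono) auto
   ultimately show "\<exists>y. (\<phi> has_real_derivative y) (at x) \<and> y \<le> 0"
    by (intro exI conjI) (auto simp: algebra_simps)
  next
   have "continuous_on {0..1} N" unfolding N_def[abs_def] by (intro continuous_intros cont)
   then have "continuous_on {0..s} N" by (rule continuous_on_subset) (use s in auto)
   then show "continuous_on {0..s} \<phi>" unfolding \<phi>_def[abs_def] by (intro continuous_intros)
  qed (use s False in simp)
 qed simp
 then have "exp (- ((2 * L + 1) * s)) * N s \<le> N 0 + real (card I) * \<epsilon>\<^sup>2 * s" by (simp add: \<phi>_def)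
 also have "\<dots> \<le> N 0 + real (card I) * \<epsilon>\<^sup>2" using s by (simp add: mult_left_le)
 finally have *: "exp (- ((2 * L + 1) * s)) * N s \<le> N 0 + real (card I) * \<epsilon>\<^sup>2" .
 have "N s = exp ((2 * L + 1) * s) * (exp (- ((2 * L + 1) * s)) * N s)"
  by (simp add: mult_exp_exp flip: mult.assoc)
 also have "\<dots> \<le> exp ((2 * L + 1) * s) * (N 0 + real (card I) * \<epsilon>\<^sup>2)"
  by (intro mult_left_mono *) simp
 also have "\<dots> \<le> exp (2 * L + 1) * (N 0 + real (card I) * \<epsilon>\<^sup>2)"
  using L s N0[of 0] by (intro mult_right_mono) (auto intro: mult_left_le add_nonneg_nonneg)
 finally show ?thesis by (simp add: N_def)
qed

section \<open>Joint eigenfunctions of the Dunkl operators\<close>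

abbreviation der :: "(complex ^ 'n \<Rightarrow> complex) \<Rightarrow> complex ^ 'n \<Rightarrow> complex ^ 'n \<Rightarrow> complex" where
 "der f z \<equiv> frechet_derivative f (at z)"

lemma entire_has_derivative:
 assumes "entire_on_Cn f"
 shows "(f has_derivative der f z) (at z)"
  and "der f z (c *s v) = c * der f z v"
proof -
 obtain D where D: "(f has_derivative D) (at z)" "\<And>c v. D (c *s v) = c * D v"
  using assms unfolding entire_on_Cn_def by blast
 have "D = der f z" by (rule frechet_derivative_at[OF D(1)])
 with D show "(f has_derivative der f z) (at z)"
  "der f z (c *s v) = c * der f z v" by simp_all
qed

lemma entire_linear:
 assumes "entire_on_Cn f"
 shows "der f z (u + v) = der f z u + der f z v"
  "der f z (- v) = - der f z v"
  "der f z 0 = 0"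
 using has_derivative_linear[OF entire_has_derivative(1)[OF assms]]
 by (auto simp: linear_add linear_neg linear_0)

lemma entire_continuous: "entire_on_Cn f \<Longrightarrow> continuous_on S f"
 by (meson continuous_at_imp_continuous_on entire_has_derivative(1) has_derivative_continuous)

lemma entire_diff:
 assumes f: "entire_on_Cn f" and g: "entire_on_Cn g"
 shows "entire_on_Cn (\<lambda>z. f z - g z)"
  and "der (\<lambda>z. f z - g z) z v = der f z v - der g z v"
proof -
 have d: "((\<lambda>z. f z - g z) has_derivative (\<lambda>v. der f z v - der g z v)) (at z)" for z
  by (intro has_derivative_diff entire_has_derivative f g)
 show "entire_on_Cn (\<lambda>z. f z - g z)"
  unfolding entire_on_Cn_def
  using d entire_has_derivative(2)[OF f] entire_has_derivative(2)[OF g]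
  by (intro allI exI conjI, assumption?) (auto simp: right_diff_distrib)
 show "der (\<lambda>z. f z - g z) z v = der f z v - der g z v"
  using frechet_derivative_at[OF d] by metis
qed

lemma entire_compose_linear:
 assumes f: "entire_on_Cn f" and L: "bounded_linear L" "\<And>c v. L (c *s v) = c *s L v"
 shows "entire_on_Cn (\<lambda>z. f (L z))"
  and "der (\<lambda>z. f (L z)) z v = der f (L z) (L v)"
proof -
 have d: "((\<lambda>z. f (L z)) has_derivative (\<lambda>v. der f (L z) (L v))) (at z)" for z
  by (rule has_derivative_compose[OF bounded_linear_imp_has_derivative[OF L(1)] entire_has_derivative(1)[OF f]])
 show "entire_on_Cn (\<lambda>z. f (L z))"
  unfolding entire_on_Cn_def
  by (intro allI exI conjI, rule d) (simp add: L(2) entire_has_derivative(2)[OF f])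
 show "der (\<lambda>z. f (L z)) z v = der f (L z) (L v)"
  using frechet_derivative_at[OF d] by metis
qed

lemma bounded_linear_smult: "bounded_linear (\<lambda>z :: complex ^ 'n. c *s z)"
 by (rule bounded_linear_intro[of _ "norm c"])
   (simp_all add: vector_add_ldistrib norm_vec_smult scaleR_eq_smult vector_smult_assoc mult.commute)

lemma entire_holomorphic_line:
 assumes f: "entire_on_Cn f"
 shows "((\<lambda>\<zeta>. f (z + \<zeta> *s u)) has_field_derivative der f (z + \<zeta> *s u) u) (at \<zeta>)"
proof -
 have 1: "((\<lambda>\<zeta>. z + \<zeta> *s u) has_derivative (\<lambda>h. h *s u)) (at \<zeta>)"
 proof -
  have "bounded_linear (\<lambda>h. h *s u)"
   by (rule bounded_linear_intro[of _ "norm u"])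
     (simp_all add: vector_sadd_rdistrib norm_vec_smult scaleR_eq_smult vector_smult_assoc scaleR_conv_of_real)
  from has_derivative_add[OF has_derivative_const[of z] bounded_linear_imp_has_derivative[OF this]]
  show ?thesis by simp
 qed
 show ?thesis
  unfolding has_field_derivative_def
  by (rule has_derivative_eq_rhs[OF has_derivative_compose[OF 1 entire_has_derivative(1)[OF f]]])
    (simp add: entire_has_derivative(2)[OF f] fun_eq_iff)
qed

text \<open>Cauchy's inequality on the complex line through \<open>z\<close> in the direction \<open>v\<close>.\<close>

lemma entire_derivative_bound:
 assumes f: "entire_on_Cn f" and B: "\<And>y. norm y \<le> norm z + 1 \<Longrightarrow> norm (f y) \<le> B"
 shows "norm (der f z v) \<le> B * norm v"
proof (cases "v = 0")
 case False
 define u where "u = complex_of_real (1 / norm v) *s v"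
 have u: "norm u = 1" using False by (simp add: u_def norm_vec_smult norm_divide)
 have v: "v = complex_of_real (norm v) *s u" using False by (simp add: u_def vector_smult_assoc)
 define \<phi> where "\<phi> \<zeta> = f (z + \<zeta> *s u)" for \<zeta>
 have d: "(\<phi> has_field_derivative der f (z + \<zeta> *s u) u) (at \<zeta>)" for \<zeta>
  unfolding \<phi>_def[abs_def] by (rule entire_holomorphic_line[OF f])
 have hol: "\<phi> holomorphic_on S" for S
  using d by (meson field_differentiable_at_within field_differentiable_def holomorphic_on_def)
 have "norm ((deriv ^^ 1) \<phi> 0) \<le> fact 1 * B / 1 ^ 1"
 proof (rule Cauchy_inequality[OF hol holomorphic_on_imp_continuous_on[OF hol] zero_less_one])
  fix x :: complex assume "norm (0 - x) = 1"
  then have "norm (z + x *s u) \<le> norm z + 1"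
   using norm_triangle_ineq[of z "x *s u"] u by (simp add: norm_vec_smult)
  then show "norm (\<phi> x) \<le> B" unfolding \<phi>_def by (rule B)
 qed
 then have "norm (der f z u) \<le> B"
  using DERIV_imp_deriv[OF d[of 0]] by simp
 then have "norm v * norm (der f z u) \<le> norm v * B" by (intro mult_left_mono) auto
 moreover have "der f z v = complex_of_real (norm v) * der f z u"
  by (subst v) (rule entire_has_derivative(2)[OF f])
 ultimately show ?thesis by (simp add: norm_mult mult.commute)
next
 case True
 then show ?thesis by (simp add: entire_linear(3)[OF f])
qed

definition dunkl_quotient :: "(complex ^ 'n \<Rightarrow> complex) \<Rightarrow> complex ^ 'n \<Rightarrow> real ^ 'n \<Rightarrow> complex" where
 "dunkl_quotient f z \<alpha> = (if cbilin (cvec \<alpha>) z = 0 then complex_of_real (2 / (\<alpha> \<bullet> \<alpha>)) * der f z (cvec \<alpha>)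
   else (f z - f (complexify (reflection \<alpha>) z)) / cbilin (cvec \<alpha>) z)"

lemma dunkl_operator_eq: "dunkl_operator Rp k \<xi> f z = der f z \<xi>
  + (\<Sum>\<alpha>\<in>Rp. complex_of_real (k \<alpha>) * cbilin (cvec \<alpha>) \<xi> * dunkl_quotient f z \<alpha>)"
 by (simp add: dunkl_operator_def dunkl_quotient_def)

context dunkl_setting
begin

definition eigen :: "complex ^ 'n \<Rightarrow> (complex ^ 'n \<Rightarrow> complex) \<Rightarrow> bool" where
 "eigen w f \<longleftrightarrow> entire_on_Cn f \<and> (\<forall>\<xi> x. dunkl_operator Rp k \<xi> f x = cbilin \<xi> w * f x) \<and> f 0 = 1"

text \<open>In the radial direction the factors \<open>\<langle>\<alpha>, z\<rangle>\<close> cancel, also where they vanish.\<close>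

lemma dunkl_operator_euler:
 assumes f: "entire_on_Cn f"
 shows "dunkl_operator Rp k z f z = der f z z
  + (\<Sum>\<alpha>\<in>Rp. of_real (k \<alpha>) * (f z - f (complexify (reflection \<alpha>) z)))"
 unfolding dunkl_operator_def by (auto intro!: sum.cong simp: complexify_reflection)

lemma dunkl_operator_diff:
 assumes f: "entire_on_Cn f" and g: "entire_on_Cn g"
 shows "dunkl_operator Rp k \<xi> (\<lambda>z. f z - g z) x = dunkl_operator Rp k \<xi> f x - dunkl_operator Rp k \<xi> g x"
proof -
 have "dunkl_quotient (\<lambda>z. f z - g z) x \<alpha> = dunkl_quotient f x \<alpha> - dunkl_quotient g x \<alpha>" for \<alpha>
  unfolding dunkl_quotient_def entire_diff(2)[OF f g]
  by (cases "cbilin (cvec \<alpha>) x = 0") (simp_all add: right_diff_distrib flip: diff_divide_distrib)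
 then show ?thesis
  unfolding dunkl_operator_eq entire_diff(2)[OF f g] by (simp add: right_diff_distrib sum_subtractf)
qed

text \<open>Along the rays \<open>s \<mapsto> s g z\<close> the eigenvalue equation becomes a system as in \<open>energy_estimate\<close>. The term
 with \<open>h\<close> allows to compare eigenfunctions for different spectral parameters.\<close>

lemma perturbed_eigen_bound:
 assumes f: "entire_on_Cn f"
  and eq: "\<And>\<xi> x. dunkl_operator Rp k \<xi> f x = cbilin \<xi> w * f x + cbilin \<xi> u * h x"
  and B: "\<And>y. norm y \<le> norm z \<Longrightarrow> norm (h y) \<le> B"
 shows "(norm (f z))\<^sup>2 \<le> exp (2 * (norm z * norm w) + 1) * (real (card W) * ((norm (f 0))\<^sup>2 + (norm z * norm u * B)\<^sup>2))"
proof -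
 define P where "P g s = s *\<^sub>R complexify g z" for g s
 define D where "D g s = der f (P g s) (complexify g z)" for g s
 have nz: "norm (complexify g z) = norm z" if "g \<in> W" for g
  by (intro norm_complexify weyl_group_norm[OF that])
 have B0: "B \<ge> 0" using B[of z] norm_ge_zero order_trans by blast
 have deriv: "((\<lambda>s. f (P g s)) has_vector_derivative D g s) (at s)" for g s
 proof -
  have "(P g has_vector_derivative complexify g z) (at s)"
   unfolding P_def[abs_def] by (auto intro!: derivative_eq_intros)
  from vector_derivative_diff_chain_within[OF this has_derivative_at_withinI[OF entire_has_derivative(1)[OF f]]]
  show ?thesis by (simp add: o_def D_def)
 qed
 have "(\<Sum>g\<in>W. (norm (f (P g 1)))\<^sup>2)
  \<le> exp (2 * (norm z * norm w) + 1) * ((\<Sum>g\<in>W. (norm (f (P g 0)))\<^sup>2) + real (card W) * (norm z * norm u * B)\<^sup>2)"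
 proof (rule energy_estimate[where A=Rp and k=k and \<tau>="\<lambda>\<alpha> g. reflection \<alpha> \<circ> g" and H'=D
    and b="\<lambda>g s. cbilin (complexify g z) w" and e="\<lambda>g s. cbilin (complexify g z) u * h (P g s)"])
  show "continuous_on {0..1} (\<lambda>s. f (P g s))" for g
   using deriv by (meson continuous_at_imp_continuous_on has_vector_derivative_continuous)
  show "((\<lambda>s. f (P g s)) has_vector_derivative D g s) (at s)" for g s by (rule deriv)
  show "norm (cbilin (complexify g z) w) \<le> norm z * norm w" if "g \<in> W" for g
   using norm_cbilin_le[of "complexify g z" w] nz[OF that] by simp
  show "norm (cbilin (complexify g z) u * h (P g s)) \<le> norm z * norm u * B" if "g \<in> W" "0 < s" "s < 1" for g s
  proof -
   have "norm (P g s) \<le> norm z" using that nz[OF that(1)] by (simp add: P_def mult_left_le_one_le)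
   then show ?thesis
    using norm_cbilin_le[of "complexify g z" u] nz[OF that(1)] B0
    by (auto simp: norm_mult intro!: mult_mono B)
  qed
  show "of_real s * D g s = of_real s * cbilin (complexify g z) w * f (P g s)
    - (\<Sum>\<alpha>\<in>Rp. of_real (k \<alpha>) * (f (P g s) - f (P (reflection \<alpha> \<circ> g) s)))
    + of_real s * (cbilin (complexify g z) u * h (P g s))" if g: "g \<in> W" for g s
  proof -
   have refl: "complexify (reflection \<alpha>) (P g s) = P (reflection \<alpha> \<circ> g) s" for \<alpha>
    by (simp add: P_def scaleR_eq_smult complexify_smult[OF linear_reflection]
      complexify_compose[OF linear_reflection weyl_group_linear[OF g]])
   have "of_real s * D g s = der f (P g s) (P g s)"
    unfolding D_def by (simp add: P_def[of g s] scaleR_eq_smult entire_has_derivative(2)[OF f])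
   also have "\<dots> = dunkl_operator Rp k (P g s) f (P g s) - (\<Sum>\<alpha>\<in>Rp. of_real (k \<alpha>) * (f (P g s) - f (P (reflection \<alpha> \<circ> g) s)))"
    using dunkl_operator_euler[OF f, of "P g s"] by (simp add: refl)
   finally show ?thesis unfolding eq by (simp add: P_def scaleR_eq_smult algebra_simps)
  qed
 qed (auto simp: finite_weyl_group finite_Rp k_nonneg subsetD[OF Rp_subset] fun_eq_iff intro: weyl_group.weyl_refl)
 moreover have "(norm (f z))\<^sup>2 \<le> (\<Sum>g\<in>W. (norm (f (P g 1)))\<^sup>2)"
  using member_le_sum[OF weyl_group.weyl_id _ finite_weyl_group, of "\<lambda>g. (norm (f (P g 1)))\<^sup>2"]
  by (simp add: P_def)
 ultimately show ?thesis by (simp add: P_def distrib_left)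
qed

lemma eigen_unique:
 assumes "eigen w f" "eigen w g"
 shows "f = g"
proof
 fix z
 have e: "entire_on_Cn f" "entire_on_Cn g" using assms by (auto simp: eigen_def)
 have "(norm (f z - g z))\<^sup>2 \<le> exp (2 * (norm z * norm w) + 1) * (real (card W) * ((norm (f 0 - g 0))\<^sup>2 + (norm z * norm (0 :: complex ^ 'n) * 0)\<^sup>2))"
 proof (rule perturbed_eigen_bound[where h="\<lambda>_. 0" and f="\<lambda>z. f z - g z"])
  show "dunkl_operator Rp k \<xi> (\<lambda>z. f z - g z) x = cbilin \<xi> w * (f x - g x) + cbilin \<xi> 0 * 0" for \<xi> x
   using assms by (simp add: dunkl_operator_diff[OF e] eigen_def right_diff_distrib)
 qed (use entire_diff(1)[OF e] in auto)
 then show "f z = g z" using assms by (simp add: eigen_def)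
qed

lemma eigen_growth:
 assumes f: "eigen w f"
 shows "norm (f z) \<le> sqrt (real (card W)) * exp (norm z * norm w + 1 / 2)"
proof -
 have "(norm (f z))\<^sup>2 \<le> exp (2 * (norm z * norm w) + 1) * (real (card W) * ((norm (f 0))\<^sup>2 + (norm z * norm (0 :: complex ^ 'n) * 0)\<^sup>2))"
  by (rule perturbed_eigen_bound[where h="\<lambda>_. 0"]) (use f in \<open>auto simp: eigen_def\<close>)
 also have "\<dots> = (sqrt (real (card W)) * exp (norm z * norm w + 1 / 2))\<^sup>2"
  using f by (simp add: eigen_def power_mult_distrib exp_double[symmetric] algebra_simps)
 finally show ?thesis by (rule power2_le_imp_le) simp
qed

lemma eigen_scale:
 assumes f: "eigen w f" and c: "c \<noteq> 0"
 shows "eigen (c *s w) (\<lambda>z. f (c *s z))"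
proof -
 have e: "entire_on_Cn f" using f by (simp add: eigen_def)
 have L: "\<And>d v. c *s (d *s v) = d *s (c *s v)" for v :: "complex ^ 'n" by (simp add: vector_smult_assoc mult.commute)
 note ec = entire_compose_linear[OF e bounded_linear_smult L]
 have "dunkl_operator Rp k \<xi> (\<lambda>z. f (c *s z)) x = c * dunkl_operator Rp k \<xi> f (c *s x)" for \<xi> x
  unfolding dunkl_operator_def ec(2)
  using c by (auto simp: entire_has_derivative(2)[OF e] complexify_smult[OF linear_reflection] sum_distrib_left
    algebra_simps diff_divide_distrib intro!: sum.cong)
 then show ?thesis using f ec(1) by (simp add: eigen_def)
qed

lemma eigen_reflection:
 assumes f: "eigen w f" and \<beta>: "\<beta> \<in> R"
 shows "eigen (complexify (reflection \<beta>) w) (\<lambda>z. f (complexify (reflection \<beta>) z))"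
proof -
 let ?\<sigma> = "complexify (reflection \<beta>)"
 have e: "entire_on_Cn f" using f by (simp add: eigen_def)
 note ec = entire_compose_linear[OF e bounded_linear_complexify[OF linear_reflection norm_reflection]
   complexify_smult[OF linear_reflection], of \<beta>]
 have "dunkl_operator Rp k \<xi> (\<lambda>z. f (?\<sigma> z)) x = dunkl_operator Rp k (?\<sigma> \<xi>) f (?\<sigma> x)" for \<xi> x
 proof -
  define G where "G \<alpha> = complex_of_real (k \<alpha>) * cbilin (cvec \<alpha>) (?\<sigma> \<xi>) * dunkl_quotient f (?\<sigma> x) \<alpha>" for \<alpha>
  have G_minus: "G (- \<alpha>) = G \<alpha>" if "\<alpha> \<in> R" for \<alpha>
   using that by (simp add: G_def dunkl_quotient_def k_uminus reflection_minus entire_linear(2)[OF e])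
  have G_refl: "complex_of_real (k \<alpha>) * cbilin (cvec \<alpha>) \<xi> * dunkl_quotient (\<lambda>z. f (?\<sigma> z)) x \<alpha> = G (reflection \<beta> \<alpha>)"
   if "\<alpha> \<in> Rp" for \<alpha>
  proof -
   have c: "cvec (reflection \<beta> \<alpha>) = ?\<sigma> (cvec \<alpha>)" by (simp add: complexify_cvec[OF linear_reflection])
   have b: "cbilin (?\<sigma> (cvec \<alpha>)) (?\<sigma> y) = cbilin (cvec \<alpha>) y" for y by (simp add: cbilin_complexify_reflection)
   have i: "reflection \<beta> \<alpha> \<bullet> reflection \<beta> \<alpha> = \<alpha> \<bullet> \<alpha>" by (simp add: reflection_inner)
   have r: "?\<sigma> (complexify (reflection \<alpha>) x) = complexify (reflection (reflection \<beta> \<alpha>)) (?\<sigma> x)"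
    unfolding complexify_compose[OF linear_reflection linear_reflection, symmetric]
    by (intro arg_cong2[where f=complexify] refl) (simp add: fun_eq_iff reflection_image_root[of \<beta> \<alpha>])
   show ?thesis using that Rp_subset by (auto simp: G_def dunkl_quotient_def ec(2) c b i r k_reflection[OF \<beta>])
  qed
  show ?thesis
   unfolding dunkl_operator_eq ec(2) G_def[symmetric]
   by (simp add: G_refl sum_Rp_reflection[where F=G, OF \<beta> G_minus])
 qed
 moreover have "?\<sigma> 0 = 0" by (simp add: complexify_reflection)
 ultimately show ?thesis
  using f ec(1) by (simp add: eigen_def cbilin_complexify_reflection)
qed

lemma eigen_weyl:
 assumes f: "eigen w f" and g: "g \<in> W"
 shows "eigen (complexify g w) (\<lambda>z. f (complexify (inv g) z))"
 using g
proof induction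
 case weyl_id
 then show ?case using f by (simp add: inv_id)
next
 case (weyl_refl g \<alpha>)
 have "inv (reflection \<alpha> \<circ> g) = inv g \<circ> reflection \<alpha>"
  by (rule inv_unique_comp) (auto simp: fun_eq_iff weyl_group_inv[OF weyl_refl(1)])
 moreover have "linear (inv g)" using weyl_group_inv(1)[OF weyl_refl(1)] by (rule weyl_group_linear)
 ultimately show ?case
  using eigen_reflection[OF weyl_refl(3,2)]
  by (simp only: complexify_compose[OF linear_reflection weyl_group_linear[OF weyl_refl(1)]]
    complexify_compose[OF _ linear_reflection])
qed

lemma eigen_0: "eigen 0 (\<lambda>_. 1)"
proof -
 have d: "((\<lambda>_. 1 :: complex) has_derivative (\<lambda>_. 0)) (at z)" for z :: "complex ^ 'n" by simp
 have "der (\<lambda>_. 1 :: complex) z = (\<lambda>_. 0)" for z :: "complex ^ 'n"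
  by (rule frechet_derivative_at[OF d, symmetric])
 moreover have "entire_on_Cn (\<lambda>_ :: complex ^ 'n. 1)"
  unfolding entire_on_Cn_def by (intro allI exI[of _ "\<lambda>_. 0"]) simp
 ultimately show ?thesis by (simp add: eigen_def dunkl_operator_def cong: if_cong)
qed

text \<open>Solvability is a closed condition on the spectral parameter: by the energy estimate
 eigenfunctions for nearby parameters are close on bounded sets, and Cauchy estimates transfer this to the
 derivatives.\<close>

lemma eigen_limit:
 assumes w: "w \<longlonglongrightarrow> w'" and f: "\<And>n. eigen (w n) (f n)"
 shows "\<exists>f'. eigen w' f'"
proof -
 have e: "entire_on_Cn (f n)" for n using f by (simp add: eigen_def)
 obtain C where C: "\<And>n. norm (w n) \<le> C"
  using convergent_imp_Bseq[OF convergentI[OF w]] unfolding Bseq_def by blast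
 have C0: "C \<ge> 0" using C[of 0] norm_ge_zero order_trans by blast
 define B where "B \<rho> = sqrt (real (card W)) * exp (\<rho> * C + 1 / 2)" for \<rho>
 have B: "norm (f n z) \<le> B \<rho>" if "norm z \<le> \<rho>" for n z \<rho>
 proof -
  have "\<rho> \<ge> 0" using that norm_ge_zero order_trans by blast
  then have "norm z * norm (w n) \<le> \<rho> * C" using that C[of n] by (intro mult_mono) auto
  then have "sqrt (real (card W)) * exp (norm z * norm (w n) + 1 / 2) \<le> B \<rho>"
   unfolding B_def by (intro mult_left_mono) auto
  with eigen_growth[OF f[of n], of z] show ?thesis by linarith
 qed
 define A where "A \<rho> = sqrt (exp (2 * (\<rho> * C) + 1) * real (card W)) * (\<rho> * B \<rho>)" for \<rho>
 have B0: "B \<rho> \<ge> 0" for \<rho> by (simp add: B_def)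
 have diff: "norm (f n z - f m z) \<le> A \<rho> * norm (w n - w m)" if z: "norm z \<le> \<rho>" for n m z \<rho>
 proof -
  have \<rho>: "\<rho> \<ge> 0" using z norm_ge_zero order_trans by blast
  have "(norm (f n z - f m z))\<^sup>2 \<le> exp (2 * (norm z * norm (w n)) + 1)
    * (real (card W) * ((norm (f n 0 - f m 0))\<^sup>2 + (norm z * norm (w n - w m) * B \<rho>)\<^sup>2))"
  proof (rule perturbed_eigen_bound[where h="f m" and f="\<lambda>z. f n z - f m z"])
   show "dunkl_operator Rp k \<xi> (\<lambda>z. f n z - f m z) x = cbilin \<xi> (w n) * (f n x - f m x) + cbilin \<xi> (w n - w m) * f m x" for \<xi> x
    using f by (simp add: dunkl_operator_diff[OF e e] eigen_def algebra_simps)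
  qed (use entire_diff(1)[OF e e] z in \<open>auto intro: B\<close>)
  also have "\<dots> = exp (2 * (norm z * norm (w n)) + 1) * real (card W) * (norm z * norm (w n - w m) * B \<rho>)\<^sup>2"
   using f by (simp add: eigen_def)
  also have "\<dots> \<le> exp (2 * (\<rho> * C) + 1) * real (card W) * (\<rho> * norm (w n - w m) * B \<rho>)\<^sup>2"
  proof (intro mult_mono power_mono)
   have "norm z * norm (w n) \<le> \<rho> * C" using z C[of n] \<rho> by (intro mult_mono) auto
   then show "exp (2 * (norm z * norm (w n)) + 1) \<le> exp (2 * (\<rho> * C) + 1)" by simp
  qed (use z \<rho> B0[of \<rho>] in simp_all)
  also have "\<dots> = (A \<rho> * norm (w n - w m))\<^sup>2"
   by (simp add: A_def power_mult_distrib algebra_simps)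
  finally show ?thesis
   by (rule power2_le_imp_le) (use \<rho> B0[of \<rho>] in \<open>simp add: A_def\<close>)
 qed
 let ?D = "\<lambda>n z. der (f n) z"
 have Ddiff: "norm (?D n z v - ?D m z v) \<le> A (\<rho> + 1) * norm (w n - w m) * norm v" if z: "norm z \<le> \<rho>" for n m z \<rho> v
  unfolding entire_diff(2)[OF e e, symmetric]
  by (rule entire_derivative_bound[OF entire_diff(1)[OF e e]]) (use z in \<open>auto intro: diff\<close>)
 have Cauchy_from: "convergent a" if "\<And>n m. norm (a n - a m) \<le> K * norm (w n - w m)" for a :: "nat \<Rightarrow> complex" and K
 proof -
  have "Cauchy w" using w by (rule LIMSEQ_imp_Cauchy)
  show ?thesis
   unfolding Cauchy_convergent_iff[symmetric]
  proof (rule metric_CauchyI)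
   fix r :: real assume r: "r > 0"
   obtain N where N: "\<And>n m. n \<ge> N \<Longrightarrow> m \<ge> N \<Longrightarrow> dist (w n) (w m) < r / (\<bar>K\<bar> + 1)"
   proof -
    have "r / (\<bar>K\<bar> + 1) > 0" using r by simp
    from metric_CauchyD[OF \<open>Cauchy w\<close> this] show ?thesis using that by blast
   qed
   have "dist (a n) (a m) < r" if "n \<ge> N" "m \<ge> N" for n m
   proof -
    have "dist (a n) (a m) \<le> K * norm (w n - w m)" using \<open>\<And>n m. norm (a n - a m) \<le> _\<close> by (simp add: dist_norm)
    also have "\<dots> \<le> (\<bar>K\<bar> + 1) * norm (w n - w m)" by (intro mult_right_mono) auto
    also have "\<dots> < r" using N[OF that] by (simp add: dist_norm field_simps)
    finally show ?thesis .
   qed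
   then show "\<exists>N. \<forall>m\<ge>N. \<forall>n\<ge>N. dist (a m) (a n) < r" by blast
  qed
 qed
 define F where "F z = lim (\<lambda>n. f n z)" for z
 define G where "G z v = lim (\<lambda>n. ?D n z v)" for z v
 have F: "(\<lambda>n. f n z) \<longlonglongrightarrow> F z" for z
  unfolding F_def convergent_LIMSEQ_iff[symmetric] by (rule Cauchy_from[OF diff[OF order_refl]])
 have G: "(\<lambda>n. ?D n z v) \<longlonglongrightarrow> G z v" for z v
  unfolding G_def convergent_LIMSEQ_iff[symmetric]
  using Ddiff[OF order_refl, of _ z v] by (intro Cauchy_from[where K="A (norm z + 1) * norm v"]) (simp add: ac_simps)
 have G_bound: "norm (?D n z v - G z v) \<le> A (\<rho> + 1) * norm (w n - w') * norm v" if z: "norm z \<le> \<rho>" for n z v \<rho>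
 proof (rule LIMSEQ_le)
  show "(\<lambda>m. norm (?D n z v - ?D m z v)) \<longlonglongrightarrow> norm (?D n z v - G z v)" by (intro tendsto_intros G)
  show "(\<lambda>m. A (\<rho> + 1) * norm (w n - w m) * norm v) \<longlonglongrightarrow> A (\<rho> + 1) * norm (w n - w') * norm v"
   by (intro tendsto_intros w)
 qed (use Ddiff[OF z] in auto)
 have dF: "(F has_derivative G z) (at z)" for z
 proof -
  let ?S = "ball (0 :: complex ^ 'n) (norm z + 1)"
  have "\<exists>h. \<forall>x\<in>?S. (\<lambda>n. f n x) \<longlonglongrightarrow> h x \<and> (h has_derivative G x) (at x within ?S)"
  proof (rule has_derivative_sequence[OF convex_ball, where ?x0.0 = 0 and l = "F 0"])
   show "(f n has_derivative ?D n x) (at x within ?S)" for n x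
    by (rule has_derivative_at_withinI[OF entire_has_derivative(1)[OF e]])
   show "\<forall>\<^sub>F n in sequentially. \<forall>x\<in>?S. \<forall>h. norm (?D n x h - G x h) \<le> r * norm h" if r: "r > 0" for r
   proof -
    have "(\<lambda>n. A (norm z + 1 + 1) * norm (w n - w')) \<longlonglongrightarrow> A (norm z + 1 + 1) * norm (w' - w')"
     by (intro tendsto_intros w)
    then have "eventually (\<lambda>n. A (norm z + 1 + 1) * norm (w n - w') < r) sequentially"
     by (rule order_tendstoD(2)) (use r in simp)
    then show ?thesis
    proof eventually_elim
     case (elim n)
     show ?case
     proof (intro ballI allI)
      fix x h :: "complex ^ 'n" assume "x \<in> ?S"
      then have "norm (?D n x h - G x h) \<le> A (norm z + 1 + 1) * norm (w n - w') * norm h"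
       by (intro G_bound) auto
      also have "\<dots> \<le> r * norm h" using elim by (intro mult_right_mono) auto
      finally show "norm (?D n x h - G x h) \<le> r * norm h" .
     qed
    qed
   qed
   show "0 \<in> ?S" using norm_ge_zero[of z] by (simp add: add_nonneg_pos)
   show "(\<lambda>n. f n 0) \<longlonglongrightarrow> F 0" by (rule F)
  qed
  then obtain h where h: "\<And>x. x \<in> ?S \<Longrightarrow> (\<lambda>n. f n x) \<longlonglongrightarrow> h x" "\<And>x. x \<in> ?S \<Longrightarrow> (h has_derivative G x) (at x within ?S)"
   by blast
  have "h x = F x" if "x \<in> ?S" for x using LIMSEQ_unique[OF h(1)[OF that] F] .
  moreover have z: "z \<in> ?S" by simp
  ultimately have "(F has_derivative G z) (at z within ?S)"
   using has_derivative_transform[OF z _ h(2)[OF z], of F] by simp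
  then show ?thesis by (simp only: at_within_open[OF z open_ball])
 qed
 have GD: "der F z = G z" for z by (rule frechet_derivative_at[OF dF, symmetric])
 have "entire_on_Cn F"
  unfolding entire_on_Cn_def
 proof (intro allI exI conjI)
  fix z show "(F has_derivative G z) (at z)" by (rule dF)
  fix c v
  have "(\<lambda>n. ?D n z (c *s v)) \<longlonglongrightarrow> c * G z v"
   unfolding entire_has_derivative(2)[OF e] by (intro tendsto_intros G)
  then show "G z (c *s v) = c * G z v" by (rule LIMSEQ_unique[OF G])
 qed
 moreover have "dunkl_operator Rp k \<xi> F x = cbilin \<xi> w' * F x" for \<xi> x
 proof (rule LIMSEQ_unique)
  show "(\<lambda>n. dunkl_operator Rp k \<xi> (f n) x) \<longlonglongrightarrow> dunkl_operator Rp k \<xi> F x"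
   unfolding dunkl_operator_eq GD
  proof (intro tendsto_add G tendsto_sum tendsto_mult tendsto_const)
   fix \<alpha>
   show "(\<lambda>n. dunkl_quotient (f n) x \<alpha>) \<longlonglongrightarrow> dunkl_quotient F x \<alpha>"
   proof (cases "cbilin (cvec \<alpha>) x = 0")
    case True
    then show ?thesis unfolding dunkl_quotient_def GD by (simp only: if_True simp_thms) (intro tendsto_intros G)
   next
    case False
    then show ?thesis unfolding dunkl_quotient_def GD by (simp only: if_False simp_thms) (intro tendsto_intros F, simp)
   qed
  qed
  have "(\<lambda>n. cbilin \<xi> (w n)) \<longlonglongrightarrow> cbilin \<xi> w'"
   unfolding cbilin_def by (intro tendsto_intros w)
  then have "(\<lambda>n. cbilin \<xi> (w n) * f n x) \<longlonglongrightarrow> cbilin \<xi> w' * F x" by (intro tendsto_intros F)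
  then show "(\<lambda>n. dunkl_operator Rp k \<xi> (f n) x) \<longlonglongrightarrow> cbilin \<xi> w' * F x"
   using f by (simp add: eigen_def)
 qed
 moreover have "F 0 = 1" using F[of 0] f by (simp add: eigen_def LIMSEQ_const_iff)
 ultimately show ?thesis unfolding eigen_def by (intro exI[of _ F] conjI allI)
qed

subsection \<open>The Dunkl kernel\<close>

text \<open>The parameters for which the definite description defining the Dunkl kernel is proper.\<close>

definition solvable :: "real ^ 'n \<Rightarrow> bool" where "solvable y \<longleftrightarrow> (\<exists>f. eigen (cvec y) f)"

lemma dunkl_kernel_eqI: "eigen w f \<Longrightarrow> dunkl_kernel Rp k z w = f z"
 unfolding dunkl_kernel_def eigen_def[symmetric]
 by (subst the_equality[of "eigen w"]) (auto dest: eigen_unique)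

lemma dunkl_kernel_not_solvable:
 assumes "\<not> solvable y" "\<not> solvable y'"
 shows "dunkl_kernel Rp k z (cvec y) = dunkl_kernel Rp k z (cvec y')"
proof -
 have "eigen (cvec y) = eigen (cvec y')" using assms by (auto simp: solvable_def fun_eq_iff)
 then show ?thesis unfolding dunkl_kernel_def eigen_def[symmetric] by simp
qed

lemma eigen_dunkl_kernel: "solvable y \<Longrightarrow> eigen (cvec y) (\<lambda>z. dunkl_kernel Rp k z (cvec y))"
 unfolding solvable_def using dunkl_kernel_eqI by (metis ext)

lemma solvable_0: "solvable 0"
 using eigen_0 by (auto simp: solvable_def)

lemma solvable_scale:
 assumes "solvable y"
 shows "solvable (c *\<^sub>R y)"
proof (cases "c = 0")
 case False
 then show ?thesis using eigen_scale[of "cvec y" _ "of_real c"] assms by (auto simp: solvable_def)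
qed (simp add: solvable_0)

lemma solvable_weyl: "solvable y \<Longrightarrow> g \<in> W \<Longrightarrow> solvable (g y)"
 using eigen_weyl[of "cvec y" _ g] by (auto simp: solvable_def complexify_cvec weyl_group_linear)

lemma closed_solvable: "closed (Collect solvable)"
 unfolding closed_sequential_limits
proof safe
 fix y l assume y: "\<forall>n. y n \<in> Collect solvable" "y \<longlonglongrightarrow> l"
 have "(\<lambda>n. cvec (y n)) \<longlonglongrightarrow> cvec l"
  unfolding cvec_def by (intro vec_tendstoI) (auto intro!: tendsto_intros y(2))
 moreover obtain f where "\<And>n. eigen (cvec (y n)) (f n)"
  using y(1) unfolding solvable_def mem_Collect_eq by metis
 ultimately show "solvable l" using eigen_limit unfolding solvable_def by blast
qed

end

section \<open>Integration by parts against the Dunkl weight\<close>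

lemma rpow_nonneg: "rpow x a \<ge> 0"
 by (simp add: rpow_def)

lemma rpow_abs_le_exp: "a \<ge> 0 \<Longrightarrow> rpow \<bar>t\<bar> a \<le> exp (a * \<bar>t\<bar>)"
proof (cases "a = 0 \<or> t = 0")
 case False
 assume a: "a \<ge> 0"
 from False have "rpow \<bar>t\<bar> a = exp (a * ln \<bar>t\<bar>)" by (simp add: rpow_def powr_def)
 also have "\<dots> \<le> exp (a * \<bar>t\<bar>)"
  using a False ln_le_minus_one[of "\<bar>t\<bar>"] by (auto intro!: mult_left_mono)
 finally show ?thesis .
qed (auto simp: rpow_def)

lemma continuous_on_rpow_abs:
 assumes "a \<ge> 0" "continuous_on S f"
 shows "continuous_on S (\<lambda>x. rpow \<bar>f x\<bar> a)"
proof (cases "a = 0")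
 case False
 then show ?thesis
  unfolding rpow_def using assms
  by (simp only: if_False) (intro continuous_on_powr' continuous_intros, auto)
qed (simp add: rpow_def)

lemma DERIV_rpow_abs_line:
 fixes c d s p :: real
 assumes nz: "c + s * d \<noteq> 0"
 shows "((\<lambda>s. rpow \<bar>c + s * d\<bar> p) has_real_derivative rpow \<bar>c + s * d\<bar> p * (p * d / (c + s * d))) (at s)"
proof -
 have e: "rpow \<bar>u\<bar> p = exp (p / 2 * ln (u\<^sup>2))" if "u \<noteq> 0" for u :: real
 proof -
  have "ln (u\<^sup>2) = 2 * ln \<bar>u\<bar>" using that ln_realpow[of "\<bar>u\<bar>" 2] by simp
  then show ?thesis using that by (simp add: rpow_def powr_def)
 qed
 have "((\<lambda>s. exp (p / 2 * ln ((c + s * d)\<^sup>2))) has_real_derivative exp (p / 2 * ln ((c + s * d)\<^sup>2)) * (p * d / (c + s * d))) (at s)"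
 proof -
  have 1: "((\<lambda>u. ln (u\<^sup>2)) has_real_derivative 2 / v) (at v)" if "v \<noteq> 0" for v :: real
  proof (rule DERIV_cong)
   show "((\<lambda>u. ln (u\<^sup>2)) has_real_derivative 1 / v\<^sup>2 * (2 * v)) (at v)"
    using that by (auto intro!: derivative_eq_intros)
   show "1 / v\<^sup>2 * (2 * v) = 2 / v" using that by (simp add: power2_eq_square)
  qed
  have 2: "((\<lambda>s. c + s * d) has_real_derivative d) (at s)" by (auto intro!: derivative_eq_intros)
  have "((\<lambda>s. p / 2 * ln ((c + s * d)\<^sup>2)) has_real_derivative p / 2 * (2 / (c + s * d) * d)) (at s)"
   by (rule DERIV_cmult[OF DERIV_chain2[OF 1[OF nz] 2]])
  also have "p / 2 * (2 / (c + s * d) * d) = p * d / (c + s * d)" by simp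
  finally show ?thesis by (rule DERIV_fun_exp)
 qed
 then have "((\<lambda>s. exp (p / 2 * ln ((c + s * d)\<^sup>2))) has_real_derivative rpow \<bar>c + s * d\<bar> p * (p * d / (c + s * d))) (at s)"
  by (simp add: e[OF nz])
 moreover have "open {s. c + s * d \<noteq> 0}"
  by (intro open_Collect_neq continuous_intros)
 ultimately show ?thesis
  by (rule has_field_derivative_transform_within_open) (use nz in \<open>auto simp: e\<close>)
qed

lemma DERIV_prod_log:
 fixes a l :: "'i \<Rightarrow> real \<Rightarrow> real"
 assumes "finite A" "\<And>i. i \<in> A \<Longrightarrow> (a i has_real_derivative a i s * l i s) (at s)"
 shows "((\<lambda>s. \<Prod>i\<in>A. a i s) has_real_derivative (\<Prod>i\<in>A. a i s) * (\<Sum>i\<in>A. l i s)) (at s)"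
 using assms
proof (induction rule: finite_induct)
 case (insert i A)
 from insert have "((\<lambda>s. a i s * (\<Prod>i\<in>A. a i s)) has_real_derivative
   a i s * ((\<Prod>i\<in>A. a i s) * (\<Sum>i\<in>A. l i s)) + a i s * l i s * (\<Prod>i\<in>A. a i s)) (at s)"
  by (intro DERIV_mult' insert.IH) auto
 then show ?case using insert.hyps by (simp add: algebra_simps)
qed simp

lemma abs_powr_minus_1_le:
 fixes a t :: real
 assumes "a > 0"
 shows "\<bar>t\<bar> powr (a - 1) \<le> \<bar>t\<bar> powr (min a 1 - 1) * exp (a * \<bar>t\<bar>)"
proof (cases "a \<le> 1")
 case True
 have "1 \<le> exp (a * \<bar>t\<bar>)" using assms by simp
 then show ?thesis using True by (simp add: mult_left_le mult_le_cancel_left1)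
next
 case False
 show ?thesis
 proof (cases "t = 0")
  case t: False
  have "\<bar>t\<bar> powr (a - 1) \<le> exp ((a - 1) * \<bar>t\<bar>)"
   using rpow_abs_le_exp[of "a - 1" t] False by (simp add: rpow_def)
  also have "\<dots> \<le> exp (a * \<bar>t\<bar>)" by (simp add: mult_right_mono)
  finally show ?thesis using False t by simp
 qed simp
qed

lemma AE_inner_neq_0:
 assumes "\<alpha> \<noteq> (0 :: real ^ 'n)"
 shows "AE x in lborel. \<alpha> \<bullet> x \<noteq> 0"
proof -
 have "negligible {x. \<alpha> \<bullet> x = 0}" using assms by (intro negligible_hyperplane) simp
 then have "{x. \<alpha> \<bullet> x = 0} \<in> null_sets lebesgue" by (simp add: negligible_iff_null_sets)
 then have "AE x in lebesgue. \<alpha> \<bullet> x \<noteq> 0" by (intro AE_I'[where N="{x. \<alpha> \<bullet> x = 0}"]) auto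
 then show ?thesis by (simp add: AE_completion_iff)
qed

lemma le_exp: "x \<le> exp (x :: real)"
 using exp_ge_add_one_self[of x] by linarith

lemma borel_measurable_field_derivative:
 fixes F :: "complex \<Rightarrow> 'a \<Rightarrow> complex"
 assumes [measurable]: "\<And>z. F z \<in> borel_measurable M"
  and deriv: "\<And>x. x \<in> space M \<Longrightarrow> ((\<lambda>z. F z x) has_field_derivative F' x) (at z0)"
 shows "F' \<in> borel_measurable M"
proof (rule borel_measurable_LIMSEQ_metric)
 let ?h = "\<lambda>n. of_real (1 / real (Suc n)) :: complex"
 show "(\<lambda>x. (F (z0 + ?h n) x - F z0 x) / ?h n) \<in> borel_measurable M" for n by measurable
 have "filterlim ?h (at 0) sequentially"
  unfolding filterlim_at
  using tendsto_of_real[where 'a=complex, OF LIMSEQ_inverse_real_of_nat]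
  by (auto simp: field_simps simp flip: of_nat_Suc intro!: always_eventually)
 from filterlim_compose[OF deriv[unfolded DERIV_def] this]
 show "(\<lambda>n. (F (z0 + ?h n) x - F z0 x) / ?h n) \<longlonglongrightarrow> F' x" if "x \<in> space M" for x
  using that by blast
qed

context dunkl_setting
begin

definition gauss :: "real ^ 'n \<Rightarrow> real" where
 "gauss x = exp (- (norm x)\<^sup>2 / 2) * weight x"

definition expo :: real where "expo = (\<Sum>\<alpha>\<in>Rp. 2 * k \<alpha> * norm \<alpha>)"

lemma kp: "\<alpha> \<in> Rp \<Longrightarrow> k \<alpha> \<ge> 0" using k_nonneg Rp_subset by blast

lemma Rp_nonzero: "\<alpha> \<in> Rp \<Longrightarrow> \<alpha> \<noteq> 0" using Rp_subset zero_notin_R by blast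

lemma weight_nonneg: "weight x \<ge> 0"
 unfolding dunkl_weight_def by (intro prod_nonneg) (simp add: rpow_nonneg)

lemma gauss_nonneg: "gauss x \<ge> 0"
 by (simp add: gauss_def weight_nonneg)

lemma continuous_weight: "continuous_on S (weight)"
 unfolding dunkl_weight_def by (intro continuous_intros continuous_on_rpow_abs) (simp add: kp)

lemma weight_measurable [measurable]: "weight \<in> borel_measurable borel"
 by (rule borel_measurable_continuous_onI[OF continuous_weight])

lemma gauss_measurable [measurable]: "gauss \<in> borel_measurable borel"
 unfolding gauss_def[abs_def] by measurable

lemma continuous_gauss: "continuous_on S gauss"
 unfolding gauss_def[abs_def] by (intro continuous_intros continuous_weight) simp

lemma weight_factor_le:
 assumes "A \<subseteq> Rp"
 shows "(\<Prod>\<alpha>\<in>A. rpow \<bar>\<alpha> \<bullet> x\<bar> (2 * k \<alpha>)) \<le> exp (expo * norm x)"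
proof -
 have A: "finite A" using assms finite_Rp finite_subset by blast
 have "(\<Prod>\<alpha>\<in>A. rpow \<bar>\<alpha> \<bullet> x\<bar> (2 * k \<alpha>)) \<le> (\<Prod>\<alpha>\<in>A. exp (2 * k \<alpha> * norm \<alpha> * norm x))"
 proof (intro prod_mono conjI rpow_nonneg)
  fix \<alpha> assume "\<alpha> \<in> A"
  then have k: "k \<alpha> \<ge> 0" using assms kp by blast
  have "rpow \<bar>\<alpha> \<bullet> x\<bar> (2 * k \<alpha>) \<le> exp (2 * k \<alpha> * \<bar>\<alpha> \<bullet> x\<bar>)" using k by (intro rpow_abs_le_exp) simp
  also have "\<dots> \<le> exp (2 * k \<alpha> * (norm \<alpha> * norm x))"
   using k Cauchy_Schwarz_ineq2[of \<alpha> x] by (simp add: mult_left_mono)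
  finally show "rpow \<bar>\<alpha> \<bullet> x\<bar> (2 * k \<alpha>) \<le> exp (2 * k \<alpha> * norm \<alpha> * norm x)" by (simp add: mult.assoc)
 qed
 also have "\<dots> = exp ((\<Sum>\<alpha>\<in>A. 2 * k \<alpha> * norm \<alpha>) * norm x)"
  using A by (simp add: exp_sum sum_distrib_right)
 also have "\<dots> \<le> exp (expo * norm x)"
  unfolding expo_def using assms finite_Rp kp by (auto intro!: mult_right_mono sum_mono2)
 finally show ?thesis .
qed

lemma weight_le: "weight x \<le> exp (expo * norm x)"
 unfolding dunkl_weight_def by (rule weight_factor_le) simp

lemma weight_scale:
 assumes "r > 0"
 shows "weight (r *\<^sub>R x) = r powr (2 * gamma_index Rp k) * weight x"
proof -
 have "rpow \<bar>\<alpha> \<bullet> (r *\<^sub>R x)\<bar> (2 * k \<alpha>) = r powr (2 * k \<alpha>) * rpow \<bar>\<alpha> \<bullet> x\<bar> (2 * k \<alpha>)" for \<alpha>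
  using assms by (simp add: rpow_def abs_mult powr_mult)
 then have "weight (r *\<^sub>R x) = (\<Prod>\<alpha>\<in>Rp. r powr (2 * k \<alpha>)) * weight x"
  by (simp add: dunkl_weight_def prod.distrib)
 also have "(\<Prod>\<alpha>\<in>Rp. r powr (2 * k \<alpha>)) = r powr (2 * gamma_index Rp k)"
  using assms finite_Rp by (simp add: powr_sum gamma_index_def sum_distrib_left)
 finally show ?thesis .
qed

lemma AE_regular: "AE x in lborel. \<forall>\<alpha>\<in>Rp. \<alpha> \<bullet> x \<noteq> 0"
 using finite_Rp Rp_nonzero by (intro AE_finite_allI AE_inner_neq_0) auto

lemma weight_pos: "(\<And>\<alpha>. \<alpha> \<in> Rp \<Longrightarrow> \<alpha> \<bullet> x \<noteq> 0) \<Longrightarrow> weight x > 0"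
 unfolding dunkl_weight_def by (intro prod_pos) (auto simp: rpow_def)

lemma gauss_le: "exp (C * norm x) * gauss x \<le> exp ((C + expo + 1)\<^sup>2 / 2) * exp (- norm x)"
proof -
 have "exp (C * norm x) * gauss x \<le> exp (C * norm x) * (exp (- (norm x)\<^sup>2 / 2) * exp (expo * norm x))"
  unfolding gauss_def by (intro mult_left_mono weight_le) auto
 also have "\<dots> = exp ((C + expo) * norm x - 1 / 2 * (norm x)\<^sup>2)"
  by (simp add: mult_exp_exp algebra_simps)
 also have "\<dots> \<le> exp ((C + expo + 1)\<^sup>2 / 2) * exp (- norm x)"
  using exp_linear_minus_square_le[of "1/2" "C + expo" "norm x"] by simp
 finally show ?thesis .
qed

lemma gauss_integrable:
 fixes H :: "real ^ 'n \<Rightarrow> complex"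
 assumes [measurable]: "H \<in> borel_measurable borel" and H: "\<And>x. norm (H x) \<le> A * exp (B * norm x)"
 shows "integrable lborel (\<lambda>x. gauss x *\<^sub>R H x)"
proof (rule Bochner_Integration.integrable_bound[OF integrable_mult_right[OF integrable_exp_neg_norm]])
 have A: "A \<ge> 0" using order_trans[OF norm_ge_zero H[of 0]] by simp
 show "AE x in lborel. norm (gauss x *\<^sub>R H x) \<le> norm (A * exp ((B + expo + 1)\<^sup>2 / 2) * exp (- norm x))"
 proof (rule AE_I2)
  fix x :: "real ^ 'n"
  have "norm (gauss x *\<^sub>R H x) \<le> gauss x * (A * exp (B * norm x))"
   using H[of x] gauss_nonneg[of x] by (simp add: mult_left_mono)
  also have "\<dots> = A * (exp (B * norm x) * gauss x)" by simp
  also have "\<dots> \<le> A * (exp ((B + expo + 1)\<^sup>2 / 2) * exp (- norm x))"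
   by (intro mult_left_mono gauss_le A)
  finally show "norm (gauss x *\<^sub>R H x) \<le> norm (A * exp ((B + expo + 1)\<^sup>2 / 2) * exp (- norm x))"
   using A by (simp add: abs_mult mult.assoc)
 qed
qed simp

lemma gauss_integrable_real: "integrable lborel (\<lambda>x. exp (C * norm x) * gauss x)"
proof -
 have "integrable lborel (\<lambda>x. gauss x *\<^sub>R complex_of_real (exp (C * norm x)))"
  by (rule gauss_integrable[of _ 1 C]) auto
 from integrable_Re[OF this] show ?thesis by (simp add: mult.commute)
qed

text \<open>The logarithmic derivative \<open>2 k(\<alpha>) / \<langle>\<alpha>, x\<rangle>\<close> of the weight is integrable against it: what is
 left of the weight is \<open>\<bar>\<langle>\<alpha>, x\<rangle>\<bar>\<close> to a power above \<open>- 1\<close>.\<close>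

lemma gauss_singular_integrable:
 fixes H :: "real ^ 'n \<Rightarrow> complex"
 assumes \<alpha>: "\<alpha> \<in> Rp" and [measurable]: "H \<in> borel_measurable borel" and H: "\<And>x. norm (H x) \<le> A * exp (B * norm x)"
 shows "integrable lborel (\<lambda>x. (k \<alpha> / (\<alpha> \<bullet> x) * gauss x) *\<^sub>R H x)"
proof (cases "k \<alpha> = 0")
 case False
 then have k: "k \<alpha> > 0" using kp[OF \<alpha>] by simp
 define a where "a = 2 * k \<alpha>"
 (* Exponents a > 1 are cut off: the excess power is absorbed by the exponential factor. *)
 define b where "b = min a 1"
 have a: "a > 0" and b: "0 < b" "b \<le> 1" using k by (auto simp: a_def b_def)
 have A: "A \<ge> 0" using order_trans[OF norm_ge_zero H[of 0]] by simp
 define C where "C = B + a * norm \<alpha> + expo"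
 let ?K = "A * k \<alpha> * exp ((C + 1)\<^sup>2 / (4 * (1 / 2)))"
 show ?thesis
 proof (rule Bochner_Integration.integrable_bound[OF integrable_mult_right[OF integrable_abs_inner_powr[OF b Rp_nonzero[OF \<alpha>]], of ?K]])
  show "AE x in lborel. norm ((k \<alpha> / (\<alpha> \<bullet> x) * gauss x) *\<^sub>R H x) \<le> norm (?K * (\<bar>\<alpha> \<bullet> x\<bar> powr (b - 1) * exp (- norm x)))"
  proof (rule AE_I2)
   fix x :: "real ^ 'n"
   let ?t = "\<alpha> \<bullet> x"
   have w: "weight x = rpow \<bar>?t\<bar> a * (\<Prod>\<beta>\<in>Rp - {\<alpha>}. rpow \<bar>\<beta> \<bullet> x\<bar> (2 * k \<beta>))"
    unfolding dunkl_weight_def a_def using \<alpha> finite_Rp by (rule prod.remove[rotated])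
   have 1: "rpow \<bar>?t\<bar> a / \<bar>?t\<bar> \<le> \<bar>?t\<bar> powr (b - 1) * exp (a * norm \<alpha> * norm x)"
   proof -
    have "rpow \<bar>?t\<bar> a / \<bar>?t\<bar> = \<bar>?t\<bar> powr (a - 1)"
     using a by (cases "?t = 0") (simp_all add: rpow_def powr_diff)
    also have "\<dots> \<le> \<bar>?t\<bar> powr (b - 1) * exp (a * \<bar>?t\<bar>)" unfolding b_def by (rule abs_powr_minus_1_le[OF a])
    also have "\<dots> \<le> \<bar>?t\<bar> powr (b - 1) * exp (a * (norm \<alpha> * norm x))"
     using a Cauchy_Schwarz_ineq2[of \<alpha> x] by (intro mult_left_mono) (auto intro: mult_left_mono)
    finally show ?thesis by (simp add: mult.assoc)
   qed
   have "weight x / \<bar>?t\<bar> = rpow \<bar>?t\<bar> a / \<bar>?t\<bar> * (\<Prod>\<beta>\<in>Rp - {\<alpha>}. rpow \<bar>\<beta> \<bullet> x\<bar> (2 * k \<beta>))"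
    by (simp add: w)
   also have "\<dots> \<le> \<bar>?t\<bar> powr (b - 1) * exp (a * norm \<alpha> * norm x) * exp (expo * norm x)"
    by (intro mult_mono 1 weight_factor_le) (auto intro!: prod_nonneg rpow_nonneg)
   finally have 2: "weight x / \<bar>?t\<bar> \<le> \<bar>?t\<bar> powr (b - 1) * exp (a * norm \<alpha> * norm x) * exp (expo * norm x)" .
   have "norm ((k \<alpha> / ?t * gauss x) *\<^sub>R H x) = k \<alpha> * exp (- (norm x)\<^sup>2 / 2) * (weight x / \<bar>?t\<bar>) * norm (H x)"
    using k weight_nonneg[of x] by (simp add: gauss_def abs_mult)
   also have "\<dots> \<le> k \<alpha> * exp (- (norm x)\<^sup>2 / 2) * (\<bar>?t\<bar> powr (b - 1) * exp (a * norm \<alpha> * norm x) * exp (expo * norm x)) * (A * exp (B * norm x))"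
    using k A weight_nonneg[of x] by (intro mult_mono 2 H order_refl) (auto intro!: mult_nonneg_nonneg divide_nonneg_nonneg)
   also have "\<dots> = A * k \<alpha> * \<bar>?t\<bar> powr (b - 1) * exp (C * norm x - 1 / 2 * (norm x)\<^sup>2)"
   proof -
    have "exp (C * norm x - 1 / 2 * (norm x)\<^sup>2) = exp (- (norm x)\<^sup>2 / 2) * exp (a * norm \<alpha> * norm x) * exp (expo * norm x) * exp (B * norm x)"
     by (simp add: mult_exp_exp C_def algebra_simps)
    then show ?thesis by simp
   qed
   also have "\<dots> \<le> A * k \<alpha> * \<bar>?t\<bar> powr (b - 1) * (exp ((C + 1)\<^sup>2 / (4 * (1 / 2))) * exp (- norm x))"
    using k A by (intro mult_left_mono exp_linear_minus_square_le) auto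
   also have "\<dots> = ?K * (\<bar>?t\<bar> powr (b - 1) * exp (- norm x))" by (simp add: ac_simps)
   finally show "norm ((k \<alpha> / (\<alpha> \<bullet> x) * gauss x) *\<^sub>R H x) \<le> norm (?K * (\<bar>\<alpha> \<bullet> x\<bar> powr (b - 1) * exp (- norm x)))"
    unfolding real_norm_def by (rule order_trans[OF _ abs_ge_self])
  qed
 qed simp
qed simp

lemma gauss_line_derivative:
 assumes "\<And>\<alpha>. \<alpha> \<in> Rp \<Longrightarrow> \<alpha> \<bullet> (x + s *\<^sub>R \<xi>) \<noteq> 0"
 shows "((\<lambda>s. gauss (x + s *\<^sub>R \<xi>)) has_real_derivative
  gauss (x + s *\<^sub>R \<xi>) * ((\<Sum>\<alpha>\<in>Rp. 2 * k \<alpha> * (\<alpha> \<bullet> \<xi>) / (\<alpha> \<bullet> (x + s *\<^sub>R \<xi>))) - \<xi> \<bullet> (x + s *\<^sub>R \<xi>))) (at s)"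
proof -
 let ?p = "\<lambda>s. x + s *\<^sub>R \<xi>"
 have e: "\<alpha> \<bullet> ?p s = \<alpha> \<bullet> x + s * (\<alpha> \<bullet> \<xi>)" for \<alpha> s by (simp add: inner_right_distrib)
 have w: "((\<lambda>s. weight (?p s)) has_real_derivative weight (?p s) * (\<Sum>\<alpha>\<in>Rp. 2 * k \<alpha> * (\<alpha> \<bullet> \<xi>) / (\<alpha> \<bullet> ?p s))) (at s)"
  unfolding dunkl_weight_def e
  by (intro DERIV_prod_log[where l="\<lambda>\<alpha> s. 2 * k \<alpha> * (\<alpha> \<bullet> \<xi>) / (\<alpha> \<bullet> x + s * (\<alpha> \<bullet> \<xi>))"] finite_Rp DERIV_rpow_abs_line)
    (use assms in \<open>simp add: e\<close>)
 have n: "(norm (?p s))\<^sup>2 = x \<bullet> x + 2 * s * (\<xi> \<bullet> x) + s\<^sup>2 * (\<xi> \<bullet> \<xi>)" for s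
  unfolding power2_norm_eq_inner
  by (simp add: inner_add_left inner_add_right inner_commute power2_eq_square algebra_simps)
 have g: "((\<lambda>s. exp (- (norm (?p s))\<^sup>2 / 2)) has_real_derivative exp (- (norm (?p s))\<^sup>2 / 2) * (- (\<xi> \<bullet> ?p s))) (at s)"
  unfolding n by (auto intro!: derivative_eq_intros simp: inner_right_distrib field_simps)
 show ?thesis
  unfolding gauss_def by (rule DERIV_cong[OF DERIV_mult[OF g w]]) (simp add: algebra_simps)
qed

text \<open>The derivative of \<open>gauss * F\<close> along \<open>\<xi>\<close>, including the logarithmic derivative of the weight, has
 integral \<open>0\<close>.\<close>

lemma gauss_integration_by_parts:
 fixes F :: "real ^ 'n \<Rightarrow> complex"
 assumes deriv: "\<And>x. (F has_derivative F' x) (at x)"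
  and F: "\<And>x. norm (F x) \<le> A * exp (B * norm x)"
  and F'm [measurable]: "(\<lambda>x. F' x \<xi>) \<in> borel_measurable borel"
  and F': "\<And>x. norm (F' x \<xi>) \<le> A * exp (B * norm x)"
 shows "(\<integral>x. gauss x *\<^sub>R F' x \<xi> - gauss x *\<^sub>R (of_real (\<xi> \<bullet> x) * F x)
   + (\<Sum>\<alpha>\<in>Rp. (k \<alpha> / (\<alpha> \<bullet> x) * gauss x) *\<^sub>R (of_real (2 * (\<alpha> \<bullet> \<xi>)) * F x)) \<partial>lborel) = 0"
proof (rule integral_line_derivative_eq_0[where G="\<lambda>x. gauss x *\<^sub>R F x" and \<xi>=\<xi>])
 have A: "A \<ge> 0" using order_trans[OF norm_ge_zero F[of 0]] by simp
 have cF: "continuous_on S F" for S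
  using deriv by (meson continuous_at_imp_continuous_on has_derivative_continuous)
 then have Fm [measurable]: "F \<in> borel_measurable borel" by (rule borel_measurable_continuous_onI)
 show "integrable lborel (\<lambda>x. gauss x *\<^sub>R F x)" by (rule gauss_integrable[OF Fm F])
 show "continuous_on UNIV (\<lambda>x. gauss x *\<^sub>R F x)" by (intro continuous_intros continuous_gauss cF)
 have xi: "norm (of_real (\<xi> \<bullet> x) * F x) \<le> norm \<xi> * A * exp ((B + 1) * norm x)" for x
 proof -
  have "norm (of_real (\<xi> \<bullet> x) * F x) \<le> norm \<xi> * norm x * (A * exp (B * norm x))"
   unfolding norm_mult norm_of_real by (intro mult_mono Cauchy_Schwarz_ineq2 F) auto
  also have "\<dots> \<le> norm \<xi> * exp (norm x) * (A * exp (B * norm x))"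
   using A le_exp by (intro mult_right_mono mult_left_mono) auto
  finally show ?thesis by (simp add: mult_exp_exp algebra_simps)
 qed
 have al: "norm (of_real c * F x) \<le> \<bar>c\<bar> * A * exp (B * norm x)" for c x
  using F[of x] by (simp add: norm_mult mult.assoc mult_left_mono)
 show "integrable lborel (\<lambda>x. gauss x *\<^sub>R F' x \<xi> - gauss x *\<^sub>R (of_real (\<xi> \<bullet> x) * F x)
   + (\<Sum>\<alpha>\<in>Rp. (k \<alpha> / (\<alpha> \<bullet> x) * gauss x) *\<^sub>R (of_real (2 * (\<alpha> \<bullet> \<xi>)) * F x)))"
  by (intro Bochner_Integration.integrable_add Bochner_Integration.integrable_diff Bochner_Integration.integrable_sum
    gauss_integrable[OF _ F'] gauss_integrable[OF _ xi] gauss_singular_integrable[OF _ _ al])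
    measurable
 show "AE x in lborel. \<exists>S. finite S \<and> (\<forall>s\<in>{0<..<1} - S.
   ((\<lambda>s. gauss (x + s *\<^sub>R \<xi>) *\<^sub>R F (x + s *\<^sub>R \<xi>)) has_vector_derivative
   gauss (x + s *\<^sub>R \<xi>) *\<^sub>R F' (x + s *\<^sub>R \<xi>) \<xi>
   - gauss (x + s *\<^sub>R \<xi>) *\<^sub>R (of_real (\<xi> \<bullet> (x + s *\<^sub>R \<xi>)) * F (x + s *\<^sub>R \<xi>))
   + (\<Sum>\<alpha>\<in>Rp. (k \<alpha> / (\<alpha> \<bullet> (x + s *\<^sub>R \<xi>)) * gauss (x + s *\<^sub>R \<xi>)) *\<^sub>R (of_real (2 * (\<alpha> \<bullet> \<xi>)) * F (x + s *\<^sub>R \<xi>)))) (at s))"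
  using AE_regular
 proof eventually_elim
  case (elim x)
  let ?S = "(\<lambda>\<alpha>. - (\<alpha> \<bullet> x) / (\<alpha> \<bullet> \<xi>)) ` Rp"
  show ?case
  proof (intro exI[of _ ?S] conjI ballI)
   show "finite ?S" using finite_Rp by simp
   fix s assume s: "s \<in> {0<..<1} - ?S"
   let ?y = "x + s *\<^sub>R \<xi>"
   have nz: "\<alpha> \<bullet> ?y \<noteq> 0" if "\<alpha> \<in> Rp" for \<alpha>
   proof
    assume "\<alpha> \<bullet> ?y = 0"
    then have eq: "\<alpha> \<bullet> x + s * (\<alpha> \<bullet> \<xi>) = 0" by (simp add: inner_right_distrib)
    then have "\<alpha> \<bullet> \<xi> \<noteq> 0" using elim that by auto
    with eq have "s = - (\<alpha> \<bullet> x) / (\<alpha> \<bullet> \<xi>)" by (simp add: field_simps)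
    then show False using s that by auto
   qed
   have "((\<lambda>s. x + s *\<^sub>R \<xi>) has_vector_derivative \<xi>) (at s)" by (auto intro!: derivative_eq_intros)
   from vector_derivative_diff_chain_within[OF this has_derivative_at_withinI[OF deriv]]
   have dF: "((\<lambda>s. F (x + s *\<^sub>R \<xi>)) has_vector_derivative F' ?y \<xi>) (at s)" by (simp add: o_def)
   have sum_eq: "(\<Sum>\<alpha>\<in>Rp. (k \<alpha> / (\<alpha> \<bullet> ?y) * gauss ?y) *\<^sub>R (of_real (2 * (\<alpha> \<bullet> \<xi>)) * F ?y))
    = (gauss ?y * (\<Sum>\<alpha>\<in>Rp. 2 * k \<alpha> * (\<alpha> \<bullet> \<xi>) / (\<alpha> \<bullet> ?y))) *\<^sub>R F ?y"
    unfolding sum_distrib_left scaleR_sum_left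
    by (intro sum.cong refl) (simp add: scaleR_conv_of_real ac_simps)
   have "((\<lambda>s. gauss (x + s *\<^sub>R \<xi>) *\<^sub>R F (x + s *\<^sub>R \<xi>)) has_vector_derivative
    gauss ?y *\<^sub>R F' ?y \<xi> + (gauss ?y * ((\<Sum>\<alpha>\<in>Rp. 2 * k \<alpha> * (\<alpha> \<bullet> \<xi>) / (\<alpha> \<bullet> ?y)) - \<xi> \<bullet> ?y)) *\<^sub>R F ?y) (at s)"
    by (rule has_vector_derivative_scaleR[OF gauss_line_derivative[OF nz] dF])
   then show "((\<lambda>s. gauss (x + s *\<^sub>R \<xi>) *\<^sub>R F (x + s *\<^sub>R \<xi>)) has_vector_derivative
    gauss ?y *\<^sub>R F' ?y \<xi> - gauss ?y *\<^sub>R (of_real (\<xi> \<bullet> ?y) * F ?y)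
    + (\<Sum>\<alpha>\<in>Rp. (k \<alpha> / (\<alpha> \<bullet> ?y) * gauss ?y) *\<^sub>R (of_real (2 * (\<alpha> \<bullet> \<xi>)) * F ?y))) (at s)"
    unfolding sum_eq by (simp add: right_diff_distrib scaleR_diff_left scaleR_conv_of_real algebra_simps)
  qed
 qed
qed

lemma gauss_weyl: "g \<in> W \<Longrightarrow> gauss (g x) = gauss x"
 by (simp add: gauss_def weyl_group_norm dunkl_weight_weyl)

lemma integral_odd_reflection:
 fixes h :: "real ^ 'n \<Rightarrow> complex"
 assumes [measurable]: "h \<in> borel_measurable borel" and odd: "\<And>x. h (reflection \<alpha> x) = - h x"
 shows "(\<integral>x. h x \<partial>lborel) = 0"
 using integral_lborel_orthogonal[OF linear_reflection norm_reflection, of h \<alpha>] by (simp add: odd)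

lemma bounded_linear_cvec: "bounded_linear cvec"
 by (rule bounded_linear_intro[of _ 1]) (simp_all add: scaleR_eq_smult)

text \<open>The constant in the growth bounds of eigenfunctions.\<close>

definition cardK :: real where "cardK = sqrt (real (card W)) * exp (1 / 2)"

lemma cardK_nonneg: "cardK \<ge> 0" by (simp add: cardK_def)

lemma eigen_growth': "eigen w f \<Longrightarrow> norm (f z) \<le> cardK * exp (norm z * norm w)"
 using eigen_growth[of w f z] by (simp add: cardK_def exp_add ac_simps)

lemma eigen_derivative_growth:
 assumes f: "eigen w f"
 shows "norm (der f z v) \<le> cardK * exp ((norm z + 1) * norm w) * norm v"
proof (rule entire_derivative_bound)
 show "entire_on_Cn f" using f by (simp add: eigen_def)
 fix y :: "complex ^ 'n" assume y: "norm y \<le> norm z + 1"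
 have "norm (f y) \<le> cardK * exp (norm y * norm w)" by (rule eigen_growth'[OF f])
 also have "\<dots> \<le> cardK * exp ((norm z + 1) * norm w)"
  using y cardK_nonneg by (intro mult_left_mono) (auto intro!: mult_right_mono)
 finally show "norm (f y) \<le> cardK * exp ((norm z + 1) * norm w)" .
qed

text \<open>Integrating a joint eigenfunction equation against another: the reflection terms are odd and drop
 out, the adjoint of \<open>T\<^sub>\<xi>\<close> is \<open>\<langle>\<xi>, x\<rangle> - T\<^sub>\<xi>\<close>.\<close>

lemma eigen_gauss_moment:
 assumes f: "eigen (cvec a) f" and h: "eigen (cvec b) h"
 shows "(\<integral>x. gauss x *\<^sub>R (of_real (\<xi> \<bullet> x) * (f (cvec x) * h (cvec x))) \<partial>lborel)
  = of_real (\<xi> \<bullet> (a + b)) * (\<integral>x. gauss x *\<^sub>R (f (cvec x) * h (cvec x)) \<partial>lborel)"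
proof -
 have ef: "entire_on_Cn f" and eh: "entire_on_Cn h" using f h by (auto simp: eigen_def)
 note K = cardK_nonneg
 define Df where "Df x = der f (cvec x) (cvec \<xi>)" for x
 define Dh where "Dh x = der h (cvec x) (cvec \<xi>)" for x
 let ?w = "\<lambda>\<alpha> x. k \<alpha> / (\<alpha> \<bullet> x) * gauss x"
 let ?f = "\<lambda>x. f (cvec x)" and ?h = "\<lambda>x. h (cvec x)"
 define F where "F x = ?f x * ?h x" for x
 define F' where "F' x v = ?f x * der h (cvec x) (cvec v) + der f (cvec x) (cvec v) * ?h x" for x v
 have d: "((\<lambda>x. u (cvec x)) has_derivative (\<lambda>v. der u (cvec x) (cvec v))) (at x)"
  if "entire_on_Cn u" for u x
  by (rule has_derivative_compose[OF bounded_linear_imp_has_derivative[OF bounded_linear_cvec] entire_has_derivative(1)[OF that]])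
 have dF: "(F has_derivative F' x) (at x)" for x
  unfolding F_def[abs_def] F'_def[abs_def] by (rule has_derivative_mult[OF d[OF ef] d[OF eh]])
 have growth: "norm (u (cvec x)) \<le> cardK * exp (norm c * norm x)"
  and dgrowth: "norm (der u (cvec x) (cvec \<xi>)) \<le> cardK * exp (norm c) * norm \<xi> * exp (norm c * norm x)"
  if u: "eigen (cvec c) u" for u c x
 proof -
  show "norm (u (cvec x)) \<le> cardK * exp (norm c * norm x)"
   using eigen_growth'[OF u, of "cvec x"] by (simp add: mult.commute)
  have "exp ((norm x + 1) * norm c) = exp (norm c) * exp (norm c * norm x)"
   by (simp add: mult_exp_exp algebra_simps)
  then show "norm (der u (cvec x) (cvec \<xi>)) \<le> cardK * exp (norm c) * norm \<xi> * exp (norm c * norm x)"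
   using eigen_derivative_growth[OF u, of "cvec x" "cvec \<xi>"] by (simp add: ac_simps)
 qed
 have fm [measurable]: "?f \<in> borel_measurable borel" "?h \<in> borel_measurable borel"
  using d[OF ef] d[OF eh]
  by (auto intro!: borel_measurable_continuous_onI continuous_at_imp_continuous_on has_derivative_continuous)
 have rm [measurable]: "reflection \<alpha> \<in> borel_measurable borel" for \<alpha> :: "real ^ 'n"
  by (intro borel_measurable_continuous_onI linear_continuous_on) (simp add: linear_reflection linear_linear)
 define B where "B = norm a + norm b"
 define A where "A = cardK * (cardK * exp (norm b) * norm \<xi>) + (cardK * exp (norm a) * norm \<xi>) * cardK + cardK * cardK"
 have prod: "norm (p * q) \<le> P * Q * exp (B * norm x)"
  if "norm p \<le> P * exp (norm a * norm x)" "norm q \<le> Q * exp (norm b * norm x)" for p q :: complex and P Q and x :: "real ^ 'n"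
 proof -
  have "norm (p * q) \<le> (P * exp (norm a * norm x)) * (Q * exp (norm b * norm x))"
   unfolding norm_mult using that order_trans[OF norm_ge_zero that(1)] by (intro mult_mono) auto
  moreover have "exp (B * norm x) = exp (norm a * norm x) * exp (norm b * norm x)"
   by (simp add: B_def mult_exp_exp algebra_simps)
  ultimately show ?thesis by (simp add: ac_simps)
 qed
 have prodfh: "norm (?f y * ?h z) \<le> cardK * cardK * exp (B * norm x)" if "norm y = norm x" "norm z = norm x" for x y z :: "real ^ 'n"
 proof (rule prod)
  show "norm (?f y) \<le> cardK * exp (norm a * norm x)" using growth[OF f, of y] that by simp
  show "norm (?h z) \<le> cardK * exp (norm b * norm x)" using growth[OF h, of z] that by simp
 qed
 have A0: "A \<ge> cardK * cardK" "A \<ge> 0"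
  using K by (auto simp: A_def intro!: add_nonneg_nonneg mult_nonneg_nonneg)
 have F: "norm (F x) \<le> A * exp (B * norm x)" for x
  unfolding F_def using prodfh[of x x x] A0 by (auto intro: order_trans mult_right_mono)
 have F': "norm (F' x \<xi>) \<le> A * exp (B * norm x)" for x
 proof -
  have "norm (F' x \<xi>) \<le> norm (?f x * Dh x) + norm (Df x * ?h x)"
   unfolding F'_def Dh_def Df_def by (rule norm_triangle_ineq)
  also have "\<dots> \<le> cardK * (cardK * exp (norm b) * norm \<xi>) * exp (B * norm x)
    + (cardK * exp (norm a) * norm \<xi>) * cardK * exp (B * norm x)"
   unfolding Dh_def Df_def by (intro add_mono prod growth[OF f] growth[OF h] dgrowth[OF f] dgrowth[OF h])
  also have "\<dots> \<le> A * exp (B * norm x)"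
   using K by (simp add: A_def distrib_right)
  finally show ?thesis .
 qed
 have Dm: "(\<lambda>x. der u (cvec x) (cvec \<xi>)) \<in> borel_measurable borel" if u: "entire_on_Cn u" for u
 proof (rule borel_measurable_field_derivative)
  have cv: "continuous_on UNIV (cvec :: real ^ 'n \<Rightarrow> _)" using bounded_linear_cvec by (rule linear_continuous_on)
  show "(\<lambda>x. u (cvec x + \<zeta> *s cvec \<xi>)) \<in> borel_measurable borel" for \<zeta>
   by (intro borel_measurable_continuous_onI continuous_on_compose2[OF entire_continuous[OF u, of UNIV]] continuous_intros cv) auto
  show "((\<lambda>\<zeta>. u (cvec x + \<zeta> *s cvec \<xi>)) has_field_derivative der u (cvec x) (cvec \<xi>)) (at 0)" for x
   using entire_holomorphic_line[OF u, of "cvec x" "cvec \<xi>" 0] by simp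
 qed
 have F'm: "(\<lambda>x. F' x \<xi>) \<in> borel_measurable borel"
  unfolding F'_def using Dm[OF ef] Dm[OF eh] by measurable
 define r where "r \<alpha> x = ?f (reflection \<alpha> x) * ?h x + ?f x * ?h (reflection \<alpha> x)" for \<alpha> x
 have rbound: "norm (of_real c * r \<alpha> x) \<le> \<bar>c\<bar> * (2 * cardK * cardK) * exp (B * norm x)" for c \<alpha> x
 proof -
  have "norm (r \<alpha> x) \<le> 2 * cardK * cardK * exp (B * norm x)"
   unfolding r_def
   using norm_triangle_ineq[of "?f (reflection \<alpha> x) * ?h x" "?f x * ?h (reflection \<alpha> x)"]
    prodfh[of "reflection \<alpha> x" x x] prodfh[of x x "reflection \<alpha> x"] by simp
  then show ?thesis by (simp add: norm_mult mult.assoc mult_left_mono)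
 qed
 have r_m [measurable]: "r \<alpha> \<in> borel_measurable borel" for \<alpha> unfolding r_def[abs_def]
  using measurable_compose[OF rm fm(1), of \<alpha>] measurable_compose[OF rm fm(2), of \<alpha>] by measurable
 have r_int: "integrable lborel (\<lambda>x. ?w \<alpha> x *\<^sub>R (of_real (\<alpha> \<bullet> \<xi>) * r \<alpha> x))" if "\<alpha> \<in> Rp" for \<alpha>
  by (rule gauss_singular_integrable[OF that _ rbound]) measurable
 have r_odd: "(\<integral>x. ?w \<alpha> x *\<^sub>R (of_real (\<alpha> \<bullet> \<xi>) * r \<alpha> x) \<partial>lborel) = 0" if "\<alpha> \<in> Rp" for \<alpha>
 proof (rule integral_odd_reflection[of _ \<alpha>])
  have W: "reflection \<alpha> \<in> W" using that Rp_subset by (intro weyl_group_reflection) auto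
  have s: "\<alpha> \<bullet> reflection \<alpha> x = - (\<alpha> \<bullet> x)" for x
   by (simp add: reflection_inner[symmetric] reflection_self)
  show "(k \<alpha> / (\<alpha> \<bullet> reflection \<alpha> x) * gauss (reflection \<alpha> x)) *\<^sub>R (of_real (\<alpha> \<bullet> \<xi>) * r \<alpha> (reflection \<alpha> x))
   = - (?w \<alpha> x *\<^sub>R (of_real (\<alpha> \<bullet> \<xi>) * r \<alpha> x))" for x
   by (simp add: s gauss_weyl[OF W] r_def algebra_simps)
 qed measurable
 have key: "gauss x *\<^sub>R F' x \<xi> - gauss x *\<^sub>R (of_real (\<xi> \<bullet> x) * F x)
   + (\<Sum>\<alpha>\<in>Rp. ?w \<alpha> x *\<^sub>R (of_real (2 * (\<alpha> \<bullet> \<xi>)) * F x))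
  = of_real (\<xi> \<bullet> (a + b)) * (gauss x *\<^sub>R F x) - gauss x *\<^sub>R (of_real (\<xi> \<bullet> x) * F x)
   + (\<Sum>\<alpha>\<in>Rp. ?w \<alpha> x *\<^sub>R (of_real (\<alpha> \<bullet> \<xi>) * r \<alpha> x))"
  if x: "\<forall>\<alpha>\<in>Rp. \<alpha> \<bullet> x \<noteq> 0" for x
 proof -
  have D: "der u (cvec x) (cvec \<xi>) = of_real (\<xi> \<bullet> c) * u (cvec x)
    - (\<Sum>\<alpha>\<in>Rp. of_real (k \<alpha> * (\<alpha> \<bullet> \<xi>) / (\<alpha> \<bullet> x)) * (u (cvec x) - u (cvec (reflection \<alpha> x))))"
   if u: "eigen (cvec c) u" for u c
  proof -
   have "dunkl_operator Rp k (cvec \<xi>) u (cvec x) = of_real (\<xi> \<bullet> c) * u (cvec x)"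
    using u by (simp add: eigen_def cbilin_cvec)
   moreover have "dunkl_operator Rp k (cvec \<xi>) u (cvec x) = der u (cvec x) (cvec \<xi>)
    + (\<Sum>\<alpha>\<in>Rp. of_real (k \<alpha> * (\<alpha> \<bullet> \<xi>) / (\<alpha> \<bullet> x)) * (u (cvec x) - u (cvec (reflection \<alpha> x))))"
    unfolding dunkl_operator_def
    using x by (intro arg_cong2[where f="(+)"] refl sum.cong) (simp_all add: cbilin_cvec complexify_cvec[OF linear_reflection])
   ultimately show ?thesis by (simp add: algebra_simps)
  qed
  define q where "q \<alpha> = complex_of_real (k \<alpha> * (\<alpha> \<bullet> \<xi>) / (\<alpha> \<bullet> x))" for \<alpha>
  have "F' x \<xi> = of_real (\<xi> \<bullet> (a + b)) * F x - (\<Sum>\<alpha>\<in>Rp. q \<alpha> * (2 * F x - r \<alpha> x))"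
   unfolding F'_def D[OF f] D[OF h] q_def[symmetric]
   by (simp add: F_def r_def algebra_simps inner_right_distrib sum_distrib_left sum_distrib_right sum_subtractf sum.distrib)
  then have "F' x \<xi> + (\<Sum>\<alpha>\<in>Rp. q \<alpha> * (2 * F x)) = of_real (\<xi> \<bullet> (a + b)) * F x + (\<Sum>\<alpha>\<in>Rp. q \<alpha> * r \<alpha> x)"
   by (simp add: sum_subtractf right_diff_distrib)
  then have "gauss x *\<^sub>R (F' x \<xi> + (\<Sum>\<alpha>\<in>Rp. q \<alpha> * (2 * F x))) = gauss x *\<^sub>R (of_real (\<xi> \<bullet> (a + b)) * F x + (\<Sum>\<alpha>\<in>Rp. q \<alpha> * r \<alpha> x))"
   by simp
  moreover have "gauss x *\<^sub>R (\<Sum>\<alpha>\<in>Rp. q \<alpha> * (2 * F x)) = (\<Sum>\<alpha>\<in>Rp. ?w \<alpha> x *\<^sub>R (of_real (2 * (\<alpha> \<bullet> \<xi>)) * F x))"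
   unfolding scaleR_sum_right by (intro sum.cong refl) (simp add: q_def scaleR_conv_of_real)
  moreover have "gauss x *\<^sub>R (\<Sum>\<alpha>\<in>Rp. q \<alpha> * r \<alpha> x) = (\<Sum>\<alpha>\<in>Rp. ?w \<alpha> x *\<^sub>R (of_real (\<alpha> \<bullet> \<xi>) * r \<alpha> x))"
   unfolding scaleR_sum_right by (intro sum.cong refl) (simp add: q_def scaleR_conv_of_real)
  ultimately show ?thesis by (simp add: scaleR_add_right algebra_simps)
 qed
 have F_m [measurable]: "F \<in> borel_measurable borel" unfolding F_def[abs_def] by measurable
 have int1: "integrable lborel (\<lambda>x. gauss x *\<^sub>R F x)" by (rule gauss_integrable[OF F_m F])
 have int2: "integrable lborel (\<lambda>x. gauss x *\<^sub>R (of_real (\<xi> \<bullet> x) * F x))"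
 proof (rule gauss_integrable)
  show "norm (of_real (\<xi> \<bullet> x) * F x) \<le> norm \<xi> * A * exp ((B + 1) * norm x)" for x
  proof -
   have "norm (of_real (\<xi> \<bullet> x) * F x) \<le> norm \<xi> * norm x * (A * exp (B * norm x))"
    unfolding norm_mult norm_of_real by (intro mult_mono Cauchy_Schwarz_ineq2 F) auto
   also have "\<dots> \<le> norm \<xi> * exp (norm x) * (A * exp (B * norm x))"
    using A0 le_exp by (intro mult_right_mono mult_left_mono) auto
   finally show ?thesis by (simp add: mult_exp_exp algebra_simps)
  qed
 qed measurable
 have "0 = (\<integral>x. of_real (\<xi> \<bullet> (a + b)) * (gauss x *\<^sub>R F x) - gauss x *\<^sub>R (of_real (\<xi> \<bullet> x) * F x)
   + (\<Sum>\<alpha>\<in>Rp. ?w \<alpha> x *\<^sub>R (of_real (\<alpha> \<bullet> \<xi>) * r \<alpha> x)) \<partial>lborel)"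
  unfolding gauss_integration_by_parts[OF dF F F'm F', symmetric]
 proof (rule integral_cong_AE)
  show "AE x in lborel. gauss x *\<^sub>R F' x \<xi> - gauss x *\<^sub>R (of_real (\<xi> \<bullet> x) * F x)
   + (\<Sum>\<alpha>\<in>Rp. ?w \<alpha> x *\<^sub>R (of_real (2 * (\<alpha> \<bullet> \<xi>)) * F x))
   = of_real (\<xi> \<bullet> (a + b)) * (gauss x *\<^sub>R F x) - gauss x *\<^sub>R (of_real (\<xi> \<bullet> x) * F x)
   + (\<Sum>\<alpha>\<in>Rp. ?w \<alpha> x *\<^sub>R (of_real (\<alpha> \<bullet> \<xi>) * r \<alpha> x))"
   using AE_regular by eventually_elim (rule key)
 qed (use F'm in measurable)
 also have "\<dots> = of_real (\<xi> \<bullet> (a + b)) * (\<integral>x. gauss x *\<^sub>R F x \<partial>lborel) - (\<integral>x. gauss x *\<^sub>R (of_real (\<xi> \<bullet> x) * F x) \<partial>lborel)"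
 proof -
  have int1': "integrable lborel (\<lambda>x. of_real (\<xi> \<bullet> (a + b)) * (gauss x *\<^sub>R F x))"
   by (rule integrable_mult_right[OF int1])
  have int3: "integrable lborel (\<lambda>x. \<Sum>\<alpha>\<in>Rp. ?w \<alpha> x *\<^sub>R (of_real (\<alpha> \<bullet> \<xi>) * r \<alpha> x))"
   by (intro Bochner_Integration.integrable_sum r_int)
  have "(\<integral>x. (\<Sum>\<alpha>\<in>Rp. ?w \<alpha> x *\<^sub>R (of_real (\<alpha> \<bullet> \<xi>) * r \<alpha> x)) \<partial>lborel) = 0"
   by (subst Bochner_Integration.integral_sum[OF r_int]) (simp_all only: r_odd sum.neutral_const cong: sum.cong)
  then show ?thesis
   by (subst Bochner_Integration.integral_add[OF Bochner_Integration.integrable_diff[OF int1' int2] int3],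
     subst Bochner_Integration.integral_diff[OF int1' int2])
     (simp only: integral_mult_right_zero add_0_right)
 qed
 finally show ?thesis by (simp add: F_def)
qed

end

section \<open>Symmetry and spherical means of the Dunkl kernel\<close>

lemma linear_isometry_inner:
 assumes "linear g" "\<And>x. norm (g x) = norm x"
 shows "g x \<bullet> g y = x \<bullet> (y :: 'a::real_inner)"
proof -
 have "(norm (g (x + y)))\<^sup>2 = (norm (x + y))\<^sup>2" using assms(2) by simp
 then show ?thesis
  using assms(2)[of x] assms(2)[of y]
  by (simp add: linear_add[OF assms(1)] dot_norm)
qed

context dunkl_setting
begin

lemma weyl_inner_inv:
 assumes g: "g \<in> W"
 shows "inv g a \<bullet> b = a \<bullet> g b"
proof -
 have "g (inv g a) \<bullet> g b = inv g a \<bullet> b"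
  by (rule linear_isometry_inner) (use weyl_group_linear[OF g] weyl_group_norm[OF g] in auto)
 then show ?thesis using weyl_group_inv(2)[OF g] by simp
qed

definition total :: real where "total = (\<integral>x. gauss x \<partial>lborel)"

lemma integrable_gauss: "integrable lborel gauss"
 using gauss_integrable_real[of 0] by simp

lemma total_pos: "total > 0"
proof -
 have "total \<noteq> 0"
 proof
  assume "total = 0"
  then have "AE x in lborel. gauss x = 0"
   unfolding total_def using integrable_gauss gauss_nonneg
   by (subst (asm) integral_nonneg_eq_0_iff_AE) auto
  then have "AE x in (lborel :: (real ^ 'n) measure). False"
   using AE_regular
  proof eventually_elim
   case (elim x)
   then show ?case using weight_pos[of x] by (auto simp: gauss_def)
  qed
  then show False by (simp add: AE_iff_nn_integral)
 qed
 moreover have "total \<ge> 0" unfolding total_def by (intro Bochner_Integration.integral_nonneg gauss_nonneg)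
 ultimately show ?thesis by simp
qed

lemma dunkl_const_eq: "dunkl_const Rp k = 1 / total"
 by (simp add: dunkl_const_def total_def gauss_def[abs_def])

lemma continuous_on_eigen_ray:
 assumes f: "eigen w f" and g: "continuous_on S g"
 shows "continuous_on S (\<lambda>x. f (\<zeta> *s cvec (g x)))"
proof -
 have "continuous_on S (\<lambda>x. \<zeta> *s cvec (g x))"
  by (intro bounded_linear.continuous_on[OF bounded_linear_smult] bounded_linear.continuous_on[OF bounded_linear_cvec] g)
 moreover have "entire_on_Cn f" using f by (simp add: eigen_def)
 ultimately show ?thesis
  by (intro continuous_on_compose2[OF entire_continuous[of f UNIV]]) auto
qed

lemma eigen_ray_derivative:
 assumes f: "eigen w f"
 shows "((\<lambda>\<zeta>. f (\<zeta> *s u)) has_field_derivative der f (\<zeta> *s u) u) (at \<zeta>)"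
proof -
 have e: "entire_on_Cn f" using f by (simp add: eigen_def)
 show ?thesis using entire_holomorphic_line[OF e, of 0 u \<zeta>] by simp
qed

lemma eigen_euler:
 assumes f: "eigen w f"
 shows "der f z z = cbilin z w * f z - (\<Sum>\<alpha>\<in>Rp. of_real (k \<alpha>) * (f z - f (complexify (reflection \<alpha>) z)))"
proof -
 have e: "entire_on_Cn f" using f by (simp add: eigen_def)
 show ?thesis using dunkl_operator_euler[OF e, of z] f by (simp add: eigen_def)
qed

text \<open>As functions of \<open>s\<close>, the integrals of \<open>gauss x * f (s g x) * h x\<close> and the functions
 \<open>exp (s\<^sup>2 \<parallel>a\<parallel>\<^sup>2 / 2) * f (s g b)\<close>, with \<open>g\<close> in the reflection group, solve the same first-order system
 with a regular singular point at \<open>0\<close>; by the energy estimate a solution is determined by its values at \<open>0\<close>.\<close>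

lemma gaussian_pairing:
 assumes f: "eigen (cvec a) f" and h: "eigen (cvec b) h"
 shows "(\<integral>x. gauss x *\<^sub>R (f (cvec x) * h (cvec x)) \<partial>lborel)
  = (\<integral>x. gauss x *\<^sub>R h (cvec x) \<partial>lborel) * (of_real (exp ((norm a)\<^sup>2 / 2)) * f (cvec b))"
proof -
 have ef: "entire_on_Cn f" and eh: "entire_on_Cn h" using f h by (auto simp: eigen_def)
 have gc: "continuous_on S g" if "g \<in> W" for g :: "real ^ 'n \<Rightarrow> real ^ 'n" and S
  using weyl_group_linear[OF that] by (intro linear_continuous_on) (simp add: linear_linear)
 define \<phi> where "\<phi> g \<zeta> x = gauss x *\<^sub>R (f (\<zeta> *s cvec (g x)) * h (cvec x))" for g \<zeta> x
 define \<psi> where "\<psi> g \<zeta> x = gauss x *\<^sub>R (der f ((\<zeta> *s cvec (g x))) (cvec (g x)) * h (cvec x))" for g \<zeta> x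
 define \<Phi> where "\<Phi> g \<zeta> = (\<integral>x. \<phi> g \<zeta> x \<partial>lborel)" for g \<zeta>
 define \<Psi> where "\<Psi> g \<zeta> = (\<integral>x. \<psi> g \<zeta> x \<partial>lborel)" for g \<zeta>
 have fm [measurable]: "(\<lambda>x. f (\<zeta> *s cvec (g x))) \<in> borel_measurable borel" if "g \<in> W" for g \<zeta>
  by (rule borel_measurable_continuous_onI[OF continuous_on_eigen_ray[OF f gc[OF that]]])
 have hm [measurable]: "(\<lambda>x. h (cvec x)) \<in> borel_measurable borel"
  using continuous_on_eigen_ray[OF h continuous_on_id, of UNIV 1]
  by (intro borel_measurable_continuous_onI) simp
 have fh: "norm (f (\<zeta> *s cvec (g x)) * h (cvec x)) \<le> cardK * cardK * exp ((norm \<zeta> * norm a + norm b) * norm x)"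
  if "g \<in> W" for g \<zeta> x
 proof -
  have "norm (f (\<zeta> *s cvec (g x)) * h (cvec x)) \<le> (cardK * exp (norm \<zeta> * norm x * norm a)) * (cardK * exp (norm x * norm b))"
   unfolding norm_mult
   using eigen_growth'[OF f, of "\<zeta> *s cvec (g x)"] eigen_growth'[OF h, of "cvec x"] cardK_nonneg
   by (intro mult_mono) (auto simp: norm_vec_smult weyl_group_norm[OF that])
  also have "\<dots> = cardK * cardK * exp ((norm \<zeta> * norm a + norm b) * norm x)"
   by (simp add: mult_exp_exp algebra_simps)
  finally show ?thesis .
 qed
 have \<phi>_int: "integrable lborel (\<phi> g \<zeta>)" if g: "g \<in> W" for g \<zeta>
  unfolding \<phi>_def[abs_def] by (rule gauss_integrable[OF _ fh[OF g]]) (use fm[OF g] in measurable)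
 have \<phi>_deriv: "((\<lambda>\<zeta>. \<phi> g \<zeta> x) has_field_derivative \<psi> g \<zeta> x) (at \<zeta>)" for g \<zeta> x
  unfolding \<phi>_def \<psi>_def scaleR_conv_of_real
  by (auto intro!: derivative_eq_intros eigen_ray_derivative[OF f])
 have \<psi>_m: "\<psi> g \<zeta> \<in> borel_measurable lborel" if g: "g \<in> W" for g \<zeta>
  by (rule borel_measurable_field_derivative[where F="\<phi> g"]) (use \<phi>_int[OF g] \<phi>_deriv in auto)
 define T where "T \<zeta> = norm (\<zeta> :: complex) + 1" for \<zeta>
 define D where "D \<zeta> = T \<zeta> * norm a + 1 + norm b" for \<zeta>
 have \<psi>_bound: "norm (\<psi> g \<zeta>' x) \<le> cardK * exp (norm a) * cardK * (exp (D \<zeta> * norm x) * gauss x)"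
  if g: "g \<in> W" and \<zeta>': "\<zeta>' \<in> cball \<zeta> 1" for g \<zeta> \<zeta>' x
 proof -
  have n: "norm \<zeta>' \<le> T \<zeta>" using \<zeta>' norm_triangle_sub[of \<zeta>' \<zeta>] by (simp add: T_def dist_norm norm_minus_commute)
  have "norm (der f ((\<zeta>' *s cvec (g x))) (cvec (g x)) * h (cvec x))
   \<le> (cardK * exp ((norm \<zeta>' * norm x + 1) * norm a) * norm x) * (cardK * exp (norm x * norm b))"
   unfolding norm_mult
   using eigen_derivative_growth[OF f, of "\<zeta>' *s cvec (g x)" "cvec (g x)"] eigen_growth'[OF h, of "cvec x"] cardK_nonneg
   by (intro mult_mono) (auto simp: norm_vec_smult weyl_group_norm[OF g])
  also have "\<dots> \<le> (cardK * exp ((T \<zeta> * norm x + 1) * norm a) * exp (norm x)) * (cardK * exp (norm x * norm b))"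
   using n cardK_nonneg le_exp[of "norm x"]
   by (intro mult_right_mono mult_mono) (auto intro!: mult_right_mono add_right_mono)
  also have "\<dots> = cardK * exp (norm a) * cardK * exp (D \<zeta> * norm x)"
  proof -
   have "exp (D \<zeta> * norm x) * exp (norm a) = exp ((T \<zeta> * norm x + 1) * norm a) * exp (norm x) * exp (norm x * norm b)"
    by (simp add: mult_exp_exp D_def algebra_simps)
   then show ?thesis by (simp add: ac_simps)
  qed
  finally have "gauss x * norm (der f ((\<zeta>' *s cvec (g x))) (cvec (g x)) * h (cvec x))
   \<le> gauss x * (cardK * exp (norm a) * cardK * exp (D \<zeta> * norm x))"
   using gauss_nonneg[of x] by (rule mult_left_mono)
  then show ?thesis
   unfolding \<psi>_def norm_scaleR using gauss_nonneg[of x] by (simp only: abs_of_nonneg ac_simps)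
 qed
 have bound_int: "integrable lborel (\<lambda>x. cardK * exp (norm a) * cardK * (exp (D \<zeta> * norm x) * gauss x))" for \<zeta>
  by (rule integrable_mult_right[OF gauss_integrable_real])
 have \<psi>_int: "integrable lborel (\<psi> g \<zeta>)" if g: "g \<in> W" for g \<zeta>
  by (rule Bochner_Integration.integrable_bound[OF bound_int \<psi>_m[OF g]], rule AE_I2)
    (unfold real_norm_def, rule order_trans[OF \<psi>_bound[OF g, of \<zeta> \<zeta>] abs_ge_self], simp)
 have \<Phi>_deriv: "(\<Phi> g has_field_derivative \<Psi> g \<zeta>) (at \<zeta>)" if g: "g \<in> W" for g \<zeta>
  unfolding \<Phi>_def[abs_def] \<Psi>_def
  by (rule has_field_derivative_lebesgue_integral[where \<delta>=1, OF \<phi>_deriv zero_less_one \<phi>_int[OF g] \<psi>_m[OF g] \<psi>_bound[OF g, where \<zeta>=\<zeta>] bound_int])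
 define c where "c g = inv g a" for g :: "real ^ 'n \<Rightarrow> real ^ 'n"
 have nc: "c g \<bullet> c g = (norm a)\<^sup>2" if "g \<in> W" for g
  using weyl_group_norm[OF weyl_group_inv(1)[OF that]] by (simp add: c_def power2_norm_eq_inner[symmetric])
 have ray: "complexify (reflection \<alpha>) (of_real s *s cvec (g x)) = of_real s *s cvec ((reflection \<alpha> \<circ> g) x)" for \<alpha> s and g :: "real ^ 'n \<Rightarrow> real ^ 'n" and x
  by (simp add: complexify_smult[OF linear_reflection] complexify_cvec[OF linear_reflection])
 have \<Psi>_eq: "of_real s * \<Psi> g (of_real s) = of_real s * of_real (s * (norm a)\<^sup>2 + a \<bullet> g b) * \<Phi> g (of_real s)
   - (\<Sum>\<alpha>\<in>Rp. of_real (k \<alpha>) * (\<Phi> g (of_real s) - \<Phi> (reflection \<alpha> \<circ> g) (of_real s)))"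
  if g: "g \<in> W" and s: "s > 0" for g s
 proof -
  let ?s = "complex_of_real s"
  have Wr: "reflection \<alpha> \<circ> g \<in> W" if "\<alpha> \<in> Rp" for \<alpha> using that g Rp_subset by (auto intro: weyl_group.weyl_refl)
  (* An eigenfunction for the parameter s g^{-1} a, to which the moment formula applies. *)
  define e where "e z = f (complexify g (?s *s z))" for z
  have ee: "eigen (cvec (s *\<^sub>R c g)) e"
  proof -
   have "inv (inv g) = g" by (rule inv_inv_eq[OF weyl_group_inv(4)[OF g]])
   then have "eigen (complexify (inv g) (cvec a)) (\<lambda>z. f (complexify g z))"
    using eigen_weyl[OF f weyl_group_inv(1)[OF g]] by simp
   from eigen_scale[OF this, of ?s] s show ?thesis
    by (simp add: e_def[abs_def] c_def complexify_cvec[OF weyl_group_linear[OF weyl_group_inv(1)[OF g]]])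
  qed
  have ex: "e (cvec x) = f (?s *s cvec (g x))" for x
   by (simp add: e_def complexify_smult[OF weyl_group_linear[OF g]] complexify_cvec[OF weyl_group_linear[OF g]])
  have moment: "(\<integral>x. gauss x *\<^sub>R (of_real (c g \<bullet> x) * (f (?s *s cvec (g x)) * h (cvec x))) \<partial>lborel)
    = of_real (s * (norm a)\<^sup>2 + a \<bullet> g b) * \<Phi> g ?s"
   using eigen_gauss_moment[OF ee h, of "c g"]
   by (simp add: ex \<Phi>_def \<phi>_def inner_add_right nc[OF g]) (simp add: c_def weyl_inner_inv[OF g])
  have pt: "?s * \<psi> g ?s x = ?s * (gauss x *\<^sub>R (of_real (c g \<bullet> x) * (f (?s *s cvec (g x)) * h (cvec x))))
    - (\<Sum>\<alpha>\<in>Rp. of_real (k \<alpha>) * (\<phi> g ?s x - \<phi> (reflection \<alpha> \<circ> g) ?s x))" for x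
  proof -
   let ?y = "?s *s cvec (g x)"
   have "?s * der f ?y (cvec (g x)) = der f ?y ?y"
    by (simp add: entire_has_derivative(2)[OF ef])
   also have "\<dots> = ?s * of_real (c g \<bullet> x) * f ?y - (\<Sum>\<alpha>\<in>Rp. of_real (k \<alpha>) * (f ?y - f (?s *s cvec ((reflection \<alpha> \<circ> g) x))))"
    unfolding eigen_euler[OF f] ray using weyl_inner_inv[OF g, of a x]
    by (simp add: cbilin_cvec c_def inner_commute)
   finally have 1: "?s * der f ?y (cvec (g x)) = \<dots>" .
   have "?s * \<psi> g ?s x = gauss x *\<^sub>R ((?s * der f ?y (cvec (g x))) * h (cvec x))"
    by (simp add: \<psi>_def scaleR_conv_of_real)
   also have "\<dots> = ?s * (gauss x *\<^sub>R (of_real (c g \<bullet> x) * (f ?y * h (cvec x))))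
    - gauss x *\<^sub>R (\<Sum>\<alpha>\<in>Rp. of_real (k \<alpha>) * (f ?y * h (cvec x) - f (?s *s cvec ((reflection \<alpha> \<circ> g) x)) * h (cvec x)))"
    unfolding 1 by (simp add: left_diff_distrib right_diff_distrib scaleR_conv_of_real sum_distrib_left sum_distrib_right ac_simps)
   also have "gauss x *\<^sub>R (\<Sum>\<alpha>\<in>Rp. of_real (k \<alpha>) * (f ?y * h (cvec x) - f (?s *s cvec ((reflection \<alpha> \<circ> g) x)) * h (cvec x)))
    = (\<Sum>\<alpha>\<in>Rp. of_real (k \<alpha>) * (\<phi> g ?s x - \<phi> (reflection \<alpha> \<circ> g) ?s x))"
    unfolding scaleR_sum_right by (intro sum.cong refl) (simp add: \<phi>_def scaleR_conv_of_real algebra_simps)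
   finally show ?thesis .
  qed
  have int1: "integrable lborel (\<lambda>x. gauss x *\<^sub>R (of_real (c g \<bullet> x) * (f (?s *s cvec (g x)) * h (cvec x))))"
  proof -
   have i: "integrable lborel (\<lambda>x. ?s * \<psi> g ?s x + (\<Sum>\<alpha>\<in>Rp. of_real (k \<alpha>) * (\<phi> g ?s x - \<phi> (reflection \<alpha> \<circ> g) ?s x)))"
    by (intro Bochner_Integration.integrable_add Bochner_Integration.integrable_sum integrable_mult_right
      Bochner_Integration.integrable_diff \<psi>_int \<phi>_int g Wr)
   have "integrable lborel (\<lambda>x. inverse ?s * (?s * (gauss x *\<^sub>R (of_real (c g \<bullet> x) * (f (?s *s cvec (g x)) * h (cvec x))))))"
    by (rule integrable_mult_right) (use i in \<open>simp add: pt\<close>)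
   then show ?thesis using s by (simp add: mult.assoc[symmetric])
  qed
  have "?s * \<Psi> g ?s = (\<integral>x. ?s * \<psi> g ?s x \<partial>lborel)" by (simp add: \<Psi>_def)
  also have "\<dots> = ?s * (\<integral>x. gauss x *\<^sub>R (of_real (c g \<bullet> x) * (f (?s *s cvec (g x)) * h (cvec x))) \<partial>lborel)
    - (\<Sum>\<alpha>\<in>Rp. of_real (k \<alpha>) * (\<Phi> g ?s - \<Phi> (reflection \<alpha> \<circ> g) ?s))"
   unfolding pt \<Phi>_def
   by (subst Bochner_Integration.integral_diff, rule integrable_mult_right[OF int1],
     intro Bochner_Integration.integrable_sum integrable_mult_right Bochner_Integration.integrable_diff \<phi>_int g Wr, assumption,
     subst Bochner_Integration.integral_sum,
     intro integrable_mult_right Bochner_Integration.integrable_diff \<phi>_int g Wr, assumption,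
     subst integral_mult_right_zero)
     (simp add: Bochner_Integration.integral_diff \<phi>_int g Wr cong: sum.cong)
  finally show ?thesis unfolding moment by simp
 qed
 define c0 where "c0 = (\<integral>x. gauss x *\<^sub>R h (cvec x) \<partial>lborel)"
 define U where "U g s = complex_of_real (exp (s\<^sup>2 * (norm a)\<^sup>2 / 2)) * f (of_real s *s cvec (g b))" for g and s :: real
 define U' where "U' g s = complex_of_real (s * (norm a)\<^sup>2) * U g s
   + of_real (exp (s\<^sup>2 * (norm a)\<^sup>2 / 2)) * der f ((of_real s *s cvec (g b))) (cvec (g b))" for g and s :: real
 have U_deriv: "(U g has_vector_derivative U' g s) (at s)" for g s
 proof -
  have 1: "((\<lambda>s. complex_of_real (exp (s\<^sup>2 * (norm a)\<^sup>2 / 2))) has_vector_derivative of_real (exp (s\<^sup>2 * (norm a)\<^sup>2 / 2) * (s * (norm a)\<^sup>2))) (at s)"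
   by (intro has_vector_derivative_of_real) (auto intro!: derivative_eq_intros simp: has_real_derivative_iff_has_vector_derivative[symmetric])
  have 2: "((\<lambda>s. f (of_real s *s cvec (g b))) has_vector_derivative der f ((of_real s *s cvec (g b))) (cvec (g b))) (at s)"
   by (rule has_vector_derivative_real_field[OF eigen_ray_derivative[OF f]])
  show ?thesis unfolding U_def[abs_def] U'_def
   using has_vector_derivative_mult[OF 1 2] by (simp add: U_def algebra_simps)
 qed
 have U_eq: "of_real s * U' g s = of_real s * of_real (s * (norm a)\<^sup>2 + a \<bullet> g b) * U g s
   - (\<Sum>\<alpha>\<in>Rp. of_real (k \<alpha>) * (U g s - U (reflection \<alpha> \<circ> g) s))" for g s
 proof -
  let ?s = "complex_of_real s" and ?E = "complex_of_real (exp (s\<^sup>2 * (norm a)\<^sup>2 / 2))"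
  let ?y = "?s *s cvec (g b)"
  have "?s * der f ?y (cvec (g b)) = der f ?y ?y"
   by (simp add: entire_has_derivative(2)[OF ef])
  also have "\<dots> = ?s * of_real (a \<bullet> g b) * f ?y - (\<Sum>\<alpha>\<in>Rp. of_real (k \<alpha>) * (f ?y - f (?s *s cvec ((reflection \<alpha> \<circ> g) b))))"
   unfolding eigen_euler[OF f] ray by (simp add: cbilin_cvec inner_commute)
  finally have 1: "?s * der f ?y (cvec (g b)) = \<dots>" .
  have "?s * U' g s = ?s * of_real (s * (norm a)\<^sup>2) * U g s + ?E * (?s * der f ?y (cvec (g b)))"
   by (simp add: U'_def algebra_simps)
  also have "\<dots> = ?s * of_real (s * (norm a)\<^sup>2) * U g s + ?s * of_real (a \<bullet> g b) * U g s
   - (\<Sum>\<alpha>\<in>Rp. of_real (k \<alpha>) * (U g s - U (reflection \<alpha> \<circ> g) s))"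
   unfolding 1 U_def by (simp add: right_diff_distrib sum_distrib_left ac_simps)
  finally show ?thesis by (simp add: algebra_simps)
 qed
 define H where "H g s = \<Phi> g (of_real s) - c0 * U g s" for g s
 define H' where "H' g s = \<Psi> g (of_real s) - c0 * U' g s" for g s
 have H_deriv: "(H g has_vector_derivative H' g s) (at s)" if "g \<in> W" for g s
  unfolding H_def[abs_def] H'_def
  by (intro has_vector_derivative_diff has_vector_derivative_mult_right has_vector_derivative_real_field \<Phi>_deriv U_deriv that)
 have "(\<Sum>g\<in>W. (norm (H g 1))\<^sup>2) \<le> exp (2 * ((norm a)\<^sup>2 + norm a * norm b) + 1) * ((\<Sum>g\<in>W. (norm (H g 0))\<^sup>2) + real (card W) * 0\<^sup>2)"
 proof (rule energy_estimate[where A=Rp and k=k and \<tau>="\<lambda>\<alpha> g. reflection \<alpha> \<circ> g" and H'=H' and e="\<lambda>_ _. 0"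
    and b="\<lambda>g s. of_real (s * (norm a)\<^sup>2 + a \<bullet> g b)"])
  show "continuous_on {0..1} (H g)" if "g \<in> W" for g
   using H_deriv[OF that] by (meson continuous_at_imp_continuous_on has_vector_derivative_continuous)
  show "of_real s * H' g s = of_real s * of_real (s * (norm a)\<^sup>2 + a \<bullet> g b) * H g s
    - (\<Sum>\<alpha>\<in>Rp. of_real (k \<alpha>) * (H g s - H (reflection \<alpha> \<circ> g) s)) + of_real s * 0" if "g \<in> W" "0 < s" for g s
  proof -
   have alg: "z * \<beta> * P - S1 - c * (z * \<beta> * u - S2) = z * \<beta> * (P - c * u) - (S1 - c * S2) + z * 0" for z \<beta> P S1 c u S2 :: complex
    by (simp add: algebra_simps)
   have 1: "(\<Sum>\<alpha>\<in>Rp. of_real (k \<alpha>) * (H g s - H (reflection \<alpha> \<circ> g) s))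
    = (\<Sum>\<alpha>\<in>Rp. of_real (k \<alpha>) * (\<Phi> g (of_real s) - \<Phi> (reflection \<alpha> \<circ> g) (of_real s)))
     - c0 * (\<Sum>\<alpha>\<in>Rp. of_real (k \<alpha>) * (U g s - U (reflection \<alpha> \<circ> g) s))"
    unfolding H_def sum_distrib_left sum_subtractf[symmetric] by (intro sum.cong refl) (simp add: algebra_simps)
   have 2: "of_real s * H' g s = of_real s * \<Psi> g (of_real s) - c0 * (of_real s * U' g s)"
    by (simp add: H'_def algebra_simps)
   show ?thesis
    unfolding 2 1 \<Psi>_eq[OF that] U_eq unfolding H_def by (rule alg)
  qed
  show "norm (complex_of_real (s * (norm a)\<^sup>2 + a \<bullet> g b)) \<le> (norm a)\<^sup>2 + norm a * norm b" if "g \<in> W" "0 < s" "s < 1" for g s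
  proof -
   have "\<bar>s * (norm a)\<^sup>2 + a \<bullet> g b\<bar> \<le> \<bar>s * (norm a)\<^sup>2\<bar> + \<bar>a \<bullet> g b\<bar>" by simp
   also have "\<dots> \<le> (norm a)\<^sup>2 + norm a * norm b"
    using that Cauchy_Schwarz_ineq2[of a "g b"] by (intro add_mono) (auto simp: abs_mult weyl_group_norm mult_left_le_one_le)
   finally show ?thesis by (simp only: norm_of_real)
  qed
  show "reflection \<alpha> \<circ> g \<in> W" if "g \<in> W" "\<alpha> \<in> Rp" for \<alpha> g
   using that Rp_subset by (auto intro: weyl_group.weyl_refl)
 qed (auto simp: finite_weyl_group finite_Rp kp H_deriv fun_eq_iff simp del: o_apply simp: comp_def)
 also have "\<dots> = 0"
 proof -
  have "f 0 = 1" using f by (simp add: eigen_def)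
  then show ?thesis by (simp add: H_def \<Phi>_def \<phi>_def U_def c0_def)
 qed
 finally have le0: "(\<Sum>g\<in>W. (norm (H g 1))\<^sup>2) \<le> 0" .
 have "(norm (H id 1))\<^sup>2 \<le> (\<Sum>g\<in>W. (norm (H g 1))\<^sup>2)"
  by (rule member_le_sum[OF weyl_group.weyl_id _ finite_weyl_group]) simp
 then have "(norm (H id 1))\<^sup>2 \<le> 0" using le0 by (rule order_trans)
 then have "H id 1 = 0" by simp
 then show ?thesis by (simp add: H_def \<Phi>_def \<phi>_def U_def c0_def)
qed

lemma gaussian_mean:
 assumes "eigen (cvec a) f"
 shows "(\<integral>x. gauss x *\<^sub>R f (cvec x) \<partial>lborel) = of_real (total * exp ((norm a)\<^sup>2 / 2))"
proof -
 have 0: "eigen (cvec 0) (\<lambda>_. 1)" using eigen_0 by simp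
 have "(\<integral>x. gauss x *\<^sub>R (1 :: complex) \<partial>lborel) = (\<integral>x. complex_of_real (gauss x) \<partial>lborel)"
  by (simp add: scaleR_conv_of_real)
 also have "\<dots> = of_real total" unfolding total_def by (rule integral_complex_of_real)
 finally have "(\<integral>x. gauss x *\<^sub>R (1 :: complex) \<partial>lborel) = of_real total" .
 then show ?thesis using gaussian_pairing[OF assms 0] assms by (simp add: eigen_def)
qed

text \<open>Exchanging the roles of the two eigenfunctions in \<open>gaussian_pairing\<close> leaves its left-hand side
 unchanged.\<close>

lemma eigen_symmetric:
 assumes f: "eigen (cvec a) f" and h: "eigen (cvec b) h"
 shows "f (cvec b) = h (cvec a)"
proof -
 let ?e = "of_real total * of_real (exp ((norm a)\<^sup>2 / 2)) * of_real (exp ((norm b)\<^sup>2 / 2)) :: complex"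
 have "?e * f (cvec b) = (\<integral>x. gauss x *\<^sub>R (f (cvec x) * h (cvec x)) \<partial>lborel)"
  using gaussian_pairing[OF f h] gaussian_mean[OF h] by (simp add: ac_simps)
 also have "\<dots> = ?e * h (cvec a)"
  using gaussian_pairing[OF h f] gaussian_mean[OF f] by (simp add: ac_simps)
 finally show ?thesis using total_pos by simp
qed

subsection \<open>Spherical means\<close>

definition bessel_index :: real where "bessel_index = gamma_index Rp k + real CARD('n) / 2 - 1"

lemma bessel_index_ge: "bessel_index \<ge> - 1/2"
proof -
 have "gamma_index Rp k \<ge> 0" unfolding gamma_index_def by (intro sum_nonneg kp)
 moreover have "1 \<le> CARD('n)" by (simp add: Suc_leI)
 then have "real CARD('n) \<ge> 1" by (simp only: real_of_nat_ge_one_iff)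
 ultimately show ?thesis unfolding bessel_index_def by linarith
qed

lemma sphere_const_eq: "sphere_const Rp k = (\<integral>z. weight z \<partial>surface_measure)"
 unfolding sphere_const_def set_lebesgue_integral_def
proof (rule integral_cong_AE)
 have "closed (sphere 0 1 :: (real ^ 'n) set)" by simp
 then show "(\<lambda>x. indicator (sphere 0 1) x *\<^sub>R weight x) \<in> borel_measurable surface_measure"
  unfolding real_scaleR_def
  by (intro borel_measurable_times borel_measurable_indicator) (simp_all add: weight_measurable)
qed (use AE_surface_norm weight_measurable in \<open>auto elim!: eventually_mono\<close>)

lemma weight_sphere_bound: "norm z = 1 \<Longrightarrow> weight z \<le> exp expo"
 using weight_le[of z] by simp

text \<open>As a function of complex \<open>r\<close> the mean is entire of exponential type, and \<open>gaussian_mean\<close>, applied to the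
 rescaled eigenfunctions and written in polar coordinates, is its Gaussian transform.\<close>

lemma spherical_mean:
 assumes f: "eigen (cvec a) f"
 shows "(\<integral>z. weight z *\<^sub>R f (of_real r *s cvec z) \<partial>surface_measure)
   = of_real (total / (2 powr bessel_index * Gamma (bessel_index + 1)) * spherical_bessel_imag bessel_index (norm a * r))"
proof -
 let ?N = "CARD('n)"
 define v where "v z = indicator (sphere 0 1) z * weight z" for z
 have v0: "0 \<le> v z" "v z \<le> exp expo" for z
  using weight_nonneg[of z] weight_sphere_bound[of z] by (auto simp: v_def indicator_def)
 have vm [measurable]: "v \<in> borel_measurable borel"
  unfolding v_def[abs_def] by (intro borel_measurable_times borel_measurable_indicator weight_measurable) simp
 define \<phi> where "\<phi> \<zeta> z = v z *\<^sub>R f (\<zeta> *s cvec z)" for \<zeta> z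
 define \<psi> where "\<psi> \<zeta> z = v z *\<^sub>R der f (\<zeta> *s cvec z) (cvec z)" for \<zeta> z
 define M where "M \<zeta> = (\<integral>z. \<phi> \<zeta> z \<partial>surface_measure)" for \<zeta>
 have fm [measurable]: "(\<lambda>z. f (\<zeta> *s cvec z)) \<in> borel_measurable borel" for \<zeta>
  by (rule borel_measurable_continuous_onI[OF continuous_on_eigen_ray[OF f continuous_on_id]])
 have \<phi>_bound: "norm (\<phi> \<zeta> z) \<le> exp expo * (cardK * exp (norm a * norm \<zeta>))" for \<zeta> z
 proof (cases "norm z = 1")
  case True
  have "norm (\<phi> \<zeta> z) = v z * norm (f (\<zeta> *s cvec z))" using v0 by (simp add: \<phi>_def)
  also have "\<dots> \<le> exp expo * (cardK * exp (norm a * norm \<zeta>))"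
   using eigen_growth'[OF f, of "\<zeta> *s cvec z"] v0[of z] True
   by (intro mult_mono) (auto simp: norm_vec_smult mult.commute)
  finally show ?thesis .
 qed (use cardK_nonneg in \<open>simp add: \<phi>_def v_def\<close>)
 have \<phi>_int: "integrable surface_measure (\<phi> \<zeta>)" for \<zeta>
  by (rule surface.integrable_const_bound[of _ "exp expo * (cardK * exp (norm a * norm \<zeta>))"])
    (use \<phi>_bound in \<open>auto simp: \<phi>_def[abs_def]\<close>)
 have \<phi>_deriv: "((\<lambda>\<zeta>. \<phi> \<zeta> z) has_field_derivative \<psi> \<zeta> z) (at \<zeta>)" for \<zeta> z
  unfolding \<phi>_def \<psi>_def scaleR_conv_of_real by (auto intro!: derivative_eq_intros eigen_ray_derivative[OF f])
 have \<psi>_m: "\<psi> \<zeta> \<in> borel_measurable surface_measure" for \<zeta>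
  by (rule borel_measurable_field_derivative[where F=\<phi>]) (use \<phi>_int \<phi>_deriv in auto)
 have \<psi>_bound: "norm (\<psi> \<zeta>' z) \<le> exp expo * (cardK * exp ((norm \<zeta> + 2) * norm a))" if "\<zeta>' \<in> cball \<zeta> 1" for \<zeta> \<zeta>' z
 proof (cases "norm z = 1")
  case True
  have n: "norm \<zeta>' \<le> norm \<zeta> + 1" using that norm_triangle_sub[of \<zeta>' \<zeta>] by (simp add: dist_norm norm_minus_commute)
  have "norm (\<psi> \<zeta>' z) = v z * norm (der f (\<zeta>' *s cvec z) (cvec z))" using v0 by (simp add: \<psi>_def)
  also have "\<dots> \<le> exp expo * (cardK * exp ((norm \<zeta>' + 1) * norm a))"
   using eigen_derivative_growth[OF f, of "\<zeta>' *s cvec z" "cvec z"] v0[of z] True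
   by (intro mult_mono) (auto simp: norm_vec_smult)
  also have "\<dots> \<le> exp expo * (cardK * exp ((norm \<zeta> + 2) * norm a))"
   using n cardK_nonneg by (intro mult_left_mono) (auto intro!: mult_right_mono)
  finally show ?thesis .
 qed (use cardK_nonneg in \<open>simp add: \<psi>_def v_def\<close>)
 have M_deriv: "(M has_field_derivative (\<integral>z. \<psi> \<zeta> z \<partial>surface_measure)) (at \<zeta>)" for \<zeta>
  unfolding M_def[abs_def]
  by (rule has_field_derivative_lebesgue_integral[where \<delta>=1, OF \<phi>_deriv zero_less_one \<phi>_int \<psi>_m \<psi>_bound[where \<zeta>=\<zeta>]]) simp_all
 have hol: "M holomorphic_on UNIV"
  using M_deriv by (meson field_differentiable_at_within field_differentiable_def holomorphic_on_def)
 let ?K = "measure surface_measure (UNIV :: (real ^ 'n) set) * (exp expo * cardK)"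
 have M_bound: "norm (M \<zeta>) \<le> ?K * exp (norm a * norm \<zeta>)" for \<zeta>
 proof -
  have "norm (M \<zeta>) \<le> (\<integral>z. norm (\<phi> \<zeta> z) \<partial>surface_measure)" unfolding M_def by (rule integral_norm_bound)
  also have "\<dots> \<le> (\<integral>z. exp expo * (cardK * exp (norm a * norm \<zeta>)) \<partial>(surface_measure :: (real ^ 'n) measure))"
   by (intro integral_mono integrable_norm \<phi>_int \<phi>_bound) simp
  finally show ?thesis by (simp add: ac_simps)
 qed
 have AE_v: "AE z in surface_measure. v z = weight (z :: real ^ 'n) \<and> norm z = 1"
  using AE_surface_norm by eventually_elim (simp add: v_def)
 have transform: "(\<integral>r. (indicator {0<..} r * r powr (2 * bessel_index + 1) * exp (- r\<^sup>2 / 2)) *\<^sub>R M (of_real (s * r)) \<partial>lborel)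
   = of_real (total * exp (s\<^sup>2 * (norm a)\<^sup>2 / 2))" if s: "0 < s" "s \<le> 1" for s
 proof -
  have es: "eigen (cvec (s *\<^sub>R a)) (\<lambda>z. f (of_real s *s z))"
   using eigen_scale[OF f, of "of_real s"] s by simp
  have int: "integrable lborel (\<lambda>x. gauss x *\<^sub>R f (of_real s *s cvec x))"
   by (rule gauss_integrable[of _ cardK "s * norm a"])
     (use eigen_growth'[OF f] s in \<open>auto simp: norm_vec_smult ac_simps intro: order_trans[OF eigen_growth'[OF f]]\<close>)
  have "of_real (total * exp (s\<^sup>2 * (norm a)\<^sup>2 / 2)) = (\<integral>x. gauss x *\<^sub>R f (of_real s *s cvec x) \<partial>lborel)"
   using gaussian_mean[OF es] s by (simp add: power_mult_distrib)
  also have "\<dots> = (\<integral>r. (indicator {0<..} r * r ^ (?N - 1)) *\<^sub>R (\<integral>z. gauss (r *\<^sub>R z) *\<^sub>R f (of_real s *s cvec (r *\<^sub>R z)) \<partial>surface_measure) \<partial>lborel)"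
   by (rule integral_polar[OF int])
  also have "\<dots> = (\<integral>r. (indicator {0<..} r * r powr (2 * bessel_index + 1) * exp (- r\<^sup>2 / 2)) *\<^sub>R M (of_real (s * r)) \<partial>lborel)"
  proof (intro Bochner_Integration.integral_cong refl)
   fix r :: real
   show "(indicator {0<..} r * r ^ (?N - 1)) *\<^sub>R (\<integral>z. gauss (r *\<^sub>R z) *\<^sub>R f (of_real s *s cvec (r *\<^sub>R z)) \<partial>surface_measure)
    = (indicator {0<..} r * r powr (2 * bessel_index + 1) * exp (- r\<^sup>2 / 2)) *\<^sub>R M (of_real (s * r))"
   proof (cases "r > 0")
    case True
    have fm': "(\<lambda>z. f (of_real s *s cvec (r *\<^sub>R z))) \<in> borel_measurable borel"
     by (intro borel_measurable_continuous_onI continuous_on_eigen_ray[OF f] continuous_intros)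
    have "(\<integral>z. gauss (r *\<^sub>R z) *\<^sub>R f (of_real s *s cvec (r *\<^sub>R z)) \<partial>surface_measure)
     = (\<integral>z. (exp (- r\<^sup>2 / 2) * r powr (2 * gamma_index Rp k)) *\<^sub>R \<phi> (of_real (s * r)) z \<partial>surface_measure)"
    proof (rule integral_cong_AE)
     show "(\<lambda>z. gauss (r *\<^sub>R z) *\<^sub>R f (of_real s *s cvec (r *\<^sub>R z))) \<in> borel_measurable surface_measure"
      using fm' by measurable
     show "(\<lambda>z. (exp (- r\<^sup>2 / 2) * r powr (2 * gamma_index Rp k)) *\<^sub>R \<phi> (of_real (s * r)) z) \<in> borel_measurable surface_measure"
      using \<phi>_int[of "of_real (s * r)"] by measurable
     show "AE z in surface_measure. gauss (r *\<^sub>R z) *\<^sub>R f (of_real s *s cvec (r *\<^sub>R z))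
      = (exp (- r\<^sup>2 / 2) * r powr (2 * gamma_index Rp k)) *\<^sub>R \<phi> (of_real (s * r)) z"
      using AE_v
     proof eventually_elim
      case (elim z)
      then show ?case using True
       by (simp add: gauss_def weight_scale \<phi>_def vector_smult_assoc power_mult_distrib)
     qed
    qed
    also have "\<dots> = (exp (- r\<^sup>2 / 2) * r powr (2 * gamma_index Rp k)) *\<^sub>R M (of_real (s * r))"
     by (simp add: M_def)
    moreover have "r ^ (?N - 1) * r powr (2 * gamma_index Rp k) = r powr (2 * bessel_index + 1)"
    proof -
     have "real (?N - 1) = real ?N - 1" by (simp add: of_nat_diff)
     then have "2 * bessel_index + 1 = real (?N - 1) + 2 * gamma_index Rp k" by (simp add: bessel_index_def)
     then show ?thesis using True by (simp only: powr_add powr_realpow)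
    qed
    ultimately show ?thesis using True by (simp add: ac_simps flip: mult.assoc)
   qed simp
  qed
  finally show ?thesis ..
 qed
 have "(\<integral>z. weight z *\<^sub>R f (of_real r *s cvec z) \<partial>surface_measure) = M (of_real r)"
  unfolding M_def
 proof (rule integral_cong_AE)
  show "\<phi> (of_real r) \<in> borel_measurable surface_measure" using \<phi>_int by auto
  show "AE z in surface_measure. weight z *\<^sub>R f (of_real r *s cvec z) = \<phi> (of_real r) z"
   using AE_v by eventually_elim (simp add: \<phi>_def)
 qed (use fm[of "of_real r"] in measurable)
 also have "\<dots> = of_real (total / (2 powr bessel_index * Gamma (bessel_index + 1)) * spherical_bessel_imag bessel_index (norm a * r))"
  by (rule spherical_bessel_from_gaussian_transform[OF bessel_index_ge hol M_bound transform])
 finally show ?thesis .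
qed

lemma sphere_const_total: "sphere_const Rp k = total / (2 powr bessel_index * Gamma (bessel_index + 1))"
proof -
 have e: "eigen (cvec 0) (\<lambda>_. 1)" using eigen_0 by simp
 have j: "spherical_bessel_imag bessel_index 0 = 1"
  using spherical_bessel_imag_ge_1[OF bessel_index_ge, of 0] spherical_bessel_imag_le_exp[OF bessel_index_ge, of 0] by simp
 have "complex_of_real (sphere_const Rp k) = (\<integral>z. complex_of_real (weight z) \<partial>surface_measure)"
  unfolding sphere_const_eq by (rule integral_complex_of_real[symmetric])
 also have "\<dots> = (\<integral>z. weight z *\<^sub>R (1 :: complex) \<partial>surface_measure)"
  by (simp add: scaleR_conv_of_real)
 also have "\<dots> = of_real (total / (2 powr bessel_index * Gamma (bessel_index + 1)))"
  using spherical_mean[OF e, of 0] j by simp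
 finally show ?thesis by (simp only: of_real_eq_iff)
qed

lemma sphere_const_pos: "sphere_const Rp k > 0"
 unfolding sphere_const_total using total_pos bessel_index_ge by (intro divide_pos_pos mult_pos_pos Gamma_real_pos) auto

end

section \<open>Existence of the Dunkl kernel from the Feller property\<close>

text \<open>Test the convergence at time \<open>0\<close> with a bump function supported in the ball.\<close>

lemma feller_kernel_concentrates:
 fixes S :: "'a::euclidean_space set"
 assumes K: "feller_kernels S K" and x: "x \<in> S" and \<delta>: "\<delta> > 0"
 shows "((\<lambda>t. measure (K t x) (ball x \<delta> \<inter> S)) \<longlongrightarrow> 1) (at_right 0)"
proof -
 define f where "f y = max 0 (1 - dist y x / \<delta>)" for y :: 'a
 have f: "f \<in> C0_on S"
 proof -
  have "eventually (\<lambda>y. f y = 0) (inf at_infinity (principal S))"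
   unfolding eventually_inf_principal eventually_at_infinity
  proof (intro exI[of _ "norm x + \<delta>"] allI impI)
   fix y :: 'a assume "norm x + \<delta> \<le> norm y"
   then have "dist y x \<ge> \<delta>" using norm_triangle_ineq2[of y x] by (simp add: dist_norm)
   then show "f y = 0" using \<delta> by (simp add: f_def)
  qed
  then have "(f \<longlongrightarrow> 0) (inf at_infinity (principal S))" by (rule tendsto_eventually)
  moreover have "continuous_on S f" unfolding f_def[abs_def] using \<delta> by (intro continuous_intros) auto
  ultimately show ?thesis by (simp add: C0_on_def)
 qed
 have "((\<lambda>t. LINT y|K t x. f y) \<longlongrightarrow> f x) (at_right 0)"
  using K f x by (auto simp: feller_kernels_def)
 then have lim: "((\<lambda>t. LINT y|K t x. f y) \<longlongrightarrow> 1) (at_right 0)" by (simp add: f_def)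
 have kt: "K t \<in> borel_on S \<rightarrow>\<^sub>M prob_algebra (borel_on S)" if "t > 0" for t
  using K that by (auto simp: feller_kernels_def)
 have bounds: "(LINT y|K t x. f y) \<le> measure (K t x) (ball x \<delta> \<inter> S) \<and> measure (K t x) (ball x \<delta> \<inter> S) \<le> 1" if t: "t > 0" for t
 proof -
  have kx: "prob_space (K t x)" "sets (K t x) = sets (borel_on S)" "space (K t x) = S"
   using prob_kernelD[OF kt[OF t], of x] x by simp_all
  interpret prob_space "K t x" by (rule kx)
  have B: "ball x \<delta> \<inter> S \<in> sets (K t x)"
   unfolding kx(2) sets_restrict_space by (rule image_eqI[of _ _ "ball x \<delta>"]) auto
  have fm: "f \<in> borel_measurable (K t x)"
   using C0_on_measurable[OF f] by (simp add: measurable_cong_sets[OF kx(2) refl])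
  have "(LINT y|K t x. f y) \<le> (LINT y|K t x. indicator (ball x \<delta> \<inter> S) y)"
  proof (rule integral_mono)
   show "integrable (K t x) f"
    by (rule prob_space_bounded_integrable[OF kx(1) fm, of 1]) (use \<delta> in \<open>auto simp: f_def\<close>)
   show "integrable (K t x) (indicator (ball x \<delta> \<inter> S) :: 'a \<Rightarrow> real)"
    using B by (intro integrable_real_indicator) (auto simp: emeasure_eq_measure)
   fix y assume "y \<in> space (K t x)"
   then show "f y \<le> indicator (ball x \<delta> \<inter> S) y"
    using \<delta> kx(3) by (auto simp: f_def indicator_def dist_commute)
  qed
  then show ?thesis using B by simp
 qed
 show ?thesis
 proof (rule tendsto_sandwich[OF _ _ lim tendsto_const])
  show "\<forall>\<^sub>F t in at_right 0. (LINT y|K t x. f y) \<le> measure (K t x) (ball x \<delta> \<inter> S)"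
   using bounds by (auto simp: eventually_at_right_field intro!: exI[of _ 1])
  show "\<forall>\<^sub>F t in at_right 0. measure (K t x) (ball x \<delta> \<inter> S) \<le> 1"
   using bounds by (auto simp: eventually_at_right_field intro!: exI[of _ 1])
 qed
qed

text \<open>A kernel of rank one cannot separate two starting points \<open>x\<close>, \<open>x'\<close>: with small disjoint
 neighbourhoods \<open>A\<close> and \<open>B\<close> of them,
 \<open>K\<^sub>t(x,A) K\<^sub>t(x',B) = K\<^sub>t(x,B) K\<^sub>t(x',A)\<close>,
 while the left side tends to 1 and the right side to 0 as \<open>t\<close> decreases to 0.\<close>

lemma feller_kernel_not_rank_one:
 fixes S U :: "'a::euclidean_space set"
 assumes K: "feller_kernels S K" and U: "open U" and x: "x \<in> S \<inter> U" "x' \<in> S \<inter> U"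
  and rank_one: "\<And>t x A. t > 0 \<Longrightarrow> x \<in> S \<inter> U \<Longrightarrow> A \<in> sets (borel_on S) \<Longrightarrow> A \<subseteq> U \<Longrightarrow>
   measure (K t x) A = a t x * b t A"
 shows "x = x'"
proof (rule ccontr)
 assume ne: "x \<noteq> x'"
 obtain e where e: "e > 0" "ball x e \<subseteq> U" using U x openE by blast
 obtain e' where e': "e' > 0" "ball x' e' \<subseteq> U" using U x openE by blast
 define \<delta> where "\<delta> = min (dist x x' / 2) (min e e')"
 have \<delta>: "\<delta> > 0" using ne e e' by (simp add: \<delta>_def)
 define A where "A = ball x \<delta> \<inter> S"
 define B where "B = ball x' \<delta> \<inter> S"
 have AU: "A \<subseteq> U" and BU: "B \<subseteq> U" using e e' by (auto simp: A_def B_def \<delta>_def)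
 have As: "A \<in> sets (borel_on S)" and Bs: "B \<in> sets (borel_on S)"
  unfolding A_def B_def sets_restrict_space by (auto intro!: image_eqI[of _ _ "ball _ \<delta>"])
 have disj: "A \<inter> B = {}"
 proof (rule equals0I)
  fix z assume "z \<in> A \<inter> B"
  then have "dist x z < dist x x' / 2" "dist x' z < dist x x' / 2" by (auto simp: A_def B_def \<delta>_def)
  then show False using dist_triangle2[of x x' z] by linarith
 qed
 have limA: "((\<lambda>t. measure (K t x) A) \<longlongrightarrow> 1) (at_right 0)"
  and limB: "((\<lambda>t. measure (K t x') B) \<longlongrightarrow> 1) (at_right 0)"
  unfolding A_def B_def using feller_kernel_concentrates[OF K _ \<delta>] x by auto
 have small: "measure (K t y) C1 * measure (K t y') C2 \<le> 1 - measure (K t y) C1'"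
  if "t > 0" "y \<in> S" "y' \<in> S" "C1 \<in> sets (borel_on S)" "C2 \<in> sets (borel_on S)" "C1' \<in> sets (borel_on S)" "C1' \<inter> C1 = {}" for t y y' C1 C2 C1'
 proof -
  have kt: "K t \<in> borel_on S \<rightarrow>\<^sub>M prob_algebra (borel_on S)" using K that by (auto simp: feller_kernels_def)
  note ky = prob_kernelD[OF kt, of y] and ky' = prob_kernelD[OF kt, of y']
  interpret P: prob_space "K t y" by (rule ky) (use that in simp)
  interpret P': prob_space "K t y'" by (rule ky') (use that in simp)
  have "measure (K t y) C1' + measure (K t y) C1 = measure (K t y) (C1' \<union> C1)"
   using that ky by (intro P.finite_measure_Union[symmetric]) auto
  then have "measure (K t y) C1 \<le> 1 - measure (K t y) C1'"
   using P.prob_le_1[of "C1' \<union> C1"] by linarith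
  moreover have "measure (K t y) C1 * measure (K t y') C2 \<le> measure (K t y) C1"
   using P'.prob_le_1[of C2] by (intro mult_right_le_one_le) auto
  ultimately show ?thesis by simp
 qed
 have ineq: "measure (K t x) A * measure (K t x') B \<le> 1 - measure (K t x) A" if t: "t > 0" for t
 proof -
  have "measure (K t x) A * measure (K t x') B = measure (K t x) B * measure (K t x') A"
   using rank_one[OF t] x As Bs AU BU by simp
  also have "\<dots> \<le> 1 - measure (K t x) A" using small[OF t, of x x' B A A] x As Bs disj by auto
  finally show ?thesis .
 qed
 have lhs: "((\<lambda>t. measure (K t x) A * measure (K t x') B) \<longlongrightarrow> 1 * 1) (at_right 0)"
  by (intro tendsto_intros limA limB)
 have rhs: "((\<lambda>t. 1 - measure (K t x) A) \<longlongrightarrow> 1 - 1) (at_right 0)"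
  by (intro tendsto_intros limA)
 have "(1::real) * 1 \<le> 1 - 1"
 proof (rule tendsto_le[OF trivial_limit_at_right_real rhs lhs])
  show "\<forall>\<^sub>F t in at_right 0. measure (K t x) A * measure (K t x') B \<le> 1 - measure (K t x) A"
   using ineq by (auto simp: eventually_at_right_field intro!: exI[of _ 1])
 qed
 then show False by simp
qed

context dunkl_setting
begin

lemma solvable_scale_iff: "c \<noteq> 0 \<Longrightarrow> solvable (c *\<^sub>R y) \<longleftrightarrow> solvable y"
 using solvable_scale[of y c] solvable_scale[of "c *\<^sub>R y" "1 / c"] by auto

text \<open>At points where the eigenvalue problem has no solution the kernel takes a fixed default
 value, so there the transition densities would have rank one.\<close>

lemma solvable_of_feller_density:
 assumes K: "feller_kernels S K" and cone: "\<And>c x. c > 0 \<Longrightarrow> x \<in> S \<Longrightarrow> c *\<^sub>R x \<in> S"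
  and density: "\<And>t x A. t > 0 \<Longrightarrow> x \<in> S \<Longrightarrow> A \<in> sets (borel_on S) \<Longrightarrow> measure (K t x) A =
   C t * (LINT y:A|lborel. exp (- ((norm x)\<^sup>2 + (norm y)\<^sup>2) / (2 * t)) *
    (q (x /\<^sub>R sqrt t) (y /\<^sub>R sqrt t) * j y / j x) * weight y)"
  and default: "\<And>x y. y \<in> S \<Longrightarrow> \<not> solvable y \<Longrightarrow> q x y = q0 x"
  and y: "y \<in> S"
 shows "solvable y"
proof (rule ccontr)
 assume ns: "\<not> solvable y"
 have y0: "y \<noteq> 0" using ns solvable_0 by auto
 have "y = 2 *\<^sub>R y"
 proof (rule feller_kernel_not_rank_one[OF K])
  show "open (- Collect solvable)" using closed_solvable by (simp add: open_closed)
  show "y \<in> S \<inter> - Collect solvable" "2 *\<^sub>R y \<in> S \<inter> - Collect solvable"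
   using y ns cone by (auto simp: solvable_scale_iff)
  fix t :: real and x and A
  assume t: "t > 0" and x: "x \<in> S \<inter> - Collect solvable" and A: "A \<in> sets (borel_on S)" "A \<subseteq> - Collect solvable"
  have AS: "A \<subseteq> S" using sets.sets_into_space[OF A(1)] by simp
  have "(LINT y:A|lborel. exp (- ((norm x)\<^sup>2 + (norm y)\<^sup>2) / (2 * t)) *
    (q (x /\<^sub>R sqrt t) (y /\<^sub>R sqrt t) * j y / j x) * weight y)
   = (LINT y:A|lborel. (exp (- (norm x)\<^sup>2 / (2 * t)) * q0 (x /\<^sub>R sqrt t) / j x)
     * (exp (- (norm y)\<^sup>2 / (2 * t)) * j y * weight y))"
   unfolding set_lebesgue_integral_def
  proof (intro Bochner_Integration.integral_cong refl)
   fix z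
   show "indicator A z *\<^sub>R (exp (- ((norm x)\<^sup>2 + (norm z)\<^sup>2) / (2 * t)) *
    (q (x /\<^sub>R sqrt t) (z /\<^sub>R sqrt t) * j z / j x) * weight z)
    = indicator A z *\<^sub>R ((exp (- (norm x)\<^sup>2 / (2 * t)) * q0 (x /\<^sub>R sqrt t) / j x)
     * (exp (- (norm z)\<^sup>2 / (2 * t)) * j z * weight z))"
   proof (cases "z \<in> A")
    case True
    then have zS: "z \<in> S" and zn: "\<not> solvable z" using AS A(2) by auto
    have "q (x /\<^sub>R sqrt t) (z /\<^sub>R sqrt t) = q0 (x /\<^sub>R sqrt t)"
     by (rule default) (use t zS zn cone[of "inverse (sqrt t)" z] in \<open>simp_all add: solvable_scale_iff\<close>)
    moreover have "exp (- ((norm x)\<^sup>2 + (norm z)\<^sup>2) / (2 * t)) = exp (- (norm x)\<^sup>2 / (2 * t)) * exp (- (norm z)\<^sup>2 / (2 * t))"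
     by (simp add: mult_exp_exp diff_divide_distrib)
    ultimately show ?thesis by simp
   qed simp
  qed
  also have "\<dots> = (exp (- (norm x)\<^sup>2 / (2 * t)) * q0 (x /\<^sub>R sqrt t) / j x)
     * (LINT y:A|lborel. exp (- (norm y)\<^sup>2 / (2 * t)) * j y * weight y)"
   by (rule set_integral_mult_right)
  finally have int: "(LINT y:A|lborel. exp (- ((norm x)\<^sup>2 + (norm y)\<^sup>2) / (2 * t)) *
    (q (x /\<^sub>R sqrt t) (y /\<^sub>R sqrt t) * j y / j x) * weight y) = \<dots>" .
  have xS: "x \<in> S" using x by simp
  show "measure (K t x) A = (exp (- (norm x)\<^sup>2 / (2 * t)) * q0 (x /\<^sub>R sqrt t) / j x)
     * (C t * (LINT y:A|lborel. exp (- (norm y)\<^sup>2 / (2 * t)) * j y * weight y))"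
   unfolding density[OF t xS A(1)] int by (rule mult.left_commute)
 qed
 then show False using y0 by (simp add: scaleR_2)
qed

abbreviation E where "E \<equiv> dunkl_kernel_real Rp k"
abbreviation J where "J \<equiv> dunkl_bessel_real R Rp k"

lemma dunkl_bessel_real_eq: "J x y = (\<Sum>g\<in>W. E x (g y)) / real (card W)"
 by (simp add: dunkl_bessel_real_def dunkl_bessel_def dunkl_kernel_real_def Re_divide_of_nat
   complexify_cvec[OF weyl_group_linear] cong: sum.cong)

lemma dunkl_kernel_real_default:
 "\<not> solvable y \<Longrightarrow> \<not> solvable y' \<Longrightarrow> E x y = E x y'"
 unfolding dunkl_kernel_real_def by (rule arg_cong[OF dunkl_kernel_not_solvable])

lemma solvable_weyl_iff: "g \<in> W \<Longrightarrow> solvable (g y) \<longleftrightarrow> solvable y"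
 using solvable_weyl[of y g] solvable_weyl[of "g y" "inv g"] by (auto simp: weyl_group_inv)

lemma dunkl_bessel_real_default:
 assumes y: "\<not> solvable y" and y': "\<not> solvable y'"
 shows "J x y = E x y'"
proof -
 have "(\<Sum>g\<in>W. E x (g y)) = (\<Sum>g\<in>W. E x y')"
  by (intro sum.cong refl dunkl_kernel_real_default) (simp_all add: solvable_weyl_iff y y')
 then show ?thesis using card_W_pos by (simp add: dunkl_bessel_real_eq)
qed

lemma solvable_of_chamber:
 assumes "\<And>y. y \<in> weyl_chamber Rp \<Longrightarrow> solvable y"
 shows "solvable y"
proof -
 obtain g where "g \<in> W" "g y \<in> weyl_chamber Rp" using orbit_meets_chamber by blast
 then show ?thesis using assms solvable_weyl_iff by blast
qed

end

section \<open>Real Dunkl kernel and Bessel function\<close>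

locale dunkl_kernel_setting = dunkl_setting R Rp k
 for R Rp :: "(real ^ 'n) set" and k +
 assumes all_solvable: "\<And>y. solvable y"
begin

lemma eigen_kernel: "eigen (cvec y) (\<lambda>z. dunkl_kernel Rp k z (cvec y))"
 by (rule eigen_dunkl_kernel[OF all_solvable])

lemma E_symmetric: "E x y = E y x"
 unfolding dunkl_kernel_real_def by (rule arg_cong[OF eigen_symmetric[OF eigen_kernel eigen_kernel]])

lemma E_0: "E 0 y = 1"
 using eigen_kernel[of y] by (simp add: dunkl_kernel_real_def eigen_def)

lemma E_scale: "c \<noteq> 0 \<Longrightarrow> E (c *\<^sub>R x) y = E x (c *\<^sub>R y)"
 using dunkl_kernel_eqI[OF eigen_scale[OF eigen_kernel[of y], of "of_real c"]]
 by (simp add: dunkl_kernel_real_def)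

lemma E_weyl:
 assumes g: "g \<in> W"
 shows "E x (g y) = E (inv g x) y"
proof -
 have "dunkl_kernel Rp k (cvec x) (complexify g (cvec y)) = dunkl_kernel Rp k (complexify (inv g) (cvec x)) (cvec y)"
  by (rule dunkl_kernel_eqI[OF eigen_weyl[OF eigen_kernel g]])
 then show ?thesis
  unfolding dunkl_kernel_real_def complexify_cvec[OF weyl_group_linear[OF g]]
   complexify_cvec[OF weyl_group_linear[OF weyl_group_inv(1)[OF g]]] by simp
qed

lemma E_bound: "\<bar>E x y\<bar> \<le> cardK * exp (norm x * norm y)"
proof -
 have "\<bar>E x y\<bar> \<le> norm (dunkl_kernel Rp k (cvec x) (cvec y))"
  unfolding dunkl_kernel_real_def by (rule abs_Re_le_cmod)
 also have "\<dots> \<le> cardK * exp (norm (cvec x) * norm (cvec y))" by (rule eigen_growth'[OF eigen_kernel])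
 finally show ?thesis by simp
qed

lemma E_lipschitz:
 assumes "norm x \<le> r" "norm x' \<le> r" "norm y \<le> r"
 shows "\<bar>E x y - E x' y\<bar> \<le> cardK * exp ((r + 1) * r) * norm (x - x')"
proof -
 let ?f = "\<lambda>z. dunkl_kernel Rp k z (cvec y)"
 have e: "entire_on_Cn ?f" using eigen_kernel by (simp add: eigen_def)
 have "norm (?f (cvec x) - ?f (cvec x')) \<le> (cardK * exp ((r + 1) * r)) * norm (cvec x - cvec x')"
 proof (rule differentiable_bound[of "cball 0 r"])
  show "(?f has_derivative der ?f z) (at z within cball 0 r)" for z
   by (rule has_derivative_at_withinI[OF entire_has_derivative(1)[OF e]])
  fix z :: "complex ^ 'n" assume z: "z \<in> cball 0 r"
  show "onorm (der ?f z) \<le> cardK * exp ((r + 1) * r)"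
  proof (rule onorm_le)
   fix v
   have "norm (der ?f z v) \<le> cardK * exp ((norm z + 1) * norm (cvec y)) * norm v"
    by (rule eigen_derivative_growth[OF eigen_kernel])
   also have "\<dots> \<le> cardK * exp ((r + 1) * r) * norm v"
   proof -
    have "0 \<le> r" using order_trans[OF norm_ge_zero assms(1)] .
    then show ?thesis
     using z assms cardK_nonneg by (intro mult_right_mono mult_left_mono) (auto intro!: mult_mono)
   qed
   finally show "norm (der ?f z v) \<le> cardK * exp ((r + 1) * r) * norm v" .
  qed
 qed (use assms in auto)
 moreover have "\<bar>E x y - E x' y\<bar> \<le> norm (?f (cvec x) - ?f (cvec x'))"
  unfolding dunkl_kernel_real_def using abs_Re_le_cmod[of "?f (cvec x) - ?f (cvec x')"] by simp
 moreover have "norm (cvec x - cvec x') = norm (x - x')" using norm_cvec[of "x - x'"] by simp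
 ultimately show ?thesis by simp
qed

lemma continuous_E: "continuous_on UNIV (\<lambda>p. E (fst p) (snd p))"
proof (rule continuous_at_imp_continuous_on, rule ballI)
 fix p :: "(real ^ 'n) \<times> (real ^ 'n)"
 define r where "r = norm p + 1"
 define L where "L = cardK * exp ((r + 1) * r)"
 have bnd: "\<bar>E (fst p') (snd p') - E (fst p) (snd p)\<bar> \<le> L * norm (fst p' - fst p) + L * norm (snd p' - snd p)"
  if d: "dist p' p < 1" for p'
 proof -
  have "norm p' \<le> r" using d norm_triangle_sub[of p' p] by (simp add: r_def dist_norm)
  moreover have "norm (fst p') \<le> norm p'" "norm (snd p') \<le> norm p'" "norm (fst p) \<le> norm p" "norm (snd p) \<le> norm p"
   using norm_fst_le[of "fst p'" "snd p'"] norm_snd_le[of "snd p'" "fst p'"]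
    norm_fst_le[of "fst p" "snd p"] norm_snd_le[of "snd p" "fst p"] by simp_all
  ultimately have n: "norm (fst p') \<le> r" "norm (snd p') \<le> r" "norm (fst p) \<le> r" "norm (snd p) \<le> r"
   by (auto simp: r_def)
  have "\<bar>E (fst p') (snd p') - E (fst p) (snd p')\<bar> \<le> L * norm (fst p' - fst p)"
   unfolding L_def by (rule E_lipschitz) (use n in auto)
  moreover have "\<bar>E (snd p') (fst p) - E (snd p) (fst p)\<bar> \<le> L * norm (snd p' - snd p)"
   unfolding L_def by (rule E_lipschitz) (use n in auto)
  ultimately show ?thesis unfolding E_symmetric[of "fst p"] by linarith
 qed
 show "isCont (\<lambda>p. E (fst p) (snd p)) p"
  unfolding isCont_def
 proof (rule LIM_zero_cancel, rule Lim_null_comparison)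
  show "\<forall>\<^sub>F p' in at p. norm (E (fst p') (snd p') - E (fst p) (snd p)) \<le> L * norm (fst p' - fst p) + L * norm (snd p' - snd p)"
   using bnd by (auto simp: eventually_at intro!: exI[of _ 1])
  have "((\<lambda>p'. L * norm (fst p' - fst p) + L * norm (snd p' - snd p)) \<longlongrightarrow> L * norm (fst p - fst p) + L * norm (snd p - snd p)) (at p)"
   by (intro tendsto_intros)
  then show "((\<lambda>p'. L * norm (fst p' - fst p) + L * norm (snd p' - snd p)) \<longlongrightarrow> 0) (at p)" by simp
 qed
qed

lemma J_bound: "\<bar>J x y\<bar> \<le> cardK * exp (norm x * norm y)"
proof -
 have "\<bar>\<Sum>g\<in>W. E x (g y)\<bar> \<le> (\<Sum>g\<in>W. cardK * exp (norm x * norm y))"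
  by (intro order_trans[OF sum_abs] sum_mono order_trans[OF E_bound]) (simp add: weyl_group_norm)
 then have "\<bar>\<Sum>g\<in>W. E x (g y)\<bar> \<le> real (card W) * (cardK * exp (norm x * norm y))" by simp
 then show ?thesis using card_W_pos unfolding dunkl_bessel_real_eq abs_divide
  by (simp add: divide_le_eq mult.commute)
qed

lemma continuous_J: "continuous_on UNIV (\<lambda>p. J (fst p) (snd p))"
 unfolding dunkl_bessel_real_eq
proof (intro continuous_intros)
 fix g assume g: "g \<in> W"
 have "continuous_on UNIV (\<lambda>p :: (real ^ 'n) \<times> (real ^ 'n). (fst p, g (snd p)))"
  using weyl_group_linear[OF g]
  by (intro continuous_intros linear_continuous_on_compose[where f=snd]) (auto intro: continuous_intros)
 from continuous_on_compose2[OF continuous_E this]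
 show "continuous_on UNIV (\<lambda>p. E (fst p) (g (snd p)))" by simp
qed (use card_W_pos in simp)

lemma J_scale: "c \<noteq> 0 \<Longrightarrow> J (c *\<^sub>R x) y = J x (c *\<^sub>R y)"
 by (simp add: dunkl_bessel_real_eq E_scale linear_scale[OF weyl_group_linear] cong: sum.cong)

lemma J_0: "J 0 y = 1"
 using card_W_pos by (simp add: dunkl_bessel_real_eq E_0)

lemma J_symmetric: "J x y = J y x"
proof -
 have "(\<Sum>g\<in>W. E x (g y)) = (\<Sum>g\<in>W. E y (inv g x))"
  by (intro sum.cong refl) (simp add: E_weyl E_symmetric[of y])
 also have "\<dots> = (\<Sum>g\<in>W. E y (g x))"
  by (rule sum.reindex_bij_betw[OF bij_betw_weyl_group_inv])
 finally show ?thesis by (simp add: dunkl_bessel_real_eq)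
qed

lemma J_weyl:
 assumes h: "h \<in> W"
 shows "J (h x) y = J x y"
proof -
 have "(\<Sum>g\<in>W. E y (g (h x))) = (\<Sum>g\<in>W. E y ((g \<circ> h) x))" by simp
 also have "\<dots> = (\<Sum>g\<in>W. E y (g x))"
  by (rule sum.reindex_bij_betw[OF bij_betw_weyl_group_compose(1)[OF h]])
 finally show ?thesis unfolding J_symmetric[of _ y] by (simp add: dunkl_bessel_real_eq)
qed

lemma E_measurable:
 assumes "f \<in> borel_measurable M" "g \<in> borel_measurable M"
 shows "(\<lambda>x. E (f x) (g x)) \<in> borel_measurable M"
 by (rule borel_measurable_continuous_Pair[OF assms continuous_E])

lemma J_measurable:
 assumes "f \<in> borel_measurable M" "g \<in> borel_measurable M"
 shows "(\<lambda>x. J (f x) (g x)) \<in> borel_measurable M"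
 by (rule borel_measurable_continuous_Pair[OF assms continuous_J])

lemma integrable_surface_bounded:
 fixes f :: "real ^ 'n \<Rightarrow> real"
 assumes "f \<in> borel_measurable borel" and B: "\<And>z. norm z = 1 \<Longrightarrow> \<bar>f z\<bar> \<le> B"
 shows "integrable surface_measure f"
 by (rule surface.integrable_const_bound[of _ B])
   (use assms AE_surface_norm in \<open>auto elim!: eventually_mono\<close>)

lemma spherical_mean_E:
 "(\<integral>z. E (r *\<^sub>R z) y * weight z \<partial>surface_measure)
  = sphere_const Rp k * spherical_bessel_imag bessel_index (norm y * r)"
proof -
 let ?f = "\<lambda>z. dunkl_kernel Rp k z (cvec y)"
 let ?h = "\<lambda>z. weight z *\<^sub>R ?f (of_real r *s cvec z)"
 have int: "integrable surface_measure ?h"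
 proof (rule surface.integrable_const_bound[of _ "exp expo * (cardK * exp (\<bar>r\<bar> * norm y))"])
  have "(\<lambda>z. ?f (of_real r *s cvec z)) \<in> borel_measurable borel"
   by (rule borel_measurable_continuous_onI[OF continuous_on_eigen_ray[OF eigen_kernel continuous_on_id]])
  then show "?h \<in> borel_measurable surface_measure" by measurable
  show "AE z in surface_measure. norm (?h z) \<le> exp expo * (cardK * exp (\<bar>r\<bar> * norm y))"
   using AE_surface_norm
  proof eventually_elim
   case (elim z)
   have "norm (?h z) = weight z * norm (?f (of_real r *s cvec z))" using weight_nonneg by simp
   also have "\<dots> \<le> exp expo * (cardK * exp (\<bar>r\<bar> * norm y))"
    using eigen_growth'[OF eigen_kernel, of "of_real r *s cvec z" y] weight_sphere_bound[OF elim] elim weight_nonneg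
    by (intro mult_mono) (auto simp: norm_vec_smult)
   finally show ?case .
  qed
 qed
 have "(\<integral>z. E (r *\<^sub>R z) y * weight z \<partial>surface_measure) = (\<integral>z. Re (?h z) \<partial>surface_measure)"
  by (intro Bochner_Integration.integral_cong refl) (simp add: dunkl_kernel_real_def)
 also have "\<dots> = Re (\<integral>z. ?h z \<partial>surface_measure)" by (rule integral_Re[OF int])
 also have "\<dots> = sphere_const Rp k * spherical_bessel_imag bessel_index (norm y * r)"
  unfolding spherical_mean[OF eigen_kernel] sphere_const_total Re_complex_of_real ..
 finally show ?thesis .
qed

lemma integrable_E_weight:
 "integrable surface_measure (\<lambda>z. E (r *\<^sub>R z) y * weight z)"
proof (rule integrable_surface_bounded[where B="cardK * exp (\<bar>r\<bar> * norm y) * exp expo"])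
 show "(\<lambda>z. E (r *\<^sub>R z) y * weight z) \<in> borel_measurable borel"
  by (intro borel_measurable_times E_measurable weight_measurable) measurable
 fix z :: "real ^ 'n" assume z: "norm z = 1"
 show "\<bar>E (r *\<^sub>R z) y * weight z\<bar> \<le> cardK * exp (\<bar>r\<bar> * norm y) * exp expo"
  unfolding abs_mult using E_bound[of "r *\<^sub>R z" y] weight_nonneg[of z] weight_sphere_bound[OF z] z cardK_nonneg
  by (intro mult_mono) auto
qed

lemma spherical_mean_J:
 "(\<integral>z. J (r *\<^sub>R z) y * weight z \<partial>surface_measure)
  = sphere_const Rp k * spherical_bessel_imag bessel_index (norm y * r)"
proof -
 have "(\<integral>z. J (r *\<^sub>R z) y * weight z \<partial>surface_measure)
  = (\<integral>z. (\<Sum>g\<in>W. E (r *\<^sub>R z) (g y) * weight z) / real (card W) \<partial>surface_measure)"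
  by (simp add: dunkl_bessel_real_eq sum_distrib_right)
 also have "\<dots> = (\<Sum>g\<in>W. (\<integral>z. E (r *\<^sub>R z) (g y) * weight z \<partial>surface_measure)) / real (card W)"
  by (simp add: Bochner_Integration.integral_sum integrable_E_weight)
 also have "\<dots> = sphere_const Rp k * spherical_bessel_imag bessel_index (norm y * r)"
  using card_W_pos by (simp add: spherical_mean_E weyl_group_norm cong: sum.cong)
 finally show ?thesis .
qed

end

section \<open>Radial laws and the radial part of the semigroup\<close>

text \<open>On the chamber \<open>q\<close> is the Bessel function and \<open>c\<close> the order of the group; on the whole space \<open>q\<close> is the
 Dunkl kernel and \<open>c = 1\<close>.\<close>

locale drift_semigroup = dunkl_kernel_setting R Rp k
 for R Rp :: "(real ^ 'n) set" and k +
 fixes S :: "(real ^ 'n) set" and c :: real and q :: "real ^ 'n \<Rightarrow> real ^ 'n \<Rightarrow> real" and lam :: "real ^ 'n"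
  and K :: "real \<Rightarrow> real ^ 'n \<Rightarrow> (real ^ 'n) measure"
 assumes closed_S: "closed S" and cone: "\<And>r x. r \<ge> 0 \<Longrightarrow> x \<in> S \<Longrightarrow> r *\<^sub>R x \<in> S" and S_nonempty: "S \<noteq> {}"
  and K: "feller_kernels S K"
  and density: "\<And>t x A. t > 0 \<Longrightarrow> x \<in> S \<Longrightarrow> A \<in> sets (borel_on S) \<Longrightarrow> measure (K t x) A =
   c * dunkl_const Rp k * exp (- (norm lam)\<^sup>2 * t / 2) / t powr (gamma_index Rp k + real CARD('n) / 2) *
   (LINT y:A|lborel. exp (- ((norm x)\<^sup>2 + (norm y)\<^sup>2) / (2 * t)) *
    (q (x /\<^sub>R sqrt t) (y /\<^sub>R sqrt t) * dunkl_bessel_real R Rp k y lam / dunkl_bessel_real R Rp k x lam) * weight y)"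
begin

abbreviation d where "d \<equiv> sphere_const Rp k"
abbreviation j where "j \<equiv> spherical_bessel_imag bessel_index"
abbreviation w where "w \<equiv> weight"
abbreviation jl where "jl y \<equiv> J y lam"

lemma j_ge_1: "j x \<ge> 1" by (rule spherical_bessel_imag_ge_1[OF bessel_index_ge])

lemma j_pos: "j x > 0" using j_ge_1[of x] by simp

lemma continuous_j: "continuous_on A j"
 by (rule continuous_on_subset[OF continuous_spherical_bessel_imag[OF bessel_index_ge]]) simp

lemma j_measurable [measurable]: "j \<in> borel_measurable borel"
 by (rule borel_measurable_continuous_onI[OF continuous_j])

lemma jl_measurable [measurable]: "jl \<in> borel_measurable borel"
 by (rule J_measurable) simp_all

lemma continuous_jl: "continuous_on A jl"
proof -
 have "continuous_on A (\<lambda>y. (y, lam))" by (intro continuous_intros)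
 from continuous_on_compose2[OF continuous_J this] show ?thesis by simp
qed

lemma S_borel [measurable]: "S \<in> sets borel" using closed_S by (rule borel_closed)

lemma zero_in_S: "0 \<in> S" using S_nonempty cone[of 0] by auto

lemma sets_borel_on_S: "A \<in> sets (borel_on S) \<longleftrightarrow> A \<subseteq> S \<and> A \<in> sets borel"
 by (subst sets_restrict_space_iff) auto

lemma kernel_K: "t > 0 \<Longrightarrow> K t \<in> borel_on S \<rightarrow>\<^sub>M prob_algebra (borel_on S)"
 using K by (simp add: feller_kernels_def)

text \<open>Where \<open>J(x,\<lambda>)\<close> vanished, the transition density from \<open>x\<close> would be identically \<open>0\<close>; as
 \<open>J(0,\<lambda>) = 1\<close>, the sign is constant along rays.\<close>

lemma jl_nonzero:
 assumes x: "x \<in> S"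
 shows "jl x \<noteq> 0"
proof
 assume "jl x = 0"
 moreover have "S \<in> sets (borel_on S)" by (simp add: sets_borel_on_S)
 ultimately have "measure (K 1 x) S = 0" using density[of 1 x S] x by simp
 moreover have "prob_space (K 1 x)" "space (K 1 x) = S"
  using prob_kernelD[OF kernel_K, of 1 x] x by simp_all
 ultimately show False using prob_space.prob_space[of "K 1 x"] by simp
qed

lemma jl_pos:
 assumes x: "x \<in> S"
 shows "jl x > 0"
proof (rule ccontr)
 assume "\<not> jl x > 0"
 then have le: "jl (1 *\<^sub>R x) \<le> 0" by simp
 have "continuous_on {0..1} (\<lambda>s. jl (s *\<^sub>R x))"
  by (rule continuous_on_compose2[OF continuous_jl[of UNIV]]) (auto intro!: continuous_intros)
 then obtain s where "0 \<le> s" "s \<le> 1" "jl (s *\<^sub>R x) = 0"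
  using IVT2'[of "\<lambda>s. jl (s *\<^sub>R x)" 1 0 0] le by (auto simp: J_0)
 then show False using jl_nonzero[OF cone[OF _ x]] by auto
qed

end

text \<open>The two spherical means are what makes the norm of the process Markovian.\<close>

locale radial_setting = drift_semigroup R Rp k S c q lam K
 for R Rp :: "(real ^ 'n) set" and k S c q lam K +
 assumes c_pos: "c > 0"
  and continuous_q: "continuous_on UNIV (\<lambda>p. q (fst p) (snd p))"
  and q_bound: "\<And>x y. \<bar>q x y\<bar> \<le> cardK * exp (norm x * norm y)"
  and q_scale: "\<And>a x y. a \<noteq> 0 \<Longrightarrow> q (a *\<^sub>R x) y = q x (a *\<^sub>R y)"
  and q_mean: "\<And>r y. r \<ge> 0 \<Longrightarrow> y \<in> S \<Longrightarrow> c * (LINT z:sphere 0 1 \<inter> S|surface_measure. q (r *\<^sub>R z) y * weight z)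
   = sphere_const Rp k * spherical_bessel_imag bessel_index (norm y * r)"
  and J_mean: "\<And>r. r \<ge> 0 \<Longrightarrow> c * (LINT z:sphere 0 1 \<inter> S|surface_measure. dunkl_bessel_real R Rp k (r *\<^sub>R z) lam * weight z)
   = sphere_const Rp k * spherical_bessel_imag bessel_index (norm lam * r)"
begin

lemma q_measurable:
 assumes "f \<in> borel_measurable M" "g \<in> borel_measurable M"
 shows "(\<lambda>x. q (f x) (g x)) \<in> borel_measurable M"
 by (rule borel_measurable_continuous_Pair[OF assms continuous_q])

lemma jl_le: "jl x \<le> cardK * exp (norm x * norm lam)" using J_bound[of x lam] by simp

text \<open>The density of the radial law with respect to the surface measure.\<close>

definition u :: "real \<Rightarrow> real ^ 'n \<Rightarrow> real" where
 "u r z = indicator (sphere 0 1 \<inter> S) z * (c / d * jl (r *\<^sub>R z) / j (norm lam * r) * w z)"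

text \<open>The value \<open>0\<close> off \<open>S\<close> only makes the dilation a map into \<open>S\<close>.\<close>

definition dil :: "real \<Rightarrow> real ^ 'n \<Rightarrow> real ^ 'n" where "dil r z = (if z \<in> S then r *\<^sub>R z else 0)"

text \<open>The radial measures are the mixtures of these laws.\<close>

definition \<Lambda> :: "real \<Rightarrow> (real ^ 'n) measure" where
 "\<Lambda> r = distr (density surface_measure (\<lambda>z. ennreal (u r z))) (borel_on S) (dil r)"

lemma sphere_S_borel [measurable]: "sphere 0 1 \<inter> S \<in> sets borel"
 using closed_S by (intro borel_closed closed_Int) auto

lemma u_measurable:
 assumes [measurable]: "f \<in> borel_measurable M" "g \<in> borel_measurable M"
 shows "(\<lambda>x. u (f x) (g x)) \<in> borel_measurable M"
proof -
 have [measurable]: "(\<lambda>x. jl (f x *\<^sub>R g x)) \<in> borel_measurable M" by (intro J_measurable) measurable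
 show ?thesis unfolding u_def by measurable
qed

lemma u_measurable' [measurable]: "u r \<in> borel_measurable borel"
 by (rule u_measurable[of "\<lambda>_. r" borel "\<lambda>z. z"]) simp_all

lemma u_nonneg: "r \<ge> 0 \<Longrightarrow> u r z \<ge> 0"
 using jl_pos[of "r *\<^sub>R z"] cone[of r z] j_pos[of "norm lam * r"] c_pos sphere_const_pos weight_nonneg[of z]
 by (auto simp: u_def indicator_def intro!: mult_nonneg_nonneg divide_nonneg_pos)

lemma dil_in_S: "r \<ge> 0 \<Longrightarrow> dil r z \<in> S" using cone zero_in_S by (simp add: dil_def)

lemma dil_measurable_borel [measurable]: "dil r \<in> borel_measurable borel"
 unfolding dil_def[abs_def] by measurable

lemma dil_measurable: "r \<ge> 0 \<Longrightarrow> dil r \<in> borel \<rightarrow>\<^sub>M borel_on S"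
 by (intro measurable_restrict_space2) (auto simp: dil_in_S)

lemma norm_dil: "r \<ge> 0 \<Longrightarrow> u r z \<noteq> 0 \<Longrightarrow> norm (dil r z) = r"
 by (auto simp: u_def dil_def indicator_def split: if_splits)

lemma
 assumes r: "r \<ge> 0"
 shows nn_integral_\<Lambda>: "f \<in> borel_measurable (borel_on S) \<Longrightarrow> (\<integral>\<^sup>+x. f x \<partial>\<Lambda> r) = (\<integral>\<^sup>+z. ennreal (u r z) * f (dil r z) \<partial>surface_measure)"
  and integral_\<Lambda>: "g \<in> borel_measurable (borel_on S) \<Longrightarrow> (\<integral>x. g x \<partial>\<Lambda> r) = (\<integral>z. u r z * (g (dil r z) :: real) \<partial>surface_measure)"
proof -
 have m: "dil r \<in> density surface_measure (\<lambda>z. ennreal (u r z)) \<rightarrow>\<^sub>M borel_on S"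
  using dil_measurable[OF r] by (simp add: measurable_cong_sets[OF sets_density refl] measurable_cong_sets[OF sets_surface_measure refl])
 show "(\<integral>\<^sup>+x. f x \<partial>\<Lambda> r) = (\<integral>\<^sup>+z. ennreal (u r z) * f (dil r z) \<partial>surface_measure)" if f: "f \<in> borel_measurable (borel_on S)"
 proof -
  have [measurable]: "(\<lambda>z. f (dil r z)) \<in> borel_measurable borel" by (rule measurable_compose[OF dil_measurable[OF r] f])
  have "f \<in> borel_measurable (distr (density surface_measure (\<lambda>z. ennreal (u r z))) (borel_on S) (dil r))"
   using f by simp
  from nn_integral_distr[OF m this] show ?thesis
   unfolding \<Lambda>_def by (simp only:) (rule nn_integral_density; measurable)
 qed
 show "(\<integral>x. g x \<partial>\<Lambda> r) = (\<integral>z. u r z * g (dil r z) \<partial>surface_measure)" if g: "g \<in> borel_measurable (borel_on S)"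
 proof -
  have [measurable]: "(\<lambda>z. g (dil r z)) \<in> borel_measurable borel" by (rule measurable_compose[OF dil_measurable[OF r] g])
  show ?thesis unfolding \<Lambda>_def integral_distr[OF m g]
   by (subst integral_density) (use u_nonneg[OF r] in auto)
 qed
qed

lemma sets_\<Lambda>: "sets (\<Lambda> r) = sets (borel_on S)" by (simp add: \<Lambda>_def)

lemma space_\<Lambda>: "space (\<Lambda> r) = S" by (simp add: \<Lambda>_def)

lemma emeasure_\<Lambda>:
 assumes "r \<ge> 0" "A \<in> sets (borel_on S)"
 shows "emeasure (\<Lambda> r) A = (\<integral>\<^sup>+z. ennreal (u r z) * indicator A (dil r z) \<partial>surface_measure)"
 using nn_integral_\<Lambda>[OF assms(1), of "indicator A"] assms(2) by (simp add: sets_\<Lambda>)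

lemma u_le:
 assumes "\<bar>r\<bar> \<le> b"
 shows "\<bar>u r z\<bar> \<le> c / d * (cardK * exp (b * norm lam)) * exp expo"
proof (cases "z \<in> sphere 0 1 \<inter> S")
 case True
 have "\<bar>jl (r *\<^sub>R z)\<bar> \<le> cardK * exp (\<bar>r\<bar> * norm lam)" using J_bound[of "r *\<^sub>R z" lam] True by simp
 also have "\<dots> \<le> cardK * exp (b * norm lam)" using assms cardK_nonneg by (intro mult_left_mono) (auto intro: mult_right_mono)
 finally have 1: "\<bar>jl (r *\<^sub>R z)\<bar> \<le> cardK * exp (b * norm lam)" .
 have 2: "\<bar>jl (r *\<^sub>R z)\<bar> / j (norm lam * r) \<le> \<bar>jl (r *\<^sub>R z)\<bar>"
  using mult_left_mono[OF j_ge_1[of "norm lam * r"], of "\<bar>jl (r *\<^sub>R z)\<bar>"] j_pos[of "norm lam * r"]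
  by (simp add: divide_le_eq)
 have 3: "w z \<le> exp expo" by (rule weight_sphere_bound) (use True in simp)
 have "\<bar>u r z\<bar> = c / d * (\<bar>jl (r *\<^sub>R z)\<bar> / j (norm lam * r)) * w z"
  using True c_pos sphere_const_pos j_pos[of "norm lam * r"] weight_nonneg[of z] by (simp add: u_def abs_mult)
 also have "\<dots> \<le> c / d * (cardK * exp (b * norm lam)) * exp expo"
  using order_trans[OF 2 1] 3 c_pos sphere_const_pos weight_nonneg[of z] cardK_nonneg
   j_pos[of "norm lam * r"]
  by (intro mult_mono) auto
 finally show ?thesis .
qed (use c_pos sphere_const_pos cardK_nonneg in \<open>simp add: u_def\<close>)

lemma u_integrable: "integrable surface_measure (u r)"
 by (rule integrable_surface_bounded) (auto intro: u_le[OF order_refl])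

lemma integral_u:
 assumes r: "r \<ge> 0"
 shows "(\<integral>z. u r z \<partial>surface_measure) = 1"
proof -
 have "(\<integral>z. u r z \<partial>surface_measure)
  = (\<integral>z. (1 / (d * j (norm lam * r))) * (c * (indicator (sphere 0 1 \<inter> S) z *\<^sub>R (jl (r *\<^sub>R z) * w z))) \<partial>surface_measure)"
  by (intro Bochner_Integration.integral_cong refl) (simp add: u_def)
 also have "\<dots> = (1 / (d * j (norm lam * r))) * (c * (LINT z:sphere 0 1 \<inter> S|surface_measure. jl (r *\<^sub>R z) * w z))"
  unfolding set_lebesgue_integral_def by (simp only: integral_mult_right_zero)
 also have "\<dots> = 1" unfolding J_mean[OF r] using sphere_const_pos j_pos[of "norm lam * r"] by simp
 finally show ?thesis .
qed

lemma prob_space_\<Lambda>: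
 assumes r: "r \<ge> 0"
 shows "prob_space (\<Lambda> r)"
proof
 have "S \<in> sets (borel_on S)" by (simp add: sets_borel_on_S)
 from emeasure_\<Lambda>[OF r this] have "emeasure (\<Lambda> r) S = (\<integral>\<^sup>+z. ennreal (u r z) \<partial>surface_measure)"
  by (simp add: dil_in_S[OF r])
 also have "\<dots> = ennreal (\<integral>z. u r z \<partial>surface_measure)"
  by (rule nn_integral_eq_integral[OF u_integrable]) (simp add: u_nonneg[OF r])
 finally show "emeasure (\<Lambda> r) (space (\<Lambda> r)) = 1" by (simp add: space_\<Lambda> integral_u[OF r])
qed

lemma AE_\<Lambda>_norm:
 assumes r: "r \<ge> 0"
 shows "AE x in \<Lambda> r. norm x = r"
proof -
 have m: "(\<lambda>x. norm x) \<in> borel_measurable (borel_on S)" by (intro measurable_restrict_space1) measurable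
 have A: "{x \<in> S. norm x \<noteq> r} \<in> sets (borel_on S)"
  unfolding sets_borel_on_S by (auto intro: measurable_sets_borel)
 have "emeasure (\<Lambda> r) {x \<in> S. norm x \<noteq> r} = (\<integral>\<^sup>+z. 0 \<partial>(surface_measure :: (real ^ 'n) measure))"
  unfolding emeasure_\<Lambda>[OF r A] using norm_dil[OF r]
  by (intro nn_integral_cong) (force simp: indicator_def)
 then have "emeasure (\<Lambda> r) {x \<in> S. norm x \<noteq> r} = 0" by simp
 then show ?thesis
  by (intro AE_I[of _ _ "{x \<in> S. norm x \<noteq> r}"]) (auto simp: space_\<Lambda> sets_\<Lambda> A)
qed

lemma kernel_\<Lambda>: "\<Lambda> \<in> borel_on {0..} \<rightarrow>\<^sub>M prob_algebra (borel_on S)"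
proof (intro measurable_prob_algebraI measurable_subprob_algebra)
 fix A assume A: "A \<in> sets (borel_on S)"
 then have [measurable]: "A \<in> sets borel" by (simp add: sets_borel_on_S)
 interpret surface: sigma_finite_measure "surface_measure :: (real ^ 'n) measure" ..
 have [measurable]: "(\<lambda>p. u (fst p) (snd p)) \<in> borel_measurable (borel \<Otimes>\<^sub>M borel)"
  by (intro u_measurable) measurable
 have [measurable]: "(\<lambda>p. dil (fst p) (snd p)) \<in> borel_measurable (borel \<Otimes>\<^sub>M borel)"
  unfolding dil_def by measurable
 have "(\<lambda>(r, z). ennreal (u r z) * indicator A (dil r z)) \<in> borel_measurable (borel \<Otimes>\<^sub>M surface_measure)"
  unfolding split_beta by measurable
 from surface.borel_measurable_nn_integral[OF this]
 have "(\<lambda>r. \<integral>\<^sup>+z. ennreal (u r z) * indicator A (dil r z) \<partial>surface_measure) \<in> borel_measurable (borel_on {0..})"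
  by (rule measurable_restrict_space1)
 then show "(\<lambda>r. emeasure (\<Lambda> r) A) \<in> borel_measurable (borel_on {0..})"
  by (subst measurable_cong[OF emeasure_\<Lambda>[OF _ A]]) simp_all
qed (auto simp: prob_space_\<Lambda> sets_\<Lambda> prob_space_imp_subprob_space)

text \<open>The transition density of the one-dimensional Bessel process with drift.\<close>

definition q1 :: "real \<Rightarrow> real \<Rightarrow> real \<Rightarrow> real" where
 "q1 t r s = dunkl_const Rp k * d * exp (- (norm lam)\<^sup>2 * t / 2) / t powr (gamma_index Rp k + real CARD('n) / 2)
   * (exp (- (r\<^sup>2 + s\<^sup>2) / (2 * t)) * (j (r * s / t) * j (s * norm lam) / j (r * norm lam))
   * (indicator {0<..} s * (s ^ (CARD('n) - 1) * s powr (2 * gamma_index Rp k))))"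

lemma dunkl_const_pos: "dunkl_const Rp k > 0" using total_pos by (simp add: dunkl_const_eq)

lemma q1_nonneg: "t > 0 \<Longrightarrow> q1 t r s \<ge> 0"
 unfolding q1_def using dunkl_const_pos sphere_const_pos j_pos[of "r * s / t"] j_pos[of "s * norm lam"] j_pos[of "r * norm lam"]
 by (auto simp: indicator_def)

lemma q1_measurable [measurable]: "q1 t r \<in> borel_measurable borel"
 unfolding q1_def[abs_def] by measurable

text \<open>Integrating the transition density against \<open>\<Lambda>\<^sub>r\<close> cancels the factor \<open>J(x,\<lambda>)\<close> in the
 denominator and leaves a spherical mean of \<open>q(\<cdot>,y)\<close>, which depends on \<open>|y|\<close> only.\<close>

lemma intertwining_density:
 assumes t: "t > 0" and r: "r \<ge> 0" and A: "A \<in> sets (borel_on S)"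
 shows "(\<integral>\<^sup>+x. emeasure (K t x) A \<partial>\<Lambda> r) = (\<integral>\<^sup>+s. ennreal (q1 t r s) * emeasure (\<Lambda> s) A \<partial>lborel)"
proof -
 have AS: "A \<subseteq> S" and Ab [measurable]: "A \<in> sets borel" using A by (auto simp: sets_borel_on_S)
 define C where "C = c * dunkl_const Rp k * exp (- (norm lam)\<^sup>2 * t / 2) / t powr (gamma_index Rp k + real CARD('n) / 2)"
 have C: "C > 0" using c_pos dunkl_const_pos t by (simp add: C_def)
 define D where "D = c / d / j (norm lam * r) * C"
 have D: "D > 0" using c_pos sphere_const_pos C j_pos by (simp add: D_def)
 define v where "v z = indicator (sphere 0 1 \<inter> S) z * w z" for z
 define h where "h y = exp (- (r\<^sup>2 + (norm y)\<^sup>2) / (2 * t)) * jl y * w y" for y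
 define F where "F z y = D * (v z * (indicator A y * (h y * q (r *\<^sub>R z) (y /\<^sub>R t))))" for z y
 define G where "G y = C / j (norm lam * r) * (indicator A y * (h y * j (norm y / t * r)))" for y
 have h_m [measurable]: "h \<in> borel_measurable borel" unfolding h_def[abs_def] by measurable
 have v_m [measurable]: "v \<in> borel_measurable borel" unfolding v_def[abs_def] by measurable
 have kt: "prob_space (K t x)" "sets (K t x) = sets (borel_on S)" if "x \<in> S" for x
  using prob_kernelD[OF kernel_K[OF t], of x] that by simp_all
 have qs: "q (x /\<^sub>R sqrt t) (y /\<^sub>R sqrt t) = q x (y /\<^sub>R t)" for x y
 proof -
  have "inverse (sqrt t) * inverse (sqrt t) = inverse t" using t by (simp flip: inverse_mult_distrib)
  then show ?thesis using q_scale[of "inverse (sqrt t)" x "y /\<^sub>R sqrt t"] t by simp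
 qed
 (* The factor jl (r z) of u cancels the denominator of the transition density. *)
 have start: "u r z * measure (K t (dil r z)) A = (\<integral>y. F z y \<partial>lborel)" for z
 proof (cases "z \<in> sphere 0 1 \<inter> S")
  case True
  then have z: "r *\<^sub>R z \<in> S" "norm z = 1" "z \<in> S" using cone r by auto
  have "(\<integral>y. F z y \<partial>lborel) = (\<integral>y. (D * w z * jl (r *\<^sub>R z)) * (indicator A y *\<^sub>R (exp (- ((norm (r *\<^sub>R z))\<^sup>2 + (norm y)\<^sup>2) / (2 * t)) *
    (q ((r *\<^sub>R z) /\<^sub>R sqrt t) (y /\<^sub>R sqrt t) * jl y / jl (r *\<^sub>R z)) * w y)) \<partial>lborel)"
   using jl_pos[OF z(1)] True unfolding qs
   by (intro Bochner_Integration.integral_cong refl) (simp add: F_def v_def h_def z(2) power_mult_distrib)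
  also have "\<dots> = (D * w z * jl (r *\<^sub>R z)) * (LINT y:A|lborel. exp (- ((norm (r *\<^sub>R z))\<^sup>2 + (norm y)\<^sup>2) / (2 * t)) *
    (q ((r *\<^sub>R z) /\<^sub>R sqrt t) (y /\<^sub>R sqrt t) * jl y / jl (r *\<^sub>R z)) * w y)"
   unfolding set_lebesgue_integral_def by (simp only: integral_mult_right_zero)
  also have "\<dots> = (c / d / j (norm lam * r) * w z * jl (r *\<^sub>R z)) * measure (K t (r *\<^sub>R z)) A"
   unfolding density[OF t z(1) A] by (simp add: D_def C_def)
  also have "\<dots> = u r z * measure (K t (dil r z)) A"
   using True by (simp add: u_def dil_def)
  finally show ?thesis ..
 qed (simp add: u_def F_def v_def)
 interpret P: pair_sigma_finite "surface_measure :: (real ^ 'n) measure" lborel ..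
 define B where "B y = D * exp expo * cardK * cardK * exp ((r / t + norm lam + expo) * norm y - (1 / (2 * t)) * (norm y)\<^sup>2)" for y :: "real ^ 'n"
 have F_le: "norm (F z y) \<le> B y" for z y
 proof (cases "z \<in> sphere 0 1 \<inter> S \<and> y \<in> A")
  case True
  have "norm (F z y) = D * (w z * ((exp (- (r\<^sup>2 + (norm y)\<^sup>2) / (2 * t)) * jl y * w y) * \<bar>q (r *\<^sub>R z) (y /\<^sub>R t)\<bar>))"
   using True D weight_nonneg[of z] weight_nonneg[of y] jl_pos[of y] AS by (simp add: F_def v_def h_def abs_mult subset_iff)
  also have "\<dots> \<le> D * (exp expo * ((exp (- (1 / (2 * t)) * (norm y)\<^sup>2) * (cardK * exp (norm y * norm lam)) * exp (expo * norm y)) * (cardK * exp (r / t * norm y))))"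
  proof (intro mult_left_mono mult_mono weight_le jl_le)
   show "w z \<le> exp expo" by (rule weight_sphere_bound) (use True in simp)
   show "exp (- (r\<^sup>2 + (norm y)\<^sup>2) / (2 * t)) \<le> exp (- (1 / (2 * t)) * (norm y)\<^sup>2)"
    using t by (simp add: field_simps)
   show "\<bar>q (r *\<^sub>R z) (y /\<^sub>R t)\<bar> \<le> cardK * exp (r / t * norm y)"
    using q_bound[of "r *\<^sub>R z" "y /\<^sub>R t"] True r t by (simp add: divide_inverse ac_simps)
  qed (use D True AS jl_pos[of y] weight_nonneg cardK_nonneg in \<open>auto intro!: mult_nonneg_nonneg\<close>)
  also have "\<dots> = B y"
  proof -
   have "exp ((r / t + norm lam + expo) * norm y - (1 / (2 * t)) * (norm y)\<^sup>2)
    = exp (- (1 / (2 * t)) * (norm y)\<^sup>2) * exp (norm y * norm lam) * exp (expo * norm y) * exp (r / t * norm y)"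
    by (simp add: mult_exp_exp distrib_right)
   then show ?thesis unfolding B_def by (simp only: ac_simps)
  qed
  finally show ?thesis .
 qed (use D cardK_nonneg in \<open>auto simp: F_def v_def B_def\<close>)
 have B_int: "integrable lborel B"
  unfolding B_def[abs_def] using t by (intro integrable_mult_right integrable_exp_linear_minus_square) simp
 have F_m: "case_prod F \<in> borel_measurable (surface_measure \<Otimes>\<^sub>M lborel)"
 proof -
  have [measurable]: "(\<lambda>p. q (r *\<^sub>R fst p) (snd p /\<^sub>R t)) \<in> borel_measurable ((borel :: (real ^ 'n) measure) \<Otimes>\<^sub>M borel)"
   by (intro q_measurable) measurable
  show ?thesis unfolding F_def split_beta by measurable
 qed
 have F_int: "integrable (surface_measure \<Otimes>\<^sub>M lborel) (case_prod F)"
 proof (rule Bochner_Integration.integrable_bound)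
  have [measurable]: "B \<in> borel_measurable borel" using B_int by simp
  show "integrable ((surface_measure :: (real ^ 'n) measure) \<Otimes>\<^sub>M lborel) (\<lambda>p. B (snd p))"
  proof (rule P.Fubini_integrable)
   show "(\<lambda>p. B (snd p)) \<in> borel_measurable ((surface_measure :: (real ^ 'n) measure) \<Otimes>\<^sub>M lborel)" by measurable
  qed (use B_int in auto)
  show "AE p in surface_measure \<Otimes>\<^sub>M lborel. norm (case_prod F p) \<le> norm (B (snd p))"
  proof (rule AE_I2)
   fix p :: "(real ^ 'n) \<times> (real ^ 'n)"
   show "norm (case_prod F p) \<le> norm (B (snd p))"
    using order_trans[OF F_le abs_ge_self] by (simp add: split_beta)
  qed
 qed (rule F_m)
 have mean: "(\<integral>z. F z y \<partial>surface_measure) = G y" for y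
 proof (cases "y \<in> A")
  case True
  then have yS: "y /\<^sub>R t \<in> S" using AS cone[of "inverse t" y] t by auto
  have "(\<integral>z. F z y \<partial>surface_measure)
   = (\<integral>z. (D * h y / c) * (c * (indicator (sphere 0 1 \<inter> S) z *\<^sub>R (q (r *\<^sub>R z) (y /\<^sub>R t) * w z))) \<partial>surface_measure)"
   using True c_pos by (intro Bochner_Integration.integral_cong refl) (simp add: F_def v_def)
  also have "\<dots> = (D * h y / c) * (c * (LINT z:sphere 0 1 \<inter> S|surface_measure. q (r *\<^sub>R z) (y /\<^sub>R t) * w z))"
   unfolding set_lebesgue_integral_def by (simp only: integral_mult_right_zero)
  also have "\<dots> = G y"
   unfolding q_mean[OF r yS] using True c_pos sphere_const_pos t
   by (simp add: G_def D_def divide_inverse ac_simps)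
  finally show ?thesis .
 qed (simp add: F_def G_def)
 have G_int: "integrable lborel G"
  using P.integrable_snd[OF F_int] by (simp add: mean)
 have G0: "G y \<ge> 0" for y
  using C j_pos[of "norm lam * r"] j_pos[of "norm y / t * r"] jl_pos[of y] weight_nonneg[of y] AS
  by (auto simp: G_def h_def indicator_def)
 have [measurable]: "G \<in> borel_measurable borel" using G_int by simp
 have bounded: "measure (K t x) A \<le> 1" if "x \<in> S" for x
  using prob_space.prob_le_1[OF kt(1)[OF that]] .
 have mK: "(\<lambda>x. measure (K t x) A) \<in> borel_measurable (borel_on S)"
  unfolding measure_def
  by (intro measurable_compose[OF prob_kernel_emeasure_measurable[OF kernel_K[OF t] A]]) measurable
 interpret L: prob_space "\<Lambda> r" by (rule prob_space_\<Lambda>[OF r])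
 have "(\<integral>\<^sup>+x. emeasure (K t x) A \<partial>\<Lambda> r) = (\<integral>\<^sup>+x. ennreal (measure (K t x) A) \<partial>\<Lambda> r)"
  by (intro nn_integral_cong finite_measure.emeasure_eq_measure prob_space.finite_measure kt(1)) (simp add: space_\<Lambda>)
 also have "\<dots> = ennreal (\<integral>x. measure (K t x) A \<partial>\<Lambda> r)"
 proof (rule nn_integral_eq_integral)
  show "integrable (\<Lambda> r) (\<lambda>x. measure (K t x) A)"
   by (rule prob_space_bounded_integrable[OF prob_space_\<Lambda>[OF r], of _ 1])
     (use mK bounded in \<open>auto simp: space_\<Lambda> measurable_cong_sets[OF sets_\<Lambda> refl]\<close>)
 qed simp
 also have "(\<integral>x. measure (K t x) A \<partial>\<Lambda> r) = (\<integral>z. \<integral>y. F z y \<partial>lborel \<partial>surface_measure)"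
  unfolding integral_\<Lambda>[OF r mK] start ..
 also have "\<dots> = (\<integral>y. G y \<partial>lborel)"
  unfolding P.Fubini_integral[OF F_int, symmetric] mean ..
 also have "ennreal \<dots> = (\<integral>\<^sup>+y. ennreal (G y) \<partial>lborel)"
  by (rule nn_integral_eq_integral[OF G_int, symmetric]) (simp add: G0)
 also have "\<dots> = (\<integral>\<^sup>+s. indicator {0<..} s * ennreal (s ^ (CARD('n) - 1)) * (\<integral>\<^sup>+z. ennreal (G (s *\<^sub>R z)) \<partial>surface_measure) \<partial>lborel)"
  by (rule nn_integral_polar) measurable
 also have "\<dots> = (\<integral>\<^sup>+s. ennreal (q1 t r s) * emeasure (\<Lambda> s) A \<partial>lborel)"
 proof (intro nn_integral_cong)
  fix s :: real
  show "indicator {0<..} s * ennreal (s ^ (CARD('n) - 1)) * (\<integral>\<^sup>+z. ennreal (G (s *\<^sub>R z)) \<partial>surface_measure)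
   = ennreal (q1 t r s) * emeasure (\<Lambda> s) A"
  proof (cases "s > 0")
   case True
   have "ennreal (s ^ (CARD('n) - 1)) * (\<integral>\<^sup>+z. ennreal (G (s *\<^sub>R z)) \<partial>surface_measure)
    = (\<integral>\<^sup>+z. ennreal (s ^ (CARD('n) - 1)) * ennreal (G (s *\<^sub>R z)) \<partial>surface_measure)"
    by (rule nn_integral_cmult[symmetric]) measurable
   also have "\<dots> = (\<integral>\<^sup>+z. ennreal (q1 t r s) * (ennreal (u s z) * indicator A (dil s z)) \<partial>surface_measure)"
   proof (rule nn_integral_cong_AE)
    show "AE z in surface_measure. ennreal (s ^ (CARD('n) - 1)) * ennreal (G (s *\<^sub>R z)) = ennreal (q1 t r s) * (ennreal (u s z) * indicator A (dil s z))"
     using AE_surface_norm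
    proof eventually_elim
     case (elim z)
     show ?case
     proof (cases "s *\<^sub>R z \<in> A")
      case sA: True
      have zS: "z \<in> S" using cone[of "inverse s" "s *\<^sub>R z"] True AS sA by auto
      have pos: "j (s * norm lam) > 0" "j (r * norm lam) > 0" by (rule j_pos)+
      have "s ^ (CARD('n) - 1) * G (s *\<^sub>R z) = q1 t r s * u s z"
       using sA zS elim True c_pos sphere_const_pos pos
       by (simp add: G_def h_def q1_def u_def C_def weight_scale power_mult_distrib mult.commute[of "norm lam"] field_simps)
      then have "ennreal (s ^ (CARD('n) - 1)) * ennreal (G (s *\<^sub>R z)) = ennreal (q1 t r s) * ennreal (u s z)"
       using True G0 q1_nonneg[OF t] u_nonneg[of s z] by (simp flip: ennreal_mult)
      then show ?thesis using sA zS by (simp add: dil_def)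
     next
      case False
      then show ?thesis by (auto simp: G_def dil_def u_def indicator_def)
     qed
    qed
   qed
   also have "\<dots> = ennreal (q1 t r s) * emeasure (\<Lambda> s) A"
   proof -
    have [measurable]: "(\<lambda>z. indicator A (dil s z) :: ennreal) \<in> borel_measurable borel" by measurable
    show ?thesis unfolding emeasure_\<Lambda>[OF less_imp_le[OF True] A] by (rule nn_integral_cmult) measurable
   qed
   finally show ?thesis using True by simp
  qed (simp add: q1_def)
 qed
 finally show ?thesis .
qed

end

section \<open>The norm as an intertwined process\<close>

context radial_setting
begin

definition Q :: "real \<Rightarrow> real \<Rightarrow> real measure" where
 "Q t r = distr (\<Lambda> r \<bind> K t) (borel_on {0..}) norm"

lemma norm_measurable: "norm \<in> borel_on S \<rightarrow>\<^sub>M borel_on {0..}"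
 by (intro measurable_restrict_space2 measurable_restrict_space1) auto

lemma kernel_Q: "t > 0 \<Longrightarrow> Q t \<in> borel_on {0..} \<rightarrow>\<^sub>M prob_algebra (borel_on {0..})"
 unfolding Q_def[abs_def]
 by (intro measurable_compose[OF measurable_bind_prob_space[OF kernel_\<Lambda> kernel_K]] measurable_distr_prob_space norm_measurable)

lemma emeasure_Q:
 assumes t: "t > 0" and r: "r \<ge> 0" and B: "B \<in> sets (borel_on {0..})"
 shows "emeasure (Q t r) B = (\<integral>\<^sup>+s. ennreal (q1 t r s) * indicator B s \<partial>lborel)"
proof -
 let ?A = "norm -` B \<inter> S"
 have A: "?A \<in> sets (borel_on S)" using measurable_sets[OF norm_measurable B] by simp
 have \<Lambda>r: "\<Lambda> r \<in> space (prob_algebra (borel_on S))"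
  using prob_space_\<Lambda>[OF r] by (simp add: space_prob_algebra sets_\<Lambda>)
 have bind: "\<Lambda> r \<bind> K t \<in> space (prob_algebra (borel_on S))"
  using measurable_space[OF measurable_bind_prob_space[OF kernel_\<Lambda> kernel_K[OF t]], of r] r by simp
 then have sb: "sets (\<Lambda> r \<bind> K t) = sets (borel_on S)" by (simp add: space_prob_algebra)
 then have spb: "space (\<Lambda> r \<bind> K t) = S" using sets_eq_imp_space_eq[OF sb] by simp
 have "emeasure (Q t r) B = emeasure (\<Lambda> r \<bind> K t) ?A"
  unfolding Q_def using B norm_measurable
  by (subst emeasure_distr) (simp_all add: spb measurable_cong_sets[OF sb refl])
 also have "\<dots> = (\<integral>\<^sup>+x. emeasure (K t x) ?A \<partial>\<Lambda> r)"
  by (rule emeasure_bind_prob_algebra[OF \<Lambda>r kernel_K[OF t] A])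
 also have "\<dots> = (\<integral>\<^sup>+s. ennreal (q1 t r s) * emeasure (\<Lambda> s) ?A \<partial>lborel)"
  by (rule intertwining_density[OF t r A])
 also have "\<dots> = (\<integral>\<^sup>+s. ennreal (q1 t r s) * indicator B s \<partial>lborel)"
 proof (intro nn_integral_cong)
  fix s :: real
  show "ennreal (q1 t r s) * emeasure (\<Lambda> s) ?A = ennreal (q1 t r s) * indicator B s"
  proof (cases "s > 0")
   case True
   interpret L: prob_space "\<Lambda> s" by (rule prob_space_\<Lambda>) (use True in simp)
   have "emeasure (\<Lambda> s) ?A = (\<integral>\<^sup>+x. indicator ?A x \<partial>\<Lambda> s)" using A by (simp add: sets_\<Lambda>)
   also have "\<dots> = (\<integral>\<^sup>+x. indicator B s \<partial>\<Lambda> s)"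
   proof (rule nn_integral_cong_AE)
    have "AE x in \<Lambda> s. norm x = s \<and> x \<in> S"
     using AE_\<Lambda>_norm[of s] True AE_space[of "\<Lambda> s"] by (auto simp: space_\<Lambda>)
    then show "AE x in \<Lambda> s. indicator ?A x = (indicator B s :: ennreal)"
     by eventually_elim (auto simp: indicator_def)
   qed
   also have "\<dots> = indicator B s" by (simp add: L.emeasure_space_1)
   finally show ?thesis by simp
  qed (simp add: q1_def)
 qed
 finally show ?thesis .
qed

lemma Q_density:
 assumes t: "t > 0" and r: "r \<ge> 0"
 shows "Q t r = density (restrict_space lborel {0..}) (\<lambda>s. ennreal (q1 t r s))"
proof (rule measure_eqI)
 have s: "sets (restrict_space lborel {0..}) = sets (borel_on {0..})" by (rule sets_restrict_space_cong) simp
 then show "sets (Q t r) = sets (density (restrict_space lborel {0..}) (\<lambda>s. ennreal (q1 t r s)))"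
  unfolding Q_def sets_distr sets_density by (rule sym)
 fix B assume "B \<in> sets (Q t r)"
 then have B: "B \<in> sets (borel_on {0..})" by (simp add: Q_def)
 then have B0: "B \<subseteq> {0..}" using sets.sets_into_space[OF B] by simp
 have "emeasure (density (restrict_space lborel {0..}) (\<lambda>s. ennreal (q1 t r s))) B
  = (\<integral>\<^sup>+s. ennreal (q1 t r s) * indicator B s \<partial>restrict_space lborel {0..})"
  by (rule emeasure_density) (use B s in \<open>auto intro: measurable_restrict_space1\<close>)
 also have "\<dots> = (\<integral>\<^sup>+s. ennreal (q1 t r s) * indicator B s * indicator {0..} s \<partial>lborel)"
  by (rule nn_integral_restrict_space) simp
 also have "\<dots> = (\<integral>\<^sup>+s. ennreal (q1 t r s) * indicator B s \<partial>lborel)"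
  using B0 by (intro nn_integral_cong) (auto simp: indicator_def)
 finally show "emeasure (Q t r) B = emeasure (density (restrict_space lborel {0..}) (\<lambda>s. ennreal (q1 t r s))) B"
  by (simp add: emeasure_Q[OF t r B])
qed

lemma intertwining_norm: "intertwining S {0..} norm K Q \<Lambda>"
proof
 show "feller_kernels S K" by (rule K)
 show "(\<integral>\<^sup>+x. emeasure (K t x) A \<partial>\<Lambda> r) = (\<integral>\<^sup>+s. emeasure (\<Lambda> s) A \<partial>Q t r)"
  if "t > 0" "r \<in> {0..}" and A: "A \<in> sets (borel_on S)" for t r A
 proof -
  have t: "t > 0" and r: "r \<ge> 0" using that by auto
  have s: "sets (restrict_space lborel {0..}) = sets (borel_on {0..})" by (rule sets_restrict_space_cong) simp
  have m: "(\<lambda>s. emeasure (\<Lambda> s) A) \<in> borel_measurable (restrict_space lborel {0..})"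
   using prob_kernel_emeasure_measurable[OF kernel_\<Lambda> A] by (simp add: measurable_cong_sets[OF s refl])
  have "(\<integral>\<^sup>+s. emeasure (\<Lambda> s) A \<partial>Q t r) = (\<integral>\<^sup>+s. ennreal (q1 t r s) * emeasure (\<Lambda> s) A \<partial>restrict_space lborel {0..})"
   unfolding Q_density[OF t r] by (rule nn_integral_density) (use m in \<open>auto intro: measurable_restrict_space1\<close>)
  also have "\<dots> = (\<integral>\<^sup>+s. ennreal (q1 t r s) * emeasure (\<Lambda> s) A * indicator {0..} s \<partial>lborel)"
   by (rule nn_integral_restrict_space) simp
  also have "\<dots> = (\<integral>\<^sup>+s. ennreal (q1 t r s) * emeasure (\<Lambda> s) A \<partial>lborel)"
   by (intro nn_integral_cong) (auto simp: q1_def indicator_def)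
  also have "\<dots> = (\<integral>\<^sup>+x. emeasure (K t x) A \<partial>\<Lambda> r)" by (rule intertwining_density[OF t r A, symmetric])
  finally show ?thesis ..
 qed
qed (auto simp: closed_S norm_measurable kernel_\<Lambda> kernel_Q AE_\<Lambda>_norm)

lemma C0_norm:
 assumes f: "f \<in> C0_on {0..}"
 shows "(\<lambda>x. f (norm x)) \<in> C0_on S"
 unfolding C0_on_def
proof (intro CollectI conjI)
 have c: "continuous_on {0..} f" and l: "(f \<longlongrightarrow> 0) (inf at_infinity (principal {0..}))"
  using f by (auto simp: C0_on_def)
 show "continuous_on S (\<lambda>x. f (norm x))"
  by (rule continuous_on_compose2[OF c]) (auto intro!: continuous_intros)
 show "((\<lambda>x. f (norm x)) \<longlongrightarrow> 0) (inf at_infinity (principal S))"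
 proof (rule tendstoI)
  fix e :: real assume "e > 0"
  from tendstoD[OF l this] obtain b where "\<And>x. norm x \<ge> b \<Longrightarrow> x \<in> {0..} \<Longrightarrow> dist (f x) 0 < e"
   unfolding eventually_inf_principal eventually_at_infinity by blast
  then show "\<forall>\<^sub>F x in inf at_infinity (principal S). dist (f (norm x)) 0 < e"
   unfolding eventually_inf_principal eventually_at_infinity by (intro exI[of _ b]) simp
 qed
qed

text \<open>Continuity in the radius by dominated convergence; decay because \<open>\<Lambda> r\<close> lives on the sphere of radius \<open>r\<close>.\<close>

lemma C0_\<Lambda>:
 assumes g: "g \<in> C0_on S"
 shows "(\<lambda>r. \<integral>x. g x \<partial>\<Lambda> r) \<in> C0_on {0..}"
 unfolding C0_on_def
proof (intro CollectI conjI)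
 have c: "continuous_on S g" and l: "(g \<longlongrightarrow> 0) (inf at_infinity (principal S))"
  using g by (auto simp: C0_on_def)
 obtain B where B: "\<And>x. x \<in> S \<Longrightarrow> \<bar>g x\<bar> \<le> B" using C0_on_bounded[OF g closed_S] by blast
 have B0: "B \<ge> 0" using B[OF zero_in_S] by simp
 note gm = C0_on_measurable[OF g]
 show "continuous_on {0..} (\<lambda>r. \<integral>x. g x \<partial>\<Lambda> r)"
  unfolding continuous_on_sequentially
 proof (intro allI impI ballI)
  fix X and r :: real assume "r \<in> {0..}" and "(\<forall>n. X n \<in> {0..}) \<and> X \<longlonglongrightarrow> r"
  then have r: "r \<ge> 0" and X0: "\<And>n. X n \<ge> 0" and X: "X \<longlonglongrightarrow> r" by auto
  from X have "Bseq X" by (meson convergentI convergent_imp_Bseq)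
  then obtain b where "\<forall>n. norm (X n) \<le> b" by (rule BseqE)
  then have b: "\<bar>X n\<bar> \<le> b" for n by simp
  have gdm: "(\<lambda>z. g (dil s z)) \<in> borel_measurable borel" if "s \<ge> 0" for s
   by (rule measurable_compose[OF dil_measurable[OF that] gm])
  have "(\<lambda>n. \<integral>z. u (X n) z * g (dil (X n) z) \<partial>surface_measure) \<longlonglongrightarrow> (\<integral>z. u r z * g (dil r z) \<partial>surface_measure)"
  proof (rule integral_dominated_convergence[where w="\<lambda>_. c / d * (cardK * exp (b * norm lam)) * exp expo * B"])
   show "(\<lambda>z. u r z * g (dil r z)) \<in> borel_measurable surface_measure"
    using gdm[OF r] u_measurable'[of r] by simp
   show "(\<lambda>z. u (X n) z * g (dil (X n) z)) \<in> borel_measurable surface_measure" for n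
    using gdm[OF X0] u_measurable'[of "X n"] by simp
   show "AE z in surface_measure. norm (u (X n) z * g (dil (X n) z)) \<le> c / d * (cardK * exp (b * norm lam)) * exp expo * B" for n
   proof (rule AE_I2)
    fix z
    show "norm (u (X n) z * g (dil (X n) z)) \<le> c / d * (cardK * exp (b * norm lam)) * exp expo * B"
     unfolding real_norm_def abs_mult
     using c_pos sphere_const_pos cardK_nonneg
     by (intro mult_mono u_le b B dil_in_S X0) auto
   qed
   show "AE z in surface_measure. (\<lambda>n. u (X n) z * g (dil (X n) z)) \<longlonglongrightarrow> u r z * g (dil r z)"
   proof (rule AE_I2)
    fix z
    show "(\<lambda>n. u (X n) z * g (dil (X n) z)) \<longlonglongrightarrow> u r z * g (dil r z)"
    proof (cases "z \<in> S")
     case True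
     have 1: "(\<lambda>n. jl (X n *\<^sub>R z)) \<longlonglongrightarrow> jl (r *\<^sub>R z)"
      by (rule continuous_on_tendsto_compose[OF continuous_jl[of UNIV]]) (auto intro!: tendsto_intros X)
     have 2: "(\<lambda>n. j (norm lam * X n)) \<longlonglongrightarrow> j (norm lam * r)"
      by (rule continuous_on_tendsto_compose[OF continuous_j[of UNIV]]) (auto intro!: tendsto_intros X)
     have 3: "(\<lambda>n. g (X n *\<^sub>R z)) \<longlonglongrightarrow> g (r *\<^sub>R z)"
      by (rule continuous_on_tendsto_compose[OF c]) (auto intro!: tendsto_intros X cone True r X0 always_eventually)
     show ?thesis
      using True j_pos[of "norm lam * r"] sphere_const_pos unfolding u_def dil_def
      by (auto intro!: tendsto_intros 1 2 3)
    qed (simp add: u_def)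
   qed
  qed simp
  then show "((\<lambda>r. \<integral>x. g x \<partial>\<Lambda> r) \<circ> X) \<longlonglongrightarrow> (\<integral>x. g x \<partial>\<Lambda> r)"
   by (simp add: comp_def integral_\<Lambda>[OF X0 gm] integral_\<Lambda>[OF r gm])
 qed
 show "((\<lambda>r. \<integral>x. g x \<partial>\<Lambda> r) \<longlongrightarrow> 0) (inf at_infinity (principal {0..}))"
 proof (rule tendstoI)
  fix e :: real assume e: "e > 0"
  then have "e / 2 > 0" by simp
  from tendstoD[OF l this] obtain b where b: "\<And>x. norm x \<ge> b \<Longrightarrow> x \<in> S \<Longrightarrow> \<bar>g x\<bar> < e / 2"
   unfolding eventually_inf_principal eventually_at_infinity by (auto simp: dist_norm)
  have "\<bar>\<integral>x. g x \<partial>\<Lambda> r\<bar> < e" if r: "r \<ge> 0" "r \<ge> b" for r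
  proof -
   interpret L: prob_space "\<Lambda> r" by (rule prob_space_\<Lambda>[OF r(1)])
   have gi: "integrable (\<Lambda> r) g"
    by (rule prob_space_bounded_integrable[OF L.prob_space_axioms, of _ B])
      (use gm B in \<open>auto simp: space_\<Lambda> measurable_cong_sets[OF sets_\<Lambda> refl]\<close>)
   have "\<bar>\<integral>x. g x \<partial>\<Lambda> r\<bar> \<le> (\<integral>x. \<bar>g x\<bar> \<partial>\<Lambda> r)" by (rule integral_abs_bound)
   also have "\<dots> \<le> (\<integral>x. e / 2 \<partial>\<Lambda> r)"
   proof (rule integral_mono_AE)
    have "AE x in \<Lambda> r. norm x = r \<and> x \<in> S"
     using AE_\<Lambda>_norm[OF r(1)] AE_space[of "\<Lambda> r"] by (auto simp: space_\<Lambda>)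
    then show "AE x in \<Lambda> r. \<bar>g x\<bar> \<le> e / 2"
     by eventually_elim (use b r in \<open>auto intro: less_imp_le\<close>)
   qed (use gi in auto)
   also have "\<dots> < e" using e by (simp add: L.prob_space)
   finally show ?thesis .
  qed
  then show "\<forall>\<^sub>F r in inf at_infinity (principal {0..}). dist (\<integral>x. g x \<partial>\<Lambda> r) 0 < e"
   unfolding eventually_inf_principal eventually_at_infinity by (intro exI[of _ b]) auto
 qed
qed

lemma measure_Q_q1:
 assumes t: "t > 0" and x: "x \<ge> 0" and A: "A \<in> sets (borel_on {0..})"
 shows "measure (Q t x) A = (\<integral>s. q1 t x s * indicator A s \<partial>lborel)"
proof -
 have [measurable]: "A \<in> sets borel" using A by (auto simp: sets_restrict_space_iff)
 have "measure (Q t x) A = enn2real (\<integral>\<^sup>+s. ennreal (q1 t x s * indicator A s) \<partial>lborel)"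
  unfolding measure_def emeasure_Q[OF t x A]
  by (intro arg_cong[where f=enn2real] nn_integral_cong) (simp split: split_indicator)
 also have "\<dots> = (\<integral>s. q1 t x s * indicator A s \<partial>lborel)"
  by (rule integral_eq_nn_integral[symmetric]) (use q1_nonneg[OF t] in auto)
 finally show ?thesis .
qed

lemma measure_Q:
 fixes A :: "real set"
 defines "\<kappa> \<equiv> gamma_index Rp k + real CARD('n) / 2 - 1 / 2"
 assumes t: "t > 0" and x: "x \<ge> 0" and A: "A \<in> sets (borel_on {0..})"
 shows "measure (Q t x) A =
   exp (- (norm lam)\<^sup>2 * t / 2) / (2 powr (\<kappa> - 1/2) * Gamma (\<kappa> + 1/2) * t powr (\<kappa> + 1/2)) *
    (LINT y:A|lborel. exp (- (x\<^sup>2 + y\<^sup>2) / (2 * t)) *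
     (spherical_bessel_imag (\<kappa> - 1/2) (x * y / t) * spherical_bessel_imag (\<kappa> - 1/2) (y * norm lam)
       / spherical_bessel_imag (\<kappa> - 1/2) (x * norm lam)) * rpow y (2 * \<kappa>))"
proof -
 have \<kappa>: "\<kappa> - 1/2 = bessel_index" "\<kappa> + 1/2 = bessel_index + 1" "gamma_index Rp k + real CARD('n) / 2 = bessel_index + 1"
  by (simp_all add: \<kappa>_def bessel_index_def)
 have A0: "A \<subseteq> {0..}" and Ab [measurable]: "A \<in> sets borel"
  using A by (auto simp: sets_restrict_space_iff)
 have const: "dunkl_const Rp k * d = 1 / (2 powr bessel_index * Gamma (bessel_index + 1))"
  using total_pos by (simp add: dunkl_const_eq sphere_const_total)
 have rp: "y ^ (CARD('n) - 1) * y powr (2 * gamma_index Rp k) = rpow y (2 * \<kappa>)" if y: "y > 0" for y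
 proof -
  have "real (CARD('n) - 1) + 2 * gamma_index Rp k = 2 * \<kappa>" by (simp add: \<kappa>_def of_nat_diff)
  then have "y ^ (CARD('n) - 1) * y powr (2 * gamma_index Rp k) = y powr (2 * \<kappa>)"
   using y by (simp only: powr_add[symmetric] powr_realpow[symmetric])
  then show ?thesis using y by (simp add: rpow_def)
 qed
 let ?g = "\<lambda>y. exp (- (x\<^sup>2 + y\<^sup>2) / (2 * t)) *
     (j (x * y / t) * j (y * norm lam) / j (x * norm lam)) * rpow y (2 * \<kappa>)"
 let ?c = "exp (- (norm lam)\<^sup>2 * t / 2) / (2 powr bessel_index * Gamma (bessel_index + 1) * t powr (bessel_index + 1))"
 have "measure (Q t x) A = (\<integral>s. q1 t x s * indicator A s \<partial>lborel)" by (rule measure_Q_q1[OF t x A])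
 also have "\<dots> = (\<integral>s. ?c * (indicator A s *\<^sub>R ?g s) \<partial>lborel)"
 proof (rule integral_cong_AE)
  have "(\<lambda>y. rpow y (2 * \<kappa>)) \<in> borel_measurable borel"
   unfolding rpow_def by (cases "2 * \<kappa> = 0") auto
  then show "(\<lambda>s. ?c * (indicator A s *\<^sub>R ?g s)) \<in> borel_measurable lborel" by simp
  have "AE s in lborel. s \<noteq> (0::real)" by (rule AE_lborel_singleton)
  then show "AE s in lborel. q1 t x s * indicator A s = ?c * (indicator A s *\<^sub>R ?g s)"
  proof eventually_elim
   case (elim s)
   show ?case
   proof (cases "s \<in> A")
    case True
    then have "s > 0" using A0 elim by force
    then show ?thesis using True
     using rp[of s] unfolding q1_def const \<kappa>(3) by simp
   qed simp
  qed
 qed simp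
 also have "\<dots> = ?c * (LINT y:A|lborel. ?g y)"
  unfolding set_lebesgue_integral_def by (rule integral_mult_right_zero)
 finally show ?thesis unfolding \<kappa> .
qed

abbreviation sphere_integral where
 "sphere_integral f r \<equiv> (LINT z:sphere 0 1 \<inter> S|surface_measure. f (r *\<^sub>R z) * J lam (r *\<^sub>R z) / j (norm lam * r) * w z)"

lemma radial_integral:
 assumes r: "r \<ge> 0" and f: "f \<in> borel_measurable (borel_on S)"
 shows "c / d * sphere_integral f r
  = (\<integral>x. f x \<partial>\<Lambda> r)"
proof -
 have "c / d * sphere_integral f r
  = (\<integral>z. c / d * (indicator (sphere 0 1 \<inter> S) z *\<^sub>R (f (r *\<^sub>R z) * J lam (r *\<^sub>R z) / j (norm lam * r) * w z)) \<partial>surface_measure)"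
  unfolding set_lebesgue_integral_def by (rule integral_mult_right_zero[symmetric])
 also have "\<dots> = (\<integral>x. f x \<partial>\<Lambda> r)"
  unfolding integral_\<Lambda>[OF r f]
  by (intro Bochner_Integration.integral_cong refl) (auto simp: u_def dil_def indicator_def J_symmetric[of lam])
 finally show ?thesis .
qed

lemma
 fixes f :: "real ^ 'n \<Rightarrow> real"
 assumes \<nu>: "prob_space \<nu>" "sets \<nu> = sets (borel_on {0..})"
 shows prob_space_mixture: "prob_space (\<nu> \<bind> \<Lambda>)"
  and sets_mixture: "sets (\<nu> \<bind> \<Lambda>) = sets (borel_on S)"
  and emeasure_mixture: "A \<in> sets (borel_on S) \<Longrightarrow> emeasure (\<nu> \<bind> \<Lambda>) A = (\<integral>\<^sup>+r. emeasure (\<Lambda> r) A \<partial>\<nu>)"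
  and nn_integral_mixture: "g \<in> borel_measurable (borel_on S) \<Longrightarrow> (\<integral>\<^sup>+x. g x \<partial>(\<nu> \<bind> \<Lambda>)) = (\<integral>\<^sup>+r. \<integral>\<^sup>+x. g x \<partial>\<Lambda> r \<partial>\<nu>)"
  and integral_mixture: "f \<in> borel_measurable (borel_on S) \<Longrightarrow> (\<And>x. x \<in> S \<Longrightarrow> \<bar>f x\<bar> \<le> B) \<Longrightarrow>
   (\<integral>x. f x \<partial>(\<nu> \<bind> \<Lambda>)) = (\<integral>r. \<integral>x. f x \<partial>\<Lambda> r \<partial>\<nu>)"
proof -
 interpret \<nu>: prob_space \<nu> by (rule \<nu>)
 have sp: "space \<nu> = {0..}" using sets_eq_imp_space_eq[OF \<nu>(2)] by simp
 have s: "\<nu> \<in> space (prob_algebra (borel_on {0..}))" using \<nu> by (simp add: space_prob_algebra)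
 have m: "\<Lambda> \<in> \<nu> \<rightarrow>\<^sub>M prob_algebra (borel_on S)" using kernel_\<Lambda> by (simp add: measurable_cong_sets[OF \<nu>(2) refl])
 show "prob_space (\<nu> \<bind> \<Lambda>)" by (rule prob_space_bind'[OF s kernel_\<Lambda>])
 show "sets (\<nu> \<bind> \<Lambda>) = sets (borel_on S)" by (rule sets_bind) (auto simp: sets_\<Lambda> sp)
 show "emeasure (\<nu> \<bind> \<Lambda>) A = (\<integral>\<^sup>+r. emeasure (\<Lambda> r) A \<partial>\<nu>)" if "A \<in> sets (borel_on S)"
  by (rule emeasure_bind_prob_algebra[OF s kernel_\<Lambda> that])
 show "(\<integral>\<^sup>+x. g x \<partial>(\<nu> \<bind> \<Lambda>)) = (\<integral>\<^sup>+r. \<integral>\<^sup>+x. g x \<partial>\<Lambda> r \<partial>\<nu>)" if "g \<in> borel_measurable (borel_on S)"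
  by (rule nn_integral_bind[OF that measurable_prob_algebraD[OF m]])
 show "(\<integral>x. f x \<partial>(\<nu> \<bind> \<Lambda>)) = (\<integral>r. \<integral>x. f x \<partial>\<Lambda> r \<partial>\<nu>)"
  if f: "f \<in> borel_measurable (borel_on S)" and B: "\<And>x. x \<in> S \<Longrightarrow> \<bar>f x\<bar> \<le> B"
 proof -
  have b: "\<bar>f x\<bar> \<le> B" if "x \<in> space (borel_on S)" for x using B that by simp
  show ?thesis
   by (rule integral_bind[OF f b measurable_prob_algebraD[OF m], where B'=1])
    (use prob_space.emeasure_space_1[OF prob_space_\<Lambda>] sp \<nu>.finite_measure_axioms in \<open>auto\<close>)
 qed
qed

definition radial :: "(real ^ 'n) measure \<Rightarrow> bool" where
 "radial \<mu> \<longleftrightarrow> prob_space \<mu> \<and> sets \<mu> = sets (borel_on S) \<and>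
   (\<exists>\<nu>. prob_space \<nu> \<and> sets \<nu> = sets (borel_on {0..}) \<and>
    (\<forall>f :: real ^ 'n \<Rightarrow> real. f \<in> borel_measurable (borel_on S) \<longrightarrow> bounded (f ` S) \<longrightarrow>
      (LINT x|\<mu>. f x) = c / d * (LINT r|\<nu>. sphere_integral f r)))"

lemma radial_iff_mixture:
 "radial \<mu> \<longleftrightarrow> (\<exists>\<nu>. prob_space \<nu> \<and> sets \<nu> = sets (borel_on {0..}) \<and> \<mu> = \<nu> \<bind> \<Lambda>)"
proof -
 have inner: "c / d * (LINT r|\<nu>. sphere_integral f r)
   = (\<integral>r. \<integral>x. f x \<partial>\<Lambda> r \<partial>\<nu>)"
  if "sets \<nu> = sets (borel_on {0..})" "f \<in> borel_measurable (borel_on S)" for \<nu> f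
 proof -
  have sp: "space \<nu> = {0..}" using sets_eq_imp_space_eq[OF that(1)] by simp
  show ?thesis
   unfolding integral_mult_right_zero[symmetric]
   by (intro Bochner_Integration.integral_cong refl radial_integral that) (simp add: sp)
 qed
 show ?thesis
 proof
  assume "radial \<mu>"
  then obtain \<nu> where \<mu>: "prob_space \<mu>" "sets \<mu> = sets (borel_on S)" and \<nu>: "prob_space \<nu>" "sets \<nu> = sets (borel_on {0..})"
   and eq0: "\<forall>f :: real ^ 'n \<Rightarrow> real. f \<in> borel_measurable (borel_on S) \<longrightarrow> bounded (f ` S) \<longrightarrow>
      (LINT x|\<mu>. f x) = c / d * (LINT r|\<nu>. sphere_integral f r)"
   unfolding radial_def by blast
  have eq: "(LINT x|\<mu>. f x) = (\<integral>r. \<integral>x. f x \<partial>\<Lambda> r \<partial>\<nu>)"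
   if "f \<in> borel_measurable (borel_on S)" "bounded (f ` S)" for f :: "real ^ 'n \<Rightarrow> real"
   using eq0[rule_format, OF that] unfolding inner[OF \<nu>(2) that(1)] .
  have "\<mu> = \<nu> \<bind> \<Lambda>"
  proof (rule measure_eqI)
   show "sets \<mu> = sets (\<nu> \<bind> \<Lambda>)" using \<mu> sets_mixture[OF \<nu>] by simp
   fix A assume "A \<in> sets \<mu>"
   then have A: "A \<in> sets (borel_on S)" using \<mu> by simp
   interpret \<mu>: prob_space \<mu> by (rule \<mu>)
   interpret m: prob_space "\<nu> \<bind> \<Lambda>" by (rule prob_space_mixture[OF \<nu>])
   have ind: "(indicator A :: real ^ 'n \<Rightarrow> real) \<in> borel_measurable (borel_on S)" using A by simp
   have "measure \<mu> A = (\<integral>x. indicator A x \<partial>\<mu>)" using A \<mu> by simp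
   also have "\<dots> = (\<integral>r. \<integral>x. indicator A x \<partial>\<Lambda> r \<partial>\<nu>)"
    by (rule eq[OF ind]) (auto simp: bounded_iff indicator_def intro!: exI[of _ 1])
   also have "\<dots> = (\<integral>x. indicator A x \<partial>(\<nu> \<bind> \<Lambda>))"
    by (rule integral_mixture[OF \<nu> ind, symmetric, where B=1]) (simp add: indicator_def)
   also have "\<dots> = measure (\<nu> \<bind> \<Lambda>) A" using A sets_mixture[OF \<nu>] by simp
   finally show "emeasure \<mu> A = emeasure (\<nu> \<bind> \<Lambda>) A"
    by (simp add: \<mu>.emeasure_eq_measure m.emeasure_eq_measure)
  qed
  then show "\<exists>\<nu>. prob_space \<nu> \<and> sets \<nu> = sets (borel_on {0..}) \<and> \<mu> = \<nu> \<bind> \<Lambda>" using \<nu> by blast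
 next
  assume "\<exists>\<nu>. prob_space \<nu> \<and> sets \<nu> = sets (borel_on {0..}) \<and> \<mu> = \<nu> \<bind> \<Lambda>"
  then obtain \<nu> where \<nu>: "prob_space \<nu>" "sets \<nu> = sets (borel_on {0..})" and \<mu>: "\<mu> = \<nu> \<bind> \<Lambda>" by blast
  show "radial \<mu>"
   unfolding radial_def
  proof (intro conjI exI[of _ \<nu>] allI impI)
   fix f :: "real ^ 'n \<Rightarrow> real" assume f: "f \<in> borel_measurable (borel_on S)" and "bounded (f ` S)"
   then obtain B where B: "\<And>x. x \<in> S \<Longrightarrow> \<bar>f x\<bar> \<le> B" by (auto simp: bounded_iff)
   show "(LINT x|\<mu>. f x) = c / d * (LINT r|\<nu>. sphere_integral f r)"
    unfolding inner[OF \<nu>(2) f] \<mu> by (rule integral_mixture[OF \<nu> f B])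
  qed (simp_all add: \<nu> \<mu> prob_space_mixture[OF \<nu>] sets_mixture[OF \<nu>])
 qed
qed

lemma
 fixes M :: "'w measure" and X :: "real \<Rightarrow> 'w \<Rightarrow> real ^ 'n"
 assumes X: "feller_process S K M X" and initial: "radial (distr M (borel_on S) (X 0))"
 shows radial_at_time: "t \<ge> 0 \<Longrightarrow> radial (distr M (borel_on S) (X t))"
  and feller_process_norm: "feller_process {0..} Q M (\<lambda>t \<omega>. norm (X t \<omega>))"
proof -
 have X0: "X t \<in> M \<rightarrow>\<^sub>M borel_on S" if "t \<ge> 0" for t using X that by (simp add: feller_process_def)
 have M: "prob_space M" using X by (simp add: feller_process_def)
 obtain \<nu> where \<nu>: "prob_space \<nu>" "sets \<nu> = sets (borel_on {0..})" and law: "distr M (borel_on S) (X 0) = \<nu> \<bind> \<Lambda>"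
  using initial unfolding radial_iff_mixture by blast
 have sp: "space \<nu> = {0..}" using sets_eq_imp_space_eq[OF \<nu>(2)] by simp
 interpret intertwined_process S "{0..}" norm K Q \<Lambda> M X
 proof (intro intertwined_process.intro intertwined_process_axioms.intro intertwining_norm X)
  fix A assume A: "A \<in> sets (borel_on S)"
  have m: "(\<lambda>x. emeasure (\<Lambda> (norm x)) A) \<in> borel_measurable (borel_on S)"
   by (rule measurable_compose[OF norm_measurable prob_kernel_emeasure_measurable[OF kernel_\<Lambda> A]])
  have "(\<integral>\<^sup>+\<omega>. emeasure (\<Lambda> (norm (X 0 \<omega>))) A \<partial>M) = (\<integral>\<^sup>+x. emeasure (\<Lambda> (norm x)) A \<partial>distr M (borel_on S) (X 0))"
   using m by (intro nn_integral_distr[symmetric] X0) simp_all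
  also have "\<dots> = (\<integral>\<^sup>+r. \<integral>\<^sup>+x. emeasure (\<Lambda> (norm x)) A \<partial>\<Lambda> r \<partial>\<nu>)"
   unfolding law by (rule nn_integral_mixture[OF \<nu> m])
  also have "\<dots> = (\<integral>\<^sup>+r. emeasure (\<Lambda> r) A \<partial>\<nu>)"
  proof (rule nn_integral_cong)
   fix r assume "r \<in> space \<nu>"
   then have r: "r \<ge> 0" by (simp add: sp)
   interpret L: prob_space "\<Lambda> r" by (rule prob_space_\<Lambda>[OF r])
   have "(\<integral>\<^sup>+x. emeasure (\<Lambda> (norm x)) A \<partial>\<Lambda> r) = (\<integral>\<^sup>+x. emeasure (\<Lambda> r) A \<partial>\<Lambda> r)"
    by (rule nn_integral_cong_AE) (use AE_\<Lambda>_norm[OF r] in \<open>auto elim!: eventually_mono\<close>)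
   then show "(\<integral>\<^sup>+x. emeasure (\<Lambda> (norm x)) A \<partial>\<Lambda> r) = emeasure (\<Lambda> r) A" by (simp add: L.emeasure_space_1)
  qed
  also have "\<dots> = emeasure (distr M (borel_on S) (X 0)) A"
   unfolding law by (rule emeasure_mixture[OF \<nu> A, symmetric])
  also have "\<dots> = emeasure M (X 0 -` A \<inter> space M)"
   by (rule emeasure_distr[OF X0 A]) simp
  finally show "emeasure M (X 0 -` A \<inter> space M) = (\<integral>\<^sup>+\<omega>. emeasure (\<Lambda> (norm (X 0 \<omega>))) A \<partial>M)" ..
 qed
 show "feller_process {0..} Q M (\<lambda>t \<omega>. norm (X t \<omega>))"
  by (rule feller_process_Z[OF C0_norm C0_\<Lambda>])
 show "radial (distr M (borel_on S) (X t))" if t: "t \<ge> 0"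
  unfolding radial_iff_mixture
  using law_at_time[OF t] prob_space.prob_space_distr[OF M Z_measurable[OF t]] by (intro exI[of _ "distr M (borel_on {0..}) (Z t)"]) simp
qed

end

context radial_setting
begin

text \<open>By the exponential bounds on \<open>j\<close>, the density \<open>q1 t x s\<close> is at most \<open>exp (- (s - x)\<^sup>2 / (2 t))\<close> times a power
 of \<open>t\<close> and factors depending on \<open>s\<close> alone.\<close>

lemma Q_rare:
 assumes \<epsilon>: "\<epsilon> > 0"
 shows "\<exists>\<eta>. \<eta> \<longlonglongrightarrow> 0 \<and> (\<forall>n. \<eta> n \<ge> 0) \<and>
   (\<forall>n\<ge>1. \<forall>x\<in>{0..L}. real n * measure (Q (1 / real n) x) {y\<in>{0..}. \<bar>y - x\<bar> \<ge> \<epsilon>} \<le> \<eta> n)"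
proof -
 define p where "p = gamma_index Rp k + real CARD('n) / 2"
 define a where "a = 2 * bessel_index + 1"
 define H where "H s = indicator {0<..} s * s powr a * exp ((L + norm lam) * s - s\<^sup>2 / 2)" for s :: real
 define I where "I = (\<integral>s. H s \<partial>lborel)"
 define C where "C = dunkl_const Rp k * d"
 define e where "e n = exp (- (\<epsilon>\<^sup>2 / 4 * real n))" for n
 have C: "C > 0" using dunkl_const_pos sphere_const_pos by (simp add: C_def)
 have H_int: "integrable lborel H"
  unfolding H_def[abs_def] using bessel_index_ge by (intro integrable_powr_exp_linear_minus_square) (simp add: a_def)
 have I0: "I \<ge> 0" unfolding I_def by (intro Bochner_Integration.integral_nonneg) (simp add: H_def)
 (* For n \<ge> 2 half of the exponent - n (s - x)^2 / 2 yields the small factor e n and the other half,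
   at most - (s - x)^2 / 2, integrability in s. For n = 1 the bound is trivial. *)
 define \<eta> where "\<eta> n = (if n \<le> 1 then 1 else C * I * (real n powr (p + 1) * e n))" for n
 have lim: "(\<lambda>n. real n powr (p + 1) * e n) \<longlonglongrightarrow> 0"
 proof -
  have "\<epsilon>\<^sup>2 / 4 > 0" using \<epsilon> by simp
  then show ?thesis unfolding e_def by real_asymp
 qed
 have "\<eta> \<longlonglongrightarrow> C * I * 0"
  by (rule Lim_transform_eventually[OF tendsto_mult_left[OF lim]])
    (rule eventually_mono[OF eventually_gt_at_top[of "1::nat"]], simp add: \<eta>_def)
 moreover have "\<eta> n \<ge> 0" for n using C I0 by (simp add: \<eta>_def e_def)
 moreover have "real n * measure (Q (1 / real n) x) {y\<in>{0..}. \<bar>y - x\<bar> \<ge> \<epsilon>} \<le> \<eta> n" if n: "n \<ge> 1" and x: "x \<in> {0..L}" for n x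
 proof (cases "n \<le> 1")
  case True
  then have "n = 1" using n by simp
  moreover have "measure (Q 1 x) {y\<in>{0..}. \<bar>y - x\<bar> \<ge> \<epsilon>} \<le> 1"
   by (rule prob_space.prob_le_1, rule prob_kernelD(1)[OF kernel_Q]) (use x in auto)
  ultimately show ?thesis by (simp add: \<eta>_def)
 next
  case False
  then have n2: "real n \<ge> 2" by simp
  define A where "A = {y\<in>{0..}. \<bar>y - x\<bar> \<ge> \<epsilon>}"
  have Ab [measurable]: "A \<in> sets borel" unfolding A_def by measurable
  have A: "A \<in> sets (borel_on {0..})" using Ab by (auto simp: sets_restrict_space_iff A_def)
  have le: "q1 (1 / real n) x s * indicator A s \<le> C * (real n powr p * e n) * H s" for s
  proof (cases "s > 0 \<and> s \<in> A")
   case True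
   then have s: "s > 0" "\<epsilon> \<le> \<bar>s - x\<bar>" by (auto simp: A_def)
   have sq: "\<epsilon>\<^sup>2 \<le> (s - x)\<^sup>2" using s \<epsilon> by (simp add: abs_le_square_iff[symmetric])
   have e1: "- (x\<^sup>2 + s\<^sup>2) / (2 * (1 / real n)) + \<bar>x * s / (1 / real n)\<bar> \<le> - (\<epsilon>\<^sup>2 / 4 * real n) + (L * s - s\<^sup>2 / 2)"
   proof -
    have "- (x\<^sup>2 + s\<^sup>2) / (2 * (1 / real n)) + \<bar>x * s / (1 / real n)\<bar> = - (real n / 2 * (s - x)\<^sup>2)"
    proof -
     have "\<bar>x * s / (1 / real n)\<bar> = real n * (x * s)" using s x by (simp add: abs_mult)
     moreover have "- b / (2 * (1 / real n)) = - (real n / 2 * b)" for b :: real by simp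
     note this[of "x\<^sup>2 + s\<^sup>2"]
     moreover have "real n / 2 * (s - x)\<^sup>2 = real n / 2 * (x\<^sup>2 + s\<^sup>2) - real n * (x * s)"
      by (simp add: power2_eq_square field_simps)
     ultimately show ?thesis by linarith
    qed
    also have "\<dots> \<le> - (\<epsilon>\<^sup>2 / 4 * real n) - (s - x)\<^sup>2 / 2"
    proof -
     have "real n * \<epsilon>\<^sup>2 \<le> real n * (s - x)\<^sup>2" using sq n2 by (intro mult_left_mono) auto
     moreover have "2 * (s - x)\<^sup>2 \<le> real n * (s - x)\<^sup>2" using n2 by (intro mult_right_mono) auto
     ultimately show ?thesis by (simp add: field_simps)
    qed
    also have "\<dots> \<le> - (\<epsilon>\<^sup>2 / 4 * real n) + (L * s - s\<^sup>2 / 2)"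
    proof -
     have "x * s \<le> L * s" using x s by (intro mult_right_mono) auto
     moreover have "(s - x)\<^sup>2 = s\<^sup>2 - 2 * (x * s) + x\<^sup>2" by (simp add: power2_eq_square algebra_simps)
     ultimately show ?thesis using zero_le_power2[of x] by linarith
    qed
    finally show ?thesis .
   qed
   have pw: "s ^ (CARD('n) - 1) * s powr (2 * gamma_index Rp k) = s powr a"
   proof -
    have "real (CARD('n) - 1) + 2 * gamma_index Rp k = a" by (simp add: a_def bessel_index_def of_nat_diff)
    then show ?thesis using s by (simp only: powr_add[symmetric] powr_realpow[symmetric])
   qed
   have "exp (- (x\<^sup>2 + s\<^sup>2) / (2 * (1 / real n))) * (j (x * s / (1 / real n)) * j (s * norm lam) / j (x * norm lam))
    \<le> exp (- (x\<^sup>2 + s\<^sup>2) / (2 * (1 / real n))) * (exp \<bar>x * s / (1 / real n)\<bar> * exp \<bar>s * norm lam\<bar> / 1)"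
    using j_ge_1[of "x * norm lam"] j_pos[of "s * norm lam"] j_pos[of "x * s / (1 / real n)"]
    by (intro mult_left_mono frac_le mult_mono spherical_bessel_imag_le_exp bessel_index_ge) auto
   also have "\<dots> = exp (- (x\<^sup>2 + s\<^sup>2) / (2 * (1 / real n)) + \<bar>x * s / (1 / real n)\<bar>) * exp (s * norm lam)"
    using s by (simp add: exp_add)
   also have "\<dots> \<le> exp (- (\<epsilon>\<^sup>2 / 4 * real n) + (L * s - s\<^sup>2 / 2)) * exp (s * norm lam)"
    using e1 by (intro mult_right_mono) auto
   also have "\<dots> = e n * exp ((L + norm lam) * s - s\<^sup>2 / 2)"
    by (simp add: e_def mult_exp_exp algebra_simps)
   finally have k1: "exp (- (x\<^sup>2 + s\<^sup>2) / (2 * (1 / real n))) * (j (x * s / (1 / real n)) * j (s * norm lam) / j (x * norm lam))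
    \<le> e n * exp ((L + norm lam) * s - s\<^sup>2 / 2)" .
   have k2: "exp (- (norm lam)\<^sup>2 * (1 / real n) / 2) / (1 / real n) powr p \<le> real n powr p"
   proof -
    have "exp (- (norm lam)\<^sup>2 * (1 / real n) / 2) \<le> 1" by simp
    then have "exp (- (norm lam)\<^sup>2 * (1 / real n) / 2) * real n powr p \<le> 1 * real n powr p"
     by (intro mult_right_mono) auto
    then show ?thesis using n2 by (simp add: powr_divide)
   qed
   have "q1 (1 / real n) x s * indicator A s
    = C * (exp (- (norm lam)\<^sup>2 * (1 / real n) / 2) / (1 / real n) powr p
     * ((exp (- (x\<^sup>2 + s\<^sup>2) / (2 * (1 / real n))) * (j (x * s / (1 / real n)) * j (s * norm lam) / j (x * norm lam))) * s powr a))"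
    using True s(1) unfolding q1_def C_def p_def[symmetric] pw by (simp only: indicator_def) simp
   also have "\<dots> \<le> C * (real n powr p * ((e n * exp ((L + norm lam) * s - s\<^sup>2 / 2)) * s powr a))"
    by (rule mult_left_mono[OF mult_mono[OF k2 mult_right_mono[OF k1]]])
      (use C in \<open>auto intro!: mult_nonneg_nonneg divide_nonneg_nonneg less_imp_le[OF j_pos]\<close>)
   also have "\<dots> = C * (real n powr p * e n) * H s" using s by (simp add: H_def)
   finally show ?thesis .
  next
   case False
   then have "q1 (1 / real n) x s * indicator A s = 0" by (auto simp: q1_def)
   moreover have "C * (real n powr p * e n) * H s \<ge> 0" using C by (simp add: H_def e_def)
   ultimately show ?thesis by linarith
  qed
  have "measure (Q (1 / real n) x) A = (\<integral>s. q1 (1 / real n) x s * indicator A s \<partial>lborel)"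
   by (rule measure_Q_q1[OF _ _ A]) (use n2 x in auto)
  also have "\<dots> \<le> (\<integral>s. C * (real n powr p * e n) * H s \<partial>lborel)"
  proof (rule integral_mono'[OF integrable_mult_right[OF H_int] le])
   show "0 \<le> C * (real n powr p * e n) * H s" for s using C by (simp add: H_def e_def)
  qed
  also have "\<dots> = C * (real n powr p * e n) * I" unfolding I_def by simp
  finally have "real n * measure (Q (1 / real n) x) A \<le> real n * (C * (real n powr p * e n) * I)"
   by (intro mult_left_mono) auto
  also have "\<dots> = C * I * (real n powr (p + 1) * e n)" using n2 by (simp add: powr_add)
  finally show ?thesis using False by (simp add: \<eta>_def A_def)
 qed
 ultimately show ?thesis by (intro exI[of _ \<eta>]) auto
qed

lemma bessel_process_1d_norm:
 fixes M :: "'w measure" and X :: "real \<Rightarrow> 'w \<Rightarrow> real ^ 'n"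
 assumes X: "feller_process S K M X" and initial: "radial (distr M (borel_on S) (X 0))"
  and Y: "\<exists>Y. (\<forall>t\<ge>0. Y t \<in> M \<rightarrow>\<^sub>M borel_on {0..} \<and> (AE \<omega> in M. Y t \<omega> = norm (X t \<omega>))) \<and> continuous_paths M Y"
 shows "bessel_process_1d (gamma_index Rp k + real CARD('n) / 2 - 1 / 2) (norm lam) M (\<lambda>t \<omega>. norm (X t \<omega>))"
 unfolding bessel_process_1d_def
 using feller_process_norm[OF X initial] measure_Q Y by (intro conjI exI[of _ Q]) auto

end

section \<open>Reflection-invariant integrals over the sphere and the chamber\<close>

lemma set_integral_sphere:
 fixes f :: "real ^ 'n \<Rightarrow> real"
 assumes [measurable]: "f \<in> borel_measurable borel"
 shows "(LINT z:sphere 0 1|surface_measure. f z) = (\<integral>z. f z \<partial>surface_measure)"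
 unfolding set_lebesgue_integral_def
proof (rule integral_cong_AE)
 have [measurable]: "sphere 0 1 \<in> sets (borel :: (real ^ 'n) measure)" by simp
 show "(\<lambda>z. indicator (sphere 0 1) z *\<^sub>R f z) \<in> borel_measurable surface_measure" by measurable
qed (use AE_surface_norm in \<open>auto elim!: eventually_mono\<close>)

lemma surface_measure_orthogonal:
 fixes g :: "real ^ 'n \<Rightarrow> real ^ 'n"
 assumes g: "linear g" "\<And>x. norm (g x) = norm x"
 shows "distr surface_measure borel g = surface_measure"
proof (rule measure_eqI)
 have gm [measurable]: "g \<in> borel_measurable borel"
  using g(1) by (intro borel_measurable_continuous_onI linear_continuous_on) (simp add: linear_linear)
 have [measurable]: "(sgn :: real ^ 'n \<Rightarrow> real ^ 'n) \<in> borel_measurable borel"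
  unfolding sgn_div_norm[abs_def] by measurable
 have [measurable]: "cball 0 1 - {0} \<in> sets (borel :: (real ^ 'n) measure)" by auto
 fix A assume "A \<in> sets (distr surface_measure borel g)"
 then have [measurable]: "A \<in> sets borel" by simp
 have sg: "g (sgn u) = sgn (g u)" for u by (simp add: sgn_div_norm linear_scale[OF g(1)] g(2))
 have ind: "indicator (cball 0 1 - {0}) (g u) = (indicator (cball 0 1 - {0}) u :: ennreal)" for u
  using g(2)[of u] by (auto simp: indicator_def)
 have "emeasure (distr surface_measure borel g) A = (\<integral>\<^sup>+z. indicator A (g z) \<partial>surface_measure)"
  by (subst nn_integral_indicator[symmetric], simp) (subst nn_integral_distr, simp_all add: measurable_cong_sets[OF sets_surface_measure refl])
 also have "\<dots> = of_nat CARD('n) * (\<integral>\<^sup>+u. indicator A (sgn (g u)) * indicator (cball 0 1 - {0}) (g u) \<partial>lborel)"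
  by (subst nn_integral_surface) (simp_all add: sg ind)
 also have "(\<integral>\<^sup>+u. indicator A (sgn (g u)) * indicator (cball 0 1 - {0}) (g u) \<partial>lborel)
  = (\<integral>\<^sup>+u. indicator A (sgn u) * indicator (cball 0 1 - {0}) u \<partial>distr lborel borel g)"
  by (subst nn_integral_distr) simp_all
 also have "of_nat CARD('n) * \<dots> = (\<integral>\<^sup>+z. indicator A z \<partial>surface_measure)"
  unfolding lborel_distr_orthogonal[OF g] by (subst nn_integral_surface) simp_all
 finally show "emeasure (distr surface_measure borel g) A = emeasure surface_measure A"
  by (simp)
qed simp

text \<open>The surface measure is the image of Lebesgue measure on the ball under \<open>x \<mapsto> x / \<parallel>x\<parallel>\<close>.\<close>

lemma AE_surface_of_lborel:
 fixes P :: "real ^ 'n \<Rightarrow> bool"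
 assumes [measurable]: "Measurable.pred borel P" and P: "AE x in lborel. P x"
  and hom: "\<And>r x. r > 0 \<Longrightarrow> P (r *\<^sub>R x) \<longleftrightarrow> P x"
 shows "AE z in surface_measure. P z"
proof -
 have "(\<integral>\<^sup>+z. indicator {z. \<not> P z} z \<partial>surface_measure)
  = of_nat CARD('n) * (\<integral>\<^sup>+u. indicator {z. \<not> P z} (sgn u) * indicator (cball 0 1 - {0}) u \<partial>lborel)"
  by (rule nn_integral_surface) measurable
 also have "(\<integral>\<^sup>+u. indicator {z. \<not> P z} (sgn u) * indicator (cball 0 1 - {0}) u \<partial>lborel) = (\<integral>\<^sup>+(u :: real ^ 'n). 0 \<partial>lborel)"
 proof (rule nn_integral_cong_AE)
  show "AE u in lborel. indicator {z. \<not> P z} (sgn u) * indicator (cball 0 1 - {0}) u = (0 :: ennreal)"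
   using P
  proof eventually_elim
   case (elim u)
   show ?case
   proof (cases "u = 0")
    case False
    then show ?thesis using hom[of "inverse (norm u)" u] elim by (simp add: sgn_div_norm)
   qed simp
  qed
 qed
 finally have "(\<integral>\<^sup>+z. indicator {z. \<not> P z} z \<partial>surface_measure) = 0" by simp
 then have "emeasure surface_measure {z. \<not> P z} = 0" by (subst (asm) nn_integral_indicator) simp_all
 then show ?thesis by (intro AE_I[of _ _ "{z. \<not> P z}"]) auto
qed

context dunkl_setting
begin

lemma closed_chamber: "closed (weyl_chamber Rp)"
proof -
 have "weyl_chamber Rp = (\<Inter>\<alpha>\<in>Rp. {x. x \<bullet> \<alpha> \<ge> 0})" by (auto simp: weyl_chamber_def)
 then show ?thesis by (auto intro!: closed_INT closed_Collect_le continuous_intros)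
qed

lemma chamber_cone: "r \<ge> 0 \<Longrightarrow> x \<in> weyl_chamber Rp \<Longrightarrow> r *\<^sub>R x \<in> weyl_chamber Rp"
 by (simp add: weyl_chamber_def)

lemma chamber_scale_iff: "r > 0 \<Longrightarrow> r *\<^sub>R x \<in> weyl_chamber Rp \<longleftrightarrow> x \<in> weyl_chamber Rp"
 by (auto simp: weyl_chamber_def zero_le_mult_iff)

lemma chamber_nonempty: "weyl_chamber Rp \<noteq> {}"
 by (auto simp: weyl_chamber_def intro!: exI[of _ 0])

definition chamber_hits :: "real ^ 'n \<Rightarrow> real" where
 "chamber_hits y = (\<Sum>g\<in>W. indicator (weyl_chamber Rp) (g y))"

lemma weyl_measurable: "g \<in> W \<Longrightarrow> g \<in> borel_measurable borel"
 using weyl_group_linear by (intro borel_measurable_continuous_onI linear_continuous_on) (simp add: linear_linear)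

lemma chamber_borel [measurable]: "weyl_chamber Rp \<in> sets borel"
 by (rule borel_closed[OF closed_chamber])

lemma indicator_chamber_measurable: "g \<in> W \<Longrightarrow> (\<lambda>y. indicator (weyl_chamber Rp) (g y) :: real) \<in> borel_measurable borel"
 by (rule measurable_compose[OF weyl_measurable borel_measurable_indicator[OF chamber_borel]])

lemma chamber_hits_measurable: "chamber_hits \<in> borel_measurable borel"
 unfolding chamber_hits_def[abs_def] by (intro borel_measurable_sum indicator_chamber_measurable)

lemma chamber_hits_ge_1: "chamber_hits y \<ge> 1"
proof -
 obtain g where g: "g \<in> W" "g y \<in> weyl_chamber Rp" using orbit_meets_chamber by blast
 then have "indicator (weyl_chamber Rp) (g y) \<le> chamber_hits y"
  unfolding chamber_hits_def by (intro member_le_sum) (auto simp: finite_weyl_group)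
 then show ?thesis using g by simp
qed

lemma chamber_hits_le: "chamber_hits y \<le> real (card W)"
 unfolding chamber_hits_def using sum_bounded_above[of W "\<lambda>g. indicator (weyl_chamber Rp) (g y)" "1::real"] by simp

lemma chamber_hits_scale: "r > 0 \<Longrightarrow> chamber_hits (r *\<^sub>R y) = chamber_hits y"
 unfolding chamber_hits_def
 by (intro sum.cong refl) (simp add: linear_scale[OF weyl_group_linear] indicator_def chamber_scale_iff)

text \<open>This is applied to Lebesgue measure, in order to determine \<open>chamber_hits\<close>, and then to the surface
 measure.\<close>

lemma integral_chamber_hits:
 fixes \<phi> :: "real ^ 'n \<Rightarrow> real"
 assumes N: "sets N = sets borel" "\<And>g. g \<in> W \<Longrightarrow> distr N borel g = N"
  and \<phi>: "integrable N \<phi>" and inv: "\<And>g x. g \<in> W \<Longrightarrow> \<phi> (g x) = \<phi> x"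
 shows "(\<integral>y. chamber_hits y * \<phi> y \<partial>N) = real (card W) * (\<integral>y. indicator (weyl_chamber Rp) y * \<phi> y \<partial>N)"
proof -
 have \<phi>m: "\<phi> \<in> borel_measurable borel" using \<phi> by (simp add: measurable_cong_sets[OF N(1) refl, symmetric])
 have im: "(\<lambda>y. indicator (weyl_chamber Rp) (g y) * \<phi> y) \<in> borel_measurable N" if "g \<in> W" for g
  using indicator_chamber_measurable[OF that] \<phi>m by (simp add: measurable_cong_sets[OF N(1) refl])
 have int: "integrable N (\<lambda>y. indicator (weyl_chamber Rp) (g y) * \<phi> y)" if "g \<in> W" for g
  by (rule Bochner_Integration.integrable_bound[OF \<phi> im[OF that]]) (auto simp: indicator_def)
 have "(\<integral>y. chamber_hits y * \<phi> y \<partial>N) = (\<Sum>g\<in>W. \<integral>y. indicator (weyl_chamber Rp) (g y) * \<phi> y \<partial>N)"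
  unfolding chamber_hits_def sum_distrib_right by (rule Bochner_Integration.integral_sum) (rule int)
 also have "\<dots> = (\<Sum>g\<in>W. \<integral>y. indicator (weyl_chamber Rp) y * \<phi> y \<partial>N)"
 proof (rule sum.cong[OF refl])
  fix g assume g: "g \<in> W"
  have gm: "g \<in> N \<rightarrow>\<^sub>M borel" using weyl_measurable[OF g] by (simp add: measurable_cong_sets[OF N(1) refl])
  have "(\<integral>y. indicator (weyl_chamber Rp) (g y) * \<phi> y \<partial>N) = (\<integral>y. indicator (weyl_chamber Rp) (g y) * \<phi> (g y) \<partial>N)"
   by (simp add: inv[OF g])
  also have "\<dots> = (\<integral>y. indicator (weyl_chamber Rp) y * \<phi> y \<partial>distr N borel g)"
   by (intro integral_distr[symmetric] gm borel_measurable_times borel_measurable_indicator chamber_borel \<phi>m)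
  finally show "(\<integral>y. indicator (weyl_chamber Rp) (g y) * \<phi> y \<partial>N) = (\<integral>y. indicator (weyl_chamber Rp) y * \<phi> y \<partial>N)"
   by (simp add: N(2)[OF g])
 qed
 finally show ?thesis by simp
qed

end

context dunkl_kernel_setting
begin

lemma gauss_J_integrable: "integrable lborel (\<lambda>y. gauss y * J y a)"
proof (rule Bochner_Integration.integrable_bound)
 show "integrable lborel (\<lambda>y. cardK * (exp (norm a * norm y) * gauss y))"
  by (intro integrable_mult_right gauss_integrable_real)
 show "(\<lambda>y. gauss y * J y a) \<in> borel_measurable lborel"
  using J_measurable[of "\<lambda>y. y" borel "\<lambda>_. a"] by simp
 show "AE y in lborel. norm (gauss y * J y a) \<le> norm (cardK * (exp (norm a * norm y) * gauss y))"
 proof (rule AE_I2)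
  fix y
  have "norm (gauss y * J y a) \<le> gauss y * (cardK * exp (norm y * norm a))"
   unfolding norm_mult using J_bound[of y a] gauss_nonneg[of y] by (intro mult_mono) auto
  then show "norm (gauss y * J y a) \<le> norm (cardK * (exp (norm a * norm y) * gauss y))"
   using cardK_nonneg gauss_nonneg[of y] by (simp add: abs_mult ac_simps)
 qed
qed

lemma gauss_J_integral: "(\<integral>y. gauss y * J y a \<partial>lborel) = total * exp ((norm a)\<^sup>2 / 2)"
proof -
 have E: "integrable lborel (\<lambda>y. gauss y * E y b) \<and> (\<integral>y. gauss y * E y b \<partial>lborel) = total * exp ((norm b)\<^sup>2 / 2)" for b
 proof -
  let ?f = "\<lambda>y. gauss y *\<^sub>R dunkl_kernel Rp k (cvec y) (cvec b)"
  have m: "(\<lambda>y. dunkl_kernel Rp k (cvec y) (cvec b)) \<in> borel_measurable borel"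
   using continuous_on_eigen_ray[OF eigen_kernel continuous_on_id, of UNIV 1 b]
   by (intro borel_measurable_continuous_onI) simp
  have int: "integrable lborel ?f"
   by (rule gauss_integrable[OF m, of cardK "norm b"])
     (use eigen_growth'[OF eigen_kernel, of "cvec _" b] in \<open>simp add: mult.commute\<close>)
  have eq: "gauss y * E y b = Re (?f y)" for y by (simp add: dunkl_kernel_real_def)
  show ?thesis unfolding eq integral_Re[OF int] gaussian_mean[OF eigen_kernel] Re_complex_of_real
   using integrable_Re[OF int] by (intro conjI) auto
 qed
 have "(\<integral>y. gauss y * J y a \<partial>lborel) = (\<integral>y. (\<Sum>g\<in>W. gauss y * E y (g a)) / real (card W) \<partial>lborel)"
  by (simp add: dunkl_bessel_real_eq sum_distrib_left)
 also have "\<dots> = (\<Sum>g\<in>W. \<integral>y. gauss y * E y (g a) \<partial>lborel) / real (card W)"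
  using E by (simp add: Bochner_Integration.integral_sum)
 also have "\<dots> = total * exp ((norm a)\<^sup>2 / 2)"
  using E card_W_pos by (simp add: weyl_group_norm cong: sum.cong)
 finally show ?thesis .
qed

text \<open>Some group element moves \<open>y\<close> into the chamber, and the total mass 1 of the transition kernel at the
 origin leaves no room for a second one on a set of positive measure.\<close>

lemma chamber_hits_AE:
 assumes K: "drift_semigroup R Rp k (weyl_chamber Rp) (real (card W)) J lam K"
 shows "AE y in lborel. chamber_hits y = 1"
proof -
 interpret K: drift_semigroup R Rp k "weyl_chamber Rp" "real (card W)" J lam K by (rule K)
 let ?C = "weyl_chamber Rp"
 define \<phi> where "\<phi> y = gauss y * J y lam" for y
 have \<phi>_int: "integrable lborel \<phi>" unfolding \<phi>_def[abs_def] by (rule gauss_J_integrable)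
 have Jpos: "J y lam > 0" for y
 proof -
  obtain g where g: "g \<in> W" "g y \<in> ?C" using orbit_meets_chamber by blast
  then show ?thesis using K.jl_pos[OF g(2)] J_weyl[OF g(1), of y lam] by simp
 qed
 have C: "?C \<in> sets (borel_on ?C)" by (simp add: K.sets_borel_on_S)
 have "0 \<in> ?C" by (rule K.zero_in_S)
 then have K1: "prob_space (K 1 0)" "space (K 1 0) = ?C"
  using prob_kernelD[OF K.kernel_K, of 1 0] by simp_all
 have "1 = measure (K 1 0) ?C" using prob_space.prob_space[OF K1(1)] K1(2) by simp
 also have "\<dots> = real (card W) * dunkl_const Rp k * exp (- (norm lam)\<^sup>2 / 2) * (\<integral>y. indicator ?C y * \<phi> y \<partial>lborel)"
 proof -
  have "(LINT y:?C|lborel. exp (- ((norm (0 :: real ^ 'n))\<^sup>2 + (norm y)\<^sup>2) / (2 * 1)) *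
    (J (0 /\<^sub>R sqrt 1) (y /\<^sub>R sqrt 1) * J y lam / J 0 lam) * weight y) = (\<integral>y. indicator ?C y * \<phi> y \<partial>lborel)"
   unfolding set_lebesgue_integral_def
   by (intro Bochner_Integration.integral_cong refl) (simp add: \<phi>_def gauss_def J_0)
  then show ?thesis using K.density[OF zero_less_one \<open>0 \<in> ?C\<close> C] by simp
 qed
 also have "\<dots> = dunkl_const Rp k * exp (- (norm lam)\<^sup>2 / 2) * (\<integral>y. chamber_hits y * \<phi> y \<partial>lborel)"
  by (subst integral_chamber_hits[OF _ _ \<phi>_int])
    (simp_all add: lborel_distr_orthogonal weyl_group_linear weyl_group_norm \<phi>_def gauss_weyl J_weyl)
 finally have 1: "(\<integral>y. chamber_hits y * \<phi> y \<partial>lborel) = total * exp ((norm lam)\<^sup>2 / 2)"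
  using total_pos by (simp add: dunkl_const_eq exp_minus field_simps)
 have int: "integrable lborel (\<lambda>y. chamber_hits y * \<phi> y)"
 proof (rule Bochner_Integration.integrable_bound)
  show "integrable lborel (\<lambda>y. real (card W) * \<phi> y)" using \<phi>_int by simp
  show "(\<lambda>y. chamber_hits y * \<phi> y) \<in> borel_measurable lborel"
   using chamber_hits_measurable \<phi>_int by simp
  show "AE y in lborel. norm (chamber_hits y * \<phi> y) \<le> norm (real (card W) * \<phi> y)"
   using chamber_hits_ge_1 chamber_hits_le by (intro AE_I2) (simp add: abs_mult mult_right_mono order_trans[OF zero_le_one])
 qed
 have \<phi>0: "\<phi> y \<ge> 0" for y using gauss_nonneg[of y] Jpos[of y] by (simp add: \<phi>_def)
 have le: "\<phi> y \<le> chamber_hits y * \<phi> y" for y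
  using mult_right_mono[OF chamber_hits_ge_1 \<phi>0] by simp
 have "(\<integral>y. (chamber_hits y - 1) * \<phi> y \<partial>lborel) = 0"
  using 1 gauss_J_integral[of lam] int \<phi>_int
  by (simp add: left_diff_distrib Bochner_Integration.integral_diff \<phi>_def[abs_def])
 then have "AE y in lborel. (chamber_hits y - 1) * \<phi> y = 0"
  using int \<phi>_int le
  by (subst (asm) integral_nonneg_eq_0_iff_AE) (auto simp: left_diff_distrib)
 then show ?thesis using AE_regular
 proof eventually_elim
  case (elim y)
  have "\<phi> y > 0" using weight_pos[of y] elim(2) Jpos[of y] by (simp add: \<phi>_def gauss_def)
  then show ?case using elim(1) by simp
 qed
qed

text \<open>Both factors of the integrand are invariant under the group, so the integral over the chamber
 is a fraction \<open>1 / \<bar>W\<bar>\<close> of the integral over the sphere.\<close>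

lemma chamber_mean_J:
 assumes K: "drift_semigroup R Rp k (weyl_chamber Rp) (real (card W)) J lam K"
 shows "real (card W) * (LINT z:sphere 0 1 \<inter> weyl_chamber Rp|surface_measure. J (r *\<^sub>R z) y * weight z)
   = sphere_const Rp k * spherical_bessel_imag bessel_index (norm y * r)"
proof -
 let ?C = "weyl_chamber Rp"
 define \<phi> where "\<phi> z = J (r *\<^sub>R z) y * weight z" for z
 have \<phi>m [measurable]: "\<phi> \<in> borel_measurable borel"
  unfolding \<phi>_def[abs_def] by (intro borel_measurable_times J_measurable weight_measurable) measurable
 have \<phi>_int: "integrable surface_measure \<phi>"
 proof (rule integrable_surface_bounded[where B="cardK * exp (\<bar>r\<bar> * norm y) * exp expo"])
  fix z :: "real ^ 'n" assume z: "norm z = 1"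
  show "\<bar>\<phi> z\<bar> \<le> cardK * exp (\<bar>r\<bar> * norm y) * exp expo"
   unfolding \<phi>_def abs_mult using J_bound[of "r *\<^sub>R z" y] weight_nonneg[of z] weight_sphere_bound[OF z] z cardK_nonneg
   by (intro mult_mono) auto
 qed (rule \<phi>m)
 have inv: "\<phi> (g z) = \<phi> z" if g: "g \<in> W" for g z
  using J_weyl[OF g, of "r *\<^sub>R z" y] by (simp add: \<phi>_def dunkl_weight_weyl[OF g] linear_scale[OF weyl_group_linear[OF g]])
 have hits: "AE z in surface_measure. chamber_hits z = 1"
  by (rule AE_surface_of_lborel[OF _ chamber_hits_AE[OF K]])
    (use chamber_hits_measurable in \<open>simp_all add: chamber_hits_scale\<close>)
 have "(LINT z:sphere 0 1 \<inter> ?C|surface_measure. \<phi> z) = (LINT z:sphere 0 1|surface_measure. indicator ?C z * \<phi> z)"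
  unfolding set_lebesgue_integral_def by (intro Bochner_Integration.integral_cong refl) (simp add: indicator_inter_arith)
 also have "\<dots> = (\<integral>z. indicator ?C z * \<phi> z \<partial>surface_measure)" by (rule set_integral_sphere) measurable
 finally have "real (card W) * (LINT z:sphere 0 1 \<inter> ?C|surface_measure. \<phi> z) = (\<integral>z. chamber_hits z * \<phi> z \<partial>surface_measure)"
  by (subst integral_chamber_hits[OF _ _ \<phi>_int])
    (simp_all add: surface_measure_orthogonal weyl_group_linear weyl_group_norm inv)
 also have "\<dots> = (\<integral>z. \<phi> z \<partial>surface_measure)"
  by (rule integral_cong_AE) (use hits chamber_hits_measurable in \<open>auto elim!: eventually_mono\<close>)
 also have "\<dots> = sphere_const Rp k * spherical_bessel_imag bessel_index (norm y * r)"
  unfolding \<phi>_def by (rule spherical_mean_J)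
 finally show ?thesis by (simp only: \<phi>_def)
qed

end

section \<open>Processes on the chamber and on the whole space\<close>

lemma borel_on_UNIV: "borel_on UNIV = (borel :: 'a::topological_space measure)"
 by (rule measure_eqI) (simp_all add: sets_restrict_space emeasure_restrict_space)

context dunkl_setting
begin

text \<open>Solvability is obtained on the chamber and transported by the group. The paths of the norm are continuous
 since those of the process are.\<close>

lemma bessel_process_radial:
 fixes M :: "'w measure" and X :: "real \<Rightarrow> 'w \<Rightarrow> real ^ 'n"
 assumes process: "bessel_process R Rp k lam M X"
  and initial: "bessel_radial R Rp k lam (distr M (borel_on (weyl_chamber Rp)) (X 0))"
 shows "t \<ge> 0 \<Longrightarrow> bessel_radial R Rp k lam (distr M (borel_on (weyl_chamber Rp)) (X t))"
  and "bessel_process_1d (gamma_index Rp k + real CARD('n) / 2 - 1 / 2) (norm lam) M (\<lambda>t \<omega>. norm (X t \<omega>))"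
proof -
 let ?C = "weyl_chamber Rp"
 obtain K where X: "feller_process ?C K M X" and paths: "continuous_paths M X"
  and density: "\<And>t x A. t > 0 \<Longrightarrow> x \<in> ?C \<Longrightarrow> A \<in> sets (borel_on ?C) \<Longrightarrow> measure (K t x) A =
   real (card W) * dunkl_const Rp k * exp (- (norm lam)\<^sup>2 * t / 2) / t powr (gamma_index Rp k + real CARD('n) / 2) *
   (LINT y:A|lborel. exp (- ((norm x)\<^sup>2 + (norm y)\<^sup>2) / (2 * t)) *
    (J (x /\<^sub>R sqrt t) (y /\<^sub>R sqrt t) * J y lam / J x lam) * weight y)"
  using process unfolding bessel_process_def by blast
 have K: "feller_kernels ?C K" using X by (simp add: feller_process_def)
 have default: "J x y = E x (SOME y. \<not> solvable y)" if "\<not> solvable y" for x y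
  by (rule dunkl_bessel_real_default[OF that someI[of "\<lambda>y. \<not> solvable y", OF that]])
 have solv: "solvable y" if "y \<in> ?C" for y
  by (rule solvable_of_feller_density[OF K chamber_cone density, where ?q0.0="\<lambda>x. E x (SOME y. \<not> solvable y)"])
    (use that default in auto)
 interpret A: dunkl_kernel_setting R Rp k by unfold_locales (rule solvable_of_chamber[OF solv])
 have drift: "drift_semigroup R Rp k ?C (real (card W)) J lam K"
  by unfold_locales (auto simp: closed_chamber chamber_cone chamber_nonempty K density)
 interpret A: radial_setting R Rp k ?C "real (card W)" J lam K
  by (intro radial_setting.intro radial_setting_axioms.intro drift A.continuous_J A.J_bound A.J_scale A.chamber_mean_J[OF drift])
    (use card_W_pos in simp)
 have radial: "A.radial \<mu> \<longleftrightarrow> bessel_radial R Rp k lam \<mu>" for \<mu>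
  unfolding A.radial_def bessel_radial_def bessel_index_def ..
 have init: "A.radial (distr M (borel_on ?C) (X 0))" using initial by (simp only: radial)
 show "bessel_radial R Rp k lam (distr M (borel_on ?C) (X t))" if "t \<ge> 0"
  using A.radial_at_time[OF X init that] by (simp only: radial)
 show "bessel_process_1d (gamma_index Rp k + real CARD('n) / 2 - 1 / 2) (norm lam) M (\<lambda>t \<omega>. norm (X t \<omega>))"
 proof (rule A.bessel_process_1d_norm[OF X init], intro exI[of _ "\<lambda>t \<omega>. norm (X t \<omega>)"] conjI allI impI)
  show "(\<lambda>\<omega>. norm (X t \<omega>)) \<in> M \<rightarrow>\<^sub>M borel_on {0..}" if "t \<ge> 0" for t
   using A.feller_process_norm[OF X init] that by (simp add: feller_process_def)
  show "continuous_paths M (\<lambda>t \<omega>. norm (X t \<omega>))"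
   using paths by (auto simp: continuous_paths_def intro: continuous_on_norm)
 qed simp
qed

text \<open>Here \<open>q\<close> is the Dunkl kernel itself, and the norm inherits right-continuous paths with left limits.\<close>

lemma hybrid_dunkl_bessel_process_radial:
 fixes M :: "'w measure" and X :: "real \<Rightarrow> 'w \<Rightarrow> real ^ 'n"
 assumes process: "hybrid_dunkl_bessel_process R Rp k lam M X"
  and initial: "hybrid_dunkl_bessel_radial R Rp k lam (distr M borel (X 0))"
 shows "t \<ge> 0 \<Longrightarrow> hybrid_dunkl_bessel_radial R Rp k lam (distr M borel (X t))"
  and "bessel_process_1d (gamma_index Rp k + real CARD('n) / 2 - 1 / 2) (norm lam) M (\<lambda>t \<omega>. norm (X t \<omega>))"
proof -
 obtain K where X: "feller_process UNIV K M X" and paths: "rcll_paths M X"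
  and density0: "\<forall>t>0. \<forall>x. \<forall>A\<in>sets borel. measure (K t x) A =
   dunkl_const Rp k * exp (- (norm lam)\<^sup>2 * t / 2) / t powr (gamma_index Rp k + real CARD('n) / 2) *
   (LINT y:A|lborel. exp (- ((norm x)\<^sup>2 + (norm y)\<^sup>2) / (2 * t)) *
    (E (x /\<^sub>R sqrt t) (y /\<^sub>R sqrt t) * J y lam / J x lam) * weight y)"
  using process unfolding hybrid_dunkl_bessel_process_def by blast
 have density: "measure (K t x) A =
   1 * dunkl_const Rp k * exp (- (norm lam)\<^sup>2 * t / 2) / t powr (gamma_index Rp k + real CARD('n) / 2) *
   (LINT y:A|lborel. exp (- ((norm x)\<^sup>2 + (norm y)\<^sup>2) / (2 * t)) *
    (E (x /\<^sub>R sqrt t) (y /\<^sub>R sqrt t) * J y lam / J x lam) * weight y)"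
  if "t > 0" "x \<in> UNIV" "A \<in> sets (borel_on UNIV)" for t x A
  unfolding mult_1_left by (rule density0[rule_format]) (use that in \<open>simp_all add: borel_on_UNIV\<close>)
 have K: "feller_kernels UNIV K" using X by (simp add: feller_process_def)
 have default: "E x y = E x (SOME y. \<not> solvable y)" if "\<not> solvable y" for x y
  by (rule dunkl_kernel_real_default[OF that someI[of "\<lambda>y. \<not> solvable y", OF that]])
 have solv: "solvable y" for y
  by (rule solvable_of_feller_density[OF K UNIV_I density, where ?q0.0="\<lambda>x. E x (SOME y. \<not> solvable y)"])
    (use default in auto)
 interpret B: dunkl_kernel_setting R Rp k by unfold_locales (rule solv)
 have sphere: "(LINT z:sphere 0 1 \<inter> UNIV|surface_measure. f z * weight z) = (\<integral>z. f z * weight z \<partial>surface_measure)"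
  if "f \<in> borel_measurable borel" for f
  unfolding Int_UNIV_right by (intro set_integral_sphere borel_measurable_times that weight_measurable)
 interpret B: radial_setting R Rp k UNIV 1 E lam K
 proof (intro radial_setting.intro radial_setting_axioms.intro B.continuous_E B.E_bound B.E_scale)
  show "drift_semigroup R Rp k UNIV 1 E lam K"
   by unfold_locales (auto simp: K density)
  show "1 * (LINT z:sphere 0 1 \<inter> UNIV|surface_measure. E (r *\<^sub>R z) y * weight z)
   = sphere_const Rp k * spherical_bessel_imag bessel_index (norm y * r)" for r y
   by (subst sphere) (simp_all add: B.spherical_mean_E B.E_measurable)
  show "1 * (LINT z:sphere 0 1 \<inter> UNIV|surface_measure. J (r *\<^sub>R z) lam * weight z)
   = sphere_const Rp k * spherical_bessel_imag bessel_index (norm lam * r)" for r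
   by (subst sphere) (simp_all add: B.spherical_mean_J B.J_measurable)
 qed simp
 have radial: "B.radial \<mu> \<longleftrightarrow> hybrid_dunkl_bessel_radial R Rp k lam \<mu>" for \<mu>
  unfolding B.radial_def hybrid_dunkl_bessel_radial_def bessel_index_def borel_on_UNIV Int_UNIV_right ..
 have init: "B.radial (distr M (borel_on UNIV) (X 0))" using initial by (simp only: radial borel_on_UNIV)
 show "hybrid_dunkl_bessel_radial R Rp k lam (distr M borel (X t))" if "t \<ge> 0"
  using B.radial_at_time[OF X init that] by (simp only: radial borel_on_UNIV)
 have rcll: "rcll_paths M (\<lambda>t \<omega>. norm (X t \<omega>))"
  unfolding rcll_paths_def
 proof (intro ballI conjI allI impI)
  fix \<omega> t assume \<omega>: "\<omega> \<in> space M"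
  show "continuous (at_right t) (\<lambda>t. norm (X t \<omega>))" if "t \<ge> 0"
   using paths \<omega> that by (intro continuous_norm) (simp add: rcll_paths_def)
  show "\<exists>l. ((\<lambda>t. norm (X t \<omega>)) \<longlongrightarrow> l) (at_left t)" if t: "t > 0"
  proof -
   obtain l where "((\<lambda>t. X t \<omega>) \<longlongrightarrow> l) (at_left t)"
    using paths \<omega> t unfolding rcll_paths_def by blast
   then show ?thesis by (intro exI[of _ "norm l"] tendsto_norm)
  qed
 qed
 show "bessel_process_1d (gamma_index Rp k + real CARD('n) / 2 - 1 / 2) (norm lam) M (\<lambda>t \<omega>. norm (X t \<omega>))"
  by (rule B.bessel_process_1d_norm[OF X init continuous_modification_of_rcll[OF B.feller_process_norm[OF X init] rcll B.Q_rare]])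
qed

end

theorem proposition3p8:
 fixes R Rp :: "(real ^ 'n) set"
  and k :: "real ^ 'n \<Rightarrow> real"
  and lam :: "real ^ 'n"
  and M :: "'w measure"
  and X :: "real \<Rightarrow> 'w \<Rightarrow> real ^ 'n"
 assumes "root_system R"
  and "positive_subsystem R Rp"
  and "multiplicity_function R k"
 shows
  "(lam \<in> weyl_chamber Rp \<and> bessel_process R Rp k lam M X \<and>
    bessel_radial R Rp k lam (distr M (borel_on (weyl_chamber Rp)) (X 0)) \<longrightarrow>
    (\<forall>t\<ge>0. bessel_radial R Rp k lam (distr M (borel_on (weyl_chamber Rp)) (X t))) \<and>
    bessel_process_1d (gamma_index Rp k + real CARD('n) / 2 - 1 / 2) (norm lam) M
     (\<lambda>t \<omega>. norm (X t \<omega>))) \<and>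
   (hybrid_dunkl_bessel_process R Rp k lam M X \<and>
    hybrid_dunkl_bessel_radial R Rp k lam (distr M borel (X 0)) \<longrightarrow>
    (\<forall>t\<ge>0. hybrid_dunkl_bessel_radial R Rp k lam (distr M borel (X t))) \<and>
    bessel_process_1d (gamma_index Rp k + real CARD('n) / 2 - 1 / 2) (norm lam) M
     (\<lambda>t \<omega>. norm (X t \<omega>)))"
proof -
 interpret dunkl_setting R Rp k using assms by unfold_locales
 show ?thesis
  by (intro conjI impI allI; elim conjE)
    (rule bessel_process_radial hybrid_dunkl_bessel_process_radial; assumption)+
qed

end
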